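(* Let $u$ be the solution of $\partial_t u=\mathcal{L}u+\sigma(u)\dot w$, $u(0,\cdot)=u_0$. If $u_0$ is continuous, then $u$ is continuous in $L^p(\mathrm{P})$ for all $p>0$ (that is, $(t,x)\mapsto u(t,x)\in L^p(\mathrm{P})$ is continuous on $\mathbf{R}_+\times\mathbf{R}$). Consequently, $u$ has a separable modification. If, in addition, $u_0$ is uniformly continuous, then for all $T,p>0$, $$\lim_{\delta,\rho\downarrow0}\ \sup_{\substack{s,t\in[0,T]\\ |t-s|\le\rho}}\ \sup_{\substack{x,y\in\mathbf{R}\\ |x-y|\le\delta}}\left\|u(t,x)-u(s,y)\right\|_{L^p(\mathrm{P})}=0 .$$
   Context: $X=\{X_t\}_{t\ge 0}$ is a real-valued Lévy process, $X_0=0$, with $\mathrm{E}\exp(i\xi X_t)=\exp(-t\Psi(\xi))$ for $t\ge 0$, $\xi\in\mathbf{R}$. $\mathcal{L}$ is its $L^2(\mathbf{R})$-generator, acting on $x$ only, with Fourier multiplier $-\Psi$. Define $\Upsilon(\beta):=\frac{1}{2\pi}\int_{-\infty}^\infty\frac{d\xi}{\beta+2\,\mathrm{Re}\,\Psi(\xi)}$ for $\beta>0$. Standing assumption: $\Upsilon(\beta)<\infty$ for all $\beta>0$. Then $X_t$ has a density $p_t$ for each $t>0$; put $(P_tg)(x):=\int_{-\infty}^\infty p_t(y-x)g(y)\,dy$ for $t>0$ and $P_0g:=g$. $\sigma:\mathbf{R}\to\mathbf{R}$ is globally Lipschitz with (optimal) Lipschitz constant $\mathrm{Lip}_\sigma$,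 $0<\mathrm{Lip}_\sigma<\infty$. $u_0:\mathbf{R}\to\mathbf{R}$ is bounded, nonnegative and measurable. $\dot w$ is space-time white noise on $\mathbf{R}_+\times\mathbf{R}$; $\mathcal{F}=\{\mathcal{F}_t\}_{t\ge0}$ is the filtration generated by it (enlarged to satisfy the usual conditions); "predictable" is with respect to $\mathcal{F}$, and stochastic integrals $w(ds\,dy)$ are in the sense of Walsh. A solution means a mild solution: a predictable random field $u$ such that for all $(t,x)\in\mathbf{R}_+\times\mathbf{R}$, almost surely, $$u(t,x)=(P_tu_0)(x)+\int_{-\infty}^\infty\int_0^t\sigma(u(s,y))\,p_{t-s}(y-x)\,w(ds\,dy),$$ and $\sup_{x\in\mathbf{R}}\sup_{t\in[0,T]}\mathrm{E}(|u(t,x)|^2)<\infty$ for all $T>0$. Such a solution exists and is unique up to a modification. For $p>0$, $\|Z\|_{L^p(\mathrm{P})}:=\{\mathrm{E}(|Z|^p)\}^{1/p}$. *)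

theory Defs
  imports "HOL-Probability.Probability"
begin

section \<open>Levy processes\<close>

definition cadlag :: "(real \<Rightarrow> real) \<Rightarrow> bool" where
  "cadlag f \<longleftrightarrow>
     (\<forall>t\<ge>0. (f \<longlongrightarrow> f t) (at_right t)) \<and> (\<forall>t>0. \<exists>l. (f \<longlongrightarrow> l) (at_left t))"

text \<open>Sato's definition. Only times \<open>t \<ge> 0\<close> are meaningful.\<close>

definition levy_process :: "'v measure \<Rightarrow> (real \<Rightarrow> 'v \<Rightarrow> real) \<Rightarrow> bool" where
  "levy_process N X \<longleftrightarrow>
     prob_space N \<and>
     (\<forall>t\<ge>0. X t \<in> borel_measurable N) \<and>
     (AE \<omega> in N. X 0 \<omega> = 0) \<and>
     (\<forall>(\<tau> :: nat \<Rightarrow> real) n. 0 \<le> \<tau> 0 \<and> mono \<tau> \<longrightarrow>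
        prob_space.indep_vars N (\<lambda>_. borel) (\<lambda>i \<omega>. X (\<tau> (Suc i)) \<omega> - X (\<tau> i) \<omega>) {..<n}) \<and>
     (\<forall>s\<ge>0. \<forall>t\<ge>0. distr N borel (\<lambda>\<omega>. X (s + t) \<omega> - X s \<omega>) = distr N borel (X t)) \<and>
     (\<forall>t\<ge>0. \<forall>\<epsilon>>0.
        ((\<lambda>s. measure N {\<omega> \<in> space N. \<epsilon> < \<bar>X s \<omega> - X t \<omega>\<bar>}) \<longlongrightarrow> 0) (at t within {0..})) \<and>
     (AE \<omega> in N. cadlag (\<lambda>t. X t \<omega>))"

text \<open>Imposing the identity at all \<open>t \<ge> 0\<close> determines \<open>\<Psi>\<close> uniquely.\<close>

definition characteristic_exponent ::
    "'v measure \<Rightarrow> (real \<Rightarrow> 'v \<Rightarrow> real) \<Rightarrow> (real \<Rightarrow> complex) \<Rightarrow> bool" where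
  "characteristic_exponent N X \<Psi> \<longleftrightarrow>
     (\<forall>t\<ge>0. \<forall>\<xi>. char (distr N borel (X t)) \<xi> = exp (- (of_real t * \<Psi> \<xi>)))"

definition Upsilon :: "(real \<Rightarrow> complex) \<Rightarrow> real \<Rightarrow> ennreal" where
  "Upsilon \<Psi> \<beta> = ennreal (1 / (2 * pi)) * (\<integral>\<^sup>+\<xi>. ennreal (1 / (\<beta> + 2 * Re (\<Psi> \<xi>))) \<partial>lborel)"

text \<open>
  A density is only determined up to null sets for each \<open>t\<close>; joint measurability in \<open>(t, y)\<close> makes
  \<open>p (t - s) (y - x)\<close> a legitimate factor of a space-time integrand. Nonnegativity has to be
  required separately because \<^const>\<open>ennreal\<close> truncates negative values.
\<close>

definition transition_density ::
    "'v measure \<Rightarrow> (real \<Rightarrow> 'v \<Rightarrow> real) \<Rightarrow> (real \<Rightarrow> real \<Rightarrow> real) \<Rightarrow> bool" where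
  "transition_density N X p \<longleftrightarrow>
     (\<forall>t>0. (\<forall>y. 0 \<le> p t y) \<and> distributed N lborel (X t) (\<lambda>y. ennreal (p t y))) \<and>
     (\<lambda>(t, y). p t y) \<in> borel_measurable (restrict_space borel ({0<..} \<times> UNIV))"

definition levy_semigroup ::
    "(real \<Rightarrow> real \<Rightarrow> real) \<Rightarrow> real \<Rightarrow> (real \<Rightarrow> real) \<Rightarrow> real \<Rightarrow> real" where
  "levy_semigroup p t g x = (if t = 0 then g x else (\<integral>y. p t (y - x) * g y \<partial>lborel))"

section \<open>Space-time white noise and its filtration\<close>

text \<open>Degenerate (almost surely constant) variables count as Gaussian.\<close>

definition gaussian_rv :: "'w measure \<Rightarrow> ('w \<Rightarrow> real) \<Rightarrow> bool" where
  "gaussian_rv M Z \<longleftrightarrow>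
     Z \<in> borel_measurable M \<and>
     (\<exists>m. (AE \<omega> in M. Z \<omega> = m) \<or>
          (\<exists>s>0. distributed M lborel Z (\<lambda>x. ennreal (normal_density m s x))))"

definition gaussian_process :: "'w measure \<Rightarrow> 'i set \<Rightarrow> ('i \<Rightarrow> 'w \<Rightarrow> real) \<Rightarrow> bool" where
  "gaussian_process M I W \<longleftrightarrow>
     (\<forall>J c. finite J \<and> J \<subseteq> I \<longrightarrow> gaussian_rv M (\<lambda>\<omega>. \<Sum>j\<in>J. c j * W j \<omega>))"

definition noise_sets :: "(real \<times> real) set set" where
  "noise_sets = {B \<in> sets borel. B \<subseteq> {0..} \<times> UNIV \<and> emeasure lborel B < \<infinity>}"

definition white_noise :: "'w measure \<Rightarrow> ((real \<times> real) set \<Rightarrow> 'w \<Rightarrow> real) \<Rightarrow> bool" where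
  "white_noise M w \<longleftrightarrow>
     gaussian_process M noise_sets w \<and>
     (\<forall>A\<in>noise_sets. (\<integral>\<omega>. w A \<omega> \<partial>M) = 0) \<and>
     (\<forall>A\<in>noise_sets. \<forall>B\<in>noise_sets. (\<integral>\<omega>. w A \<omega> * w B \<omega> \<partial>M) = measure lborel (A \<inter> B))"

definition noise_events ::
    "'w measure \<Rightarrow> ((real \<times> real) set \<Rightarrow> 'w \<Rightarrow> real) \<Rightarrow> real \<Rightarrow> 'w set set" where
  "noise_events M w t =
     {w B -` U \<inter> space M | B U. B \<in> noise_sets \<and> B \<subseteq> {0..t} \<times> UNIV \<and> U \<in> sets borel}"

text \<open>
  The usual augmentation: adjoin all null sets, then make the filtration right-continuous. The
  intersection below is already a sigma-algebra; \<^const>\<open>sigma\<close> only packages it as a measure.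
\<close>

definition noise_filtration ::
    "'w measure \<Rightarrow> ((real \<times> real) set \<Rightarrow> 'w \<Rightarrow> real) \<Rightarrow> real \<Rightarrow> 'w measure" where
  "noise_filtration M w t =
     sigma (space M) (\<Inter>s\<in>{t<..}. sigma_sets (space M) (noise_events M w s \<union> null_sets M))"

definition predictable_sigma ::
    "'w measure \<Rightarrow> (real \<Rightarrow> 'w measure) \<Rightarrow> (real \<times> real \<times> 'w) measure" where
  "predictable_sigma M F =
     sigma ({0..} \<times> UNIV \<times> space M)
       ({{a<..b} \<times> A \<times> G | a b A G. 0 \<le> a \<and> a < b \<and> A \<in> sets borel \<and> G \<in> sets (F a)} \<union>
        {{0} \<times> A \<times> G | A G. A \<in> sets borel \<and> G \<in> sets (F 0)})"

definition predictable ::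
    "'w measure \<Rightarrow> (real \<Rightarrow> 'w measure) \<Rightarrow> (real \<Rightarrow> real \<Rightarrow> 'w \<Rightarrow> real) \<Rightarrow> bool" where
  "predictable M F f \<longleftrightarrow> (\<lambda>(s, y, \<omega>). f s y \<omega>) \<in> borel_measurable (predictable_sigma M F)"

section \<open>The Walsh integral over all of space-time\<close>

definition has_simple_walsh_integral ::
    "'w measure \<Rightarrow> (real \<Rightarrow> 'w measure) \<Rightarrow> ((real \<times> real) set \<Rightarrow> 'w \<Rightarrow> real) \<Rightarrow>
     (real \<Rightarrow> real \<Rightarrow> 'w \<Rightarrow> real) \<Rightarrow> ('w \<Rightarrow> real) \<Rightarrow> bool" where
  "has_simple_walsh_integral M F w f Z \<longleftrightarrow>
     (\<exists>(n::nat) a b A Y.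
        (\<forall>i<n. 0 \<le> a i \<and> a i < b i \<and> A i \<in> sets borel \<and> emeasure lborel (A i) < \<infinity> \<and>
               Y i \<in> borel_measurable (F (a i)) \<and> bounded (Y i ` space M)) \<and>
        f = (\<lambda>s y \<omega>. \<Sum>i<n. Y i \<omega> * indicator {a i<..b i} s * indicator (A i) y) \<and>
        Z = (\<lambda>\<omega>. \<Sum>i<n. Y i \<omega> * w ({a i<..b i} \<times> A i) \<omega>))"

definition sq_norm_integrand :: "'w measure \<Rightarrow> (real \<Rightarrow> real \<Rightarrow> 'w \<Rightarrow> real) \<Rightarrow> ennreal" where
  "sq_norm_integrand M f =
     (\<integral>\<^sup>+s\<in>{0..}. (\<integral>\<^sup>+y. (\<integral>\<^sup>+\<omega>. ennreal ((f s y \<omega>)\<^sup>2) \<partial>M) \<partial>lborel) \<partial>lborel)"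

text \<open>Extension of the simple integral by the \<open>L\<^sup>2\<close> isometry; it determines \<open>Z\<close> almost surely.\<close>

definition has_walsh_integral ::
    "'w measure \<Rightarrow> (real \<Rightarrow> 'w measure) \<Rightarrow> ((real \<times> real) set \<Rightarrow> 'w \<Rightarrow> real) \<Rightarrow>
     (real \<Rightarrow> real \<Rightarrow> 'w \<Rightarrow> real) \<Rightarrow> ('w \<Rightarrow> real) \<Rightarrow> bool" where
  "has_walsh_integral M F w f Z \<longleftrightarrow>
     predictable M F f \<and> sq_norm_integrand M f < \<infinity> \<and> Z \<in> borel_measurable M \<and>
     (\<exists>g Y. (\<forall>n::nat. has_simple_walsh_integral M F w (g n) (Y n)) \<and>
        (\<lambda>n. sq_norm_integrand M (\<lambda>s y \<omega>. g n s y \<omega> - f s y \<omega>)) \<longlonglongrightarrow> 0 \<and>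
        (\<lambda>n. \<integral>\<^sup>+\<omega>. ennreal ((Y n \<omega> - Z \<omega>)\<^sup>2) \<partial>M) \<longlonglongrightarrow> 0)"

section \<open>Mild solutions\<close>

text \<open>
  The integrand is cut off by the indicator of \<open>{0..<t}\<close>, which restricts the integral to the time
  interval from 0 to \<open>t\<close> and avoids the undefined density at time 0.
\<close>

definition mild_solution ::
    "'w measure \<Rightarrow> ((real \<times> real) set \<Rightarrow> 'w \<Rightarrow> real) \<Rightarrow> (real \<Rightarrow> real \<Rightarrow> real) \<Rightarrow>
     (real \<Rightarrow> real) \<Rightarrow> (real \<Rightarrow> real) \<Rightarrow> (real \<Rightarrow> real \<Rightarrow> 'w \<Rightarrow> real) \<Rightarrow> bool" where
  "mild_solution M w p \<sigma> u0 u \<longleftrightarrow>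
     predictable M (noise_filtration M w) u \<and>
     (\<forall>t\<ge>0. \<forall>x. \<exists>Z.
        has_walsh_integral M (noise_filtration M w) w
          (\<lambda>s y \<omega>. indicator {0..<t} s * (\<sigma> (u s y \<omega>) * p (t - s) (y - x))) Z \<and>
        (AE \<omega> in M. u t x \<omega> = levy_semigroup p t u0 x + Z \<omega>)) \<and>
     (\<forall>T>0. (SUP x. SUP t\<in>{0..T}. \<integral>\<^sup>+\<omega>. ennreal (\<bar>u t x \<omega>\<bar>\<^sup>2) \<partial>M) < \<infinity>)"

text \<open>The optimal Lipschitz constant, meaningful only for Lipschitz functions.\<close>

definition Lip :: "(real \<Rightarrow> real) \<Rightarrow> real" where
  "Lip f = Inf {L. L-lipschitz_on UNIV f}"

section \<open>Continuity in mean and separability\<close>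

definition Lp_norm :: "'w measure \<Rightarrow> real \<Rightarrow> ('w \<Rightarrow> real) \<Rightarrow> ennreal" where
  "Lp_norm M p Z =
     (let m = \<integral>\<^sup>+\<omega>. ennreal (\<bar>Z \<omega>\<bar> powr p) \<partial>M
      in if m = \<infinity> then \<infinity> else ennreal (enn2real m powr (1 / p)))"

definition continuous_in_Lp ::
    "'w measure \<Rightarrow> real \<Rightarrow> (real \<Rightarrow> real \<Rightarrow> 'w \<Rightarrow> real) \<Rightarrow> bool" where
  "continuous_in_Lp M p v \<longleftrightarrow>
     (\<forall>t\<ge>0. \<forall>x. v t x \<in> borel_measurable M \<and> Lp_norm M p (v t x) < \<infinity>) \<and>
     (\<forall>t\<ge>0. \<forall>x. ((\<lambda>(s, y). Lp_norm M p (\<lambda>\<omega>. v s y \<omega> - v t x \<omega>)) \<longlongrightarrow> 0)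
        (at (t, x) within {0..} \<times> UNIV))"

text \<open>
  Separability in the sense of Doob. As in Doob's theorem, a separable modification may take the
  values \<open>\<plusminus>\<infinity>\<close> (at each fixed point only with probability 0), so random fields are
  \<^typ>\<open>ereal\<close>-valued here.
\<close>

definition separable_field :: "'w measure \<Rightarrow> (real \<Rightarrow> real \<Rightarrow> 'w \<Rightarrow> ereal) \<Rightarrow> bool" where
  "separable_field M v \<longleftrightarrow>
     (\<exists>D \<Lambda>. countable D \<and> D \<subseteq> {0..} \<times> UNIV \<and> {0..} \<times> UNIV \<subseteq> closure D \<and> \<Lambda> \<in> null_sets M \<and>
        (\<forall>\<omega>\<in>space M - \<Lambda>. \<forall>G C. open G \<and> closed C \<and> (\<forall>(t, x)\<in>G \<inter> D. v t x \<omega> \<in> C) \<longrightarrow>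
           (\<forall>(t, x)\<in>G \<inter> ({0..} \<times> UNIV). v t x \<omega> \<in> C)))"

definition is_modification ::
    "'w measure \<Rightarrow> (real \<Rightarrow> real \<Rightarrow> 'w \<Rightarrow> real) \<Rightarrow> (real \<Rightarrow> real \<Rightarrow> 'w \<Rightarrow> ereal) \<Rightarrow> bool" where
  "is_modification M u v \<longleftrightarrow>
     (\<forall>t\<ge>0. \<forall>x. v t x \<in> borel_measurable M \<and> (AE \<omega> in M. v t x \<omega> = ereal (u t x \<omega>)))"

end

theory Submission
  imports Defs
begin

text \<open>
  Gaussian increments of the noise after time \<open>a\<close> are independent of \<open>\<F>\<^sub>a\<close>, so along a simple
  Walsh integral \<open>X\<close> of an integrand \<open>f\<close> a second order Taylor expansion of \<open>\<phi>(X)\<close> gives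
  \<open>E \<phi>(X\<^sub>t) \<le> E \<integral>\<integral> \<psi>(X\<^sub>s) f(s, y)\<^sup>2 ds dy\<close> whenever
  \<open>\<phi>(x + d) \<le> \<phi>(x) + \<phi>'(x) d + \<psi>(x) d\<^sup>2 + L d\<^sup>2\<^sup>l\<close> with \<open>l \<ge> 2\<close>. For \<open>\<phi>(x) = x\<^sup>2\<close> this is the
  \<open>L\<^sup>2\<close> bound of the Walsh integral. For a power truncated to quadratic growth it bounds the moments of the
  given solution directly, without Picard iteration: truncated moments are finite a priori, so they can be
  absorbed in a supremum weighted by \<open>exp (- \<beta> t)\<close>, and the bounds do not depend on the truncation.

  By Plancherel the finiteness of \<open>\<Upsilon>\<close> puts \<open>p\<close> in \<open>L\<^sup>2([0, T] \<times> \<real>)\<close>. The stochastic convolution integrates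
  against reflected translates of \<open>p\<close>, so its modulus of continuity in \<open>L\<^sup>2(P)\<close> is controlled by the continuity
  of translations in \<open>L\<^sup>2(\<real>\<^sup>2)\<close>, uniformly in space and time; stochastic continuity of the Levy process
  handles \<open>P\<^sub>t u\<^sub>0\<close>. Moment bounds turn \<open>L\<^sup>2\<close> continuity into \<open>L\<^sup>p\<close> continuity.
\<close>

text \<open>Three obstacles shape the proof. The filtration is made right-continuous, so an event of
  \<open>F a\<close> may depend on noise just after time \<open>a\<close>; independence is proved
  against noise after \<open>a + 1 / Suc n\<close> and carried over by an L^1 limit. Simple
  integrands approximate a Walsh integrand in L^2 only, without control of higher moments; since
  \<open>tpow k R\<close> is at most R^(2k) times the square, an L^2 error costs that factor and
  disappears at fixed R. Finally, the moment of a Walsh integral occurs on both sides of its own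
  estimate, because \<open>\<psi>\<close> at the running integral multiplies the squared integrand.
  Young's inequality separates the two factors; its parameter is matched to the L^2 mass of the
  kernel so that the self-referring part has coefficient at most 1/2, and what remains is free of R.
  This absorption happens inside the Walsh integral and is separate from the one for the
  solution.\<close>

section \<open>Fourier uniqueness with bounded weights\<close>

text \<open>Uniqueness of characteristic functions concerns probability laws, whereas
  \<open>R\<close> is signed. Adding a constant makes the weight positive, and (C + R) / C is a
  probability density because E R = 0, the case \<theta> = 0. Under it \<open>\<eta>\<close> has the
  same characteristic function as under \<open>M\<close>, hence the same law, and comparing the two
  laws on \<open>U\<close> isolates the contribution of \<open>R\<close>.\<close>

lemma (in prob_space) zero_char_imp_zero:
  fixes R \<eta> :: "'a \<Rightarrow> real"
  assumes R[measurable]: "R \<in> borel_measurable M" and \<eta>[measurable]: "\<eta> \<in> borel_measurable M"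
    and bdd: "\<And>\<omega>. \<omega> \<in> space M \<Longrightarrow> \<bar>R \<omega>\<bar> \<le> c"
    and zero: "\<And>\<theta>. (\<integral>\<omega>. complex_of_real (R \<omega>) * iexp (\<theta> * \<eta> \<omega>) \<partial>M) = 0"
    and U[measurable]: "U \<in> sets borel"
  shows "(\<integral>\<omega>. R \<omega> * indicator U (\<eta> \<omega>) \<partial>M) = 0"
proof -
  define C where "C = \<bar>c\<bar> + 1"
  have C: "C > 0" "\<And>\<omega>. \<omega> \<in> space M \<Longrightarrow> \<bar>R \<omega>\<bar> \<le> C" using bdd by (force simp: C_def)+
  have iR: "integrable M R" by (rule integrable_const_bound[where B=c]) (use bdd in auto)
  have "(\<integral>\<omega>. complex_of_real (R \<omega>) \<partial>M) = 0" using zero[of 0] by simp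
  then have R0: "(\<integral>\<omega>. R \<omega> \<partial>M) = 0" by (simp add: integral_complex_of_real)
  define K where "K = density M (\<lambda>\<omega>. ennreal ((C + R \<omega>) / C))"
  have nn: "AE \<omega> in M. 0 \<le> (C + R \<omega>) / C"
    using C by (intro AE_I2) (force intro!: divide_nonneg_pos dest!: C(2) simp: abs_le_iff)
  have "emeasure K (space K) = (\<integral>\<^sup>+\<omega>. ennreal ((C + R \<omega>) / C) \<partial>M)"
    unfolding K_def by (subst emeasure_density) (auto intro!: nn_integral_cong)
  also have "\<dots> = ennreal (\<integral>\<omega>. (C + R \<omega>) / C \<partial>M)"
    by (rule nn_integral_eq_integral) (use nn iR in auto)
  also have "(\<integral>\<omega>. (C + R \<omega>) / C \<partial>M) = 1"
    using C iR R0 by (simp add: prob_space)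
  finally have "emeasure K (space K) = 1" by simp
  then have K: "prob_space K" by (rule prob_spaceI)
  have mK[measurable]: "\<eta> \<in> borel_measurable K" by (simp add: K_def)
  have ch: "char (distr K borel \<eta>) = char (distr M borel \<eta>)"
  proof
    fix \<theta>
    have i1: "integrable M (\<lambda>\<omega>. iexp (\<theta> * \<eta> \<omega>))"
      by (rule integrable_const_bound[where B=1]) auto
    have i2: "integrable M (\<lambda>\<omega>. complex_of_real (R \<omega>) * iexp (\<theta> * \<eta> \<omega>))"
      by (rule integrable_const_bound[where B=c]) (use bdd in \<open>auto simp: norm_mult\<close>)
    have "char (distr K borel \<eta>) \<theta> = (\<integral>\<omega>. iexp (\<theta> * \<eta> \<omega>) \<partial>K)"
      unfolding char_def by (simp add: integral_distr)
    also have "\<dots> = (\<integral>\<omega>. ((C + R \<omega>) / C) *\<^sub>R iexp (\<theta> * \<eta> \<omega>) \<partial>M)"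
      unfolding K_def by (rule integral_density) (use nn in auto)
    also have "\<dots> = (\<integral>\<omega>. iexp (\<theta> * \<eta> \<omega>) + complex_of_real (1/C) * (complex_of_real (R \<omega>) * iexp (\<theta> * \<eta> \<omega>)) \<partial>M)"
      using C by (intro Bochner_Integration.integral_cong) (auto simp: scaleR_conv_of_real field_simps)
    also have "\<dots> = (\<integral>\<omega>. iexp (\<theta> * \<eta> \<omega>) \<partial>M)"
      by (subst Bochner_Integration.integral_add)
        (use i1 i2 zero[of \<theta>] in \<open>auto intro!: integrable_mult_right\<close>)
    also have "\<dots> = char (distr M borel \<eta>) \<theta>"
      unfolding char_def by (simp add: integral_distr)
    finally show "char (distr K borel \<eta>) \<theta> = char (distr M borel \<eta>) \<theta>" .
  qed
  have "distr K borel \<eta> = distr M borel \<eta>"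
    by (rule Levy_uniqueness[OF _ _ ch])
      (auto intro!: real_distribution_distr prob_space.real_distribution_distr[OF K])
  then have "(\<integral>x. indicator U x \<partial>distr K borel \<eta>) = (\<integral>x. (indicator U x :: real) \<partial>distr M borel \<eta>)" by simp
  then have e: "(\<integral>\<omega>. indicator U (\<eta> \<omega>) \<partial>K) = (\<integral>\<omega>. (indicator U (\<eta> \<omega>) :: real) \<partial>M)"
    by (subst (asm) (1 2) integral_distr) auto
  have i1: "integrable M (\<lambda>\<omega>. indicator U (\<eta> \<omega>) :: real)"
    by (rule integrable_const_bound[where B=1]) (auto simp: indicator_def)
  have i2: "integrable M (\<lambda>\<omega>. R \<omega> * indicator U (\<eta> \<omega>))"
    by (rule integrable_const_bound[where B=C])
      (use C in \<open>auto simp: indicator_def less_imp_le\<close>)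
  have "(\<integral>\<omega>. (indicator U (\<eta> \<omega>) :: real) \<partial>K) = (\<integral>\<omega>. ((C + R \<omega>) / C) *\<^sub>R indicator U (\<eta> \<omega>) \<partial>M)"
    unfolding K_def by (rule integral_density) (use nn in auto)
  also have "\<dots> = (\<integral>\<omega>. indicator U (\<eta> \<omega>) + (1/C) * (R \<omega> * indicator U (\<eta> \<omega>)) \<partial>M)"
    using C by (intro Bochner_Integration.integral_cong) (auto simp: field_simps)
  also have "\<dots> = (\<integral>\<omega>. indicator U (\<eta> \<omega>) \<partial>M) + (1/C) * (\<integral>\<omega>. R \<omega> * indicator U (\<eta> \<omega>) \<partial>M)"
    by (subst Bochner_Integration.integral_add) (use i1 i2 in auto)
  finally show ?thesis using e C by simp
qed

text \<open>The hypothesis covers all \<theta>, so conjugating it at -\<theta> shows that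
  \<open>cnj W\<close> satisfies it as well. Hence so do the real and imaginary parts of
  \<open>W\<close>, and the real version applies to each.\<close>

lemma (in prob_space) zero_char_imp_zero_complex:
  fixes W :: "'a \<Rightarrow> complex" and \<eta> :: "'a \<Rightarrow> real"
  assumes W[measurable]: "W \<in> borel_measurable M" and \<eta>[measurable]: "\<eta> \<in> borel_measurable M"
    and bdd: "\<And>\<omega>. \<omega> \<in> space M \<Longrightarrow> norm (W \<omega>) \<le> c"
    and zero: "\<And>\<theta>. (\<integral>\<omega>. W \<omega> * iexp (\<theta> * \<eta> \<omega>) \<partial>M) = 0"
    and U[measurable]: "U \<in> sets borel"
  shows "(\<integral>\<omega>. W \<omega> * indicator U (\<eta> \<omega>) \<partial>M) = 0"
proof -
  have i1: "integrable M (\<lambda>\<omega>. W \<omega> * iexp (\<theta> * \<eta> \<omega>))" for \<theta>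
    by (rule integrable_const_bound[where B=c]) (use bdd in \<open>auto simp: norm_mult\<close>)
  have [measurable]: "(\<lambda>\<omega>. cnj (W \<omega>)) \<in> borel_measurable M"
    by (rule borel_measurable_continuous_on[OF _ W]) (intro continuous_intros)
  have i2: "integrable M (\<lambda>\<omega>. cnj (W \<omega>) * iexp (\<theta> * \<eta> \<omega>))" for \<theta>
    by (rule integrable_const_bound[where B=c]) (use bdd in \<open>auto simp: norm_mult\<close>)
  have zero': "(\<integral>\<omega>. cnj (W \<omega>) * iexp (\<theta> * \<eta> \<omega>) \<partial>M) = 0" for \<theta>
  proof -
    have "(\<integral>\<omega>. cnj (W \<omega>) * iexp (\<theta> * \<eta> \<omega>) \<partial>M) = (\<integral>\<omega>. cnj (W \<omega> * iexp (- \<theta> * \<eta> \<omega>)) \<partial>M)"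
      by (intro Bochner_Integration.integral_cong) (auto simp: exp_cnj)
    also have "\<dots> = cnj (\<integral>\<omega>. W \<omega> * iexp (- \<theta> * \<eta> \<omega>) \<partial>M)" by (rule integral_bounded_linear[OF bounded_linear_cnj i1])
    also have "\<dots> = 0" using zero[of "- \<theta>"] by simp
    finally show ?thesis .
  qed
  have re: "(\<integral>\<omega>. Re (W \<omega>) * indicator U (\<eta> \<omega>) \<partial>M) = 0"
  proof (rule zero_char_imp_zero[where c=c])
    show "\<bar>Re (W \<omega>)\<bar> \<le> c" if "\<omega> \<in> space M" for \<omega>
      using bdd[OF that] abs_Re_le_cmod[of "W \<omega>"] by simp
    fix \<theta>
    have "(\<integral>\<omega>. complex_of_real (Re (W \<omega>)) * iexp (\<theta> * \<eta> \<omega>) \<partial>M)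
      = (\<integral>\<omega>. (1/2) * (W \<omega> * iexp (\<theta> * \<eta> \<omega>) + cnj (W \<omega>) * iexp (\<theta> * \<eta> \<omega>)) \<partial>M)"
      by (intro Bochner_Integration.integral_cong refl)
        (simp only: distrib_right[symmetric] complex_add_cnj, simp)
    also have "\<dots> = 0"
      by (subst integral_mult_right_zero, subst Bochner_Integration.integral_add)
        (use i1 i2 zero zero' in auto)
    finally show "(\<integral>\<omega>. complex_of_real (Re (W \<omega>)) * iexp (\<theta> * \<eta> \<omega>) \<partial>M) = 0" .
  qed auto
  have im: "(\<integral>\<omega>. Im (W \<omega>) * indicator U (\<eta> \<omega>) \<partial>M) = 0"
  proof (rule zero_char_imp_zero[where c=c])
    show "\<bar>Im (W \<omega>)\<bar> \<le> c" if "\<omega> \<in> space M" for \<omega>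
      using bdd[OF that] abs_Im_le_cmod[of "W \<omega>"] by simp
    fix \<theta>
    have "(\<integral>\<omega>. complex_of_real (Im (W \<omega>)) * iexp (\<theta> * \<eta> \<omega>) \<partial>M)
      = (\<integral>\<omega>. (1/(2*\<i>)) * (W \<omega> * iexp (\<theta> * \<eta> \<omega>) - cnj (W \<omega>) * iexp (\<theta> * \<eta> \<omega>)) \<partial>M)"
      by (intro Bochner_Integration.integral_cong refl)
        (simp only: left_diff_distrib[symmetric] complex_diff_cnj, simp add: mult_ac)
    also have "\<dots> = 0"
      by (subst integral_mult_right_zero, subst Bochner_Integration.integral_diff)
        (use i1 i2 zero zero' in auto)
    finally show "(\<integral>\<omega>. complex_of_real (Im (W \<omega>)) * iexp (\<theta> * \<eta> \<omega>) \<partial>M) = 0" .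
  qed auto
  have "integrable M (\<lambda>\<omega>. W \<omega> * indicator U (\<eta> \<omega>))"
    by (rule integrable_const_bound[where B="\<bar>c\<bar>"])
      (use bdd in \<open>force simp: norm_mult indicator_def\<close>)+
  note int = this
  have "Re (\<integral>\<omega>. W \<omega> * indicator U (\<eta> \<omega>) \<partial>M) = (\<integral>\<omega>. Re (W \<omega>) * indicator U (\<eta> \<omega>) \<partial>M)"
    by (subst integral_Re[OF int, symmetric], intro Bochner_Integration.integral_cong)
      (auto simp: indicator_def)
  moreover have "Im (\<integral>\<omega>. W \<omega> * indicator U (\<eta> \<omega>) \<partial>M) = (\<integral>\<omega>. Im (W \<omega>) * indicator U (\<eta> \<omega>) \<partial>M)"
    by (subst integral_Im[OF int, symmetric], intro Bochner_Integration.integral_cong)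
      (auto simp: indicator_def)
  ultimately have "(\<integral>\<omega>. W \<omega> * indicator U (\<eta> \<omega>) \<partial>M) = 0"
    using re im by (simp add: complex_eq_iff)
  then show ?thesis .
qed

section \<open>Gaussian variables\<close>

text \<open>A constant counts as Gaussian; centring forces it to be 0, and both formulas hold with
  variance 0 (with 0^0 = 1 for k = 0). In the other case dividing by the standard deviation
  \<open>s\<close> reduces the first formula to the standard normal characteristic function at the
  point \<open>s\<close>.\<close>

lemma (in prob_space) centered_gaussian:
  fixes Z :: "'a \<Rightarrow> real"
  assumes G: "gaussian_rv M Z" and m0: "(\<integral>\<omega>. Z \<omega> \<partial>M) = 0"
  shows "(\<integral>\<omega>. iexp (Z \<omega>) \<partial>M) = exp (- (\<integral>\<omega>. (Z \<omega>)\<^sup>2 \<partial>M) / 2)"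
    and "(\<integral>\<omega>. Z \<omega> ^ (2 * k) \<partial>M) = (fact (2 * k) / (2 ^ k * fact k)) * (\<integral>\<omega>. (Z \<omega>)\<^sup>2 \<partial>M) ^ k"
proof -
  have [measurable]: "Z \<in> borel_measurable M" using G by (auto simp: gaussian_rv_def)
  from G obtain m where m: "(AE \<omega> in M. Z \<omega> = m) \<or>
      (\<exists>s>0. distributed M lborel Z (\<lambda>x. ennreal (normal_density m s x)))"
    by (auto simp: gaussian_rv_def)
  have "(\<integral>\<omega>. iexp (Z \<omega>) \<partial>M) = exp (- (\<integral>\<omega>. (Z \<omega>)\<^sup>2 \<partial>M) / 2) \<and>
    (\<integral>\<omega>. Z \<omega> ^ (2 * k) \<partial>M) = (fact (2 * k) / (2 ^ k * fact k)) * (\<integral>\<omega>. (Z \<omega>)\<^sup>2 \<partial>M) ^ k"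
  proof (cases "AE \<omega> in M. Z \<omega> = m")
    case True
    then have "(\<integral>\<omega>. Z \<omega> \<partial>M) = (\<integral>\<omega>. m \<partial>M)" by (intro integral_cong_AE) auto
    then have "m = 0" using m0 by (simp add: prob_space)
    with True have Z: "AE \<omega> in M. Z \<omega> = 0" by simp
    have "(\<integral>\<omega>. iexp (Z \<omega>) \<partial>M) = (\<integral>\<omega>. 1 \<partial>M)"
      by (rule integral_cong_AE) (use Z in auto)
    moreover have "(\<integral>\<omega>. Z \<omega> ^ j \<partial>M) = (\<integral>\<omega>. 0 ^ j \<partial>M)" for j
      by (rule integral_cong_AE) (use Z in auto)
    moreover have "(\<integral>\<omega>. (0::real) ^ j \<partial>M) = 0 ^ j" for j
      by (auto simp: prob_space)
    ultimately show ?thesis by (cases "k = 0") (simp_all add: prob_space power_0_left)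
  next
    case False
    with m obtain s where s: "s > 0" and D: "distributed M lborel Z (\<lambda>x. ennreal (normal_density m s x))"
      by auto
    have "m = 0" using normal_distributed_expectation[OF s D] m0 by simp
    note D = D[unfolded this]
    have mom: "(\<integral>\<omega>. Z \<omega> ^ (2 * j) \<partial>M) = fact (2 * j) / ((2 / s\<^sup>2)^j * fact j)" for j
      using integral_normal_moment_even[of s 0 j, OF s]
        distributed_integral[OF D, of "\<lambda>x. x ^ (2 * j)"] by simp
    have v: "(\<integral>\<omega>. (Z \<omega>)\<^sup>2 \<partial>M) = s\<^sup>2" using mom[of 1] by simp
    have D': "distributed M lborel (\<lambda>x. Z x / s) std_normal_density"
      using D normal_standard_normal_convert[OF s, of Z 0] by simp
    have "distr M borel (\<lambda>x. Z x / s) = distr M lborel (\<lambda>x. Z x / s)" by (rule distr_cong) auto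
    also have "\<dots> = density lborel std_normal_density"
      using D' by (simp add: distributed_def)
    finally have "char (distr M borel (\<lambda>x. Z x / s)) s = complex_of_real (exp (- s\<^sup>2 / 2))"
      by (simp add: char_std_normal_distribution)
    moreover have "char (distr M borel (\<lambda>x. Z x / s)) s = (\<integral>\<omega>. iexp (Z \<omega>) \<partial>M)"
      unfolding char_def using s by (subst integral_distr) auto
    ultimately have "(\<integral>\<omega>. iexp (Z \<omega>) \<partial>M) = exp (- s\<^sup>2 / 2)" by simp
    then show ?thesis using mom v by (simp add: power_divide field_simps)
  qed
  then show "(\<integral>\<omega>. iexp (Z \<omega>) \<partial>M) = exp (- (\<integral>\<omega>. (Z \<omega>)\<^sup>2 \<partial>M) / 2)"
    and "(\<integral>\<omega>. Z \<omega> ^ (2 * k) \<partial>M) = (fact (2 * k) / (2 ^ k * fact k)) * (\<integral>\<omega>. (Z \<omega>)\<^sup>2 \<partial>M) ^ k"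
    by auto
qed

section \<open>White noise is independent of its past\<close>

locale white_noise_space = prob_space M for M :: "'w measure" +
  fixes w :: "(real \<times> real) set \<Rightarrow> 'w \<Rightarrow> real"
  assumes white: "white_noise M w"
begin

text \<open>The Gaussian linear span of the noise on \<open>\<B>\<close>. Joint Gaussianity enters
  only through closure of this span under sums and multiples: joint characteristic functions become
  one-dimensional ones of a single element.\<close>

definition lin :: "(real \<times> real) set set \<Rightarrow> ('w \<Rightarrow> real) set" where
  "lin \<B> = {(\<lambda>\<omega>. \<Sum>B\<in>J. c B * w B \<omega>) | J c. finite J \<and> J \<subseteq> \<B>}"

lemma lin_add:
  assumes "\<xi> \<in> lin \<B>" "\<eta> \<in> lin \<B>" shows "(\<lambda>\<omega>. \<xi> \<omega> + \<eta> \<omega>) \<in> lin \<B>"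
proof -
  obtain J c J' c' where J: "finite J" "J \<subseteq> \<B>" "\<xi> = (\<lambda>\<omega>. \<Sum>B\<in>J. c B * w B \<omega>)"
    and J': "finite J'" "J' \<subseteq> \<B>" "\<eta> = (\<lambda>\<omega>. \<Sum>B\<in>J'. c' B * w B \<omega>)"
    using assms by (auto simp: lin_def)
  have "(\<lambda>\<omega>. \<xi> \<omega> + \<eta> \<omega>) = (\<lambda>\<omega>. \<Sum>B\<in>J \<union> J'. ((if B \<in> J then c B else 0) + (if B \<in> J' then c' B else 0)) * w B \<omega>)"
  proof
    fix \<omega>
    have "(\<Sum>B\<in>J. c B * w B \<omega>) = (\<Sum>B\<in>J \<union> J'. (if B \<in> J then c B else 0) * w B \<omega>)"
      by (intro sum.mono_neutral_cong_left) (use J J' in auto)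
    moreover have "(\<Sum>B\<in>J'. c' B * w B \<omega>) = (\<Sum>B\<in>J \<union> J'. (if B \<in> J' then c' B else 0) * w B \<omega>)"
      by (intro sum.mono_neutral_cong_left) (use J J' in auto)
    ultimately show "\<xi> \<omega> + \<eta> \<omega> = (\<Sum>B\<in>J \<union> J'. ((if B \<in> J then c B else 0) + (if B \<in> J' then c' B else 0)) * w B \<omega>)"
      by (simp only: J(3) J'(3) distrib_right sum.distrib)
  qed
  then show ?thesis using J J' unfolding lin_def
    by (intro CollectI exI[of _ "J \<union> J'"]
        exI[of _ "\<lambda>B. (if B \<in> J then c B else 0) + (if B \<in> J' then c' B else 0)"]) auto
qed

lemma lin_scale:
  assumes "\<xi> \<in> lin \<B>" shows "(\<lambda>\<omega>. a * \<xi> \<omega>) \<in> lin \<B>"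
proof -
  obtain J c where J: "finite J" "J \<subseteq> \<B>" "\<xi> = (\<lambda>\<omega>. \<Sum>B\<in>J. c B * w B \<omega>)"
    using assms by (auto simp: lin_def)
  then have "(\<lambda>\<omega>. a * \<xi> \<omega>) = (\<lambda>\<omega>. \<Sum>B\<in>J. (a * c B) * w B \<omega>)"
    by (auto simp: sum_distrib_left mult.assoc)
  then show ?thesis unfolding lin_def
    by (intro CollectI exI[of _ J] exI[of _ "\<lambda>B. a * c B"]) (use J in auto)
qed

lemma lin_w: "B \<in> \<B> \<Longrightarrow> w B \<in> lin \<B>"
  unfolding lin_def by (intro CollectI exI[of _ "{B}"] exI[of _ "\<lambda>_. 1"]) auto

lemma lin_zero: "(\<lambda>\<omega>. 0) \<in> lin \<B>"
  unfolding lin_def by (intro CollectI exI[of _ "{}"]) auto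

lemma lin_sum:
  "finite I \<Longrightarrow> (\<And>i. i \<in> I \<Longrightarrow> \<xi> i \<in> lin \<B>) \<Longrightarrow> (\<lambda>\<omega>. \<Sum>i\<in>I. \<xi> i \<omega>) \<in> lin \<B>"
  by (induction I rule: finite_induct) (auto intro: lin_zero lin_add)

lemma lin_mono: "\<B> \<subseteq> \<B>' \<Longrightarrow> \<xi> \<in> lin \<B> \<Longrightarrow> \<xi> \<in> lin \<B>'"
  unfolding lin_def by blast

lemma lin_gaussian: "\<xi> \<in> lin noise_sets \<Longrightarrow> gaussian_rv M \<xi>"
  using white unfolding lin_def white_noise_def gaussian_process_def by auto

lemma measurable_lin[measurable_dest]: "\<xi> \<in> lin noise_sets \<Longrightarrow> \<xi> \<in> borel_measurable M"
  using lin_gaussian by (auto simp: gaussian_rv_def)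

lemma measurable_w: "B \<in> noise_sets \<Longrightarrow> w B \<in> borel_measurable M"
  using measurable_lin[OF lin_w] by auto

lemma cov_w: "A \<in> noise_sets \<Longrightarrow> B \<in> noise_sets \<Longrightarrow> (\<integral>\<omega>. w A \<omega> * w B \<omega> \<partial>M) = measure lborel (A \<inter> B)"
  using white by (auto simp: white_noise_def)

lemma gaussian_rv_integrable:
  assumes "gaussian_rv M Z" shows "integrable M (\<lambda>\<omega>. Z \<omega> ^ k)"
proof -
  have [measurable]: "Z \<in> borel_measurable M" using assms by (auto simp: gaussian_rv_def)
  from assms obtain m where m: "(AE \<omega> in M. Z \<omega> = m) \<or>
      (\<exists>s>0. distributed M lborel Z (\<lambda>x. ennreal (normal_density m s x)))"
    by (auto simp: gaussian_rv_def)
  show ?thesis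
  proof (cases "AE \<omega> in M. Z \<omega> = m")
    case True
    then have "integrable M (\<lambda>\<omega>. Z \<omega> ^ k) = integrable M (\<lambda>\<omega>. m ^ k)"
      by (intro integrable_cong_AE) auto
    then show ?thesis by simp
  next
    case False
    with m obtain s where s: "s > 0" and D: "distributed M lborel Z (\<lambda>x. ennreal (normal_density m s x))"
      by auto
    have a: "integrable M (\<lambda>\<omega>. (Z \<omega> - m) ^ j)" for j
      using integrable_normal_moment[of s m j, OF s]
        distributed_integrable[OF D, of "\<lambda>x. (x - m) ^ j"] by simp
    \<comment> \<open>The normal law supplies moments about the mean \<open>m\<close>; raw moments
      follow from the binomial expansion of ((Z - m) + m)^k.\<close>
    have "(\<lambda>\<omega>. Z \<omega> ^ k) = (\<lambda>\<omega>. \<Sum>j\<le>k. of_nat (k choose j) * (Z \<omega> - m) ^ j * m ^ (k - j))"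
    proof
      fix \<omega> show "Z \<omega> ^ k = (\<Sum>j\<le>k. of_nat (k choose j) * (Z \<omega> - m) ^ j * m ^ (k - j))"
        using binomial_ring[of "Z \<omega> - m" m k] by simp
    qed
    then show ?thesis using a by (auto intro!: Bochner_Integration.integrable_sum)
  qed
qed

lemma lin_integrable_power: "\<xi> \<in> lin noise_sets \<Longrightarrow> integrable M (\<lambda>\<omega>. \<xi> \<omega> ^ k)"
  by (intro gaussian_rv_integrable lin_gaussian)

lemma lin_integrable: "\<xi> \<in> lin noise_sets \<Longrightarrow> integrable M \<xi>"
  using lin_integrable_power[of \<xi> 1] by simp

lemma lin_mean:
  assumes "\<xi> \<in> lin noise_sets" shows "(\<integral>\<omega>. \<xi> \<omega> \<partial>M) = 0"
proof -
  obtain J c where J: "finite J" "J \<subseteq> noise_sets" "\<xi> = (\<lambda>\<omega>. \<Sum>B\<in>J. c B * w B \<omega>)"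
    using assms by (auto simp: lin_def)
  have i: "integrable M (w B)" if "B \<in> J" for B using lin_integrable[OF lin_w] J that by auto
  have "(\<integral>\<omega>. \<xi> \<omega> \<partial>M) = (\<Sum>B\<in>J. c B * (\<integral>\<omega>. w B \<omega> \<partial>M))"
    unfolding J(3) using i by (subst Bochner_Integration.integral_sum) auto
  also have "\<dots> = 0" using white J by (intro sum.neutral) (auto simp: white_noise_def)
  finally show ?thesis .
qed

lemma lin_integrable_mult:
  assumes "\<xi> \<in> lin noise_sets" "\<eta> \<in> lin noise_sets"
  shows "integrable M (\<lambda>\<omega>. \<xi> \<omega> * \<eta> \<omega>)"
proof -
  have "integrable M (\<lambda>\<omega>. ((\<xi> \<omega> + \<eta> \<omega>) ^ 2 - \<xi> \<omega> ^ 2 - \<eta> \<omega> ^ 2) / 2)"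
    using lin_integrable_power[OF lin_add[OF assms], of 2] lin_integrable_power[OF assms(1), of 2]
      lin_integrable_power[OF assms(2), of 2] by auto
  then show ?thesis by (simp add: power2_eq_square algebra_simps)
qed

lemma lin_char:
  assumes "\<xi> \<in> lin noise_sets"
  shows "(\<integral>\<omega>. iexp (\<xi> \<omega>) \<partial>M) = exp (- (\<integral>\<omega>. (\<xi> \<omega>)\<^sup>2 \<partial>M) / 2)"
  using centered_gaussian(1)[OF lin_gaussian lin_mean] assms by auto

lemma lin_moment:
  assumes "\<xi> \<in> lin noise_sets"
  shows "(\<integral>\<omega>. \<xi> \<omega> ^ (2 * k) \<partial>M) = (fact (2 * k) / (2 ^ k * fact k)) * (\<integral>\<omega>. (\<xi> \<omega>)\<^sup>2 \<partial>M) ^ k"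
  using centered_gaussian(2)[OF lin_gaussian lin_mean] assms by auto

definition past :: "real \<Rightarrow> (real \<times> real) set set" where
  "past a = {B \<in> noise_sets. B \<subseteq> {0..a} \<times> UNIV}"

text \<open>Open at \<open>a\<close>: such sets are disjoint from those of \<open>past a\<close>,
  and each is the increasing union of its parts after the times
  \<open>a + 1 / Suc n\<close>.\<close>

definition future :: "real \<Rightarrow> (real \<times> real) set set" where
  "future a = {B \<in> noise_sets. B \<subseteq> {a<..} \<times> UNIV}"

lemma past_sub: "past a \<subseteq> noise_sets" and future_sub: "future a \<subseteq> noise_sets"
  by (auto simp: past_def future_def)

lemma lin_past_future_cov:
  assumes "\<xi> \<in> lin (past a)" "\<eta> \<in> lin (future a)"
  shows "(\<integral>\<omega>. \<xi> \<omega> * \<eta> \<omega> \<partial>M) = 0"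
proof -
  obtain J c where J: "finite J" "J \<subseteq> past a" "\<xi> = (\<lambda>\<omega>. \<Sum>B\<in>J. c B * w B \<omega>)"
    using assms by (auto simp: lin_def)
  obtain J' c' where J': "finite J'" "J' \<subseteq> future a" "\<eta> = (\<lambda>\<omega>. \<Sum>B\<in>J'. c' B * w B \<omega>)"
    using assms by (auto simp: lin_def)
  have i: "integrable M (\<lambda>\<omega>. w B \<omega> * w B' \<omega>)" if "B \<in> J" "B' \<in> J'" for B B'
    using that J J' past_sub[of a] future_sub[of a] by (intro lin_integrable_mult lin_w) auto
  have "(\<integral>\<omega>. \<xi> \<omega> * \<eta> \<omega> \<partial>M) = (\<integral>\<omega>. (\<Sum>B\<in>J. \<Sum>B'\<in>J'. c B * c' B' * (w B \<omega> * w B' \<omega>)) \<partial>M)"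
    unfolding J(3) J'(3) sum_product
    by (intro Bochner_Integration.integral_cong refl sum.cong) (simp add: mult_ac)
  also have "\<dots> = (\<Sum>B\<in>J. \<Sum>B'\<in>J'. c B * c' B' * (\<integral>\<omega>. w B \<omega> * w B' \<omega> \<partial>M))"
    using i by (subst Bochner_Integration.integral_sum, force intro!: Bochner_Integration.integrable_sum)
      (auto intro!: sum.cong Bochner_Integration.integral_sum simp: Bochner_Integration.integral_sum)
  also have "\<dots> = 0"
  proof (intro sum.neutral ballI)
    fix B B' assume "B \<in> J" "B' \<in> J'"
    then have B: "B \<in> past a" "B' \<in> future a" using J J' by auto
    then have "B \<inter> B' = {}" by (force simp: past_def future_def)
    moreover have "(\<integral>\<omega>. w B \<omega> * w B' \<omega> \<partial>M) = measure lborel (B \<inter> B')"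
      using B past_sub future_sub by (intro cov_w) auto
    ultimately show "c B * c' B' * (\<integral>\<omega>. w B \<omega> * w B' \<omega> \<partial>M) = 0" by simp
  qed
  finally show ?thesis .
qed

text \<open>Vanishing covariance makes the variances additive, and the characteristic function of a
  centred Gaussian combination depends on its variance alone; so lack of correlation becomes a
  product formula.\<close>

lemma lin_past_future_char:
  assumes \<xi>: "\<xi> \<in> lin (past a)" and \<eta>: "\<eta> \<in> lin (future a)"
  shows "(\<integral>\<omega>. iexp (\<xi> \<omega>) * iexp (\<eta> \<omega>) \<partial>M) = (\<integral>\<omega>. iexp (\<xi> \<omega>) \<partial>M) * (\<integral>\<omega>. iexp (\<eta> \<omega>) \<partial>M)"
proof -
  have x: "\<xi> \<in> lin noise_sets" "\<eta> \<in> lin noise_sets"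
    using lin_mono[OF past_sub] lin_mono[OF future_sub] assms by auto
  have "(\<integral>\<omega>. iexp (\<xi> \<omega>) * iexp (\<eta> \<omega>) \<partial>M) = (\<integral>\<omega>. iexp (\<xi> \<omega> + \<eta> \<omega>) \<partial>M)"
    by (simp add: exp_add distrib_left)
  also have "\<dots> = exp (- (\<integral>\<omega>. (\<xi> \<omega> + \<eta> \<omega>)\<^sup>2 \<partial>M) / 2)"
    by (rule lin_char[OF lin_add[OF x]])
  also have "(\<integral>\<omega>. (\<xi> \<omega> + \<eta> \<omega>)\<^sup>2 \<partial>M) = (\<integral>\<omega>. (\<xi> \<omega>)\<^sup>2 + 2 * (\<xi> \<omega> * \<eta> \<omega>) + (\<eta> \<omega>)\<^sup>2 \<partial>M)"
    by (simp add: power2_eq_square algebra_simps)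
  also have "\<dots> = (\<integral>\<omega>. (\<xi> \<omega>)\<^sup>2 \<partial>M) + (\<integral>\<omega>. (\<eta> \<omega>)\<^sup>2 \<partial>M)"
    using lin_integrable_power[OF x(1), of 2] lin_integrable_power[OF x(2), of 2]
      lin_integrable_mult[OF x] lin_past_future_cov[OF assms] by simp
  finally show ?thesis
    by (simp only: lin_char[OF x(1)] lin_char[OF x(2)] of_real_mult[symmetric] exp_add[symmetric]
        add_divide_distrib minus_add_distrib)
qed

section \<open>Independence of future noise from the augmented filtration\<close>

text \<open>Induction on the list of constraints, removing one indicator at a time by Fourier
  uniqueness in the variable \<open>w B\<close>. The extra factor with an arbitrary past combination
  \<open>\<xi>\<close> leaves room for the frequencies that this creates; for the empty list the
  claim is the product formula for characteristic functions.\<close>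

lemma noise_cylinder_zero:
  assumes \<eta>: "\<eta> \<in> lin (future a)"
    and L: "\<And>B U. (B, U) \<in> set L \<Longrightarrow> B \<in> past a \<and> U \<in> sets borel"
    and \<xi>: "\<xi> \<in> lin (past a)"
  shows "(\<integral>\<omega>. (iexp (\<eta> \<omega>) - (\<integral>\<omega>. iexp (\<eta> \<omega>) \<partial>M)) * (\<Prod>(B, U)\<leftarrow>L. indicator U (w B \<omega>)) * iexp (\<xi> \<omega>) \<partial>M) = 0"
  using L \<xi>
proof (induction L arbitrary: \<xi>)
  case Nil
  have x: "\<xi> \<in> lin noise_sets" "\<eta> \<in> lin noise_sets"
    using lin_mono[OF past_sub] lin_mono[OF future_sub] Nil \<eta> by auto
  have [measurable]: "\<xi> \<in> borel_measurable M" "\<eta> \<in> borel_measurable M"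
    using x measurable_lin by auto
  have i: "integrable M (\<lambda>\<omega>. iexp (\<xi> \<omega>) * iexp (\<eta> \<omega>))" "integrable M (\<lambda>\<omega>. iexp (\<xi> \<omega>))"
    by (auto intro!: integrable_const_bound[where B=1] simp: norm_mult)
  have "(\<integral>\<omega>. (iexp (\<eta> \<omega>) - (\<integral>\<omega>. iexp (\<eta> \<omega>) \<partial>M)) * iexp (\<xi> \<omega>) \<partial>M)
    = (\<integral>\<omega>. iexp (\<xi> \<omega>) * iexp (\<eta> \<omega>) - (\<integral>\<omega>. iexp (\<eta> \<omega>) \<partial>M) * iexp (\<xi> \<omega>) \<partial>M)"
    by (simp add: algebra_simps)
  also have "\<dots> = 0" using i lin_past_future_char[OF Nil(2) \<eta>]
    by (subst Bochner_Integration.integral_diff) auto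
  finally show ?case by simp
next
  case (Cons BU L)
  obtain B U where BU: "BU = (B, U)" by (cases BU)
  have B: "B \<in> past a" "U \<in> sets borel" using Cons.prems(1)[of B U] by (auto simp: BU)
  have x: "\<xi> \<in> lin noise_sets" "\<eta> \<in> lin noise_sets"
    using lin_mono[OF past_sub] lin_mono[OF future_sub] Cons.prems \<eta> by auto
  have [measurable]: "\<xi> \<in> borel_measurable M" "\<eta> \<in> borel_measurable M" "w B \<in> borel_measurable M"
    using x measurable_lin measurable_w B past_sub by auto
  define c where "c = (\<integral>\<omega>. iexp (\<eta> \<omega>) \<partial>M)"
  define I where "I = (\<lambda>\<omega>. (\<Prod>(B, U)\<leftarrow>L. indicator U (w B \<omega>)) :: complex)"
  have L': "B \<in> past a \<and> U \<in> sets borel" if "(B, U) \<in> set L" for B U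
    using Cons.prems(1)[of B U] that by auto
  have I: "I \<in> borel_measurable M \<and> (\<forall>\<omega>. norm (I \<omega>) \<le> 1)" unfolding I_def using L'
  proof (induction L)
    case (Cons b L)
    obtain B U where b: "b = (B, U)" by (cases b)
    have "w B \<in> borel_measurable M" "U \<in> sets borel"
      using Cons.prems[of B U] b measurable_w past_sub by auto
    moreover have "(\<lambda>\<omega>. (\<Prod>(B, U)\<leftarrow>L. indicator U (w B \<omega>)) :: complex) \<in> borel_measurable M"
      "\<And>\<omega>. norm ((\<Prod>(B, U)\<leftarrow>L. indicator U (w B \<omega>)) :: complex) \<le> 1"
      using Cons.IH Cons.prems by auto
    ultimately show ?case
      unfolding b list.map prod_list.Cons prod.case norm_mult
      by (intro conjI allI borel_measurable_times mult_le_one) (auto simp: indicator_def)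
  qed auto
  then have [measurable]: "I \<in> borel_measurable M" and nI: "norm (I \<omega>) \<le> 1" for \<omega> by auto
  have "(\<integral>\<omega>. ((iexp (\<eta> \<omega>) - c) * I \<omega> * iexp (\<xi> \<omega>)) * indicator U (w B \<omega>) \<partial>M) = 0"
  proof (rule zero_char_imp_zero_complex[where c="1 + norm c"])
    fix \<omega>
    have "norm (iexp (\<eta> \<omega>) - c) \<le> 1 + norm c" using norm_triangle_ineq4[of "iexp (\<eta> \<omega>)" c] by simp
    then have "norm (iexp (\<eta> \<omega>) - c) * norm (I \<omega>) \<le> (1 + norm c) * 1" using nI[of \<omega>]
      by (intro mult_mono) auto
    then show "norm ((iexp (\<eta> \<omega>) - c) * I \<omega> * iexp (\<xi> \<omega>)) \<le> 1 + norm c" by (simp add: norm_mult)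
  next
    fix \<theta>
    \<comment> \<open>The frequency \<open>\<theta> * w B\<close> is absorbed in
      \<open>\<xi>\<close>, so the induction hypothesis is exactly the vanishing of the Fourier
      integrals in the variable \<open>w B\<close>.\<close>
    have "(\<lambda>\<omega>. \<xi> \<omega> + \<theta> * w B \<omega>) \<in> lin (past a)"
      by (intro lin_add lin_scale lin_w B Cons.prems)
    from Cons.IH[OF L' this]
    show "(\<integral>\<omega>. (iexp (\<eta> \<omega>) - c) * I \<omega> * iexp (\<xi> \<omega>) * iexp (\<theta> * w B \<omega>) \<partial>M) = 0"
      by (simp add: I_def c_def exp_add distrib_left mult.assoc)
  qed (use B in auto)
  moreover have "(iexp (\<eta> \<omega>) - c) * (\<Prod>(B, U)\<leftarrow>BU # L. indicator U (w B \<omega>)) * iexp (\<xi> \<omega>)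
    = ((iexp (\<eta> \<omega>) - c) * I \<omega> * iexp (\<xi> \<omega>)) * indicator U (w B \<omega>)" for \<omega>
    by (simp add: BU I_def)
  ultimately show ?case unfolding c_def[symmetric] by (simp only:)
qed

text \<open>The completed filtration before right-continuity is imposed: \<open>F a\<close> is the
  intersection of the \<open>G s\<close> over s > a.\<close>

definition G :: "real \<Rightarrow> 'w set set" where
  "G a = sigma_sets (space M) (noise_events M w a \<union> null_sets M)"

lemma G_sub: "G a \<subseteq> sets M"
proof -
  have "noise_events M w a \<subseteq> sets M"
    using measurable_w by (auto simp: noise_events_def intro!: measurable_sets)
  then show ?thesis unfolding G_def by (intro sets.sigma_sets_subset) auto
qed

text \<open>A Dynkin argument: cylinder events together with the null sets form an
  intersection-stable generator of \<open>G a\<close>, and the events over which the centred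
  exponential integrates to 0 are closed under complements and disjoint countable unions.\<close>

lemma G_future_zero:
  assumes \<eta>: "\<eta> \<in> lin (future a)" and E: "E \<in> G a"
  shows "(\<integral>\<omega>. (iexp (\<eta> \<omega>) - (\<integral>\<omega>. iexp (\<eta> \<omega>) \<partial>M)) * indicator E \<omega> \<partial>M) = 0"
proof -
  define c where "c = (\<integral>\<omega>. iexp (\<eta> \<omega>) \<partial>M)"
  define Z where "Z = (\<lambda>\<omega>. iexp (\<eta> \<omega>) - c)"
  have [measurable]: "\<eta> \<in> borel_measurable M"
    using lin_mono[OF future_sub \<eta>] measurable_lin by auto
  have [measurable]: "Z \<in> borel_measurable M" by (simp add: Z_def)
  have nZ: "norm (Z \<omega>) \<le> 1 + norm c" for \<omega>
    using norm_triangle_ineq4[of "iexp (\<eta> \<omega>)" c] by (simp add: Z_def)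
  have iZ: "integrable M (\<lambda>\<omega>. Z \<omega> * indicator E \<omega>)" if "E \<in> sets M" for E
    by (rule integrable_const_bound[where B="1 + norm c"])
      (use that nZ in \<open>auto simp: norm_mult indicator_def intro: order_trans[OF norm_ge_zero nZ]\<close>)
  have iZ': "integrable M Z"
    by (rule integrable_const_bound[where B="1 + norm c"]) (use nZ in auto)
  define cyl where "cyl = (\<lambda>L. {\<omega> \<in> space M. \<forall>(B, U) \<in> set L. w B \<omega> \<in> U})"
  \<comment> \<open>Null sets must be generators here, since \<open>G a\<close> contains them;
    intersecting anything measurable with a null set gives a null set, so stability under
    intersections survives.\<close>
  define Q where "Q = null_sets M \<union> {cyl L | L. \<forall>(B, U) \<in> set L. B \<in> past a \<and> U \<in> sets borel}"
  have cyl_sets: "cyl L \<in> sets M" if L: "\<forall>(B, U) \<in> set L. B \<in> past a \<and> U \<in> sets borel" for L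
  proof -
    show ?thesis using L
    proof (induction L)
      case (Cons b L)
      obtain B U where b: "b = (B, U)" by (cases b)
      have "cyl (b # L) = (w B -` U \<inter> space M) \<inter> cyl L" by (auto simp: cyl_def b)
      moreover have "w B -` U \<inter> space M \<in> sets M"
        using Cons.prems b past_sub by (intro measurable_sets[OF measurable_w]) auto
      ultimately show ?case using Cons by auto
    qed (simp add: cyl_def)
  qed
  have Q: "Q \<subseteq> sets M" using cyl_sets by (auto simp: Q_def)
  have "Int_stable Q"
  proof (rule Int_stableI)
    fix A B assume AB: "A \<in> Q" "B \<in> Q"
    show "A \<inter> B \<in> Q"
    proof (cases "A \<in> null_sets M \<or> B \<in> null_sets M")
      case True
      then show ?thesis using AB Q by (auto simp: Q_def intro: null_set_Int1 null_set_Int2)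
    next
      case False
      then obtain L L' where "A = cyl L" "B = cyl L'"
        "\<forall>(B, U) \<in> set L. B \<in> past a \<and> U \<in> sets borel" "\<forall>(B, U) \<in> set L'. B \<in> past a \<and> U \<in> sets borel"
        using AB by (auto simp: Q_def)
      then have "A \<inter> B = cyl (L @ L')" "\<forall>(B, U) \<in> set (L @ L'). B \<in> past a \<and> U \<in> sets borel"
        by (auto simp: cyl_def)
      then show ?thesis unfolding Q_def by blast
    qed
  qed
  moreover have "Q \<subseteq> Pow (space M)" using Q sets.sets_into_space by auto
  moreover have "E \<in> sigma_sets (space M) Q"
  proof -
    have "noise_events M w a \<union> null_sets M \<subseteq> Q"
    proof -
      have "noise_events M w a \<subseteq> Q"
      proof
        fix A assume "A \<in> noise_events M w a"
        then obtain B U where "B \<in> past a" "U \<in> sets borel" "A = w B -` U \<inter> space M"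
          by (auto simp: noise_events_def past_def)
        then have "A = cyl [(B, U)]" "\<forall>(B, U) \<in> set [(B, U)]. B \<in> past a \<and> U \<in> sets borel"
          by (auto simp: cyl_def)
        then show "A \<in> Q" unfolding Q_def by blast
      qed
      then show ?thesis by (auto simp: Q_def)
    qed
    then show ?thesis using E unfolding G_def by (meson sigma_sets_mono' subsetD)
  qed
  moreover have cylZ: "(\<integral>\<omega>. Z \<omega> * indicator (cyl L) \<omega> \<partial>M) = 0"
    if L: "\<forall>(B, U) \<in> set L. B \<in> past a \<and> U \<in> sets borel" for L
  proof -
    have ind: "(\<Prod>(B, U)\<leftarrow>L. indicator U (w B \<omega>)) = (indicator (cyl L) \<omega> :: complex)" if "\<omega> \<in> space M" for \<omega>
    proof -
      have "(\<Prod>(B, U)\<leftarrow>L. indicator U (w B \<omega>)) = (if (\<forall>(B, U) \<in> set L. w B \<omega> \<in> U) then 1 else 0 :: complex)"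
        by (induction L) auto
      then show ?thesis using that by (simp add: cyl_def)
    qed
    have "(\<integral>\<omega>. Z \<omega> * indicator (cyl L) \<omega> \<partial>M)
      = (\<integral>\<omega>. (iexp (\<eta> \<omega>) - c) * (\<Prod>(B, U)\<leftarrow>L. indicator U (w B \<omega>)) * iexp 0 \<partial>M)"
      by (intro Bochner_Integration.integral_cong) (auto simp: ind Z_def)
    also have "\<dots> = 0" unfolding c_def
      by (rule noise_cylinder_zero[OF \<eta> _ lin_zero]) (use L in auto)
    finally show ?thesis .
  qed
  \<comment> \<open>The empty list of constraints describes the whole space; the mean zero obtained
    from it is what the complement case requires.\<close>
  have Z0: "(\<integral>\<omega>. Z \<omega> \<partial>M) = 0"
  proof -
    have "(\<integral>\<omega>. Z \<omega> * indicator (cyl []) \<omega> \<partial>M) = (\<integral>\<omega>. Z \<omega> \<partial>M)"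
      by (intro Bochner_Integration.integral_cong) (auto simp: cyl_def)
    then show ?thesis using cylZ[of "[]"] by simp
  qed
  have sub: "A \<in> sets M" if "A \<in> sigma_sets (space M) Q" for A
    using that sets.sigma_sets_subset[OF Q] by auto
  have "(\<integral>\<omega>. Z \<omega> * indicator E \<omega> \<partial>M) = 0"
    using calculation(1,2,3)
  proof (induction rule: sigma_sets_induct_disjoint)
    case (basic A)
    show ?case
    proof (cases "A \<in> null_sets M")
      case True
      then have "(\<integral>\<omega>. Z \<omega> * indicator A \<omega> \<partial>M) = (\<integral>\<omega>. 0 \<partial>M)"
        by (intro integral_cong_AE) (use True AE_not_in[OF True] in auto)
      then show ?thesis by simp
    next
      case False
      then show ?thesis using basic cylZ by (auto simp: Q_def)
    qed
  next
    case empty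
    show ?case by simp
  next
    case (compl A)
    have "(\<integral>\<omega>. Z \<omega> * indicator (space M - A) \<omega> \<partial>M) = (\<integral>\<omega>. Z \<omega> - Z \<omega> * indicator A \<omega> \<partial>M)"
      by (intro Bochner_Integration.integral_cong) (auto simp: indicator_def)
    then show ?case using compl sub iZ iZ' Z0 by simp
  next
    case (union A)
    have s: "A i \<in> sets M" for i using union sub by auto
    have "(LINT x:(\<Union>i. A i)|M. Z x) = (\<Sum>i. (LINT x:(A i)|M. Z x))"
    proof (rule lebesgue_integral_countable_add)
      show "set_integrable M (\<Union>i. A i) Z"
        using iZ[of "\<Union>i. A i"] s unfolding set_integrable_def
        by (subst Bochner_Integration.integrable_cong[OF refl,
              where g="\<lambda>\<omega>. Z \<omega> * indicator (\<Union>i. A i) \<omega>"]) (auto simp: indicator_def)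
    qed (use s union in \<open>auto simp: disjoint_family_on_def\<close>)
    moreover have eq: "(LINT x:B|M. Z x) = (\<integral>\<omega>. Z \<omega> * indicator B \<omega> \<partial>M)" for B
      unfolding set_lebesgue_integral_def
      by (intro Bochner_Integration.integral_cong) (auto simp: indicator_def)
    ultimately show ?case using union by simp
  qed
  then show ?thesis by (simp add: Z_def c_def)
qed

definition F :: "real \<Rightarrow> 'w measure" where "F = noise_filtration M w"

lemma G_Inter_Pow: "(\<Inter>s\<in>{a<..}. G s) \<subseteq> Pow (space M)"
proof -
  have "(\<Inter>s\<in>{a<..}. G s) \<subseteq> G (a + 1)" by (intro INF_lower) auto
  also have "\<dots> \<subseteq> Pow (space M)" using G_sub sets.sets_into_space by blast
  finally show ?thesis .
qed

lemma space_F[simp]: "space (F a) = space M"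
  unfolding F_def noise_filtration_def G_def[symmetric] by (rule space_measure_of[OF G_Inter_Pow])

lemma sets_F: "sets (F a) = (\<Inter>s\<in>{a<..}. G s)"
proof -
  have "sets (F a) = sigma_sets (space M) (\<Inter>s\<in>{a<..}. G s)"
    unfolding F_def noise_filtration_def G_def[symmetric]
    by (rule sets_measure_of[OF G_Inter_Pow])
  also have "\<dots> = (\<Inter>s\<in>{a<..}. G s)"
  proof (rule sigma_algebra.sigma_sets_eq)
    have "(\<Inter>s\<in>{a<..}. G s) = (\<Inter>T\<in>G ` {a<..}. T)" by auto
    have sp: "noise_events M w s \<union> null_sets M \<subseteq> Pow (space M)" for s
      using sets.sets_into_space by (auto simp: noise_events_def)
    have sa: "sigma_algebra (space M) (G s)" for s
      unfolding G_def by (rule sigma_algebra_sigma_sets[OF sp])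
    show "sigma_algebra (space M) (\<Inter>s\<in>{a<..}. G s)"
      unfolding sigma_algebra_iff2
    proof (intro conjI allI ballI impI)
      show "(\<Inter>s\<in>{a<..}. G s) \<subseteq> Pow (space M)" using sa[of "a+1"] unfolding sigma_algebra_iff2 by force
      show "{} \<in> (\<Inter>s\<in>{a<..}. G s)" using sa unfolding sigma_algebra_iff2 by force
      show "space M - s \<in> (\<Inter>s\<in>{a<..}. G s)" if "s \<in> (\<Inter>s\<in>{a<..}. G s)" for s
        using sa that unfolding sigma_algebra_iff2 by blast
      show "\<Union> (range A) \<in> (\<Inter>s\<in>{a<..}. G s)" if "range A \<subseteq> (\<Inter>s\<in>{a<..}. G s)" for A :: "nat \<Rightarrow> _"
        using sa that unfolding sigma_algebra_iff2 by blast
    qed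
  qed
  finally show ?thesis .
qed

lemma F_sub: "sets (F a) \<subseteq> sets M"
  using G_sub[of "a+1"] unfolding sets_F by force

lemma F_mono: "a \<le> b \<Longrightarrow> sets (F a) \<subseteq> sets (F b)"
  unfolding sets_F by auto

lemma w_F:
  assumes "B \<in> past a" shows "w B \<in> borel_measurable (F a)"
proof (rule measurableI)
  fix U :: "real set" assume "U \<in> sets borel"
  have "w B -` U \<inter> space M \<in> G s" if "a < s" for s
  proof -
    have "B \<in> noise_sets" "B \<subseteq> {0..s} \<times> UNIV" using assms that by (force simp: past_def)+
    then have "w B -` U \<inter> space M \<in> noise_events M w s"
      using \<open>U \<in> sets borel\<close> by (auto simp: noise_events_def)
    then show ?thesis by (auto simp: G_def)
  qed
  then show "w B -` U \<inter> space (F a) \<in> sets (F a)" by (simp add: sets_F)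
qed auto

lemma F_measurable_mono: "a \<le> b \<Longrightarrow> Y \<in> borel_measurable (F a) \<Longrightarrow> Y \<in> borel_measurable (F b)"
  by (rule measurable_mono[THEN subsetD, of borel borel "F a" "F b"]) (auto dest: F_mono)

lemma F_measurable_M: "Y \<in> borel_measurable (F a) \<Longrightarrow> Y \<in> borel_measurable M"
  by (rule measurable_mono[THEN subsetD, of borel borel "F a" M]) (use F_sub in auto)

lemma w_diff_sq:
  assumes "B \<in> noise_sets" "B' \<in> noise_sets" "B' \<subseteq> B"
  shows "(\<integral>\<omega>. (w B \<omega> - w B' \<omega>)\<^sup>2 \<partial>M) = measure lborel B - measure lborel B'"
proof -
  have i: "integrable M (\<lambda>\<omega>. w A \<omega> * w C \<omega>)" if "A \<in> noise_sets" "C \<in> noise_sets" for A C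
    using that by (intro lin_integrable_mult lin_w)
  have "(\<integral>\<omega>. (w B \<omega> - w B' \<omega>)\<^sup>2 \<partial>M) = (\<integral>\<omega>. w B \<omega> * w B \<omega> - 2 * (w B \<omega> * w B' \<omega>) + w B' \<omega> * w B' \<omega> \<partial>M)"
    by (simp add: power2_eq_square algebra_simps)
  also have "\<dots> = measure lborel B - 2 * measure lborel (B \<inter> B') + measure lborel B'"
    using i assms cov_w by simp
  finally show ?thesis using assms by (simp add: Int_absorb1)
qed

text \<open>Every set in the combination is cut down to times after \<open>a + 1 / Suc n\<close>.
  The L^1 error is controlled through the L^2 norm of the removed noise, the square root of the
  removed Lebesgue measure, which tends to 0 because the sets lie strictly after time
  \<open>a\<close>.\<close>

lemma lin_future_approx:
  assumes \<eta>: "\<eta> \<in> lin (future a)"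
  shows "\<exists>\<eta>'. (\<forall>n. \<eta>' n \<in> lin (future (a + 1 / Suc n))) \<and> (\<lambda>n. \<integral>\<omega>. \<bar>\<eta>' n \<omega> - \<eta> \<omega>\<bar> \<partial>M) \<longlonglongrightarrow> 0"
proof -
  obtain J c where J: "finite J" "J \<subseteq> future a" "\<eta> = (\<lambda>\<omega>. \<Sum>B\<in>J. c B * w B \<omega>)"
    using assms by (auto simp: lin_def)
  define S where "S = (\<lambda>n::nat. {a + 1 / Suc n<..} \<times> (UNIV :: real set))"
  have S[measurable]: "S n \<in> sets borel" for n
    unfolding S_def by (intro borel_open open_Times) auto
  have BS: "B \<inter> S n \<in> future (a + 1 / Suc n)" if "B \<in> future a" for B n
  proof -
    have "B \<in> sets borel" "emeasure lborel B < \<infinity>" using that by (auto simp: future_def noise_sets_def)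
    then have "emeasure lborel (B \<inter> S n) \<le> emeasure lborel B" "B \<inter> S n \<in> sets borel"
      by (auto intro!: emeasure_mono)
    then show ?thesis using that by (auto simp: future_def noise_sets_def S_def intro: le_less_trans)
  qed
  have N: "B \<in> noise_sets" "B \<inter> S n \<in> noise_sets" if "B \<in> J" for B n
    using BS[of B n] that J future_sub by auto
  define \<eta>' where "\<eta>' = (\<lambda>n \<omega>. \<Sum>B\<in>J. c B * w (B \<inter> S n) \<omega>)"
  have "\<eta>' n \<in> lin (future (a + 1 / Suc n))" for n
    unfolding \<eta>'_def by (intro lin_sum lin_scale lin_w BS J) (use J in auto)
  moreover have "(\<lambda>n. \<integral>\<omega>. \<bar>\<eta>' n \<omega> - \<eta> \<omega>\<bar> \<partial>M) \<longlonglongrightarrow> 0"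
  proof (rule tendsto_sandwich[OF _ _ tendsto_const])
    show "\<forall>\<^sub>F n in sequentially. (\<integral>\<omega>. \<bar>\<eta>' n \<omega> - \<eta> \<omega>\<bar> \<partial>M)
      \<le> (\<Sum>B\<in>J. \<bar>c B\<bar> * sqrt (measure lborel B - measure lborel (B \<inter> S n)))"
    proof (intro always_eventually allI)
      fix n
      have l: "(\<lambda>\<omega>. w B \<omega> - w (B \<inter> S n) \<omega>) \<in> lin noise_sets" if "B \<in> J" for B
        using lin_add[OF lin_w[OF N(1)[OF that]] lin_scale[OF lin_w[OF N(2)[OF that]], of "-1" n]] by simp
      have i: "integrable M (\<lambda>\<omega>. \<bar>c B * (w B \<omega> - w (B \<inter> S n) \<omega>)\<bar>)" if "B \<in> J" for B
        using lin_integrable[OF l[OF that]] by auto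
      have "(\<integral>\<omega>. \<bar>\<eta>' n \<omega> - \<eta> \<omega>\<bar> \<partial>M) \<le> (\<integral>\<omega>. (\<Sum>B\<in>J. \<bar>c B * (w B \<omega> - w (B \<inter> S n) \<omega>)\<bar>) \<partial>M)"
      proof (rule integral_mono')
        fix \<omega>
        have "\<eta>' n \<omega> - \<eta> \<omega> = - (\<Sum>B\<in>J. c B * (w B \<omega> - w (B \<inter> S n) \<omega>))"
          by (simp add: \<eta>'_def J(3) sum_subtractf[symmetric] sum_negf[symmetric] right_diff_distrib)
        then show "\<bar>\<eta>' n \<omega> - \<eta> \<omega>\<bar> \<le> (\<Sum>B\<in>J. \<bar>c B * (w B \<omega> - w (B \<inter> S n) \<omega>)\<bar>)"
          by (simp only: abs_minus_cancel) (rule sum_abs)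
      qed (use i in \<open>auto intro!: Bochner_Integration.integrable_sum\<close>)
      also have "\<dots> = (\<Sum>B\<in>J. \<bar>c B\<bar> * (\<integral>\<omega>. \<bar>w B \<omega> - w (B \<inter> S n) \<omega>\<bar> \<partial>M))"
        using i by (subst Bochner_Integration.integral_sum) (auto simp: abs_mult)
      also have "\<dots> \<le> (\<Sum>B\<in>J. \<bar>c B\<bar> * sqrt (measure lborel B - measure lborel (B \<inter> S n)))"
      proof (intro sum_mono mult_left_mono)
        fix B assume B: "B \<in> J"
        let ?D = "\<lambda>\<omega>. \<bar>w B \<omega> - w (B \<inter> S n) \<omega>\<bar>"
        \<comment> \<open>Nonnegativity of the variance bounds the squared first absolute moment by
          the second moment.\<close>
        have "(\<integral>\<omega>. ?D \<omega> \<partial>M)\<^sup>2 \<le> (\<integral>\<omega>. (?D \<omega>)\<^sup>2 \<partial>M)"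
          using variance_positive[of ?D] variance_eq[of ?D] lin_integrable[OF l[OF B]]
            lin_integrable_power[OF l[OF B], of 2] by auto
        also have "\<dots> = measure lborel B - measure lborel (B \<inter> S n)"
          using w_diff_sq[of B "B \<inter> S n"] N[OF B] by simp
        finally show "(\<integral>\<omega>. ?D \<omega> \<partial>M) \<le> sqrt (measure lborel B - measure lborel (B \<inter> S n))"
          by (rule real_le_rsqrt)
      qed auto
      finally show "(\<integral>\<omega>. \<bar>\<eta>' n \<omega> - \<eta> \<omega>\<bar> \<partial>M)
        \<le> (\<Sum>B\<in>J. \<bar>c B\<bar> * sqrt (measure lborel B - measure lborel (B \<inter> S n)))" .
    qed
    have "(\<lambda>n. measure lborel (B \<inter> S n)) \<longlonglongrightarrow> measure lborel B" if "B \<in> J" for B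
    proof -
      have B: "B \<in> sets borel" "emeasure lborel B < \<infinity>" "B \<subseteq> {a<..} \<times> UNIV"
        using that J by (auto simp: future_def noise_sets_def)
      have U: "(\<Union>n. B \<inter> S n) = B"
      proof -
        have "\<exists>n. a + 1 / Suc n < x" if "a < x" for x :: real
        proof -
          obtain n where "inverse (real (Suc n)) < x - a" using reals_Archimedean[of "x - a"] \<open>a < x\<close>
            by (metis diff_gt_0_iff_gt)
          then have "1 / Suc n < x - a" by (simp only: inverse_eq_divide)
          then show ?thesis by (intro exI[of _ n]) auto
        qed
        then show ?thesis using B(3) by (fastforce simp: S_def)
      qed
      have "incseq (\<lambda>n. B \<inter> S n)"
      proof (rule incseq_SucI)
        fix n
        have "1 / (real (Suc (Suc n))) \<le> 1 / real (Suc n)" by (intro divide_left_mono) auto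
        then show "B \<inter> S n \<subseteq> B \<inter> S (Suc n)" by (auto simp: S_def)
      qed
      then have "(\<lambda>n. measure lborel (B \<inter> S n)) \<longlonglongrightarrow> measure lborel (\<Union>n. B \<inter> S n)"
        using B U by (intro Lim_measure_incseq) auto
      then show ?thesis unfolding U .
    qed
    then have "(\<lambda>n. (\<Sum>B\<in>J. \<bar>c B\<bar> * sqrt (measure lborel B - measure lborel (B \<inter> S n))))
      \<longlonglongrightarrow> (\<Sum>B\<in>J. \<bar>c B\<bar> * sqrt (measure lborel B - measure lborel B))"
      by (intro tendsto_intros) auto
    then show "(\<lambda>n. (\<Sum>B\<in>J. \<bar>c B\<bar> * sqrt (measure lborel B - measure lborel (B \<inter> S n)))) \<longlonglongrightarrow> 0" by simp
  qed (auto intro!: always_eventually Bochner_Integration.integral_nonneg)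
  ultimately show ?thesis by blast
qed

lemma iexp_diff_le: "norm (iexp x - iexp y) \<le> \<bar>x - y\<bar>"
proof -
  have "iexp x - iexp y = iexp y * (iexp (x - y) - 1)"
    by (simp add: right_diff_distrib flip: exp_add)
  then have "norm (iexp x - iexp y) = norm (iexp (x - y) - 1)" by (simp add: norm_mult)
  also have "\<dots> \<le> \<bar>x - y\<bar>" using iexp_approx1[of "x - y" 0] by simp
  finally show ?thesis .
qed

text \<open>An event of \<open>F a\<close> belongs to \<open>G (a + 1 / Suc n)\<close> for every
  \<open>n\<close>, so the product formula holds for the cut combinations. Both sides converge,
  since x -> exp (i x) is 1-Lipschitz and the cut combinations converge in L^1.\<close>

lemma F_future_zero:
  assumes \<eta>: "\<eta> \<in> lin (future a)" and E: "E \<in> sets (F a)"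
  shows "(\<integral>\<omega>. iexp (\<eta> \<omega>) * indicator E \<omega> \<partial>M) = (\<integral>\<omega>. iexp (\<eta> \<omega>) \<partial>M) * prob E"
proof -
  obtain \<eta>' where \<eta>': "\<And>n. \<eta>' n \<in> lin (future (a + 1 / Suc n))"
    and lim: "(\<lambda>n. \<integral>\<omega>. \<bar>\<eta>' n \<omega> - \<eta> \<omega>\<bar> \<partial>M) \<longlonglongrightarrow> 0"
    using lin_future_approx[OF \<eta>] by blast
  have EM[measurable]: "E \<in> sets M" using E F_sub by auto
  have l: "\<eta> \<in> lin noise_sets" "\<eta>' n \<in> lin noise_sets" for n
    using lin_mono[OF future_sub \<eta>] lin_mono[OF future_sub \<eta>'[of n]] by auto
  note [measurable] = l[THEN measurable_lin]
  have i1: "integrable M (\<lambda>\<omega>. \<bar>\<eta>' n \<omega> - \<eta> \<omega>\<bar>)" for n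
    using lin_integrable[OF l(1)] lin_integrable[OF l(2)] by auto
  have conv: "(\<lambda>n. \<integral>\<omega>. iexp (\<eta>' n \<omega>) * indicator A \<omega> \<partial>M) \<longlonglongrightarrow> (\<integral>\<omega>. iexp (\<eta> \<omega>) * indicator A \<omega> \<partial>M)"
    if [measurable]: "A \<in> sets M" for A
  proof (rule LIM_zero_cancel, rule Lim_null_comparison[OF _ lim], intro always_eventually allI)
    fix n
    have i: "integrable M (\<lambda>\<omega>. iexp (\<xi> \<omega>) * indicator A \<omega>)" if [measurable]: "\<xi> \<in> borel_measurable M" for \<xi>
      by (rule integrable_const_bound[where B=1]) (auto simp: norm_mult indicator_def)
    have "norm ((\<integral>\<omega>. iexp (\<eta>' n \<omega>) * indicator A \<omega> \<partial>M) - (\<integral>\<omega>. iexp (\<eta> \<omega>) * indicator A \<omega> \<partial>M))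
      = norm (\<integral>\<omega>. iexp (\<eta>' n \<omega>) * indicator A \<omega> - iexp (\<eta> \<omega>) * indicator A \<omega> \<partial>M)"
      by (subst Bochner_Integration.integral_diff) (use i in auto)
    also have "\<dots> \<le> (\<integral>\<omega>. \<bar>\<eta>' n \<omega> - \<eta> \<omega>\<bar> \<partial>M)"
      by (rule order_trans[OF integral_norm_bound], rule integral_mono'[OF i1])
        (auto simp: left_diff_distrib[symmetric] norm_mult indicator_def iexp_diff_le)
    finally show "norm ((\<integral>\<omega>. iexp (\<eta>' n \<omega>) * indicator A \<omega> \<partial>M) - (\<integral>\<omega>. iexp (\<eta> \<omega>) * indicator A \<omega> \<partial>M))
      \<le> (\<integral>\<omega>. \<bar>\<eta>' n \<omega> - \<eta> \<omega>\<bar> \<partial>M)" .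
  qed
  have eq: "(\<integral>\<omega>. iexp (\<eta>' n \<omega>) * indicator E \<omega> \<partial>M) = (\<integral>\<omega>. iexp (\<eta>' n \<omega>) \<partial>M) * prob E" for n
  proof -
    define c where "c = (\<integral>\<omega>. iexp (\<eta>' n \<omega>) \<partial>M)"
    have "E \<in> G (a + 1 / Suc n)" using E by (auto simp: sets_F)
    from G_future_zero[OF \<eta>' this]
    have "0 = (\<integral>\<omega>. iexp (\<eta>' n \<omega>) * indicator E \<omega> - c * indicator E \<omega> \<partial>M)"
      by (simp add: c_def left_diff_distrib)
    also have "\<dots> = (\<integral>\<omega>. iexp (\<eta>' n \<omega>) * indicator E \<omega> \<partial>M) - (\<integral>\<omega>. c * indicator E \<omega> \<partial>M)"
    proof (rule Bochner_Integration.integral_diff)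
      show "integrable M (\<lambda>\<omega>. iexp (\<eta>' n \<omega>) * indicator E \<omega>)"
        by (rule integrable_const_bound[where B=1]) (auto simp: norm_mult indicator_def)
      show "integrable M (\<lambda>\<omega>. c * indicator E \<omega>)"
        by (rule integrable_const_bound[where B="norm c"]) (auto simp: norm_mult indicator_def)
    qed
    also have "(\<integral>\<omega>. c * indicator E \<omega> \<partial>M) = c * prob E"
    proof -
      have "(\<integral>\<omega>. c * indicator E \<omega> \<partial>M) = (\<integral>\<omega>. c * complex_of_real (indicator E \<omega>) \<partial>M)"
        by (intro Bochner_Integration.integral_cong) (auto simp: indicator_def)
      then show ?thesis by (simp add: integral_complex_of_real EM)
    qed
    finally show ?thesis by (simp add: c_def)
  qed
  have "(\<lambda>n. \<integral>\<omega>. iexp (\<eta>' n \<omega>) * indicator (space M) \<omega> \<partial>M) \<longlonglongrightarrow> (\<integral>\<omega>. iexp (\<eta> \<omega>) * indicator (space M) \<omega> \<partial>M)"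
    by (rule conv) simp
  moreover have "(\<integral>\<omega>. iexp (\<xi> \<omega>) * indicator (space M) \<omega> \<partial>M) = (\<integral>\<omega>. iexp (\<xi> \<omega>) \<partial>M)" for \<xi>
    by (intro Bochner_Integration.integral_cong) auto
  ultimately have "(\<lambda>n. (\<integral>\<omega>. iexp (\<eta>' n \<omega>) \<partial>M)) \<longlonglongrightarrow> (\<integral>\<omega>. iexp (\<eta> \<omega>) \<partial>M)"
    by simp
  from tendsto_mult_right[OF this, of "prob E"]
  have "(\<lambda>n. (\<integral>\<omega>. iexp (\<eta>' n \<omega>) \<partial>M) * prob E) \<longlonglongrightarrow> (\<integral>\<omega>. iexp (\<eta> \<omega>) \<partial>M) * prob E" .
  with conv[OF EM] show ?thesis unfolding eq by (rule LIMSEQ_unique)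
qed

text \<open>Fourier uniqueness applied to the bounded weight \<open>indicator E - prob E\<close>,
  whose Fourier integrals against \<open>\<eta>\<close> vanish by the product formula at every
  frequency.\<close>

lemma F_future_indep_events:
  assumes \<eta>: "\<eta> \<in> lin (future a)" and E: "E \<in> sets (F a)" and U[measurable]: "U \<in> sets borel"
  shows "prob (E \<inter> (\<eta> -` U \<inter> space M)) = prob E * prob (\<eta> -` U \<inter> space M)"
proof -
  have EM[measurable]: "E \<in> sets M" using E F_sub by auto
  have [measurable]: "\<eta> \<in> borel_measurable M"
    using lin_mono[OF future_sub \<eta>] measurable_lin by auto
  have z: "(\<integral>\<omega>. (indicator E \<omega> - prob E) * indicator U (\<eta> \<omega>) \<partial>M) = 0"
  proof (rule zero_char_imp_zero[where c=1])
    show "\<bar>indicator E \<omega> - prob E\<bar> \<le> 1" for \<omega>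
      using prob_le_1[of E] measure_nonneg[of M E] by (cases "\<omega> \<in> E") auto
    fix \<theta>
    have i: "integrable M (\<lambda>\<omega>. iexp (\<theta> * \<eta> \<omega>) * indicator E \<omega>)" "integrable M (\<lambda>\<omega>. iexp (\<theta> * \<eta> \<omega>))"
      by (auto intro!: integrable_const_bound[where B=1] simp: norm_mult indicator_def)
    have "(\<integral>\<omega>. complex_of_real (indicator E \<omega> - prob E) * iexp (\<theta> * \<eta> \<omega>) \<partial>M)
      = (\<integral>\<omega>. iexp (\<theta> * \<eta> \<omega>) * indicator E \<omega> - prob E * iexp (\<theta> * \<eta> \<omega>) \<partial>M)"
      by (intro Bochner_Integration.integral_cong) (auto simp: indicator_def algebra_simps)
    also have "\<dots> = 0"
      using i F_future_zero[OF lin_scale[OF \<eta>] E, of \<theta>] by (subst Bochner_Integration.integral_diff) auto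
    finally show "(\<integral>\<omega>. complex_of_real (indicator E \<omega> - prob E) * iexp (\<theta> * \<eta> \<omega>) \<partial>M) = 0" .
  qed auto
  have "(\<integral>\<omega>. (indicator E \<omega> - prob E) * indicator U (\<eta> \<omega>) \<partial>M)
    = (\<integral>\<omega>. indicator (E \<inter> (\<eta> -` U \<inter> space M)) \<omega> - prob E * indicator (\<eta> -` U \<inter> space M) \<omega> \<partial>M)"
    by (intro Bochner_Integration.integral_cong) (auto simp: indicator_def)
  also have "\<dots> = prob (E \<inter> (\<eta> -` U \<inter> space M)) - prob E * prob (\<eta> -` U \<inter> space M)"
  proof (subst Bochner_Integration.integral_diff)
    have [measurable]: "\<eta> -` U \<inter> space M \<in> events" by measurable
    show "integrable M (indicat_real (E \<inter> (\<eta> -` U \<inter> space M)))"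
      "integrable M (\<lambda>\<omega>. prob E * indicat_real (\<eta> -` U \<inter> space M) \<omega>)"
      by (auto intro!: integrable_mult_right integrable_real_indicator simp: emeasure_eq_measure)
    show "expectation (indicat_real (E \<inter> (\<eta> -` U \<inter> space M))) -
        (\<integral>\<omega>. prob E * indicat_real (\<eta> -` U \<inter> space M) \<omega> \<partial>M) =
      prob (E \<inter> (\<eta> -` U \<inter> space M)) - prob E * prob (\<eta> -` U \<inter> space M)"
      by simp
  qed
  finally show ?thesis using z by simp
qed

text \<open>The function \<open>g\<close> makes the statement serve both the noise itself and its
  square, which are the two moments needed in a single time step.\<close>

lemma F_future_indep:
  assumes \<eta>: "\<eta> \<in> lin (future a)" and Y: "Y \<in> borel_measurable (F a)" and g: "g \<in> borel_measurable borel"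
  shows "indep_var borel Y borel (\<lambda>\<omega>. g (\<eta> \<omega>) :: real)"
proof -
  have m: "\<eta> \<in> borel_measurable M"
    using lin_mono[OF future_sub \<eta>] measurable_lin by auto
  have g\<eta>: "(\<lambda>\<omega>. g (\<eta> \<omega>)) \<in> borel_measurable M" using m g by simp
  have sg: "(\<lambda>\<omega>. g (\<eta> \<omega>)) -` U \<inter> space M = \<eta> -` (g -` U) \<inter> space M" for U by auto
  have gU: "g -` U \<in> sets borel" if "U \<in> sets borel" for U
    using measurable_sets[OF g that] by simp
  have stable: "Int_stable {f -` A \<inter> space M |A. A \<in> sets borel}" for f :: "'w \<Rightarrow> real"
  proof (rule Int_stableI)
    fix a b assume "a \<in> {f -` A \<inter> space M |A. A \<in> sets borel}" "b \<in> {f -` A \<inter> space M |A. A \<in> sets borel}"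
    then obtain A B where "a = f -` A \<inter> space M" "b = f -` B \<inter> space M" "A \<in> sets borel" "B \<in> sets borel"
      by blast
    then show "a \<inter> b \<in> {f -` A \<inter> space M |A. A \<in> sets borel}"
      by (intro CollectI exI[of _ "A \<inter> B"]) auto
  qed
  have "indep_set {Y -` A \<inter> space M |A. A \<in> sets borel} {(\<lambda>\<omega>. g (\<eta> \<omega>)) -` A \<inter> space M |A. A \<in> sets borel}"
  proof (rule indep_setI)
    show "{Y -` A \<inter> space M |A. A \<in> sets borel} \<subseteq> events"
      using measurable_sets[OF F_measurable_M[OF Y]] by auto
    show "{(\<lambda>\<omega>. g (\<eta> \<omega>)) -` A \<inter> space M |A. A \<in> sets borel} \<subseteq> events"
      using measurable_sets[OF g\<eta>] by auto
    fix A B assume "A \<in> {Y -` A \<inter> space M |A. A \<in> sets borel}"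
      "B \<in> {(\<lambda>\<omega>. g (\<eta> \<omega>)) -` A \<inter> space M |A. A \<in> sets borel}"
    then obtain U V where "U \<in> sets borel" "V \<in> sets borel" "A = Y -` U \<inter> space M"
      "B = \<eta> -` (g -` V) \<inter> space M" by (auto simp: sg)
    moreover have "A \<in> sets (F a)" using calculation measurable_sets[OF Y, of U] by simp
    ultimately show "prob (A \<inter> B) = prob A * prob B"
      using F_future_indep_events[OF \<eta> _ gU] by simp
  qed
  from indep_set_sigma_sets[OF this stable stable]
  show ?thesis unfolding indep_var_eq using F_measurable_M[OF Y] g\<eta> by simp
qed

end

section \<open>Simple Walsh integrals\<close>

context white_noise_space
begin

lemma noise_sets_Times:
  assumes "S \<in> sets borel" "S \<subseteq> {0..}" "emeasure lborel S < \<infinity>" "A \<in> sets borel" "emeasure lborel A < \<infinity>"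
  shows "S \<times> A \<in> noise_sets" and "measure lborel (S \<times> A) = measure lborel S * measure lborel A"
proof -
  have e: "emeasure lborel (S \<times> A) = emeasure lborel S * emeasure lborel A"
    using assms by (subst lborel_prod[symmetric], subst lborel.emeasure_pair_measure_Times) auto
  then have "emeasure lborel (S \<times> A) < \<infinity>" using assms by (simp add: ennreal_mult_less_top)
  moreover have "S \<times> A \<in> sets borel" using assms by (intro borel_Times)
  ultimately show "S \<times> A \<in> noise_sets" using assms(2) by (auto simp: noise_sets_def)
  show "measure lborel (S \<times> A) = measure lborel S * measure lborel A"
    by (simp add: measure_def e enn2real_mult)
qed

text \<open>The definition of white noise does not mention additivity in the set argument. It holds
  almost surely, because the covariance formula gives the defect second moment 0; this is the
  special case of the empty set.\<close>

lemma w_empty: "AE \<omega> in M. w {} \<omega> = 0"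
proof -
  have e: "{} \<in> noise_sets" by (auto simp: noise_sets_def)
  have "(\<integral>\<omega>. w {} \<omega> * w {} \<omega> \<partial>M) = 0" using cov_w[OF e e] by simp
  then have "AE \<omega> in M. w {} \<omega> * w {} \<omega> = 0"
    using lin_integrable_mult[OF lin_w[OF e] lin_w[OF e]]
    by (subst (asm) integral_nonneg_eq_0_iff_AE) auto
  then show ?thesis by auto
qed

lemma w_Un:
  assumes B: "B \<in> noise_sets" "B' \<in> noise_sets" "B \<inter> B' = {}"
  shows "AE \<omega> in M. w (B \<union> B') \<omega> = w B \<omega> + w B' \<omega>"
proof -
  have fin: "emeasure lborel B < \<infinity>" "emeasure lborel B' < \<infinity>" "B \<in> sets borel" "B' \<in> sets borel"
    using B by (auto simp: noise_sets_def)
  have U: "B \<union> B' \<in> noise_sets" and m: "measure lborel (B \<union> B') = measure lborel B + measure lborel B'"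
  proof -
    have "emeasure lborel (B \<union> B') \<le> emeasure lborel B + emeasure lborel B'"
      using fin by (intro emeasure_subadditive) auto
    also have "\<dots> < \<infinity>" using fin by simp
    finally show "B \<union> B' \<in> noise_sets" using B by (auto simp: noise_sets_def)
    show "measure lborel (B \<union> B') = measure lborel B + measure lborel B'"
      using fin B by (intro measure_Union) auto
  qed
  have i: "integrable M (\<lambda>\<omega>. w A \<omega> * w C \<omega>)" if "A \<in> noise_sets" "C \<in> noise_sets" for A C
    using that by (intro lin_integrable_mult lin_w)
  have eq: "(\<lambda>\<omega>. (w (B \<union> B') \<omega> - w B \<omega> - w B' \<omega>)\<^sup>2) = (\<lambda>\<omega>. w (B \<union> B') \<omega> * w (B \<union> B') \<omega>
      - 2 * (w (B \<union> B') \<omega> * w B \<omega>) - 2 * (w (B \<union> B') \<omega> * w B' \<omega>) + 2 * (w B \<omega> * w B' \<omega>)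
      + w B \<omega> * w B \<omega> + w B' \<omega> * w B' \<omega>)"
    by (auto simp: power2_eq_square algebra_simps)
  have int: "integrable M (\<lambda>\<omega>. (w (B \<union> B') \<omega> - w B \<omega> - w B' \<omega>)\<^sup>2)"
    unfolding eq using i B U by simp
  have "(B \<union> B') \<inter> B = B" "(B \<union> B') \<inter> B' = B'" by auto
  then have "(\<integral>\<omega>. (w (B \<union> B') \<omega> - w B \<omega> - w B' \<omega>)\<^sup>2 \<partial>M) = 0"
    unfolding eq using i B U m by (simp add: cov_w)
  then have "AE \<omega> in M. (w (B \<union> B') \<omega> - w B \<omega> - w B' \<omega>)\<^sup>2 = 0"
    using int by (subst (asm) integral_nonneg_eq_0_iff_AE) auto
  then show ?thesis by auto
qed

lemma future_mean_zero:
  assumes B: "B \<in> future r" and Y: "Y \<in> borel_measurable (F r)" "integrable M Y"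
  shows "integrable M (\<lambda>\<omega>. Y \<omega> * w B \<omega>)" "(\<integral>\<omega>. Y \<omega> * w B \<omega> \<partial>M) = 0"
proof -
  have N: "w B \<in> lin noise_sets" using B future_sub by (intro lin_w) auto
  note ind = F_future_indep[OF lin_w[OF B] Y(1), of "\<lambda>x. x", simplified]
  show "integrable M (\<lambda>\<omega>. Y \<omega> * w B \<omega>)"
    by (rule indep_var_integrable[OF ind Y(2) lin_integrable[OF N]])
  show "(\<integral>\<omega>. Y \<omega> * w B \<omega> \<partial>M) = 0"
    using indep_var_lebesgue_integral[OF ind Y(2) lin_integrable[OF N]] lin_mean[OF N] by simp
qed

lemma future_square:
  assumes \<eta>: "\<eta> \<in> lin (future r)" and Y: "Y \<in> borel_measurable (F r)" "integrable M Y"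
  shows "integrable M (\<lambda>\<omega>. Y \<omega> * (\<eta> \<omega>)\<^sup>2)"
    "(\<integral>\<omega>. Y \<omega> * (\<eta> \<omega>)\<^sup>2 \<partial>M) = (\<integral>\<omega>. Y \<omega> \<partial>M) * (\<integral>\<omega>. (\<eta> \<omega>)\<^sup>2 \<partial>M)"
proof -
  have N: "\<eta> \<in> lin noise_sets" using lin_mono[OF future_sub \<eta>] .
  have ind: "indep_var borel Y borel (\<lambda>\<omega>. (\<eta> \<omega>)\<^sup>2)"
    by (rule F_future_indep[OF \<eta> Y(1), of "\<lambda>x. x\<^sup>2"]) simp
  note i = lin_integrable_power[OF N, of 2]
  show "integrable M (\<lambda>\<omega>. Y \<omega> * (\<eta> \<omega>)\<^sup>2)"
    by (rule indep_var_integrable[OF ind Y(2) i])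
  show "(\<integral>\<omega>. Y \<omega> * (\<eta> \<omega>)\<^sup>2 \<partial>M) = (\<integral>\<omega>. Y \<omega> \<partial>M) * (\<integral>\<omega>. (\<eta> \<omega>)\<^sup>2 \<partial>M)"
    by (rule indep_var_lebesgue_integral[OF ind Y(2) i])
qed

text \<open>Polarisation: the product is a quarter of the difference of the squares of
  \<open>w B + w B'\<close> and \<open>w B - w B'\<close>, each of which is future noise independent
  of \<open>Y\<close>.\<close>

lemma future_product:
  assumes B: "B \<in> future r" "B' \<in> future r" and Y: "Y \<in> borel_measurable (F r)" "integrable M Y"
  shows "integrable M (\<lambda>\<omega>. Y \<omega> * (w B \<omega> * w B' \<omega>))"
    "(\<integral>\<omega>. Y \<omega> * (w B \<omega> * w B' \<omega>) \<partial>M) = (\<integral>\<omega>. Y \<omega> \<partial>M) * measure lborel (B \<inter> B')"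
proof -
  have N: "B \<in> noise_sets" "B' \<in> noise_sets" using B future_sub by auto
  have l: "(\<lambda>\<omega>. w B \<omega> + c * w B' \<omega>) \<in> lin (future r)" for c
    by (intro lin_add lin_scale lin_w B)
  note f = future_square[OF l Y]
  have eq: "Y \<omega> * (w B \<omega> * w B' \<omega>) = (1/4) * (Y \<omega> * (w B \<omega> + 1 * w B' \<omega>)\<^sup>2 - Y \<omega> * (w B \<omega> + (-1) * w B' \<omega>)\<^sup>2)" for \<omega>
    by (simp add: power2_eq_square algebra_simps)
  show "integrable M (\<lambda>\<omega>. Y \<omega> * (w B \<omega> * w B' \<omega>))" unfolding eq
    by (intro integrable_mult_right Bochner_Integration.integrable_diff f(1))
  have v: "(\<integral>\<omega>. (w B \<omega> + c * w B' \<omega>)\<^sup>2 \<partial>M)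
    = measure lborel B + 2 * c * measure lborel (B \<inter> B') + c\<^sup>2 * measure lborel B'" for c
  proof -
    have i: "integrable M (\<lambda>\<omega>. w A \<omega> * w C \<omega>)" if "A \<in> noise_sets" "C \<in> noise_sets" for A C
      using that by (intro lin_integrable_mult lin_w)
    have "(\<integral>\<omega>. (w B \<omega> + c * w B' \<omega>)\<^sup>2 \<partial>M)
      = (\<integral>\<omega>. w B \<omega> * w B \<omega> + 2 * c * (w B \<omega> * w B' \<omega>) + c\<^sup>2 * (w B' \<omega> * w B' \<omega>) \<partial>M)"
      by (intro Bochner_Integration.integral_cong) (auto simp: power2_eq_square algebra_simps)
    also have "\<dots> = measure lborel B + 2 * c * measure lborel (B \<inter> B') + c\<^sup>2 * measure lborel B'"
      using i N by (simp add: cov_w)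
    finally show ?thesis .
  qed
  have "(\<integral>\<omega>. Y \<omega> * (w B \<omega> * w B' \<omega>) \<partial>M) = (1/4) * ((\<integral>\<omega>. Y \<omega> \<partial>M) * (\<integral>\<omega>. (w B \<omega> + 1 * w B' \<omega>)\<^sup>2 \<partial>M)
     - (\<integral>\<omega>. Y \<omega> \<partial>M) * (\<integral>\<omega>. (w B \<omega> + (-1) * w B' \<omega>)\<^sup>2 \<partial>M))"
    unfolding eq f(2)[symmetric]
    by (simp only: integral_mult_right_zero Bochner_Integration.integral_diff[OF f(1) f(1)])
  also have "\<dots> = (\<integral>\<omega>. Y \<omega> \<partial>M) * measure lborel (B \<inter> B')"
    unfolding v by (simp add: algebra_simps)
  finally show "(\<integral>\<omega>. Y \<omega> * (w B \<omega> * w B' \<omega>) \<partial>M) = (\<integral>\<omega>. Y \<omega> \<partial>M) * measure lborel (B \<inter> B')" .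
qed

end

text \<open>The sum is at most its number of terms times its largest term in absolute value. The
  constant is crude, but it only enters a remainder that vanishes under refinement and bounds used
  for finiteness.\<close>

lemma power_sum_le_card:
  fixes x :: "'i \<Rightarrow> real"
  assumes "finite I" and l: "0 < l"
  shows "(\<Sum>i\<in>I. x i) ^ (2 * l) \<le> real (card I) ^ (2 * l) * (\<Sum>i\<in>I. x i ^ (2 * l))"
proof (cases "I = {}")
  case True
  then show ?thesis using l by (simp add: zero_power)
next
  case False
  define m where "m = Max ((\<lambda>i. \<bar>x i\<bar>) ` I)"
  have m: "\<bar>x i\<bar> \<le> m" if "i \<in> I" for i unfolding m_def using assms that by (intro Max_ge) auto
  obtain k where k: "k \<in> I" "m = \<bar>x k\<bar>"
    using Max_in[of "(\<lambda>i. \<bar>x i\<bar>) ` I"] assms False unfolding m_def by (metis (no_types, lifting) finite_imageI image_iff image_is_empty)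
  have "\<bar>\<Sum>i\<in>I. x i\<bar> \<le> (\<Sum>i\<in>I. \<bar>x i\<bar>)" by (rule sum_abs)
  also have "\<dots> \<le> real (card I) * m" using m by (rule sum_bounded_above)
  finally have "\<bar>\<Sum>i\<in>I. x i\<bar> ^ (2 * l) \<le> (real (card I) * m) ^ (2 * l)" by (rule power_mono) simp
  also have "\<dots> = real (card I) ^ (2 * l) * x k ^ (2 * l)"
    by (simp add: power_mult_distrib k power_even_abs)
  also have "x k ^ (2 * l) \<le> (\<Sum>i\<in>I. x i ^ (2 * l))"
    using k assms by (intro member_le_sum) (auto simp: zero_le_even_power)
  finally show ?thesis by (simp add: power_even_abs mult_left_mono)
qed

locale simple_integrand = white_noise_space +
  fixes n :: nat and a b :: "nat \<Rightarrow> real" and A :: "nat \<Rightarrow> real set" and Y :: "nat \<Rightarrow> 'a \<Rightarrow> real"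
  assumes simple: "\<And>i. i < n \<Longrightarrow> 0 \<le> a i \<and> a i < b i \<and> A i \<in> sets borel \<and> emeasure lborel (A i) < \<infinity> \<and>
               Y i \<in> borel_measurable (F (a i)) \<and> bounded (Y i ` space M)"
begin

definition f :: "real \<Rightarrow> real \<Rightarrow> 'a \<Rightarrow> real" where
  "f s y \<omega> = (\<Sum>i<n. Y i \<omega> * indicator {a i<..b i} s * indicator (A i) y)"

definition Bl :: "nat \<Rightarrow> real \<Rightarrow> real \<Rightarrow> (real \<times> real) set" where
  "Bl i r r' = ({a i<..b i} \<inter> {r<..r'}) \<times> A i"

definition I :: "real \<Rightarrow> nat set" where "I r = {i. i < n \<and> a i \<le> r}"

text \<open>The integral stopped at time \<open>r\<close>. Only blocks already started are summed:
  this makes it measurable for \<open>F r\<close>, as the coefficients of later blocks are not, and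
  later blocks would contribute noise of the empty set, which is 0 only almost surely.\<close>

definition X :: "real \<Rightarrow> 'a \<Rightarrow> real" where
  "X r \<omega> = (\<Sum>i\<in>I r. Y i \<omega> * w (({a i<..b i} \<inter> {..r}) \<times> A i) \<omega>)"

text \<open>The increment over the time interval from \<open>r\<close> to \<open>r'\<close> of the
  blocks active at \<open>r\<close>. All its coefficients are known at time \<open>r\<close>, while
  its noise lies in the future of \<open>r\<close>.\<close>

definition D :: "real \<Rightarrow> real \<Rightarrow> 'a \<Rightarrow> real" where
  "D r r' \<omega> = (\<Sum>i\<in>I r. Y i \<omega> * w (Bl i r r') \<omega>)"

lemma finite_I[simp]: "finite (I r)" by (simp add: I_def)

lemma I_D: "i \<in> I r \<Longrightarrow> i < n" by (simp add: I_def)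

lemma Y_bdd: "\<exists>C>0. \<forall>i<n. \<forall>\<omega>\<in>space M. \<bar>Y i \<omega>\<bar> \<le> C"
proof -
  have "\<exists>C>0. \<forall>\<omega>\<in>space M. \<bar>Y i \<omega>\<bar> \<le> C" if "i < n" for i
    using simple[OF that] by (auto simp: bounded_pos)
  then obtain C where C: "\<And>i. i < n \<Longrightarrow> C i > 0" "\<And>i \<omega>. i < n \<Longrightarrow> \<omega> \<in> space M \<Longrightarrow> \<bar>Y i \<omega>\<bar> \<le> C i"
    by metis
  have "\<bar>Y i \<omega>\<bar> \<le> 1 + (\<Sum>i<n. C i)" if "i < n" "\<omega> \<in> space M" for i \<omega>
  proof -
    have "C i \<le> (\<Sum>i<n. C i)" using C(1) that by (intro member_le_sum) (auto intro: less_imp_le)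
    then show ?thesis using C(2)[OF that] by simp
  qed
  moreover have "0 < 1 + (\<Sum>i<n. C i)" using C(1) by (intro add_pos_nonneg sum_nonneg) (auto intro: less_imp_le)
  ultimately show ?thesis by blast
qed

definition CY :: real where "CY = (SOME C. C > 0 \<and> (\<forall>i<n. \<forall>\<omega>\<in>space M. \<bar>Y i \<omega>\<bar> \<le> C))"

lemma CY: "CY > 0" "i < n \<Longrightarrow> \<omega> \<in> space M \<Longrightarrow> \<bar>Y i \<omega>\<bar> \<le> CY"
  using someI_ex[OF Y_bdd[unfolded Bex_def]] unfolding CY_def[symmetric] by auto

lemma Y_meas: "i < n \<Longrightarrow> Y i \<in> borel_measurable M"
  using simple F_measurable_M by blast

lemma Y_F: "i \<in> I r \<Longrightarrow> Y i \<in> borel_measurable (F r)"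
  using simple by (auto simp: I_def intro: F_measurable_mono)

lemma cut_noise_set:
  assumes "i < n" "S \<in> sets borel"
  shows "({a i<..b i} \<inter> S) \<times> A i \<in> noise_sets"
    "measure lborel (({a i<..b i} \<inter> S) \<times> A i) = measure lborel ({a i<..b i} \<inter> S) * measure lborel (A i)"
proof -
  have "emeasure lborel ({a i<..b i} \<inter> S) \<le> emeasure lborel {a i<..b i}"
    using assms by (intro emeasure_mono) auto
  also have "\<dots> < \<infinity>" using simple[OF assms(1)] by simp
  finally have "emeasure lborel ({a i<..b i} \<inter> S) < \<infinity>" .
  moreover have "{a i<..b i} \<inter> S \<in> sets borel" "{a i<..b i} \<inter> S \<subseteq> {0..}"
    using simple[OF assms(1)] assms by auto
  ultimately show "({a i<..b i} \<inter> S) \<times> A i \<in> noise_sets"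
    "measure lborel (({a i<..b i} \<inter> S) \<times> A i) = measure lborel ({a i<..b i} \<inter> S) * measure lborel (A i)"
    using simple[OF assms(1)] by (auto intro!: noise_sets_Times)
qed

lemma Bl_future: "i < n \<Longrightarrow> Bl i r r' \<in> future r"
  using cut_noise_set(1)[of i "{r<..r'}"] by (auto simp: Bl_def future_def simp del: Int_greaterThanAtMost)

lemma Bl_measure: "i < n \<Longrightarrow> r \<le> r' \<Longrightarrow> measure lborel (Bl i r r') \<le> (r' - r) * measure lborel (A i)"
proof -
  assume i: "i < n" and r: "r \<le> r'"
  have "measure lborel ({a i<..b i} \<inter> {r<..r'}) \<le> measure lborel {r<..r'}"
    using r by (intro measure_mono_fmeasurable) (auto simp: fmeasurable_def)
  then show ?thesis using r cut_noise_set(2)[OF i, of "{r<..r'}"]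
    by (simp add: Bl_def mult_right_mono)
qed

lemma X_F: "0 \<le> r \<Longrightarrow> X r \<in> borel_measurable (F r)"
proof -
  have "({a i<..b i} \<inter> {..r}) \<times> A i \<in> past r" if "i \<in> I r" for i
    using cut_noise_set(1)[of i "{..r}"] that simple[of i] by (auto simp: I_def past_def)
  then show ?thesis unfolding X_def[abs_def]
    by (intro borel_measurable_sum borel_measurable_times Y_F w_F)
qed

lemma Yw_power_integrable:
  assumes "i < n" "B \<in> noise_sets"
  shows "integrable M (\<lambda>\<omega>. (Y i \<omega> * w B \<omega>) ^ k)"
proof (rule Bochner_Integration.integrable_bound)
  show "integrable M (\<lambda>\<omega>. CY ^ k * w B \<omega> ^ k)" by (intro integrable_mult_right lin_integrable_power lin_w assms)
  show "(\<lambda>\<omega>. (Y i \<omega> * w B \<omega>) ^ k) \<in> borel_measurable M"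
    using Y_meas[OF assms(1)] measurable_w[OF assms(2)] by simp
  show "AE \<omega> in M. norm ((Y i \<omega> * w B \<omega>) ^ k) \<le> norm (CY ^ k * w B \<omega> ^ k)"
    using CY assms by (intro AE_I2) (auto simp: abs_mult power_mult_distrib power_abs intro!: mult_right_mono power_mono)
qed

lemma sum_Yw_power_integrable:
  assumes "finite J" "\<And>i. i \<in> J \<Longrightarrow> i < n" "\<And>i. i \<in> J \<Longrightarrow> B i \<in> noise_sets"
  shows "integrable M (\<lambda>\<omega>. (\<Sum>i\<in>J. Y i \<omega> * w (B i) \<omega>) ^ (2 * k))"
proof (cases "k = 0")
  case False
  show ?thesis
  proof (rule Bochner_Integration.integrable_bound)
    show "integrable M (\<lambda>\<omega>. real (card J) ^ (2 * k) * (\<Sum>i\<in>J. (Y i \<omega> * w (B i) \<omega>) ^ (2 * k)))"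
      using assms by (intro integrable_mult_right Bochner_Integration.integrable_sum Yw_power_integrable)
    show "(\<lambda>\<omega>. (\<Sum>i\<in>J. Y i \<omega> * w (B i) \<omega>) ^ (2 * k)) \<in> borel_measurable M"
      using assms Y_meas measurable_w by (intro borel_measurable_power borel_measurable_sum borel_measurable_times) auto
    show "AE \<omega> in M. norm ((\<Sum>i\<in>J. Y i \<omega> * w (B i) \<omega>) ^ (2 * k))
      \<le> norm (real (card J) ^ (2 * k) * (\<Sum>i\<in>J. (Y i \<omega> * w (B i) \<omega>) ^ (2 * k)))"
    proof (intro AE_I2)
      fix \<omega>
      have "0 \<le> (\<Sum>i\<in>J. Y i \<omega> * w (B i) \<omega>) ^ (2 * k)" by (simp add: zero_le_even_power)
      then show "norm ((\<Sum>i\<in>J. Y i \<omega> * w (B i) \<omega>) ^ (2 * k))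
        \<le> norm (real (card J) ^ (2 * k) * (\<Sum>i\<in>J. (Y i \<omega> * w (B i) \<omega>) ^ (2 * k)))"
        using power_sum_le_card[OF assms(1), of k "\<lambda>i. Y i \<omega> * w (B i) \<omega>"] False by simp
    qed
  qed
qed simp

lemma X_power_integrable: "integrable M (\<lambda>\<omega>. X r \<omega> ^ (2 * k))"
  unfolding X_def by (intro sum_Yw_power_integrable cut_noise_set(1)) (auto simp: I_def)

lemma D_power_integrable: "integrable M (\<lambda>\<omega>. D r r' \<omega> ^ (2 * k))"
  unfolding D_def Bl_def by (intro sum_Yw_power_integrable cut_noise_set(1)) (auto simp: I_def)

lemma X_meas[measurable]: "X r \<in> borel_measurable M"
  unfolding X_def[abs_def]
  by (intro borel_measurable_sum borel_measurable_times Y_meas measurable_w cut_noise_set(1)) (auto simp: I_def)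

lemma D_meas[measurable]: "D r r' \<in> borel_measurable M"
  unfolding D_def[abs_def] Bl_def
  by (intro borel_measurable_sum borel_measurable_times Y_meas measurable_w cut_noise_set(1)) (auto simp: I_def)

lemma X_integrable: "integrable M (X r)"
  unfolding X_def[abs_def]
  using Yw_power_integrable[of _ _ 1] cut_noise_set(1)
  by (intro Bochner_Integration.integrable_sum) (auto simp: I_def)

text \<open>No block may start strictly between \<open>r\<close> and \<open>r'\<close>, for
  \<open>D\<close> would miss it. A block starting exactly at \<open>r'\<close> is harmless: it
  enters \<open>X r'\<close> with the noise of an empty set.\<close>

lemma X_step:
  assumes "0 \<le> r" "r < r'" and free: "\<forall>i<n. a i \<notin> {r<..<r'}"
  shows "AE \<omega> in M. X r' \<omega> = X r \<omega> + D r r' \<omega>"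
proof -
  have ae: "AE \<omega> in M. \<forall>i\<in>I r. w (({a i<..b i} \<inter> {..r'}) \<times> A i) \<omega>
    = w (({a i<..b i} \<inter> {..r}) \<times> A i) \<omega> + w (Bl i r r') \<omega>"
  proof (intro AE_finite_allI finite_I)
    fix i assume i: "i \<in> I r"
    have "({a i<..b i} \<inter> {..r'}) \<times> A i = ({a i<..b i} \<inter> {..r}) \<times> A i \<union> Bl i r r'"
      using assms by (auto simp: Bl_def)
    moreover have "({a i<..b i} \<inter> {..r}) \<times> A i \<in> noise_sets" "Bl i r r' \<in> noise_sets"
      using cut_noise_set(1)[OF I_D[OF i], of "{..r}"] cut_noise_set(1)[OF I_D[OF i], of "{r<..r'}"]
      by (simp_all add: Bl_def del: Int_greaterThanAtMost)
    moreover have "({a i<..b i} \<inter> {..r}) \<times> A i \<inter> Bl i r r' = {}" by (auto simp: Bl_def)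
    ultimately show "AE \<omega> in M. w (({a i<..b i} \<inter> {..r'}) \<times> A i) \<omega>
      = w (({a i<..b i} \<inter> {..r}) \<times> A i) \<omega> + w (Bl i r r') \<omega>"
      using w_Un by metis
  qed
  show ?thesis using ae w_empty
  proof eventually_elim
    case (elim \<omega>)
    have "X r' \<omega> = (\<Sum>i\<in>I r. Y i \<omega> * w (({a i<..b i} \<inter> {..r'}) \<times> A i) \<omega>)"
      unfolding X_def
    proof (rule sum.mono_neutral_right)
      show "I r \<subseteq> I r'" using assms by (auto simp: I_def)
      show "\<forall>i\<in>I r' - I r. Y i \<omega> * w (({a i<..b i} \<inter> {..r'}) \<times> A i) \<omega> = 0"
      proof
        fix i assume "i \<in> I r' - I r"
        then have "a i = r'" using free by (auto simp: I_def)
        then have e: "{a i<..b i} \<inter> {..r'} = {}" by auto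
        show "Y i \<omega> * w (({a i<..b i} \<inter> {..r'}) \<times> A i) \<omega> = 0" unfolding e using elim by simp
      qed
    qed simp
    also have "\<dots> = X r \<omega> + D r r' \<omega>"
      using elim by (simp add: X_def D_def distrib_left sum.distrib)
    finally show ?case .
  qed
qed

lemma X_0: "AE \<omega> in M. X 0 \<omega> = 0"
  using w_empty
proof eventually_elim
  case (elim \<omega>)
  have "w (({a i<..b i} \<inter> {..0}) \<times> A i) \<omega> = 0" if "i < n" for i
  proof -
    have e: "{a i<..b i} \<inter> {..0} = {}" using simple[OF that] by auto
    show ?thesis unfolding e using elim by simp
  qed
  then show ?case by (simp add: X_def I_def)
qed

lemma X_end: "(\<And>i. i < n \<Longrightarrow> b i \<le> S) \<Longrightarrow> X S \<omega> = (\<Sum>i<n. Y i \<omega> * w ({a i<..b i} \<times> A i) \<omega>)"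
proof -
  assume S: "\<And>i. i < n \<Longrightarrow> b i \<le> S"
  have "I S = {..<n}" using S simple by (force simp: I_def)
  moreover have "{a i<..b i} \<inter> {..S} = {a i<..b i}" if "i < n" for i using S[OF that] by auto
  ultimately show ?thesis by (simp add: X_def)
qed

text \<open>Gaussian moments of order 2l scale like the l-th power of the measure of a block, hence
  like (r' - r)^l. As l is at least 2, two factors r' - r are kept and the others are bounded by
  powers of \<open>S\<close>. The constant may depend on the integrand; only the quadratic order in
  the step matters.\<close>

lemma D_moment:
  assumes "2 \<le> l"
  shows "\<exists>C. \<forall>r r'. 0 \<le> r \<longrightarrow> r \<le> r' \<longrightarrow> r' \<le> S \<longrightarrow> (\<integral>\<omega>. D r r' \<omega> ^ (2 * l) \<partial>M) \<le> C * (r' - r)\<^sup>2"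
proof -
  \<comment> \<open>The even moment of order 2l of a standard normal variable.\<close>
  define c where "c = (fact (2 * l) / (2 ^ l * fact l) :: real)"
  have c: "c \<ge> 0" by (simp add: c_def)
  define K where "K = (\<Sum>i<n. CY ^ (2 * l) * (c * (S ^ (l - 2) * measure lborel (A i) ^ l)))"
  have "(\<integral>\<omega>. D r r' \<omega> ^ (2 * l) \<partial>M) \<le> real n ^ (2 * l) * K * (r' - r)\<^sup>2"
    if r: "0 \<le> r" "r \<le> r'" "r' \<le> S" for r r'
  proof -
    have N: "Bl i r r' \<in> noise_sets" if "i < n" for i using Bl_future[OF that, of r r'] future_sub by auto
    have "(\<integral>\<omega>. D r r' \<omega> ^ (2 * l) \<partial>M) \<le> (\<integral>\<omega>. real n ^ (2 * l) * (\<Sum>i<n. (Y i \<omega> * w (Bl i r r') \<omega>) ^ (2 * l)) \<partial>M)"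
    proof (rule integral_mono[OF D_power_integrable])
      show "integrable M (\<lambda>\<omega>. real n ^ (2 * l) * (\<Sum>i<n. (Y i \<omega> * w (Bl i r r') \<omega>) ^ (2 * l)))"
        using N by (intro integrable_mult_right Bochner_Integration.integrable_sum Yw_power_integrable) auto
      fix \<omega>
      have "D r r' \<omega> ^ (2 * l) \<le> real (card (I r)) ^ (2 * l) * (\<Sum>i\<in>I r. (Y i \<omega> * w (Bl i r r') \<omega>) ^ (2 * l))"
        unfolding D_def by (rule power_sum_le_card) (use assms in simp_all)
      also have "\<dots> \<le> real n ^ (2 * l) * (\<Sum>i<n. (Y i \<omega> * w (Bl i r r') \<omega>) ^ (2 * l))"
      proof (rule mult_mono)
        have "card (I r) \<le> card {..<n}" by (rule card_mono) (auto simp: I_def)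
        then show "real (card (I r)) ^ (2 * l) \<le> real n ^ (2 * l)" by (intro power_mono) auto
        show "(\<Sum>i\<in>I r. (Y i \<omega> * w (Bl i r r') \<omega>) ^ (2 * l)) \<le> (\<Sum>i<n. (Y i \<omega> * w (Bl i r r') \<omega>) ^ (2 * l))"
          by (rule sum_mono2) (auto simp: I_def zero_le_even_power)
      qed (auto intro!: sum_nonneg simp: zero_le_even_power)
      finally show "D r r' \<omega> ^ (2 * l) \<le> real n ^ (2 * l) * (\<Sum>i<n. (Y i \<omega> * w (Bl i r r') \<omega>) ^ (2 * l))" .
    qed
    also have "\<dots> = real n ^ (2 * l) * (\<Sum>i<n. (\<integral>\<omega>. (Y i \<omega> * w (Bl i r r') \<omega>) ^ (2 * l) \<partial>M))"
      using N by (subst integral_mult_right_zero, subst Bochner_Integration.integral_sum)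
        (auto intro!: Yw_power_integrable)
    also have "\<dots> \<le> real n ^ (2 * l) * (\<Sum>i<n. CY ^ (2 * l) * (c * (S ^ (l - 2) * measure lborel (A i) ^ l)) * (r' - r)\<^sup>2)"
    proof (intro mult_left_mono sum_mono)
      fix i assume "i \<in> {..<n}"
      then have i: "i < n" by simp
      have iw: "integrable M (\<lambda>\<omega>. CY ^ (2 * l) * w (Bl i r r') \<omega> ^ (2 * l))"
        by (intro integrable_mult_right lin_integrable_power lin_w N i)
      have "(\<integral>\<omega>. (Y i \<omega> * w (Bl i r r') \<omega>) ^ (2 * l) \<partial>M) \<le> (\<integral>\<omega>. CY ^ (2 * l) * w (Bl i r r') \<omega> ^ (2 * l) \<partial>M)"
      proof (rule integral_mono)
        fix \<omega> assume "\<omega> \<in> space M"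
        then have "\<bar>Y i \<omega>\<bar> ^ (2 * l) \<le> CY ^ (2 * l)" using CY(2)[OF i] by (intro power_mono) auto
        then show "(Y i \<omega> * w (Bl i r r') \<omega>) ^ (2 * l) \<le> CY ^ (2 * l) * w (Bl i r r') \<omega> ^ (2 * l)"
          by (auto simp: power_mult_distrib power_even_abs intro!: mult_right_mono zero_le_even_power)
      qed (use i N iw in \<open>auto intro!: Yw_power_integrable\<close>)
      also have "\<dots> = CY ^ (2 * l) * (c * measure lborel (Bl i r r') ^ l)"
        using lin_moment[OF lin_w[OF N[OF i]], of l] cov_w[OF N[OF i] N[OF i]]
        by (simp add: c_def power2_eq_square)
      also have "\<dots> \<le> CY ^ (2 * l) * (c * (S ^ (l - 2) * measure lborel (A i) ^ l * (r' - r)\<^sup>2))"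
      proof (intro mult_left_mono c)
        have "measure lborel (Bl i r r') ^ l \<le> ((r' - r) * measure lborel (A i)) ^ l"
          using Bl_measure[OF i r(2)] by (intro power_mono) auto
        also have "\<dots> = (r' - r) ^ (l - 2) * (r' - r)\<^sup>2 * measure lborel (A i) ^ l"
          using assms by (metis le_add_diff_inverse2 power_add power_mult_distrib)
        also have "\<dots> \<le> S ^ (l - 2) * (r' - r)\<^sup>2 * measure lborel (A i) ^ l"
          using r by (intro mult_right_mono power_mono) auto
        finally show "measure lborel (Bl i r r') ^ l \<le> S ^ (l - 2) * measure lborel (A i) ^ l * (r' - r)\<^sup>2"
          by (simp add: mult_ac)
      qed (use CY in auto)
      finally show "(\<integral>\<omega>. (Y i \<omega> * w (Bl i r r') \<omega>) ^ (2 * l) \<partial>M)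
        \<le> CY ^ (2 * l) * (c * (S ^ (l - 2) * measure lborel (A i) ^ l)) * (r' - r)\<^sup>2"
        by (simp add: mult_ac)
    qed simp
    also have "\<dots> = real n ^ (2 * l) * K * (r' - r)\<^sup>2" by (simp add: K_def sum_distrib_right)
    finally show ?thesis .
  qed
  then show ?thesis by blast
qed

lemma f_eq: "r < s \<Longrightarrow> s \<le> r' \<Longrightarrow> \<forall>i<n. a i \<notin> {r<..<r'} \<Longrightarrow>
    f s y \<omega> = (\<Sum>i\<in>I r. Y i \<omega> * indicator (Bl i r r') (s, y))"
  unfolding f_def
proof (rule sum.mono_neutral_cong_right)
  assume r: "r < s" "s \<le> r'" "\<forall>i<n. a i \<notin> {r<..<r'}"
  show "\<forall>i\<in>{..<n} - I r. Y i \<omega> * indicator {a i<..b i} s * indicator (A i) y = 0"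
    using r by (fastforce simp: I_def indicator_def)
  show "Y i \<omega> * indicator {a i<..b i} s * indicator (A i) y = Y i \<omega> * indicator (Bl i r r') (s, y)" if "i \<in> I r" for i
    using r by (auto simp: Bl_def indicator_def)
qed (auto simp: I_def)

text \<open>The second order term of one step: the state \<open>X r\<close> is frozen at the start
  of the step while the integrand is integrated over the time interval.\<close>

definition Q :: "(real \<Rightarrow> real) \<Rightarrow> real \<Rightarrow> real \<Rightarrow> real \<Rightarrow> ennreal" where
  "Q \<psi> r r1 r2 = (\<integral>\<^sup>+z\<in>{r1<..r2} \<times> UNIV. (\<integral>\<^sup>+\<omega>. ennreal (\<psi> (X r \<omega>) * (f (fst z) (snd z) \<omega>)\<^sup>2) \<partial>M) \<partial>lborel)"

text \<open>On the step the integrand is a combination of the active blocks, so its square is a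
  double sum over pairs of blocks; this matches the second moment of the noise increment term by
  term.\<close>

lemma Q_eq:
  assumes r: "0 \<le> r" "r < r'" and free: "\<forall>i<n. a i \<notin> {r<..<r'}"
    and \<psi>[measurable]: "\<psi> \<in> borel_measurable borel" and \<psi>b: "\<And>x. 0 \<le> \<psi> x" "\<And>x. \<psi> x \<le> C\<psi>"
  shows "Q \<psi> r r r' = ennreal (\<Sum>i\<in>I r. \<Sum>k\<in>I r. (\<integral>\<omega>. \<psi> (X r \<omega>) * Y i \<omega> * Y k \<omega> \<partial>M) * measure lborel (Bl i r r' \<inter> Bl k r r'))"
proof -
  define e where "e i k = (\<integral>\<omega>. \<psi> (X r \<omega>) * Y i \<omega> * Y k \<omega> \<partial>M)" for i k
  have C\<psi>: "C\<psi> \<ge> 0" using \<psi>b order_trans by blast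
  have int: "integrable M (\<lambda>\<omega>. \<psi> (X r \<omega>) * Y i \<omega> * Y k \<omega>)" if "i < n" "k < n" for i k
  proof (rule integrable_const_bound[where B="C\<psi> * CY * CY"])
    show "(\<lambda>\<omega>. \<psi> (X r \<omega>) * Y i \<omega> * Y k \<omega>) \<in> borel_measurable M" using Y_meas that by simp
    show "AE \<omega> in M. norm (\<psi> (X r \<omega>) * Y i \<omega> * Y k \<omega>) \<le> C\<psi> * CY * CY"
      using CY that \<psi>b C\<psi> by (intro AE_I2) (auto simp: abs_mult intro!: mult_mono)
  qed
  \<comment> \<open>The individual coefficients \<open>e i k\<close> may be negative. Only the whole
    sum is known to be nonnegative, being an expectation of a nonnegative variable, so the passage
    to \<open>ennreal\<close> is made for the sum.\<close>
  have inner: "(\<integral>\<^sup>+\<omega>. ennreal (\<psi> (X r \<omega>) * (f s y \<omega>)\<^sup>2) \<partial>M)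
    = ennreal (\<Sum>i\<in>I r. \<Sum>k\<in>I r. e i k * indicator (Bl i r r' \<inter> Bl k r r') (s, y))"
    and inner_nn: "0 \<le> (\<Sum>i\<in>I r. \<Sum>k\<in>I r. e i k * indicator (Bl i r r' \<inter> Bl k r r') (s, y))"
    if s: "r < s" "s \<le> r'" for s y
  proof -
    have eq: "\<psi> (X r \<omega>) * (f s y \<omega>)\<^sup>2
      = (\<Sum>i\<in>I r. \<Sum>k\<in>I r. (\<psi> (X r \<omega>) * Y i \<omega> * Y k \<omega>) * indicator (Bl i r r' \<inter> Bl k r r') (s, y))" for \<omega>
      unfolding f_eq[OF s free] power2_eq_square sum_product sum_distrib_left[of "\<psi> (X r \<omega>)"]
      by (intro sum.cong refl) (simp add: indicator_inter_arith mult_ac)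
    have i: "integrable M (\<lambda>\<omega>. \<psi> (X r \<omega>) * (f s y \<omega>)\<^sup>2)"
      unfolding eq using int by (intro Bochner_Integration.integrable_sum integrable_mult_left) (auto simp: I_def)
    have e: "(\<integral>\<omega>. \<psi> (X r \<omega>) * (f s y \<omega>)\<^sup>2 \<partial>M)
      = (\<Sum>i\<in>I r. \<Sum>k\<in>I r. e i k * indicator (Bl i r r' \<inter> Bl k r r') (s, y))"
      unfolding eq e_def using int
      by (subst Bochner_Integration.integral_sum) (auto simp: I_def intro!: sum.cong Bochner_Integration.integrable_sum
          integrable_mult_left)
    have "(\<integral>\<^sup>+\<omega>. ennreal (\<psi> (X r \<omega>) * (f s y \<omega>)\<^sup>2) \<partial>M) = ennreal (\<integral>\<omega>. \<psi> (X r \<omega>) * (f s y \<omega>)\<^sup>2 \<partial>M)"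
      by (rule nn_integral_eq_integral[OF i]) (use \<psi>b in auto)
    then show "(\<integral>\<^sup>+\<omega>. ennreal (\<psi> (X r \<omega>) * (f s y \<omega>)\<^sup>2) \<partial>M)
      = ennreal (\<Sum>i\<in>I r. \<Sum>k\<in>I r. e i k * indicator (Bl i r r' \<inter> Bl k r r') (s, y))" unfolding e .
    have "0 \<le> (\<integral>\<omega>. \<psi> (X r \<omega>) * (f s y \<omega>)\<^sup>2 \<partial>M)" using \<psi>b by (intro Bochner_Integration.integral_nonneg) auto
    then show "0 \<le> (\<Sum>i\<in>I r. \<Sum>k\<in>I r. e i k * indicator (Bl i r r' \<inter> Bl k r r') (s, y))" unfolding e .
  qed
  have out: "indicator (Bl i r r') z = (0::real)" if "z \<notin> {r<..r'} \<times> UNIV" for i z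
    using that by (auto simp: Bl_def indicator_def)
  have Bs: "Bl i r r' \<in> sets borel" "emeasure lborel (Bl i r r') < \<infinity>" if "i \<in> I r" for i
    using Bl_future[OF I_D[OF that], of r r'] by (auto simp: future_def noise_sets_def)
  have iB: "integrable lborel (\<lambda>z. indicator (Bl i r r' \<inter> Bl k r r') z :: real)" if "i \<in> I r" "k \<in> I r" for i k
  proof -
    have "emeasure lborel (Bl i r r' \<inter> Bl k r r') \<le> emeasure lborel (Bl i r r')"
      using Bs that by (intro emeasure_mono) auto
    also have "\<dots> < \<infinity>" using Bs that by auto
    finally show ?thesis using Bs that by (intro integrable_real_indicator) auto
  qed
  have "Q \<psi> r r r' = (\<integral>\<^sup>+z. ennreal (\<Sum>i\<in>I r. \<Sum>k\<in>I r. e i k * indicator (Bl i r r' \<inter> Bl k r r') z) \<partial>lborel)"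
    unfolding Q_def
  proof (intro nn_integral_cong)
    fix z :: "real \<times> real"
    obtain s y where z: "z = (s, y)" by (cases z)
    show "(\<integral>\<^sup>+\<omega>. ennreal (\<psi> (X r \<omega>) * (f (fst z) (snd z) \<omega>)\<^sup>2) \<partial>M) * indicator ({r<..r'} \<times> UNIV) z
      = ennreal (\<Sum>i\<in>I r. \<Sum>k\<in>I r. e i k * indicator (Bl i r r' \<inter> Bl k r r') z)"
    proof (cases "r < s \<and> s \<le> r'")
      case True
      then show ?thesis by (simp add: z inner)
    next
      case False
      then have "z \<notin> {r<..r'} \<times> UNIV" by (auto simp: z)
      then show ?thesis using out by (simp add: indicator_inter_arith)
    qed
  qed
  also have "\<dots> = ennreal (\<integral>z. (\<Sum>i\<in>I r. \<Sum>k\<in>I r. e i k * indicator (Bl i r r' \<inter> Bl k r r') z) \<partial>lborel)"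
  proof (rule nn_integral_eq_integral)
    show "integrable lborel (\<lambda>z. \<Sum>i\<in>I r. \<Sum>k\<in>I r. e i k * indicator (Bl i r r' \<inter> Bl k r r') z)"
      using iB by (intro Bochner_Integration.integrable_sum integrable_mult_right) auto
    show "AE z in lborel. 0 \<le> (\<Sum>i\<in>I r. \<Sum>k\<in>I r. e i k * indicator (Bl i r r' \<inter> Bl k r r') z)"
    proof (intro AE_I2)
      fix z :: "real \<times> real"
      obtain s y where z: "z = (s, y)" by (cases z)
      show "0 \<le> (\<Sum>i\<in>I r. \<Sum>k\<in>I r. e i k * indicator (Bl i r r' \<inter> Bl k r r') z)"
      proof (cases "r < s \<and> s \<le> r'")
        case True
        then show ?thesis unfolding z by (intro inner_nn) auto
      next
        case False
        then have "z \<notin> {r<..r'} \<times> UNIV" by (auto simp: z)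
        then show ?thesis using out by (simp add: indicator_inter_arith)
      qed
    qed
  qed
  also have "(\<integral>z. (\<Sum>i\<in>I r. \<Sum>k\<in>I r. e i k * indicator (Bl i r r' \<inter> Bl k r r') z) \<partial>lborel)
    = (\<Sum>i\<in>I r. \<Sum>k\<in>I r. e i k * measure lborel (Bl i r r' \<inter> Bl k r r'))"
  proof -
    have "(\<integral>z. (\<Sum>i\<in>I r. \<Sum>k\<in>I r. e i k * indicator (Bl i r r' \<inter> Bl k r r') z) \<partial>lborel)
     = (\<Sum>i\<in>I r. \<integral>z. (\<Sum>k\<in>I r. e i k * indicator (Bl i r r' \<inter> Bl k r r') z) \<partial>lborel)"
      using iB by (intro Bochner_Integration.integral_sum Bochner_Integration.integrable_sum integrable_mult_right) auto
    also have "\<dots> = (\<Sum>i\<in>I r. \<Sum>k\<in>I r. \<integral>z. e i k * indicator (Bl i r r' \<inter> Bl k r r') z \<partial>lborel)"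
      using iB by (intro sum.cong refl Bochner_Integration.integral_sum integrable_mult_right) auto
    finally show ?thesis by simp
  qed
  finally show ?thesis unfolding e_def .
qed

text \<open>In the Taylor bound at \<open>X r\<close> with increment \<open>D r r'\<close>, the
  linear term has mean 0 because the noise is centred and independent of \<open>F r\<close>; by the
  covariance of the noise the quadratic term has mean exactly \<open>Q \<psi> r r r'\<close>; the
  remainder stays as it is.\<close>

lemma one_step:
  fixes \<phi> \<phi>' \<psi> :: "real \<Rightarrow> real"
  assumes r: "0 \<le> r" "r < r'" and free: "\<forall>i<n. a i \<notin> {r<..<r'}"
    and [measurable]: "\<phi> \<in> borel_measurable borel" "\<phi>' \<in> borel_measurable borel" "\<psi> \<in> borel_measurable borel"
    and \<psi>: "\<And>x. 0 \<le> \<psi> x" "\<And>x. \<psi> x \<le> C\<psi>" and \<phi>': "\<And>x. \<bar>\<phi>' x\<bar> \<le> C' * \<bar>x\<bar>"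
    and \<phi>: "\<And>x. 0 \<le> \<phi> x" "\<And>x. \<phi> x \<le> C\<phi> * x\<^sup>2"
    and taylor: "\<And>x d. \<phi> (x + d) \<le> \<phi> x + \<phi>' x * d + \<psi> x * d\<^sup>2 + L * d ^ (2 * l)"
  shows "(\<integral>\<omega>. \<phi> (X r' \<omega>) \<partial>M) \<le> (\<integral>\<omega>. \<phi> (X r \<omega>) \<partial>M) + enn2real (Q \<psi> r r r') + L * (\<integral>\<omega>. D r r' \<omega> ^ (2 * l) \<partial>M)"
proof -
  have XF: "X r \<in> borel_measurable (F r)" by (rule X_F[OF r(1)])
  have C\<psi>: "C\<psi> \<ge> 0" using \<psi> order_trans by blast
  have i\<phi>: "integrable M (\<lambda>\<omega>. \<phi> (X r \<omega>))" for r
  proof (rule Bochner_Integration.integrable_bound)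
    show "integrable M (\<lambda>\<omega>. C\<phi> * (X r \<omega>)\<^sup>2)" using X_power_integrable[of r 1] by simp
    show "AE \<omega> in M. norm (\<phi> (X r \<omega>)) \<le> norm (C\<phi> * (X r \<omega>)\<^sup>2)"
      using \<phi> by (intro AE_I2) (smt (verit) real_norm_def)
  qed simp
  have y: "(\<lambda>\<omega>. \<phi>' (X r \<omega>) * Y i \<omega>) \<in> borel_measurable (F r)" "integrable M (\<lambda>\<omega>. \<phi>' (X r \<omega>) * Y i \<omega>)"
    if "i \<in> I r" for i
  proof -
    show "(\<lambda>\<omega>. \<phi>' (X r \<omega>) * Y i \<omega>) \<in> borel_measurable (F r)"
      by (intro borel_measurable_times Y_F that measurable_compose[OF XF]) simp
    show "integrable M (\<lambda>\<omega>. \<phi>' (X r \<omega>) * Y i \<omega>)"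
    proof (rule Bochner_Integration.integrable_bound)
      show "integrable M (\<lambda>\<omega>. C' * \<bar>X r \<omega>\<bar> * CY)" using X_integrable[of r] by simp
      show "(\<lambda>\<omega>. \<phi>' (X r \<omega>) * Y i \<omega>) \<in> borel_measurable M" using Y_meas[OF I_D[OF that]] by simp
      show "AE \<omega> in M. norm (\<phi>' (X r \<omega>) * Y i \<omega>) \<le> norm (C' * \<bar>X r \<omega>\<bar> * CY)"
      proof (intro AE_I2)
        fix \<omega> assume "\<omega> \<in> space M"
        have "\<bar>\<phi>' (X r \<omega>)\<bar> * \<bar>Y i \<omega>\<bar> \<le> (C' * \<bar>X r \<omega>\<bar>) * CY"
          using \<phi>'[of "X r \<omega>"] CY(2)[OF I_D[OF that] \<open>\<omega> \<in> space M\<close>] by (intro mult_mono) auto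
        then show "norm (\<phi>' (X r \<omega>) * Y i \<omega>) \<le> norm (C' * \<bar>X r \<omega>\<bar> * CY)" using abs_ge_self[of "C' * \<bar>X r \<omega>\<bar> * CY"] by (simp only: real_norm_def abs_mult[of "\<phi>' (X r \<omega>)"])
      qed
    qed
  qed
  have y2: "(\<lambda>\<omega>. \<psi> (X r \<omega>) * Y i \<omega> * Y k \<omega>) \<in> borel_measurable (F r)" "integrable M (\<lambda>\<omega>. \<psi> (X r \<omega>) * Y i \<omega> * Y k \<omega>)"
    if "i \<in> I r" "k \<in> I r" for i k
  proof -
    show "(\<lambda>\<omega>. \<psi> (X r \<omega>) * Y i \<omega> * Y k \<omega>) \<in> borel_measurable (F r)"
      by (intro borel_measurable_times Y_F that measurable_compose[OF XF]) simp
    show "integrable M (\<lambda>\<omega>. \<psi> (X r \<omega>) * Y i \<omega> * Y k \<omega>)"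
    proof (rule integrable_const_bound[where B="C\<psi> * CY * CY"])
      show "(\<lambda>\<omega>. \<psi> (X r \<omega>) * Y i \<omega> * Y k \<omega>) \<in> borel_measurable M" using Y_meas that I_D by simp
      show "AE \<omega> in M. norm (\<psi> (X r \<omega>) * Y i \<omega> * Y k \<omega>) \<le> C\<psi> * CY * CY"
        using CY I_D that \<psi> C\<psi> by (intro AE_I2) (auto simp: abs_mult intro!: mult_mono)
    qed
  qed
  have B: "Bl i r r' \<in> future r" if "i \<in> I r" for i using Bl_future I_D that by auto
  have eq1: "\<phi>' (X r \<omega>) * D r r' \<omega> = (\<Sum>i\<in>I r. (\<phi>' (X r \<omega>) * Y i \<omega>) * w (Bl i r r') \<omega>)" for \<omega>
    by (simp add: D_def sum_distrib_left mult.assoc)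
  have eq2: "\<psi> (X r \<omega>) * (D r r' \<omega>)\<^sup>2 = (\<Sum>i\<in>I r. \<Sum>k\<in>I r. (\<psi> (X r \<omega>) * Y i \<omega> * Y k \<omega>) * (w (Bl i r r') \<omega> * w (Bl k r r') \<omega>))" for \<omega>
    unfolding D_def power2_eq_square sum_product sum_distrib_left[of "\<psi> (X r \<omega>)"]
    by (intro sum.cong refl) (simp add: mult_ac)
  have i1: "integrable M (\<lambda>\<omega>. \<phi>' (X r \<omega>) * D r r' \<omega>)"
    unfolding eq1 using y B by (intro Bochner_Integration.integrable_sum future_mean_zero)
  have e1: "(\<integral>\<omega>. \<phi>' (X r \<omega>) * D r r' \<omega> \<partial>M) = 0"
    unfolding eq1 using y B future_mean_zero[of _ r]
    by (subst Bochner_Integration.integral_sum) (auto intro!: sum.neutral)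
  have i2: "integrable M (\<lambda>\<omega>. \<psi> (X r \<omega>) * (D r r' \<omega>)\<^sup>2)"
    unfolding eq2 using y2 B by (intro Bochner_Integration.integrable_sum future_product)
  have e2: "(\<integral>\<omega>. \<psi> (X r \<omega>) * (D r r' \<omega>)\<^sup>2 \<partial>M) =
    (\<Sum>i\<in>I r. \<Sum>k\<in>I r. (\<integral>\<omega>. \<psi> (X r \<omega>) * Y i \<omega> * Y k \<omega> \<partial>M) * measure lborel (Bl i r r' \<inter> Bl k r r'))"
  proof -
    have "(\<integral>\<omega>. \<psi> (X r \<omega>) * (D r r' \<omega>)\<^sup>2 \<partial>M) = (\<Sum>i\<in>I r. \<integral>\<omega>. (\<Sum>k\<in>I r. (\<psi> (X r \<omega>) * Y i \<omega> * Y k \<omega>) * (w (Bl i r r') \<omega> * w (Bl k r r') \<omega>)) \<partial>M)"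
      unfolding eq2 using y2 B
      by (intro Bochner_Integration.integral_sum Bochner_Integration.integrable_sum future_product)
    also have "\<dots> = (\<Sum>i\<in>I r. \<Sum>k\<in>I r. \<integral>\<omega>. (\<psi> (X r \<omega>) * Y i \<omega> * Y k \<omega>) * (w (Bl i r r') \<omega> * w (Bl k r r') \<omega>) \<partial>M)"
      using y2 B by (intro sum.cong refl Bochner_Integration.integral_sum future_product)
    also have "\<dots> = (\<Sum>i\<in>I r. \<Sum>k\<in>I r. (\<integral>\<omega>. \<psi> (X r \<omega>) * Y i \<omega> * Y k \<omega> \<partial>M) * measure lborel (Bl i r r' \<inter> Bl k r r'))"
      using y2 B by (intro sum.cong refl future_product)
    finally show ?thesis .
  qed
  have "0 \<le> (\<integral>\<omega>. \<psi> (X r \<omega>) * (D r r' \<omega>)\<^sup>2 \<partial>M)" using \<psi> by (intro Bochner_Integration.integral_nonneg) auto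
  then have Qe: "enn2real (Q \<psi> r r r') = (\<integral>\<omega>. \<psi> (X r \<omega>) * (D r r' \<omega>)\<^sup>2 \<partial>M)"
    using Q_eq[OF r free _ \<psi>] e2 by simp
  have "(\<integral>\<omega>. \<phi> (X r' \<omega>) \<partial>M) \<le> (\<integral>\<omega>. \<phi> (X r \<omega>) + \<phi>' (X r \<omega>) * D r r' \<omega> + \<psi> (X r \<omega>) * (D r r' \<omega>)\<^sup>2 + L * D r r' \<omega> ^ (2 * l) \<partial>M)"
  proof (rule integral_mono_AE)
    show "AE \<omega> in M. \<phi> (X r' \<omega>) \<le> \<phi> (X r \<omega>) + \<phi>' (X r \<omega>) * D r r' \<omega> + \<psi> (X r \<omega>) * (D r r' \<omega>)\<^sup>2 + L * D r r' \<omega> ^ (2 * l)"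
      using X_step[OF r free] by eventually_elim (simp add: taylor)
  qed (use i\<phi> i1 i2 D_power_integrable in auto)
  also have "\<dots> = (\<integral>\<omega>. \<phi> (X r \<omega>) \<partial>M) + enn2real (Q \<psi> r r r') + L * (\<integral>\<omega>. D r r' \<omega> ^ (2 * l) \<partial>M)"
    using i\<phi> i1 i2 e1 Qe D_power_integrable by simp
  finally show ?thesis .
qed

text \<open>The error term of a single step is quadratic in its length, so it disappears as the mesh is refined.\<close>

lemma growth:
  fixes \<phi> \<phi>' \<psi> \<beta> :: "real \<Rightarrow> real"
  assumes [measurable]: "\<phi> \<in> borel_measurable borel" "\<phi>' \<in> borel_measurable borel" "\<psi> \<in> borel_measurable borel"
    and \<psi>: "\<And>x. 0 \<le> \<psi> x" "\<And>x. \<psi> x \<le> C\<psi>" and \<phi>': "\<And>x. \<bar>\<phi>' x\<bar> \<le> C' * \<bar>x\<bar>"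
    and \<phi>: "\<And>x. 0 \<le> \<phi> x" "\<And>x. \<phi> x \<le> C\<phi> * x\<^sup>2"
    and taylor: "\<And>x d. \<phi> (x + d) \<le> \<phi> x + \<phi>' x * d + \<psi> x * d\<^sup>2 + L * d ^ (2 * l)"
    and l: "2 \<le> l" and L: "0 \<le> L"
    and \<beta>: "\<And>r r'. 0 \<le> r \<Longrightarrow> r < r' \<Longrightarrow> r' \<le> S \<Longrightarrow> Q \<psi> r r r' \<le> ennreal (\<beta> r' - \<beta> r)"
    and \<beta>mono: "\<And>r r'. 0 \<le> r \<Longrightarrow> r \<le> r' \<Longrightarrow> r' \<le> S \<Longrightarrow> \<beta> r \<le> \<beta> r'"
    and r: "0 \<le> r" "r \<le> r'" "r' \<le> S"
  shows "(\<integral>\<omega>. \<phi> (X r' \<omega>) \<partial>M) \<le> (\<integral>\<omega>. \<phi> (X r \<omega>) \<partial>M) + (\<beta> r' - \<beta> r)"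
proof -
  define E where "E r = (\<integral>\<omega>. \<phi> (X r \<omega>) \<partial>M)" for r
  obtain C where C: "\<And>r r'. 0 \<le> r \<Longrightarrow> r \<le> r' \<Longrightarrow> r' \<le> S \<Longrightarrow> (\<integral>\<omega>. D r r' \<omega> ^ (2 * l) \<partial>M) \<le> C * (r' - r)\<^sup>2"
    using D_moment[OF l] by metis
  have step: "E r' \<le> E r + (\<beta> r' - \<beta> r) + L * C * (r' - r)\<^sup>2"
    if r: "0 \<le> r" "r < r'" "r' \<le> S" and free: "\<forall>i<n. a i \<notin> {r<..<r'}" for r r'
  proof -
    have "enn2real (Q \<psi> r r r') \<le> \<beta> r' - \<beta> r"
      using \<beta>[OF r] \<beta>mono[of r r'] r enn2real_mono by fastforce
    moreover have "L * (\<integral>\<omega>. D r r' \<omega> ^ (2 * l) \<partial>M) \<le> L * (C * (r' - r)\<^sup>2)"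
      using C r L by (intro mult_left_mono) auto
    ultimately show ?thesis
      using one_step[OF r(1,2) free assms(1-3) \<psi> \<phi>' \<phi> taylor] unfolding E_def by simp
  qed
  \<comment> \<open>Between two consecutive starting times the interval can be refined arbitrarily,
    since the condition \<open>free\<close> passes to subintervals.\<close>
  have mesh: "E r' \<le> E r + (\<beta> r' - \<beta> r)"
    if r: "0 \<le> r" "r < r'" "r' \<le> S" and free: "\<forall>i<n. a i \<notin> {r<..<r'}" for r r'
  proof -
    \<comment> \<open>With \<open>Suc N\<close> equal steps of length \<open>h\<close> the errors
      add up to Suc N times a multiple of h^2, that is, to a multiple of 1 / Suc N.\<close>
    have part: "E r' \<le> E r + (\<beta> r' - \<beta> r) + L * C * (r' - r)\<^sup>2 / Suc N" for N
    proof -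
      define h where "h = (r' - r) / Suc N"
      have h: "h > 0" "real (Suc N) * h = r' - r" using r by (auto simp: h_def)
      have j: "E (r + real j * h) \<le> E r + (\<beta> (r + real j * h) - \<beta> r) + real j * (L * C * h\<^sup>2)" if "j \<le> Suc N" for j
        using that
      proof (induction j)
        case (Suc j)
        have "real (Suc j) * h \<le> real (Suc N) * h" using Suc.prems h by (intro mult_right_mono) auto
        then have le: "r + real (Suc j) * h \<le> r'" using h(2) by linarith
        have "E (r + real (Suc j) * h) \<le> E (r + real j * h) + (\<beta> (r + real (Suc j) * h) - \<beta> (r + real j * h))
          + L * C * (r + real (Suc j) * h - (r + real j * h))\<^sup>2"
        proof (rule step)
          show "0 \<le> r + real j * h" using r h by simp
          show "r + real j * h < r + real (Suc j) * h" using h by (simp add: distrib_right)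
          show "r + real (Suc j) * h \<le> S" using le r by simp
          have "r \<le> r + real j * h" using h by simp
          then show "\<forall>i<n. a i \<notin> {r + real j * h<..<r + real (Suc j) * h}"
            using free le by (fastforce simp del: of_nat_Suc)
        qed
        also have "r + real (Suc j) * h - (r + real j * h) = h" by (simp add: distrib_right)
        finally show ?case using Suc by (simp add: distrib_right)
      qed simp
      have "real (Suc N) * (L * C * h\<^sup>2) = L * C * (r' - r)\<^sup>2 / Suc N"
        unfolding h_def by (simp add: power_divide power2_eq_square)
      then show ?thesis using j[of "Suc N"] h by simp
    qed
    have "(\<lambda>N. E r + (\<beta> r' - \<beta> r) + L * C * (r' - r)\<^sup>2 / Suc N) \<longlonglongrightarrow> E r + (\<beta> r' - \<beta> r) + 0"
      by (intro tendsto_intros) (rule LIMSEQ_Suc[OF lim_const_over_n])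
    then have "E r' \<le> E r + (\<beta> r' - \<beta> r) + 0" by (rule LIMSEQ_le_const) (use part in auto)
    then show ?thesis by simp
  qed
  \<comment> \<open>Starting times inside the interval are removed by splitting at one of them: both
    halves contain strictly fewer, and the bound is additive over adjacent intervals.\<close>
  have "E r' \<le> E r + (\<beta> r' - \<beta> r)" if "0 \<le> r" "r \<le> r'" "r' \<le> S" for r r'
    using that
  proof (induction "card {i. i < n \<and> a i \<in> {r<..<r'}}" arbitrary: r r' rule: less_induct)
    case less
    show ?case
    proof (cases "\<exists>i<n. a i \<in> {r<..<r'}")
      case True
      then obtain i where i: "i < n" "r < a i" "a i < r'" by auto
      have "card {j. j < n \<and> a j \<in> {r<..<a i}} < card {j. j < n \<and> a j \<in> {r<..<r'}}"
        by (rule psubset_card_mono) (use i in auto)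
      moreover have "card {j. j < n \<and> a j \<in> {a i<..<r'}} < card {j. j < n \<and> a j \<in> {r<..<r'}}"
        by (rule psubset_card_mono) (use i in auto)
      ultimately have "E (a i) \<le> E r + (\<beta> (a i) - \<beta> r)" "E r' \<le> E (a i) + (\<beta> r' - \<beta> (a i))"
        using less i by auto
      then show ?thesis by simp
    next
      case False
      then show ?thesis using mesh[of r r'] less.prems by (cases "r = r'") auto
    qed
  qed
  then show ?thesis using r unfolding E_def by simp
qed

end

section \<open>Truncated powers\<close>

definition clip :: "real \<Rightarrow> real \<Rightarrow> real" where "clip R x = min \<bar>x\<bar> R"

text \<open>Equal to |x|^(2k+2) for |x| up to R and quadratic beyond. Hence it has finite
  expectation for every square integrable variable, and it increases to the full power as R
  grows.\<close>

definition tpow :: "nat \<Rightarrow> real \<Rightarrow> real \<Rightarrow> real" where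
  "tpow k R x = x\<^sup>2 * (clip R x)\<^sup>2 ^ k"

text \<open>A convex function comparable to \<^const>\<open>tpow\<close>, uniformly in \<open>R\<close>.\<close>

definition cpow :: "nat \<Rightarrow> real \<Rightarrow> real \<Rightarrow> real" where
  "cpow k R x = (clip R x)\<^sup>2 ^ Suc k / real (Suc k) + (clip R x)\<^sup>2 ^ k * (x\<^sup>2 - (clip R x)\<^sup>2)"

lemma clip_measurable[measurable]: "clip R \<in> borel_measurable borel"
  unfolding clip_def[abs_def] by measurable

lemma tpow_measurable[measurable]: "tpow k R \<in> borel_measurable borel"
  unfolding tpow_def[abs_def] by measurable

lemma cpow_measurable[measurable]: "cpow k R \<in> borel_measurable borel"
  unfolding cpow_def[abs_def] by measurable

text \<open>The tangent line of the convex function t^(k+1) at q lies below its graph on the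
  nonnegative half-line; the induction step exposes the surplus as a multiple of (p - q)^2.\<close>

lemma power_Suc_tangent:
  fixes p q :: real assumes "0 \<le> p" "0 \<le> q"
  shows "real (Suc k) * q ^ k * (p - q) \<le> p ^ Suc k - q ^ Suc k"
proof (induction k)
  case (Suc k)
  have "p ^ Suc (Suc k) - q ^ Suc (Suc k) = p * (p ^ Suc k - q ^ Suc k) + q ^ Suc k * (p - q)"
    by (simp add: algebra_simps)
  moreover have "p * (real (Suc k) * q ^ k * (p - q)) \<le> p * (p ^ Suc k - q ^ Suc k)"
    using Suc assms by (intro mult_left_mono) auto
  moreover have "p * (real (Suc k) * q ^ k * (p - q)) + q ^ Suc k * (p - q)
    = real (Suc (Suc k)) * q ^ Suc k * (p - q) + real (Suc k) * q ^ k * (p - q)\<^sup>2"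
    by (simp add: algebra_simps power2_eq_square)
  moreover have "0 \<le> real (Suc k) * q ^ k * (p - q)\<^sup>2" using assms by simp
  ultimately show ?case by linarith
qed simp

context
  fixes R :: real assumes R: "0 < R"
begin

lemma clip_bounds: "0 \<le> clip R x" "clip R x \<le> R" "clip R x \<le> \<bar>x\<bar>" "(clip R x)\<^sup>2 \<le> x\<^sup>2" "(clip R x)\<^sup>2 \<le> R\<^sup>2"
proof -
  show a: "0 \<le> clip R x" "clip R x \<le> R" "clip R x \<le> \<bar>x\<bar>" using R by (auto simp: clip_def)
  show "(clip R x)\<^sup>2 \<le> x\<^sup>2" using a power_mono[of "clip R x" "\<bar>x\<bar>" 2] by simp
  show "(clip R x)\<^sup>2 \<le> R\<^sup>2" using a power_mono[of "clip R x" R 2] by simp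
qed

text \<open>\<open>cpow k R x\<close> is the integral of min s (R^2) ^ k over s from 0 to x^2. It is
  therefore convex as a function of x^2, with slope \<open>(clip R y)\<^sup>2 ^ k\<close> at y^2,
  and the claim is the tangent line inequality in that variable.\<close>

lemma cpow_convex: "cpow k R y + (clip R y)\<^sup>2 ^ k * (x\<^sup>2 - y\<^sup>2) \<le> cpow k R x"
proof -
  define p q where "p = (clip R x)\<^sup>2" and "q = (clip R y)\<^sup>2"
  have pq: "0 \<le> p" "0 \<le> q" "q \<le> R\<^sup>2" "p \<le> x\<^sup>2" using clip_bounds by (auto simp: p_def q_def)
  have "q ^ k * (p - q) \<le> (p ^ Suc k - q ^ Suc k) / real (Suc k)"
    using power_Suc_tangent[OF pq(1,2), of k] by (simp add: field_simps del: of_nat_Suc)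
  \<comment> \<open>The second factor vanishes unless |x| exceeds R, and then p has its largest
    possible value R^2.\<close>
  moreover have "0 \<le> (p ^ k - q ^ k) * (x\<^sup>2 - p)"
  proof (cases "\<bar>x\<bar> \<le> R")
    case True
    then have "p = x\<^sup>2" by (simp add: p_def clip_def)
    then show ?thesis by simp
  next
    case False
    then have "p = R\<^sup>2" by (simp add: p_def clip_def)
    then have "q ^ k \<le> p ^ k" using pq by (intro power_mono) auto
    then show ?thesis using pq by simp
  qed
  moreover have "cpow k R x - cpow k R y - q ^ k * (x\<^sup>2 - y\<^sup>2)
    = (p ^ Suc k - q ^ Suc k) / real (Suc k) - q ^ k * (p - q) + (p ^ k - q ^ k) * (x\<^sup>2 - p)"
    unfolding cpow_def p_def[symmetric] q_def[symmetric] by (simp add: algebra_simps diff_divide_distrib)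
  ultimately show ?thesis unfolding q_def by linarith
qed

lemma cpow_bounds:
  "0 \<le> cpow k R x" "tpow k R x \<le> real (Suc k) * cpow k R x" "cpow k R x \<le> tpow k R x"
  "tpow k R x \<le> R\<^sup>2 ^ k * x\<^sup>2" "0 \<le> tpow k R x"
proof -
  define p where "p = (clip R x)\<^sup>2"
  have p: "0 \<le> p" "p \<le> x\<^sup>2" "p \<le> R\<^sup>2" using clip_bounds by (auto simp: p_def)
  have a: "0 \<le> p ^ k * (x\<^sup>2 - p)" using p by simp
  have b: "0 \<le> p ^ Suc k / real (Suc k)" using p by (simp del: of_nat_Suc)
  show "0 \<le> cpow k R x" using a b unfolding cpow_def p_def[symmetric] by (rule add_nonneg_nonneg[rotated])
  have "p ^ k * (x\<^sup>2 - p) \<le> real (Suc k) * (p ^ k * (x\<^sup>2 - p))" using a by (simp add: distrib_right)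
  then show "tpow k R x \<le> real (Suc k) * cpow k R x"
    unfolding cpow_def tpow_def p_def[symmetric] by (simp add: distrib_left algebra_simps del: of_nat_Suc)
  have "p ^ Suc k / real (Suc k) \<le> p ^ Suc k / 1" using p by (intro divide_left_mono) auto
  then show "cpow k R x \<le> tpow k R x"
    unfolding cpow_def tpow_def p_def[symmetric] by (simp add: algebra_simps del: of_nat_Suc)
  have "p ^ k \<le> R\<^sup>2 ^ k" using p by (intro power_mono) auto
  then show "tpow k R x \<le> R\<^sup>2 ^ k * x\<^sup>2" unfolding tpow_def p_def[symmetric]
    by (metis mult.commute mult_right_mono zero_le_power2)
  show "0 \<le> tpow k R x" by (simp add: tpow_def)
qed

lemma clip_scale: "1 \<le> c \<Longrightarrow> \<bar>x\<bar> \<le> c * \<bar>y\<bar> \<Longrightarrow> clip R x \<le> c * clip R y"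
  using R unfolding clip_def min_def by (auto intro: order_trans[of _ R] simp: mult_le_cancel_right1)

text \<open>If x is the larger argument in absolute value, then |x + y| is at most 2 |x|, and
  doubling the argument costs a factor 4 for the square and for each of the k clipped squares. No
  convexity of \<open>tpow\<close> enters.\<close>

lemma tpow_add: "tpow k R (x + y) \<le> 4 ^ Suc k * (tpow k R x + tpow k R y)"
proof -
  have *: "tpow k R (x + y) \<le> 4 ^ Suc k * tpow k R x" if "\<bar>y\<bar> \<le> \<bar>x\<bar>" for x y
  proof -
    have le: "\<bar>x + y\<bar> \<le> 2 * \<bar>x\<bar>" using that by simp
    then have "clip R (x + y) \<le> 2 * clip R x" by (intro clip_scale) auto
    then have "(clip R (x + y))\<^sup>2 \<le> (2 * clip R x)\<^sup>2" using clip_bounds by (intro power_mono) auto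
    then have "(clip R (x + y))\<^sup>2 ^ k \<le> (4 * (clip R x)\<^sup>2) ^ k" by (intro power_mono) (auto simp: power_mult_distrib)
    moreover have "(x + y)\<^sup>2 \<le> 4 * x\<^sup>2" using power_mono[OF le, of 2] by (simp add: power_mult_distrib)
    ultimately have "(x + y)\<^sup>2 * (clip R (x + y))\<^sup>2 ^ k \<le> (4 * x\<^sup>2) * (4 * (clip R x)\<^sup>2) ^ k"
      by (intro mult_mono) auto
    then show ?thesis by (simp add: tpow_def power_mult_distrib mult_ac)
  qed
  have nn: "0 \<le> 4 ^ Suc k * tpow k R x" "0 \<le> 4 ^ Suc k * tpow k R y" using cpow_bounds by auto
  show ?thesis
  proof (cases "\<bar>y\<bar> \<le> \<bar>x\<bar>")
    case True
    then show ?thesis using *[OF True] nn unfolding distrib_left by linarith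
  next
    case False
    then show ?thesis using *[of x y] nn unfolding distrib_left add.commute[of x y] by linarith
  qed
qed

lemma tpow_scale:
  assumes "1 \<le> c" "\<bar>x\<bar> \<le> c * \<bar>y\<bar>" shows "tpow k R x \<le> c\<^sup>2 ^ Suc k * tpow k R y"
proof -
  have "clip R x \<le> c * clip R y" using assms by (rule clip_scale)
  then have "(clip R x)\<^sup>2 \<le> (c * clip R y)\<^sup>2" using clip_bounds by (intro power_mono) auto
  then have "(clip R x)\<^sup>2 ^ k \<le> (c\<^sup>2 * (clip R y)\<^sup>2) ^ k" by (intro power_mono) (auto simp: power_mult_distrib)
  moreover have "x\<^sup>2 \<le> c\<^sup>2 * y\<^sup>2" using power_mono[OF assms(2), of 2] by (simp add: power_mult_distrib)
  ultimately have "x\<^sup>2 * (clip R x)\<^sup>2 ^ k \<le> (c\<^sup>2 * y\<^sup>2) * (c\<^sup>2 * (clip R y)\<^sup>2) ^ k"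
    by (intro mult_mono) auto
  then show ?thesis by (simp add: tpow_def power_mult_distrib mult_ac)
qed

text \<open>A form of Young's inequality by cases: either g^2 is at most \<epsilon> v^2 and the
  first term alone suffices, or v^2 is less than g^2 / \<epsilon>, and clipping respects this up to
  the factor 1 / \<epsilon>.\<close>

lemma tpow_young:
  assumes "0 < \<epsilon>" "\<epsilon> \<le> 1"
  shows "(clip R v)\<^sup>2 ^ k * g\<^sup>2 \<le> \<epsilon> * tpow k R v + (1 / \<epsilon>) ^ k * tpow k R g"
proof (cases "g\<^sup>2 \<le> \<epsilon> * v\<^sup>2")
  case True
  then have "(clip R v)\<^sup>2 ^ k * g\<^sup>2 \<le> (clip R v)\<^sup>2 ^ k * (\<epsilon> * v\<^sup>2)" by (intro mult_left_mono) auto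
  moreover have "0 \<le> (1 / \<epsilon>) ^ k * tpow k R g" using assms cpow_bounds by auto
  ultimately show ?thesis by (simp add: tpow_def mult_ac)
next
  case False
  define s where "s = sqrt (1 / \<epsilon>)"
  have s: "1 \<le> s" "s\<^sup>2 = 1 / \<epsilon>" using assms by (auto simp: s_def)
  have "v\<^sup>2 \<le> s\<^sup>2 * g\<^sup>2" using False assms unfolding s by (simp add: field_simps)
  then have "\<bar>v\<bar> \<le> \<bar>s * g\<bar>" unfolding power_mult_distrib[symmetric] by (simp only: abs_le_square_iff)
  then have "\<bar>v\<bar> \<le> s * \<bar>g\<bar>" using s by (simp add: abs_mult)
  then have "clip R v \<le> s * clip R g" using s by (intro clip_scale)
  then have "(clip R v)\<^sup>2 \<le> (s * clip R g)\<^sup>2" using clip_bounds by (intro power_mono) auto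
  then have "(clip R v)\<^sup>2 ^ k \<le> ((1 / \<epsilon>) * (clip R g)\<^sup>2) ^ k"
    by (intro power_mono) (auto simp: power_mult_distrib s)
  then have "(clip R v)\<^sup>2 ^ k * g\<^sup>2 \<le> ((1 / \<epsilon>) * (clip R g)\<^sup>2) ^ k * g\<^sup>2" by (intro mult_right_mono) auto
  moreover have "0 \<le> \<epsilon> * tpow k R v" using assms cpow_bounds by auto
  ultimately show ?thesis unfolding tpow_def power_mult_distrib by (simp only: mult_ac)
qed

text \<open>Convexity in the squared variable, taken at x + d, leaves the change of slope times 2 x
  d, and the slope at x + d times d^2. If |x| is at most 2 |d|, everything is bounded by d^(2k+2);
  otherwise x + d and x are comparable with ratio at most 3/2, and a multiple of the slope at x
  times d^2 suffices.\<close>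

lemma cpow_taylor:
  assumes k: "1 \<le> k"
  shows "cpow k R (x + d) \<le> cpow k R x + (2 * x * (clip R x)\<^sup>2 ^ k) * d
    + ((8 * real k + 1) * (9 / 4) ^ k * (clip R x)\<^sup>2 ^ k) * d\<^sup>2 + (5 * 9 ^ k) * d ^ (2 * Suc k)"
proof -
  define u v where "u = (clip R (x + d))" and "v = (clip R x)"
  have uv: "0 \<le> u" "0 \<le> v" using clip_bounds by (auto simp: u_def v_def)
  have "cpow k R (x + d) - cpow k R x \<le> u\<^sup>2 ^ k * ((x + d)\<^sup>2 - x\<^sup>2)"
    using cpow_convex[of k "x + d" x] by (simp add: u_def right_diff_distrib)
  also have "\<dots> = (2 * x * v\<^sup>2 ^ k) * d + ((u\<^sup>2 ^ k - v\<^sup>2 ^ k) * (2 * x * d) + u\<^sup>2 ^ k * d\<^sup>2)"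
    by (simp add: power2_eq_square algebra_simps)
  also have "(u\<^sup>2 ^ k - v\<^sup>2 ^ k) * (2 * x * d) + u\<^sup>2 ^ k * d\<^sup>2
    \<le> ((8 * real k + 1) * (9 / 4) ^ k * v\<^sup>2 ^ k) * d\<^sup>2 + (5 * 9 ^ k) * d ^ (2 * Suc k)"
  \<comment> \<open>In the first case both clipped values are at most 3 |d|, whence 9^k; the factor
    5 is 4 from the mixed term plus 1 from the quadratic one. In the second case (3/2)^2 gives 9/4,
    and the mixed and quadratic terms contribute 8k and 1.\<close>
  proof (cases "\<bar>x\<bar> \<le> 2 * \<bar>d\<bar>")
    case True
    have d2: "(3 * \<bar>d\<bar>)\<^sup>2 ^ k = 9 ^ k * d ^ (2 * k)"
      by (simp add: power_mult_distrib power_mult)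
    have "u \<le> 3 * \<bar>d\<bar>" "v \<le> 3 * \<bar>d\<bar>" using True clip_bounds(3)[of "x + d"] clip_bounds(3)[of x]
      by (auto simp: u_def v_def)
    then have "u\<^sup>2 ^ k \<le> (3 * \<bar>d\<bar>)\<^sup>2 ^ k" "v\<^sup>2 ^ k \<le> (3 * \<bar>d\<bar>)\<^sup>2 ^ k" using uv by (intro power_mono; simp)+
    then have le: "u\<^sup>2 ^ k \<le> 9 ^ k * d ^ (2 * k)" "v\<^sup>2 ^ k \<le> 9 ^ k * d ^ (2 * k)" unfolding d2 .
    have nn: "0 \<le> u\<^sup>2 ^ k" "0 \<le> v\<^sup>2 ^ k" by auto
    have "(u\<^sup>2 ^ k - v\<^sup>2 ^ k) * (2 * x * d) \<le> \<bar>u\<^sup>2 ^ k - v\<^sup>2 ^ k\<bar> * (2 * (\<bar>x\<bar> * \<bar>d\<bar>))"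
      using abs_ge_self[of "(u\<^sup>2 ^ k - v\<^sup>2 ^ k) * (2 * x * d)"] by (simp add: abs_mult)
    also have "\<dots> \<le> (9 ^ k * d ^ (2 * k)) * (2 * (2 * d\<^sup>2))"
    proof (rule mult_mono)
      show "\<bar>u\<^sup>2 ^ k - v\<^sup>2 ^ k\<bar> \<le> 9 ^ k * d ^ (2 * k)" using le nn by linarith
      have "\<bar>x\<bar> * \<bar>d\<bar> \<le> (2 * \<bar>d\<bar>) * \<bar>d\<bar>" using True by (intro mult_right_mono) auto
      then show "2 * (\<bar>x\<bar> * \<bar>d\<bar>) \<le> 2 * (2 * d\<^sup>2)" by (simp add: power2_eq_square mult_ac)
    qed (auto simp: zero_le_even_power)
    finally have 1: "(u\<^sup>2 ^ k - v\<^sup>2 ^ k) * (2 * x * d) \<le> 4 * 9 ^ k * d ^ (2 * Suc k)"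
      by (simp add: power2_eq_square mult_ac)
    have "u\<^sup>2 ^ k * d\<^sup>2 \<le> (9 ^ k * d ^ (2 * k)) * d\<^sup>2" using le by (intro mult_right_mono) auto
    then have 2: "u\<^sup>2 ^ k * d\<^sup>2 \<le> 9 ^ k * d ^ (2 * Suc k)" by (simp add: power2_eq_square mult_ac)
    have 3: "0 \<le> ((8 * real k + 1) * (9 / 4) ^ k * v\<^sup>2 ^ k) * d\<^sup>2" by simp
    show ?thesis using 1 2 3 by linarith
  next
    case False
    have "\<bar>x + d\<bar> \<le> (3/2) * \<bar>x\<bar>" using False by linarith
    then have "clip R (x + d) \<le> (3/2) * clip R x" by (intro clip_scale) auto
    then have u: "u \<le> (3/2) * v" by (simp add: u_def v_def)
    then have "u\<^sup>2 \<le> ((3/2) * v)\<^sup>2" using uv by (intro power_mono) auto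
    then have u2: "u\<^sup>2 \<le> 9/4 * v\<^sup>2" by (simp add: power_mult_distrib power_divide)
    then have uk: "u\<^sup>2 ^ k \<le> (9/4) ^ k * v\<^sup>2 ^ k" by (metis power_mono power_mult_distrib zero_le_power2)
    \<comment> \<open>For |x| up to 2R the clipped value is at least |x| / 2 and clipping is
      1-Lipschitz. For larger |x| the increment is less than |x| / 2, so both points lie beyond R
      and are clipped to the same value.\<close>
    have xuv: "\<bar>u - v\<bar> * \<bar>x\<bar> \<le> 2 * v * \<bar>d\<bar>"
    proof (cases "\<bar>x\<bar> \<le> 2 * R")
      case True
      then have "\<bar>x\<bar> \<le> 2 * v" by (auto simp: v_def clip_def)
      moreover have "\<bar>u - v\<bar> \<le> \<bar>d\<bar>" by (auto simp: u_def v_def clip_def)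
      ultimately have "\<bar>u - v\<bar> * \<bar>x\<bar> \<le> \<bar>d\<bar> * (2 * v)" by (intro mult_mono) auto
      then show ?thesis by (simp add: mult_ac)
    next
      case 2: False
      then have "u = v" using False by (auto simp: u_def v_def clip_def)
      then show ?thesis using uv by simp
    qed
    \<comment> \<open>Factoring out u - v leaves 2k products of total degree 2k - 1, each bounded by
      replacing both u and v by (3/2) v.\<close>
    have "\<bar>u ^ (2 * k) - v ^ (2 * k)\<bar> \<le> \<bar>u - v\<bar> * (real (2 * k) * ((3/2) * v) ^ (2 * k - 1))"
    proof -
      have "u ^ (2 * k) - v ^ (2 * k) = (u - v) * (\<Sum>i<2 * k. v ^ (2 * k - Suc i) * u ^ i)"
        by (rule power_diff_sumr2)
      moreover have "\<bar>\<Sum>i<2 * k. v ^ (2 * k - Suc i) * u ^ i\<bar> \<le> real (2 * k) * ((3/2) * v) ^ (2 * k - 1)"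
      proof -
        have "v ^ (2 * k - Suc i) * u ^ i \<le> ((3/2) * v) ^ (2 * k - 1)" if "i < 2 * k" for i
        proof -
          have "v ^ (2 * k - Suc i) * u ^ i \<le> ((3/2) * v) ^ (2 * k - Suc i) * ((3/2) * v) ^ i"
            using u uv by (intro mult_mono power_mono) auto
          also have "\<dots> = ((3/2) * v) ^ (2 * k - 1)" using that by (simp flip: power_add)
          finally show ?thesis .
        qed
        then have "(\<Sum>i<2 * k. v ^ (2 * k - Suc i) * u ^ i) \<le> real (card {..<2*k}) * ((3/2) * v) ^ (2 * k - 1)"
          by (intro sum_bounded_above) auto
        moreover have "0 \<le> (\<Sum>i<2 * k. v ^ (2 * k - Suc i) * u ^ i)" using uv by (intro sum_nonneg) auto
        ultimately show ?thesis by simp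
      qed
      ultimately show ?thesis by (simp add: abs_mult mult_left_mono)
    qed
    then have "\<bar>u\<^sup>2 ^ k - v\<^sup>2 ^ k\<bar> \<le> \<bar>u - v\<bar> * (real (2 * k) * ((3/2) * v) ^ (2 * k - 1))"
      by (simp only: power_mult)
    then have "(u\<^sup>2 ^ k - v\<^sup>2 ^ k) * (2 * x * d) \<le> \<bar>u - v\<bar> * (real (2 * k) * ((3/2) * v) ^ (2 * k - 1)) * (2 * (\<bar>x\<bar> * \<bar>d\<bar>))"
    proof -
      assume "\<bar>u\<^sup>2 ^ k - v\<^sup>2 ^ k\<bar> \<le> \<bar>u - v\<bar> * (real (2 * k) * ((3/2) * v) ^ (2 * k - 1))"
      then have "\<bar>u\<^sup>2 ^ k - v\<^sup>2 ^ k\<bar> * (2 * (\<bar>x\<bar> * \<bar>d\<bar>))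
        \<le> \<bar>u - v\<bar> * (real (2 * k) * ((3/2) * v) ^ (2 * k - 1)) * (2 * (\<bar>x\<bar> * \<bar>d\<bar>))"
        by (rule mult_right_mono) auto
      moreover have "\<bar>(u\<^sup>2 ^ k - v\<^sup>2 ^ k) * (2 * x * d)\<bar> = \<bar>u\<^sup>2 ^ k - v\<^sup>2 ^ k\<bar> * (2 * (\<bar>x\<bar> * \<bar>d\<bar>))"
        by (simp add: abs_mult)
      ultimately show ?thesis by linarith
    qed
    also have "\<dots> = (\<bar>u - v\<bar> * \<bar>x\<bar>) * (real (2 * k) * ((3/2) * v) ^ (2 * k - 1) * (2 * \<bar>d\<bar>))" by simp
    also have "\<dots> \<le> (2 * v * \<bar>d\<bar>) * (real (2 * k) * ((3/2) * v) ^ (2 * k - 1) * (2 * \<bar>d\<bar>))"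
      using xuv uv by (intro mult_right_mono) auto
    also have "\<dots> = 8 * real k * (v * ((3/2) * v) ^ (2 * k - 1)) * d\<^sup>2" by (simp add: power2_eq_square)
    also have "\<dots> \<le> 8 * real k * ((9/4) ^ k * v\<^sup>2 ^ k) * d\<^sup>2"
    proof (intro mult_right_mono mult_left_mono)
      have "v * ((3/2) * v) ^ (2 * k - 1) \<le> ((3/2) * v) * ((3/2) * v) ^ (2 * k - 1)"
        using uv by (intro mult_right_mono) auto
      also have "\<dots> = ((3/2) * v) ^ (2 * k)" using k by (metis Suc_diff_1 mult_pos_pos power_Suc zero_less_numeral less_le_trans zero_less_one)
      also have "\<dots> = (9/4) ^ k * v\<^sup>2 ^ k" by (simp add: power_mult power_mult_distrib power_divide)
      finally show "v * ((3/2) * v) ^ (2 * k - 1) \<le> (9/4) ^ k * v\<^sup>2 ^ k" .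
    qed auto
    finally have 1: "(u\<^sup>2 ^ k - v\<^sup>2 ^ k) * (2 * x * d) \<le> 8 * real k * ((9/4) ^ k * v\<^sup>2 ^ k) * d\<^sup>2" .
    have 2: "u\<^sup>2 ^ k * d\<^sup>2 \<le> (9/4) ^ k * v\<^sup>2 ^ k * d\<^sup>2" using uk by (intro mult_right_mono) auto
    have 3: "0 \<le> (5 * 9 ^ k) * d ^ (2 * Suc k)" using zero_le_even_power[of "2 * Suc k" d] by (intro mult_nonneg_nonneg) auto
    have "(8 * real k + 1) * (9 / 4) ^ k * v\<^sup>2 ^ k * d\<^sup>2
      = 8 * real k * ((9/4) ^ k * v\<^sup>2 ^ k) * d\<^sup>2 + (9/4) ^ k * v\<^sup>2 ^ k * d\<^sup>2"
      by (simp add: algebra_simps)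
    then show ?thesis using 1 2 3 by linarith
  qed
  finally show ?thesis unfolding v_def by simp
qed

end

section \<open>Walsh integrals\<close>

context simple_integrand
begin

text \<open>Only finiteness uniformly in \<open>r\<close> matters: it makes the supremum that is to
  be absorbed a real number. The value of the bound is lost afterwards.\<close>

lemma X_second_moment: "\<exists>K. \<forall>r. (\<integral>\<omega>. (X r \<omega>)\<^sup>2 \<partial>M) \<le> K"
proof (intro exI allI)
  fix r
  define B where "B i = ({a i<..b i} \<inter> {..r}) \<times> A i" for i
  have N: "B i \<in> noise_sets" if "i < n" for i using cut_noise_set(1)[OF that] by (simp add: B_def)
  have m: "measure lborel (B i) \<le> (b i - a i) * measure lborel (A i)" if "i < n" for i
  proof -
    have "measure lborel ({a i<..b i} \<inter> {..r}) \<le> measure lborel {a i<..b i}"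
      using simple[OF that] by (intro measure_mono_fmeasurable) (auto simp: fmeasurable_def)
    then show ?thesis using simple[OF that] cut_noise_set(2)[OF that, of "{..r}"]
      by (simp add: B_def mult_right_mono)
  qed
  have i1: "integrable M (\<lambda>\<omega>. (Y i \<omega> * w (B i) \<omega>)\<^sup>2)" "integrable M (\<lambda>\<omega>. CY\<^sup>2 * (w (B i) \<omega>)\<^sup>2)" if "i < n" for i
    using Yw_power_integrable[OF that N[OF that], of 2] lin_integrable_power[OF lin_w[OF N[OF that]], of 2] by auto
  have i2: "integrable M (\<lambda>\<omega>. (real n)\<^sup>2 * (\<Sum>i<n. (Y i \<omega> * w (B i) \<omega>)\<^sup>2))"
    using i1 by (intro integrable_mult_right Bochner_Integration.integrable_sum) auto
  have "(\<integral>\<omega>. (X r \<omega>)\<^sup>2 \<partial>M) \<le> (\<integral>\<omega>. (real n)\<^sup>2 * (\<Sum>i<n. (Y i \<omega> * w (B i) \<omega>)\<^sup>2) \<partial>M)"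
  proof (rule integral_mono[OF _ i2])
    show "integrable M (\<lambda>\<omega>. (X r \<omega>)\<^sup>2)" using X_power_integrable[of r 1] by simp
    fix \<omega>
    have "(X r \<omega>)\<^sup>2 \<le> (real (card (I r)))\<^sup>2 * (\<Sum>i\<in>I r. (Y i \<omega> * w (B i) \<omega>)\<^sup>2)"
      using power_sum_le_card[OF finite_I, of 1 "\<lambda>i. Y i \<omega> * w (B i) \<omega>" r] unfolding X_def B_def by simp
    also have "\<dots> \<le> (real n)\<^sup>2 * (\<Sum>i<n. (Y i \<omega> * w (B i) \<omega>)\<^sup>2)"
    proof (rule mult_mono)
      have "card (I r) \<le> card {..<n}" by (rule card_mono) (auto simp: I_def)
      then show "(real (card (I r)))\<^sup>2 \<le> (real n)\<^sup>2" by (intro power_mono) auto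
      show "(\<Sum>i\<in>I r. (Y i \<omega> * w (B i) \<omega>)\<^sup>2) \<le> (\<Sum>i<n. (Y i \<omega> * w (B i) \<omega>)\<^sup>2)"
        by (rule sum_mono2) (auto simp: I_def)
    qed (auto intro!: sum_nonneg)
    finally show "(X r \<omega>)\<^sup>2 \<le> (real n)\<^sup>2 * (\<Sum>i<n. (Y i \<omega> * w (B i) \<omega>)\<^sup>2)" .
  qed
  also have "\<dots> = (real n)\<^sup>2 * (\<Sum>i<n. (\<integral>\<omega>. (Y i \<omega> * w (B i) \<omega>)\<^sup>2 \<partial>M))"
    using i1 by (subst integral_mult_right_zero, subst Bochner_Integration.integral_sum) auto
  also have "\<dots> \<le> (real n)\<^sup>2 * (\<Sum>i<n. CY\<^sup>2 * ((b i - a i) * measure lborel (A i)))"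
  proof (intro mult_left_mono sum_mono)
    fix i assume "i \<in> {..<n}"
    then have i: "i < n" by simp
    have "(\<integral>\<omega>. (Y i \<omega> * w (B i) \<omega>)\<^sup>2 \<partial>M) \<le> (\<integral>\<omega>. CY\<^sup>2 * (w (B i) \<omega>)\<^sup>2 \<partial>M)"
    proof (rule integral_mono[OF i1[OF i]])
      fix \<omega> assume "\<omega> \<in> space M"
      then have "\<bar>Y i \<omega>\<bar>\<^sup>2 \<le> CY\<^sup>2" using CY(2)[OF i] by (intro power_mono) auto
      then show "(Y i \<omega> * w (B i) \<omega>)\<^sup>2 \<le> CY\<^sup>2 * (w (B i) \<omega>)\<^sup>2"
        by (auto simp: power_mult_distrib intro!: mult_right_mono)
    qed
    also have "\<dots> = CY\<^sup>2 * measure lborel (B i)"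
      using cov_w[OF N[OF i] N[OF i]] by (simp add: power2_eq_square)
    also have "\<dots> \<le> CY\<^sup>2 * ((b i - a i) * measure lborel (A i))" using m[OF i] by (intro mult_left_mono) auto
    finally show "(\<integral>\<omega>. (Y i \<omega> * w (B i) \<omega>)\<^sup>2 \<partial>M) \<le> CY\<^sup>2 * ((b i - a i) * measure lborel (A i))" .
  qed auto
  finally show "(\<integral>\<omega>. (X r \<omega>)\<^sup>2 \<partial>M) \<le> (real n)\<^sup>2 * (\<Sum>i<n. CY\<^sup>2 * ((b i - a i) * measure lborel (A i)))" .
qed

text \<open>A closed inequality for K, the supremum over r of E \<phi>(X r). Assumption
  \<open>H\<close> bounds the second order term by a density \<open>W K\<close> depending on the
  state only through K; its total mass is at most c0 + \<theta> K, so K is at most c0 + \<theta> K,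
  and \<theta> < 1 together with the finiteness of K gives the bound.\<close>

lemma X_end_bound:
  fixes \<phi> \<phi>' \<psi> :: "real \<Rightarrow> real" and W :: "real \<Rightarrow> real \<times> real \<Rightarrow> ennreal"
  assumes m[measurable]: "\<phi> \<in> borel_measurable borel" "\<phi>' \<in> borel_measurable borel" "\<psi> \<in> borel_measurable borel"
    and \<psi>: "\<And>x. 0 \<le> \<psi> x" "\<And>x. \<psi> x \<le> C\<psi>" and \<phi>': "\<And>x. \<bar>\<phi>' x\<bar> \<le> C' * \<bar>x\<bar>"
    and \<phi>: "\<And>x. 0 \<le> \<phi> x" "\<And>x. \<phi> x \<le> C\<phi> * x\<^sup>2"
    and taylor: "\<And>x d. \<phi> (x + d) \<le> \<phi> x + \<phi>' x * d + \<psi> x * d\<^sup>2 + L * d ^ (2 * l)"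
    and l: "2 \<le> l" and L: "0 \<le> L"
    and W[measurable]: "\<And>K. W K \<in> borel_measurable borel"
    and H: "\<And>V K z. V \<in> borel_measurable M \<Longrightarrow> 0 \<le> K \<Longrightarrow> integrable M (\<lambda>\<omega>. \<phi> (V \<omega>)) \<Longrightarrow> (\<integral>\<omega>. \<phi> (V \<omega>) \<partial>M) \<le> K \<Longrightarrow>
        0 < fst z \<Longrightarrow> (\<integral>\<^sup>+\<omega>. ennreal (\<psi> (V \<omega>) * (f (fst z) (snd z) \<omega>)\<^sup>2) \<partial>M) \<le> W K z"
    and tot: "\<And>K. 0 \<le> K \<Longrightarrow> (\<integral>\<^sup>+z\<in>{0<..} \<times> UNIV. W K z \<partial>lborel) \<le> ennreal (c0 + \<theta> * K)"
    and \<theta>: "0 \<le> c0" "0 \<le> \<theta>" "\<theta> < 1" and S: "0 \<le> S"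
  shows "(\<integral>\<omega>. \<phi> (X S \<omega>) \<partial>M) \<le> c0 / (1 - \<theta>)"
proof -
  have i\<phi>: "integrable M (\<lambda>\<omega>. \<phi> (X r \<omega>))" and le\<phi>: "(\<integral>\<omega>. \<phi> (X r \<omega>) \<partial>M) \<le> C\<phi> * (\<integral>\<omega>. (X r \<omega>)\<^sup>2 \<partial>M)" for r
  proof -
    have i: "integrable M (\<lambda>\<omega>. C\<phi> * (X r \<omega>)\<^sup>2)" using X_power_integrable[of r 1] by simp
    show i': "integrable M (\<lambda>\<omega>. \<phi> (X r \<omega>))"
    proof (rule Bochner_Integration.integrable_bound[OF i])
      show "AE \<omega> in M. norm (\<phi> (X r \<omega>)) \<le> norm (C\<phi> * (X r \<omega>)\<^sup>2)"
        using \<phi> by (intro AE_I2) (smt (verit) real_norm_def)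
    qed simp
    show "(\<integral>\<omega>. \<phi> (X r \<omega>) \<partial>M) \<le> C\<phi> * (\<integral>\<omega>. (X r \<omega>)\<^sup>2 \<partial>M)"
      using integral_mono[OF i' i] \<phi>(2) by simp
  qed
  have C\<phi>: "0 \<le> C\<phi>" using \<phi>(1)[of 1] \<phi>(2)[of 1] by simp
  obtain K2 where K2: "\<And>r. (\<integral>\<omega>. (X r \<omega>)\<^sup>2 \<partial>M) \<le> K2" using X_second_moment by blast
  define E where "E r = (\<integral>\<omega>. \<phi> (X r \<omega>) \<partial>M)" for r
  have E0: "0 \<le> E r" for r unfolding E_def by (rule Bochner_Integration.integral_nonneg) (rule \<phi>)
  have bdd: "bdd_above (E ` {0..S})"
    using le\<phi> K2 C\<phi> unfolding E_def
    by (intro bdd_aboveI[where M="C\<phi> * K2"]) (auto intro: order_trans[OF le\<phi>] mult_left_mono)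
  define K where "K = (SUP r\<in>{0..S}. E r)"
  have EK: "E r \<le> K" if "0 \<le> r" "r \<le> S" for r
    unfolding K_def by (rule cSUP_upper[OF _ bdd]) (use that in auto)
  have K0: "0 \<le> K" using E0[of 0] EK[of 0] S by simp
  \<comment> \<open>The mass of \<open>W K\<close> up to time \<open>r\<close> serves as the time
    function whose increments dominate the second order terms.\<close>
  define \<beta> where "\<beta> r = enn2real (\<integral>\<^sup>+z\<in>{0<..r} \<times> UNIV. W K z \<partial>lborel)" for r
  have [measurable]: "{r1<..r2} \<times> (UNIV :: real set) \<in> sets borel" for r1 r2 :: real
    by (intro borel_Times) auto
  have [measurable]: "{r1<..} \<times> (UNIV :: real set) \<in> sets borel" for r1 :: real
    by (intro borel_Times) auto
  have Wtop: "(\<integral>\<^sup>+z\<in>{r1<..r2} \<times> UNIV. W K z \<partial>lborel) \<le> ennreal (c0 + \<theta> * K)" if "0 \<le> r1" for r1 r2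
  proof -
    have "(\<integral>\<^sup>+z\<in>{r1<..r2} \<times> UNIV. W K z \<partial>lborel) \<le> (\<integral>\<^sup>+z\<in>{0<..} \<times> UNIV. W K z \<partial>lborel)"
      using that by (intro nn_integral_mono) (auto simp: indicator_def)
    then show ?thesis using tot[OF K0] by simp
  qed
  have fin: "(\<integral>\<^sup>+z\<in>{r1<..r2} \<times> UNIV. W K z \<partial>lborel) < \<top>" if "0 \<le> r1" for r1 r2
    using Wtop[OF that, of r2] ennreal_less_top le_less_trans by blast
  have \<beta>add: "(\<integral>\<^sup>+z\<in>{r<..r'} \<times> UNIV. W K z \<partial>lborel) = ennreal (\<beta> r' - \<beta> r)" and \<beta>mono: "\<beta> r \<le> \<beta> r'"
    if "0 \<le> r" "r \<le> r'" for r r'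
  proof -
    have "(\<integral>\<^sup>+z\<in>{0<..r'} \<times> UNIV. W K z \<partial>lborel)
      = (\<integral>\<^sup>+z. W K z * indicator ({0<..r} \<times> UNIV) z + W K z * indicator ({r<..r'} \<times> UNIV) z \<partial>lborel)"
      using that by (intro nn_integral_cong) (auto simp: indicator_def)
    also have "\<dots> = (\<integral>\<^sup>+z\<in>{0<..r} \<times> UNIV. W K z \<partial>lborel) + (\<integral>\<^sup>+z\<in>{r<..r'} \<times> UNIV. W K z \<partial>lborel)"
      by (rule nn_integral_add) auto
    finally have add: "\<beta> r' = \<beta> r + enn2real (\<integral>\<^sup>+z\<in>{r<..r'} \<times> UNIV. W K z \<partial>lborel)"
      unfolding \<beta>_def using fin[of 0] fin[OF that(1)] by (simp add: enn2real_plus)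
    then show "\<beta> r \<le> \<beta> r'" by simp
    show "(\<integral>\<^sup>+z\<in>{r<..r'} \<times> UNIV. W K z \<partial>lborel) = ennreal (\<beta> r' - \<beta> r)"
      using add fin[OF that(1)] by simp
  qed
  have "E r \<le> c0 + \<theta> * K" if r: "0 \<le> r" "r \<le> S" for r
  proof -
    have "E r \<le> E 0 + (\<beta> r - \<beta> 0)"
      unfolding E_def
    proof (rule growth[OF m \<psi> \<phi>' \<phi> taylor l L, where S=S])
      fix r r' :: real assume rr: "0 \<le> r" "r < r'" "r' \<le> S"
      have "Q \<psi> r r r' \<le> (\<integral>\<^sup>+z\<in>{r<..r'} \<times> UNIV. W K z \<partial>lborel)"
        unfolding Q_def
      proof (rule nn_integral_mono)
        fix z :: "real \<times> real"
        show "(\<integral>\<^sup>+\<omega>. ennreal (\<psi> (X r \<omega>) * (f (fst z) (snd z) \<omega>)\<^sup>2) \<partial>M) * indicator ({r<..r'} \<times> UNIV) z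
          \<le> W K z * indicator ({r<..r'} \<times> UNIV) z"
        proof (cases "r < fst z")
          case True
          then show ?thesis using rr EK[of r] K0 i\<phi>[of r]
            by (intro mult_right_mono H) (auto simp: E_def)
        next
          case False
          then show ?thesis by (auto simp: indicator_def)
        qed
      qed
      then show "Q \<psi> r r r' \<le> ennreal (\<beta> r' - \<beta> r)" using \<beta>add[of r r'] rr by simp
    qed (use r \<beta>mono in auto)
    \<comment> \<open>The two bounds on \<open>\<phi>\<close> force it to vanish at 0, and the
      integral vanishes almost surely at time 0.\<close>
    moreover have "E 0 = 0"
    proof -
      have "\<phi> 0 = 0" using \<phi>(1)[of 0] \<phi>(2)[of 0] by simp
      then have "E 0 = (\<integral>\<omega>. 0 \<partial>M)" unfolding E_def using X_0
        by (intro integral_cong_AE) (auto elim!: eventually_mono)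
      then show ?thesis by simp
    qed
    moreover have "\<beta> r - \<beta> 0 \<le> c0 + \<theta> * K"
    proof -
      have "0 \<le> c0 + \<theta> * K" using \<theta> K0 by simp
      then have "\<beta> r \<le> c0 + \<theta> * K"
        unfolding \<beta>_def using Wtop[of 0 r] enn2real_mono[of _ "ennreal (c0 + \<theta> * K)"] by simp
      moreover have "0 \<le> \<beta> 0" by (simp add: \<beta>_def)
      ultimately show ?thesis by simp
    qed
    ultimately show ?thesis by simp
  qed
  then have "K \<le> c0 + \<theta> * K" unfolding K_def by (intro cSUP_least) (use S in \<open>auto simp: K_def[symmetric]\<close>)
  then have "K * (1 - \<theta>) \<le> c0" by (simp add: algebra_simps)
  then have "K \<le> c0 / (1 - \<theta>)" using \<theta> by (simp add: pos_le_divide_eq)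
  then show ?thesis using EK[of S] S by (simp add: E_def)
qed

end

section \<open>Joint measurability and square norms of integrands\<close>

text \<open>Time 0 is left out: simple integrands live on intervals open on the left, and a single
  instant has Lebesgue measure 0.\<close>

definition halfspace :: "(real \<times> real) set" where "halfspace = {0<..} \<times> UNIV"

lemma halfspace_sets[measurable]: "halfspace \<in> sets borel"
  unfolding halfspace_def by (intro borel_Times) auto

text \<open>What Tonelli's theorem needs of an integrand. The indicator extends it by 0 to times at
  which predictability says nothing, and the pair of time and space is one point, so that Lebesgue
  measure on the plane can be used.\<close>

definition jointly_measurable :: "'w measure \<Rightarrow> (real \<Rightarrow> real \<Rightarrow> 'w \<Rightarrow> real) \<Rightarrow> bool" where
  "jointly_measurable M f \<longleftrightarrow>
     (\<lambda>(z, \<omega>). indicator halfspace z * f (fst z) (snd z) \<omega>) \<in> borel_measurable (borel \<Otimes>\<^sub>M M)"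

definition sqn :: "'w measure \<Rightarrow> (real \<Rightarrow> real \<Rightarrow> 'w \<Rightarrow> real) \<Rightarrow> ennreal" where
  "sqn M f = (\<integral>\<^sup>+z\<in>halfspace. (\<integral>\<^sup>+\<omega>. ennreal ((f (fst z) (snd z) \<omega>)\<^sup>2) \<partial>M) \<partial>lborel)"

lemma nn_integral_section_measurable:
  assumes "prob_space M" "(\<lambda>(z, \<omega>). h z \<omega>) \<in> borel_measurable (borel \<Otimes>\<^sub>M M)"
  shows "(\<lambda>z. \<integral>\<^sup>+\<omega>. h z \<omega> \<partial>M) \<in> borel_measurable borel"
proof -
  interpret prob_space M by fact
  show ?thesis
    using assms(2) by (intro borel_measurable_nn_integral) (auto simp: split_def)
qed

lemma jm_section:
  assumes "prob_space M" "jointly_measurable M f" "g \<in> borel_measurable borel"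
  shows "(\<lambda>z. (\<integral>\<^sup>+\<omega>. ennreal (g (f (fst z) (snd z) \<omega>)) \<partial>M) * indicator halfspace z) \<in> borel_measurable borel"
proof -
  have [measurable]: "g \<in> borel_measurable borel" by fact
  note [measurable] = assms(2)[unfolded jointly_measurable_def]
  have "(\<lambda>z. \<integral>\<^sup>+\<omega>. ennreal (g (indicator halfspace z * f (fst z) (snd z) \<omega>)) \<partial>M) \<in> borel_measurable borel"
    by (rule nn_integral_section_measurable[OF assms(1)]) measurable
  then have "(\<lambda>z. (\<integral>\<^sup>+\<omega>. ennreal (g (indicator halfspace z * f (fst z) (snd z) \<omega>)) \<partial>M) * indicator halfspace z) \<in> borel_measurable borel"
    by measurable
  moreover have "(\<integral>\<^sup>+\<omega>. ennreal (g (indicator halfspace z * f (fst z) (snd z) \<omega>)) \<partial>M) * indicator halfspace z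
    = (\<integral>\<^sup>+\<omega>. ennreal (g (f (fst z) (snd z) \<omega>)) \<partial>M) * indicator halfspace z" for z
    by (simp add: indicator_def)
  ultimately show ?thesis by simp
qed

lemma jm_diff:
  assumes "jointly_measurable M f" "jointly_measurable M g"
  shows "jointly_measurable M (\<lambda>s y \<omega>. f s y \<omega> - g s y \<omega>)"
proof -
  have "(\<lambda>(z, \<omega>). indicator halfspace z * (f (fst z) (snd z) \<omega> - g (fst z) (snd z) \<omega>))
    = (\<lambda>x. (case x of (z, \<omega>) \<Rightarrow> indicator halfspace z * f (fst z) (snd z) \<omega>)
        - (case x of (z, \<omega>) \<Rightarrow> indicator halfspace z * g (fst z) (snd z) \<omega>))"
    by (auto simp: right_diff_distrib)
  then show ?thesis using assms unfolding jointly_measurable_def by simp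
qed

text \<open>Tonelli's theorem turns the iterated integral into one over the plane, where reflections
  and translations act; the two time domains differ by the null set of time 0.\<close>

lemma sq_norm_eq_sqn:
  assumes M: "prob_space M" and f: "jointly_measurable M f"
  shows "sq_norm_integrand M f = sqn M f"
proof -
  define H where "H z = (\<integral>\<^sup>+\<omega>. ennreal ((f (fst z) (snd z) \<omega>)\<^sup>2) \<partial>M) * indicator halfspace z" for z
  have [measurable]: "H \<in> borel_measurable borel"
    unfolding H_def[abs_def] by (rule jm_section[OF M f]) measurable
  have "sqn M f = (\<integral>\<^sup>+z. H z \<partial>(lborel \<Otimes>\<^sub>M lborel))"
    by (simp add: sqn_def H_def lborel_prod)
  also have "\<dots> = (\<integral>\<^sup>+s. \<integral>\<^sup>+y. H (s, y) \<partial>lborel \<partial>lborel)"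
    by (rule lborel.nn_integral_fst[symmetric]) (simp add: lborel_prod)
  also have "\<dots> = sq_norm_integrand M f"
    unfolding sq_norm_integrand_def
  proof (rule nn_integral_cong_AE)
    have "AE s in lborel. s \<noteq> (0::real)" by (rule AE_lborel_singleton)
    then show "AE s in lborel. (\<integral>\<^sup>+y. H (s, y) \<partial>lborel) =
      (\<integral>\<^sup>+y. \<integral>\<^sup>+\<omega>. ennreal ((f s y \<omega>)\<^sup>2) \<partial>M \<partial>lborel) * indicator {0..} s"
      by eventually_elim (auto simp: H_def halfspace_def indicator_def)
  qed
  finally show ?thesis by simp
qed

lemma ennreal_sq_diff_le: "ennreal ((a + b + c)\<^sup>2) \<le> 3 * (ennreal (a\<^sup>2) + ennreal (b\<^sup>2) + ennreal (c\<^sup>2))"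
proof -
  have "0 \<le> (a - b)\<^sup>2 + (b - c)\<^sup>2 + (a - c)\<^sup>2" by simp
  then have "(a + b + c)\<^sup>2 \<le> 3 * (a\<^sup>2 + b\<^sup>2 + c\<^sup>2)" by (simp add: power2_eq_square algebra_simps)
  then have "ennreal ((a + b + c)\<^sup>2) \<le> ennreal (3 * (a\<^sup>2 + b\<^sup>2 + c\<^sup>2))" by (rule ennreal_leI)
  then show ?thesis by (simp add: ennreal_mult ennreal_plus)
qed

lemma nn_integral_sq3:
  assumes [measurable]: "f \<in> borel_measurable M" "g \<in> borel_measurable M" "h \<in> borel_measurable M"
  shows "(\<integral>\<^sup>+x. ennreal ((f x + g x + h x)\<^sup>2) \<partial>M)
    \<le> 3 * ((\<integral>\<^sup>+x. ennreal ((f x)\<^sup>2) \<partial>M) + (\<integral>\<^sup>+x. ennreal ((g x)\<^sup>2) \<partial>M) + (\<integral>\<^sup>+x. ennreal ((h x)\<^sup>2) \<partial>M))"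
proof -
  have "(\<integral>\<^sup>+x. ennreal ((f x + g x + h x)\<^sup>2) \<partial>M)
    \<le> (\<integral>\<^sup>+x. 3 * (ennreal ((f x)\<^sup>2) + ennreal ((g x)\<^sup>2) + ennreal ((h x)\<^sup>2)) \<partial>M)"
    by (intro nn_integral_mono ennreal_sq_diff_le)
  then show ?thesis by (simp add: nn_integral_cmult nn_integral_add)
qed

context white_noise_space
begin

lemma jm_measurable_section:
  assumes f: "jointly_measurable M f" and s: "0 < s"
  shows "f s y \<in> borel_measurable M"
proof -
  note [measurable] = f[unfolded jointly_measurable_def]
  have "(\<lambda>\<omega>. (case ((s, y), \<omega>) of (z, \<omega>) \<Rightarrow> indicator halfspace z * f (fst z) (snd z) \<omega>)) \<in> borel_measurable M"
    by measurable
  then show ?thesis using s by (simp add: halfspace_def)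
qed

text \<open>It suffices to pull back generating rectangles along the regrouping map from ((s, y),
  \<omega>) to (s, y, \<omega>). That map is restricted to positive times because the predictable
  sigma-algebra lives on nonnegative ones.\<close>

lemma predictable_jm:
  assumes "predictable M F f" shows "jointly_measurable M f"
proof -
  define P where "P = predictable_sigma M F"
  define \<G> where "\<G> = {{a<..b} \<times> A \<times> G | a b A G. 0 \<le> (a::real) \<and> a < b \<and> A \<in> sets (borel :: real measure) \<and> G \<in> sets (F a)} \<union>
        {{0} \<times> A \<times> G | A G. A \<in> sets (borel :: real measure) \<and> G \<in> sets (F 0)}"
  have Fsp: "G \<subseteq> space M" if "G \<in> sets (F a)" for G a
    using F_sub sets.sets_into_space that by blast
  have sub: "\<G> \<subseteq> Pow ({0..} \<times> UNIV \<times> space M)"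
    unfolding \<G>_def using Fsp by fastforce
  have spP: "space P = {0..} \<times> UNIV \<times> space M"
    unfolding P_def predictable_sigma_def \<G>_def[symmetric] by (rule space_measure_of[OF sub])
  define T where "T = restrict_space (borel \<Otimes>\<^sub>M M) (halfspace \<times> space M)"
  have spT: "space T = halfspace \<times> space M"
    by (auto simp: T_def space_restrict_space space_pair_measure)
  have "(\<lambda>(z, \<omega>). (fst z, snd z, \<omega>)) \<in> measurable T P"
    unfolding P_def predictable_sigma_def \<G>_def[symmetric]
  proof (rule measurable_measure_of[OF sub])
    show "(\<lambda>(z, \<omega>). (fst z, snd z, \<omega>)) \<in> space T \<rightarrow> {0..} \<times> UNIV \<times> space M"
      by (auto simp: spT halfspace_def)
    fix C assume "C \<in> \<G>"
    then consider (1) a b A G where "C = {a<..b} \<times> A \<times> G" "A \<in> sets borel" "G \<in> sets (F a)"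
      | (2) A G where "C = {0} \<times> A \<times> G" "A \<in> sets borel" "G \<in> sets (F 0)"
      unfolding \<G>_def by auto
    then obtain I A G where C: "C = I \<times> A \<times> G" "I \<in> sets borel" "A \<in> sets borel" "G \<in> sets M"
    proof cases
      case (1 a b A G)
      then show thesis using that[of "{a<..b}" A G] F_sub[of a] by auto
    next
      case (2 A G)
      then show thesis using that[of "{0}" A G] F_sub[of 0] by auto
    qed
    have "(\<lambda>(z, \<omega>). (fst z, snd z, \<omega>)) -` C \<inter> space T = ((I \<times> A) \<times> G) \<inter> (halfspace \<times> space M)"
      using C sets.sets_into_space[OF C(4)] by (auto simp: spT)
    moreover have "(I \<times> A) \<times> G \<in> sets (borel \<Otimes>\<^sub>M M)"
      by (rule pair_measureI[OF borel_Times[OF C(2,3)] C(4)])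
    ultimately show "(\<lambda>(z, \<omega>). (fst z, snd z, \<omega>)) -` C \<inter> space T \<in> sets T"
      unfolding T_def sets_restrict_space by blast
  qed
  moreover have "(\<lambda>(s, y, \<omega>). f s y \<omega>) \<in> borel_measurable P"
    using assms by (simp add: predictable_def P_def)
  ultimately have "(\<lambda>x. (\<lambda>(s, y, \<omega>). f s y \<omega>) ((\<lambda>(z, \<omega>). (fst z, snd z, \<omega>)) x)) \<in> borel_measurable T"
    by (rule measurable_compose)
  then have "(\<lambda>(z, \<omega>). f (fst z) (snd z) \<omega>) \<in> borel_measurable T" by (simp add: split_def)
  moreover have "(halfspace \<times> space M) \<inter> space (borel \<Otimes>\<^sub>M M) \<in> sets (borel \<Otimes>\<^sub>M M)"
    by (intro sets.Int pair_measureI) auto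
  ultimately have "(\<lambda>x. indicator (halfspace \<times> space M) x *\<^sub>R (case x of (z, \<omega>) \<Rightarrow> f (fst z) (snd z) \<omega>)) \<in> borel_measurable (borel \<Otimes>\<^sub>M M)"
    unfolding T_def by (subst (asm) borel_measurable_restrict_space_iff) auto
  then show ?thesis unfolding jointly_measurable_def
    by (rule measurable_cong[THEN iffD1, rotated]) (auto simp: space_pair_measure indicator_def)
qed

lemma simple_walsh_jm:
  assumes "has_simple_walsh_integral M F w f Z"
  shows "jointly_measurable M f" "Z \<in> borel_measurable M"
proof -
  from assms obtain n a b A Y where s: "\<forall>i<(n::nat). 0 \<le> a i \<and> a i < b i \<and> A i \<in> sets borel \<and> emeasure lborel (A i) < \<infinity> \<and>
               Y i \<in> borel_measurable (F (a i)) \<and> bounded (Y i ` space M)"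
    and f: "f = (\<lambda>s y \<omega>. \<Sum>i<n. Y i \<omega> * indicator {a i<..b i} s * indicator (A i) y)"
    and Z: "Z = (\<lambda>\<omega>. \<Sum>i<n. Y i \<omega> * w ({a i<..b i} \<times> A i) \<omega>)"
    unfolding has_simple_walsh_integral_def by blast
  have Ym: "Y i \<in> borel_measurable M" "A i \<in> sets borel" if "i < n" for i
    using s that F_measurable_M by auto
  have "(\<lambda>x. (case x of (z, \<omega>) \<Rightarrow> indicator halfspace z * f (fst z) (snd z) \<omega>)) =
    (\<lambda>x. indicator halfspace (fst x) * (\<Sum>i<n. Y i (snd x) * indicator {a i<..b i} (fst (fst x)) * indicator (A i) (snd (fst x))))"
    by (auto simp: f)
  moreover have fs: "fst \<in> borel_measurable (borel :: (real \<times> real) measure)"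
    "snd \<in> borel_measurable (borel :: (real \<times> real) measure)"
    by (auto intro!: borel_measurable_continuous_onI continuous_intros)
  then have ff: "(\<lambda>x. fst (fst x)) \<in> borel_measurable ((borel :: (real \<times> real) measure) \<Otimes>\<^sub>M M)"
    "(\<lambda>x. snd (fst x)) \<in> borel_measurable ((borel :: (real \<times> real) measure) \<Otimes>\<^sub>M M)"
    using measurable_compose[OF measurable_fst] by auto
  moreover have "(\<lambda>x. indicator halfspace (fst x) * (\<Sum>i<n. Y i (snd x) * indicator {a i<..b i} (fst (fst x)) * indicator (A i) (snd (fst x))))
    \<in> borel_measurable (borel \<Otimes>\<^sub>M M)"
  proof (intro borel_measurable_times borel_measurable_sum)
    fix i assume "i \<in> {..<n}"
    then have [measurable]: "Y i \<in> borel_measurable M" "A i \<in> sets borel" using Ym by auto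
    show "(\<lambda>x. Y i (snd x)) \<in> borel_measurable (borel \<Otimes>\<^sub>M M)" by measurable
    show "(\<lambda>x. indicator {a i<..b i} (fst (fst x))) \<in> borel_measurable ((borel :: (real \<times> real) measure) \<Otimes>\<^sub>M M)"
      by (rule measurable_compose[OF ff(1)]) measurable
    show "(\<lambda>x. indicator (A i) (snd (fst x))) \<in> borel_measurable ((borel :: (real \<times> real) measure) \<Otimes>\<^sub>M M)"
      by (rule measurable_compose[OF ff(2)]) measurable
  qed measurable
  ultimately show "jointly_measurable M f" unfolding jointly_measurable_def by simp
  have "w ({a i<..b i} \<times> A i) \<in> borel_measurable M" if "i < n" for i
    using s that by (intro measurable_w noise_sets_Times) auto
  then show "Z \<in> borel_measurable M" unfolding Z using Ym by (intro borel_measurable_sum borel_measurable_times) auto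
qed

lemma simple_walsh_diff:
  assumes "has_simple_walsh_integral M F w f Z" "has_simple_walsh_integral M F w f' Z'"
  shows "has_simple_walsh_integral M F w (\<lambda>s y \<omega>. f s y \<omega> - f' s y \<omega>) (\<lambda>\<omega>. Z \<omega> - Z' \<omega>)"
proof -
  from assms(1) obtain n a b A Y where s: "\<forall>i<(n::nat). 0 \<le> a i \<and> a i < b i \<and> A i \<in> sets borel \<and> emeasure lborel (A i) < \<infinity> \<and>
               Y i \<in> borel_measurable (F (a i)) \<and> bounded (Y i ` space M)"
    and f: "f = (\<lambda>s y \<omega>. \<Sum>i<n. Y i \<omega> * indicator {a i<..b i} s * indicator (A i) y)"
    and Z: "Z = (\<lambda>\<omega>. \<Sum>i<n. Y i \<omega> * w ({a i<..b i} \<times> A i) \<omega>)"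
    unfolding has_simple_walsh_integral_def by blast
  from assms(2) obtain n' a' b' A' Y' where s': "\<forall>i<(n'::nat). 0 \<le> a' i \<and> a' i < b' i \<and> A' i \<in> sets borel \<and> emeasure lborel (A' i) < \<infinity> \<and>
               Y' i \<in> borel_measurable (F (a' i)) \<and> bounded (Y' i ` space M)"
    and f': "f' = (\<lambda>s y \<omega>. \<Sum>i<n'. Y' i \<omega> * indicator {a' i<..b' i} s * indicator (A' i) y)"
    and Z': "Z' = (\<lambda>\<omega>. \<Sum>i<n'. Y' i \<omega> * w ({a' i<..b' i} \<times> A' i) \<omega>)"
    unfolding has_simple_walsh_integral_def by blast
  \<comment> \<open>The two families of blocks are concatenated, the second one shifted by
    \<open>n\<close> and with its coefficients negated.\<close>
  define a2 b2 A2 Y2 where "a2 i = (if i < n then a i else a' (i - n))"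
    and "b2 i = (if i < n then b i else b' (i - n))"
    and "A2 i = (if i < n then A i else A' (i - n))"
    and "Y2 i = (if i < n then Y i else (\<lambda>\<omega>. - Y' (i - n) \<omega>))" for i
  note d = a2_def b2_def A2_def Y2_def
  have split: "(\<Sum>i<n + n'. h i) = (\<Sum>i<n. h i) + (\<Sum>i<n'. h (n + i))" for h :: "nat \<Rightarrow> real"
    by (induction n') (auto simp: add.assoc)
  have "\<forall>i<n + n'. 0 \<le> a2 i \<and> a2 i < b2 i \<and> A2 i \<in> sets borel \<and> emeasure lborel (A2 i) < \<infinity> \<and>
               Y2 i \<in> borel_measurable (F (a2 i)) \<and> bounded (Y2 i ` space M)"
  proof (intro allI impI)
    fix i assume i: "i < n + n'"
    show "0 \<le> a2 i \<and> a2 i < b2 i \<and> A2 i \<in> sets borel \<and> emeasure lborel (A2 i) < \<infinity> \<and>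
               Y2 i \<in> borel_measurable (F (a2 i)) \<and> bounded (Y2 i ` space M)"
    proof (cases "i < n")
      case True
      then show ?thesis using s by (simp add: d)
    next
      case False
      then have "i - n < n'" using i by simp
      note s'' = s'[rule_format, OF this]
      moreover have "bounded ((\<lambda>\<omega>. - Y' (i - n) \<omega>) ` space M)"
        using s'' bounded_uminus[of "Y' (i - n) ` space M"] by (simp add: image_image)
      ultimately show ?thesis using False by (simp add: d)
    qed
  qed
  moreover have "(\<lambda>s y \<omega>. f s y \<omega> - f' s y \<omega>) = (\<lambda>s y \<omega>. \<Sum>i<n + n'. Y2 i \<omega> * indicator {a2 i<..b2 i} s * indicator (A2 i) y)"
    unfolding split f f' by (simp add: d sum_negf)
  moreover have "(\<lambda>\<omega>. Z \<omega> - Z' \<omega>) = (\<lambda>\<omega>. \<Sum>i<n + n'. Y2 i \<omega> * w ({a2 i<..b2 i} \<times> A2 i) \<omega>)"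
    unfolding split Z Z' by (simp add: d sum_negf)
  ultimately show ?thesis unfolding has_simple_walsh_integral_def by blast
qed

text \<open>At a time after the end of every block the stopped integral is the full one, so the
  bound at a fixed time applies to the simple Walsh integral itself.\<close>

lemma simple_walsh_bound:
  fixes \<phi> \<phi>' \<psi> :: "real \<Rightarrow> real" and W :: "real \<Rightarrow> real \<times> real \<Rightarrow> ennreal"
  assumes g: "has_simple_walsh_integral M F w g Z"
    and m[measurable]: "\<phi> \<in> borel_measurable borel" "\<phi>' \<in> borel_measurable borel" "\<psi> \<in> borel_measurable borel"
    and \<psi>: "\<And>x. 0 \<le> \<psi> x" "\<And>x. \<psi> x \<le> C\<psi>" and \<phi>': "\<And>x. \<bar>\<phi>' x\<bar> \<le> C' * \<bar>x\<bar>"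
    and \<phi>: "\<And>x. 0 \<le> \<phi> x" "\<And>x. \<phi> x \<le> C\<phi> * x\<^sup>2"
    and taylor: "\<And>x d. \<phi> (x + d) \<le> \<phi> x + \<phi>' x * d + \<psi> x * d\<^sup>2 + L * d ^ (2 * l)"
    and l: "2 \<le> l" and L: "0 \<le> L"
    and W[measurable]: "\<And>K. W K \<in> borel_measurable borel"
    and H: "\<And>V K z. V \<in> borel_measurable M \<Longrightarrow> 0 \<le> K \<Longrightarrow> integrable M (\<lambda>\<omega>. \<phi> (V \<omega>)) \<Longrightarrow> (\<integral>\<omega>. \<phi> (V \<omega>) \<partial>M) \<le> K \<Longrightarrow>
        0 < fst z \<Longrightarrow> (\<integral>\<^sup>+\<omega>. ennreal (\<psi> (V \<omega>) * (g (fst z) (snd z) \<omega>)\<^sup>2) \<partial>M) \<le> W K z"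
    and tot: "\<And>K. 0 \<le> K \<Longrightarrow> (\<integral>\<^sup>+z\<in>halfspace. W K z \<partial>lborel) \<le> ennreal (c0 + \<theta> * K)"
    and \<theta>: "0 \<le> c0" "0 \<le> \<theta>" "\<theta> < 1"
  shows "(\<integral>\<^sup>+\<omega>. ennreal (\<phi> (Z \<omega>)) \<partial>M) \<le> ennreal (c0 / (1 - \<theta>))"
proof -
  from g obtain n a b A Y where s: "\<forall>i<(n::nat). 0 \<le> a i \<and> a i < b i \<and> A i \<in> sets borel \<and> emeasure lborel (A i) < \<infinity> \<and>
               Y i \<in> borel_measurable (F (a i)) \<and> bounded (Y i ` space M)"
    and f: "g = (\<lambda>s y \<omega>. \<Sum>i<n. Y i \<omega> * indicator {a i<..b i} s * indicator (A i) y)"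
    and Z: "Z = (\<lambda>\<omega>. \<Sum>i<n. Y i \<omega> * w ({a i<..b i} \<times> A i) \<omega>)"
    unfolding has_simple_walsh_integral_def by blast
  interpret S: simple_integrand M w n a b A Y
    by unfold_locales (use s in auto)
  have gf: "g = S.f" unfolding f S.f_def[abs_def] ..
  define S where "S = Max (insert 0 (b ` {..<n}))"
  have S: "0 \<le> S" "\<And>i. i < n \<Longrightarrow> b i \<le> S" unfolding S_def by auto
  have ZX: "Z = S.X S" unfolding Z using S.X_end[OF S(2)] by auto
  have "(\<integral>\<omega>. \<phi> (S.X S \<omega>) \<partial>M) \<le> c0 / (1 - \<theta>)"
    by (rule S.X_end_bound[OF m \<psi> \<phi>' \<phi> taylor l L W H[unfolded gf] tot[unfolded halfspace_def] \<theta> S(1)])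
  moreover have "integrable M (\<lambda>\<omega>. \<phi> (S.X S \<omega>))"
  proof (rule Bochner_Integration.integrable_bound)
    show "integrable M (\<lambda>\<omega>. C\<phi> * (S.X S \<omega>)\<^sup>2)" using S.X_power_integrable[of S 1] by simp
    show "AE \<omega> in M. norm (\<phi> (S.X S \<omega>)) \<le> norm (C\<phi> * (S.X S \<omega>)\<^sup>2)"
      using \<phi> by (intro AE_I2) (smt (verit) real_norm_def)
  qed simp
  ultimately show ?thesis unfolding ZX
    by (subst nn_integral_eq_integral) (use \<phi> in \<open>auto intro: ennreal_leI\<close>)
qed

text \<open>For the square the second order expansion is exact with \<open>\<psi>\<close> = 1 and
  without remainder. The density \<open>W\<close> then does not depend on K, so \<theta> = 0 and
  nothing has to be absorbed.\<close>

lemma simple_walsh_L2: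
  assumes g: "has_simple_walsh_integral M F w g Z"
  shows "(\<integral>\<^sup>+\<omega>. ennreal ((Z \<omega>)\<^sup>2) \<partial>M) \<le> sqn M g"
proof (cases "sqn M g = \<top>")
  case False
  define c0 where "c0 = enn2real (sqn M g)"
  have c0: "sqn M g = ennreal c0" "0 \<le> c0" using False by (simp_all add: c0_def less_top)
  define W where "W z = (\<integral>\<^sup>+\<omega>. ennreal ((g (fst z) (snd z) \<omega>)\<^sup>2) \<partial>M) * indicator halfspace z" for z
  have W: "W \<in> borel_measurable borel" unfolding W_def
    by (rule jm_section[OF prob_space_axioms simple_walsh_jm(1)[OF g]]) measurable
  have "(\<integral>\<^sup>+\<omega>. ennreal ((Z \<omega>)\<^sup>2) \<partial>M) \<le> ennreal (c0 / (1 - 0))"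
  proof (rule simple_walsh_bound[OF g, where \<phi>="\<lambda>x. x\<^sup>2" and \<phi>'="\<lambda>x. 2 * x" and \<psi>="\<lambda>_. 1" and
        C\<psi>=1 and C'=2 and C\<phi>=1 and L=0 and l=2 and W="\<lambda>_. W"])
    fix K :: real
    have "(\<integral>\<^sup>+z\<in>halfspace. W z \<partial>lborel) = sqn M g"
      unfolding sqn_def W_def by (intro nn_integral_cong) (auto simp: indicator_def)
    then show "(\<integral>\<^sup>+z\<in>halfspace. W z \<partial>lborel) \<le> ennreal (c0 + 0 * K)" using c0 by simp
  next
    fix z :: "real \<times> real" assume "0 < fst z"
    then have "z \<in> halfspace" by (cases z) (auto simp: halfspace_def)
    then show "(\<integral>\<^sup>+\<omega>. ennreal (1 * (g (fst z) (snd z) \<omega>)\<^sup>2) \<partial>M) \<le> W z" by (simp add: W_def)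
  qed (use W c0 in \<open>auto simp: power2_eq_square algebra_simps abs_mult\<close>)
  then show ?thesis using c0 by simp
qed simp

lemma sqn_triangle3:
  assumes "jointly_measurable M f" "jointly_measurable M g" "jointly_measurable M h"
  shows "sqn M (\<lambda>s y \<omega>. f s y \<omega> + g s y \<omega> + h s y \<omega>) \<le> 3 * (sqn M f + sqn M g + sqn M h)"
proof -
  define H where "H f z = (\<integral>\<^sup>+\<omega>. ennreal ((f (fst z) (snd z) \<omega>)\<^sup>2) \<partial>M) * indicator halfspace z"
    for z and f :: "real \<Rightarrow> real \<Rightarrow> 'w \<Rightarrow> real"
  have m: "H f \<in> borel_measurable borel" if "jointly_measurable M f" for f
    unfolding H_def[abs_def] by (rule jm_section[OF prob_space_axioms that]) measurable
  note [measurable] = m[OF assms(1)] m[OF assms(2)] m[OF assms(3)]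
  have "sqn M (\<lambda>s y \<omega>. f s y \<omega> + g s y \<omega> + h s y \<omega>) \<le> (\<integral>\<^sup>+z. 3 * (H f z + H g z + H h z) \<partial>lborel)"
    unfolding sqn_def
  proof (rule nn_integral_mono)
    fix z :: "real \<times> real"
    show "(\<integral>\<^sup>+\<omega>. ennreal ((f (fst z) (snd z) \<omega> + g (fst z) (snd z) \<omega> + h (fst z) (snd z) \<omega>)\<^sup>2) \<partial>M) * indicator halfspace z
      \<le> 3 * (H f z + H g z + H h z)"
    proof (cases "z \<in> halfspace")
      case True
      then have "0 < fst z" by (auto simp: halfspace_def)
      then have "f (fst z) (snd z) \<in> borel_measurable M" "g (fst z) (snd z) \<in> borel_measurable M"
        "h (fst z) (snd z) \<in> borel_measurable M"
        using assms by (auto intro: jm_measurable_section)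
      from nn_integral_sq3[OF this] show ?thesis using True by (simp add: H_def)
    qed simp
  qed
  also have "\<dots> = 3 * (sqn M f + sqn M g + sqn M h)"
    by (simp add: nn_integral_cmult nn_integral_add) (simp add: H_def sqn_def)
  finally show ?thesis .
qed

lemma sqn_minus_commute: "sqn M (\<lambda>s y \<omega>. f s y \<omega> - g s y \<omega>) = sqn M (\<lambda>s y \<omega>. g s y \<omega> - f s y \<omega>)"
  unfolding sqn_def by (simp add: power2_commute)

lemma walsh_approx:
  assumes "has_walsh_integral M F w f Z"
  obtains g Y where "\<forall>n::nat. has_simple_walsh_integral M F w (g n) (Y n)"
    "(\<lambda>n. sqn M (\<lambda>s y \<omega>. g n s y \<omega> - f s y \<omega>)) \<longlonglongrightarrow> 0" "(\<lambda>n. \<integral>\<^sup>+\<omega>. ennreal ((Y n \<omega> - Z \<omega>)\<^sup>2) \<partial>M) \<longlonglongrightarrow> 0"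
    "jointly_measurable M f" "Z \<in> borel_measurable M" "sqn M f < \<infinity>"
proof -
  from assms have f: "predictable M F f" "sq_norm_integrand M f < \<infinity>" "Z \<in> borel_measurable M"
    and "\<exists>g Y. (\<forall>n::nat. has_simple_walsh_integral M F w (g n) (Y n)) \<and>
        (\<lambda>n. sq_norm_integrand M (\<lambda>s y \<omega>. g n s y \<omega> - f s y \<omega>)) \<longlonglongrightarrow> 0 \<and>
        (\<lambda>n. \<integral>\<^sup>+\<omega>. ennreal ((Y n \<omega> - Z \<omega>)\<^sup>2) \<partial>M) \<longlonglongrightarrow> 0"
    unfolding has_walsh_integral_def by auto
  then obtain g Y where g: "\<And>n::nat. has_simple_walsh_integral M F w (g n) (Y n)"
    "(\<lambda>n. sq_norm_integrand M (\<lambda>s y \<omega>. g n s y \<omega> - f s y \<omega>)) \<longlonglongrightarrow> 0"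
    "(\<lambda>n. \<integral>\<^sup>+\<omega>. ennreal ((Y n \<omega> - Z \<omega>)\<^sup>2) \<partial>M) \<longlonglongrightarrow> 0" by blast
  have jf: "jointly_measurable M f" using predictable_jm[OF f(1)] .
  have "sq_norm_integrand M (\<lambda>s y \<omega>. g n s y \<omega> - f s y \<omega>) = sqn M (\<lambda>s y \<omega>. g n s y \<omega> - f s y \<omega>)" for n
    by (intro sq_norm_eq_sqn prob_space_axioms jm_diff jf simple_walsh_jm(1)[OF g(1)])
  then show thesis using that[of g Y] g f jf sq_norm_eq_sqn[OF prob_space_axioms jf] by simp
qed

text \<open>The constant is not optimal (the isometry has 1), but no sharper bound is needed.\<close>

lemma walsh_diff_L2:
  assumes f: "has_walsh_integral M F w f Z" and f': "has_walsh_integral M F w f' Z'"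
  shows "(\<integral>\<^sup>+\<omega>. ennreal ((Z \<omega> - Z' \<omega>)\<^sup>2) \<partial>M) \<le> 9 * sqn M (\<lambda>s y \<omega>. f s y \<omega> - f' s y \<omega>)"
proof -
  obtain g Y where h: "\<forall>n::nat. has_simple_walsh_integral M F w (g n) (Y n)"
    "(\<lambda>n. sqn M (\<lambda>s y \<omega>. g n s y \<omega> - f s y \<omega>)) \<longlonglongrightarrow> 0" "(\<lambda>n. \<integral>\<^sup>+\<omega>. ennreal ((Y n \<omega> - Z \<omega>)\<^sup>2) \<partial>M) \<longlonglongrightarrow> 0"
    "jointly_measurable M f" "Z \<in> borel_measurable M" "sqn M f < \<infinity>"
    by (rule walsh_approx[OF f])
  note g = h(1)[rule_format] h(2-)
  obtain g' Y' where h': "\<forall>n::nat. has_simple_walsh_integral M F w (g' n) (Y' n)"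
    "(\<lambda>n. sqn M (\<lambda>s y \<omega>. g' n s y \<omega> - f' s y \<omega>)) \<longlonglongrightarrow> 0" "(\<lambda>n. \<integral>\<^sup>+\<omega>. ennreal ((Y' n \<omega> - Z' \<omega>)\<^sup>2) \<partial>M) \<longlonglongrightarrow> 0"
    "jointly_measurable M f'" "Z' \<in> borel_measurable M" "sqn M f' < \<infinity>"
    by (rule walsh_approx[OF f'])
  note g' = h'(1)[rule_format] h'(2-)
  note [measurable] = g(5) g'(5) simple_walsh_jm(2)[OF g(1)] simple_walsh_jm(2)[OF g'(1)]
  define D where "D = sqn M (\<lambda>s y \<omega>. f s y \<omega> - f' s y \<omega>)"
  define e where "e n = sqn M (\<lambda>s y \<omega>. g n s y \<omega> - f s y \<omega>)" for n
  define e' where "e' n = sqn M (\<lambda>s y \<omega>. g' n s y \<omega> - f' s y \<omega>)" for n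
  define i where "i n = (\<integral>\<^sup>+\<omega>. ennreal ((Y n \<omega> - Z \<omega>)\<^sup>2) \<partial>M)" for n
  define i' where "i' n = (\<integral>\<^sup>+\<omega>. ennreal ((Y' n \<omega> - Z' \<omega>)\<^sup>2) \<partial>M)" for n
  have bd: "(\<integral>\<^sup>+\<omega>. ennreal ((Z \<omega> - Z' \<omega>)\<^sup>2) \<partial>M) \<le> 3 * (i n + 3 * (e n + D + e' n) + i' n)" for n
  proof -
    have "(\<integral>\<^sup>+\<omega>. ennreal ((Z \<omega> - Z' \<omega>)\<^sup>2) \<partial>M)
      = (\<integral>\<^sup>+\<omega>. ennreal (((Z \<omega> - Y n \<omega>) + (Y n \<omega> - Y' n \<omega>) + (Y' n \<omega> - Z' \<omega>))\<^sup>2) \<partial>M)" by simp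
    also have "\<dots> \<le> 3 * ((\<integral>\<^sup>+\<omega>. ennreal ((Z \<omega> - Y n \<omega>)\<^sup>2) \<partial>M)
      + (\<integral>\<^sup>+\<omega>. ennreal ((Y n \<omega> - Y' n \<omega>)\<^sup>2) \<partial>M) + (\<integral>\<^sup>+\<omega>. ennreal ((Y' n \<omega> - Z' \<omega>)\<^sup>2) \<partial>M))"
      by (rule nn_integral_sq3) measurable
    also have "(\<integral>\<^sup>+\<omega>. ennreal ((Z \<omega> - Y n \<omega>)\<^sup>2) \<partial>M) = i n" by (simp add: i_def power2_commute)
    also have "(\<integral>\<^sup>+\<omega>. ennreal ((Y' n \<omega> - Z' \<omega>)\<^sup>2) \<partial>M) = i' n" by (simp add: i'_def)
    also have "(\<integral>\<^sup>+\<omega>. ennreal ((Y n \<omega> - Y' n \<omega>)\<^sup>2) \<partial>M) \<le> sqn M (\<lambda>s y \<omega>. g n s y \<omega> - g' n s y \<omega>)"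
      by (rule simple_walsh_L2[OF simple_walsh_diff[OF g(1) g'(1)]])
    also have "\<dots> = sqn M (\<lambda>s y \<omega>. (g n s y \<omega> - f s y \<omega>) + (f s y \<omega> - f' s y \<omega>) + (f' s y \<omega> - g' n s y \<omega>))"
      by simp
    also have "\<dots> \<le> 3 * (e n + D + sqn M (\<lambda>s y \<omega>. f' s y \<omega> - g' n s y \<omega>))"
      unfolding e_def D_def
      by (intro sqn_triangle3 jm_diff g(4) g'(4) simple_walsh_jm(1)[OF g(1)] simple_walsh_jm(1)[OF g'(1)])
    also have "sqn M (\<lambda>s y \<omega>. f' s y \<omega> - g' n s y \<omega>) = e' n" unfolding e'_def by (rule sqn_minus_commute)
    finally show ?thesis by (simp add: add_mono mult_left_mono add_right_mono add_left_mono)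
  qed
  have "(\<lambda>n. 3 * (i n + 3 * (e n + D + e' n) + i' n)) \<longlonglongrightarrow> 3 * (0 + 3 * (0 + D + 0) + 0)"
    using g g' unfolding i_def i'_def e_def e'_def
    by (intro tendsto_intros ennreal_tendsto_cmult) auto
  then have "(\<integral>\<^sup>+\<omega>. ennreal ((Z \<omega> - Z' \<omega>)\<^sup>2) \<partial>M) \<le> 3 * (0 + 3 * (0 + D + 0) + 0)"
    by (rule LIMSEQ_le_const) (use bd in auto)
  also have "\<dots> = 9 * D" by (simp add: mult.assoc[symmetric])
  finally show ?thesis unfolding D_def .
qed


section \<open>Truncated moments of Walsh integrals\<close>

text \<open>For integrands that are a deterministic kernel \<open>h\<close> times a random field
  \<open>g\<close>, truncated moments of the integral are controlled by those of \<open>g\<close>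
  weighted with h^2. The constant depends only on k and on the bound \<open>\<kappa>\<close> for the
  mass of h^2; in particular it is the same for all R, which later allows R to tend to
  infinity.\<close>

lemma walsh_moment:
  fixes k :: nat and \<kappa> :: real
  assumes k: "1 \<le> k" and \<kappa>: "0 \<le> \<kappa>"
  shows "\<exists>C\<ge>0. \<forall>R>0. \<forall>h g Z \<gamma> \<Gamma>.
    has_walsh_integral M F w (\<lambda>s y \<omega>. h (s, y) * g s y \<omega>) Z \<longrightarrow> h \<in> borel_measurable borel \<longrightarrow>
    (\<forall>s>0. \<forall>y. g s y \<in> borel_measurable M) \<longrightarrow> \<gamma> \<in> borel_measurable borel \<longrightarrow>
    (\<integral>\<^sup>+z\<in>halfspace. ennreal ((h z)\<^sup>2) \<partial>lborel) \<le> ennreal \<kappa> \<longrightarrow>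
    (\<forall>s>0. \<forall>y. (\<integral>\<^sup>+\<omega>. ennreal (tpow k R (g s y \<omega>)) \<partial>M) \<le> \<gamma> (s, y)) \<longrightarrow>
    (\<integral>\<^sup>+z\<in>halfspace. ennreal ((h z)\<^sup>2) * \<gamma> z \<partial>lborel) \<le> ennreal \<Gamma> \<longrightarrow> 0 \<le> \<Gamma> \<longrightarrow>
    (\<integral>\<^sup>+\<omega>. ennreal (tpow k R (Z \<omega>)) \<partial>M) \<le> ennreal (C * \<Gamma>)"
proof -
  define K1 where "K1 = (8 * real k + 1) * (9 / 4) ^ k"
  have K1: "1 \<le> K1"
  proof -
    have "1 * 1 \<le> (8 * real k + 1) * (9 / 4) ^ k" by (intro mult_mono one_le_power) auto
    then show ?thesis by (simp add: K1_def)
  qed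
  \<comment> \<open>Chosen so that the self-referring coefficient 2 K1 \<epsilon> (k+1) \<kappa> is
    at most 1/2; using \<kappa> + 1 also covers \<kappa> = 0.\<close>
  define \<epsilon> where "\<epsilon> = 1 / (4 * K1 * real (Suc k) * (\<kappa> + 1))"
  have den: "1 \<le> 4 * K1 * real (Suc k) * (\<kappa> + 1)"
  proof -
    have "1 * 1 * 1 \<le> (4 * K1) * real (Suc k) * (\<kappa> + 1)" using K1 \<kappa> by (intro mult_mono) auto
    then show ?thesis by simp
  qed
  have \<epsilon>: "0 < \<epsilon>" "\<epsilon> \<le> 1" unfolding \<epsilon>_def using den by (auto simp only: zero_less_divide_1_iff divide_le_eq_1)
  have \<theta>: "2 * K1 * (\<epsilon> * real (Suc k) * \<kappa>) \<le> 1/2"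
  proof -
    have "2 * K1 * (\<epsilon> * real (Suc k) * \<kappa>) = (1/2) * (\<kappa> / (\<kappa> + 1))"
      using K1 \<kappa> by (simp add: \<epsilon>_def divide_simps del: of_nat_Suc)
    also have "\<dots> \<le> 1/2" using \<kappa> by simp
    finally show ?thesis .
  qed
  \<comment> \<open>The factor 4^(k+1) splits \<open>tpow\<close> of a sum, k + 1 compares
    \<open>tpow\<close> with \<open>cpow\<close>, 4 K1 is 2 K1 / (1 - 1/2) after absorption, and the
    negative power of \<epsilon> comes from Young's inequality.\<close>
  define C where "C = 4 ^ Suc k * (real (Suc k) * (4 * K1 * (1 / \<epsilon>) ^ k))"
  have C: "0 \<le> C" using K1 \<epsilon> by (simp add: C_def)
  show ?thesis
  proof (intro exI[of _ C] conjI C allI impI)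
    fix R :: real and h :: "real \<times> real \<Rightarrow> real" and g :: "real \<Rightarrow> real \<Rightarrow> 'w \<Rightarrow> real" and Z :: "'w \<Rightarrow> real"
      and \<gamma> :: "real \<times> real \<Rightarrow> ennreal" and \<Gamma> :: real
    assume R: "0 < R" and f: "has_walsh_integral M F w (\<lambda>s y \<omega>. h (s, y) * g s y \<omega>) Z"
      and h[measurable]: "h \<in> borel_measurable borel"
      and g: "\<forall>s>0. \<forall>y. g s y \<in> borel_measurable M" and \<gamma>[measurable]: "\<gamma> \<in> borel_measurable borel"
      and h\<kappa>: "(\<integral>\<^sup>+z\<in>halfspace. ennreal ((h z)\<^sup>2) \<partial>lborel) \<le> ennreal \<kappa>"
      and g\<gamma>: "\<forall>s>0. \<forall>y. (\<integral>\<^sup>+\<omega>. ennreal (tpow k R (g s y \<omega>)) \<partial>M) \<le> \<gamma> (s, y)"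
      and h\<gamma>: "(\<integral>\<^sup>+z\<in>halfspace. ennreal ((h z)\<^sup>2) * \<gamma> z \<partial>lborel) \<le> ennreal \<Gamma>" and \<Gamma>: "0 \<le> \<Gamma>"
    define f' where "f' = (\<lambda>s y \<omega>. h (s, y) * g s y \<omega>)"
    define N where "N = R\<^sup>2 ^ k"
    have N: "0 \<le> N" by (simp add: N_def)
    obtain gn Y where a: "\<forall>n::nat. has_simple_walsh_integral M F w (gn n) (Y n)"
      "(\<lambda>n. sqn M (\<lambda>s y \<omega>. gn n s y \<omega> - f' s y \<omega>)) \<longlonglongrightarrow> 0" "(\<lambda>n. \<integral>\<^sup>+\<omega>. ennreal ((Y n \<omega> - Z \<omega>)\<^sup>2) \<partial>M) \<longlonglongrightarrow> 0"
      "jointly_measurable M f'" "Z \<in> borel_measurable M" "sqn M f' < \<infinity>"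
      by (rule walsh_approx[OF f[folded f'_def]])
    note a1 = a(1)[rule_format]
    note [measurable] = a(5) simple_walsh_jm(2)[OF a1]
    define e where "e n = sqn M (\<lambda>s y \<omega>. gn n s y \<omega> - f' s y \<omega>)" for n
    define i where "i n = (\<integral>\<^sup>+\<omega>. ennreal ((Y n \<omega> - Z \<omega>)\<^sup>2) \<partial>M)" for n
    \<comment> \<open>The bound for the simple approximants still contains N times their L^2 error,
      with N = R^(2k). It grows with R, but R is fixed while the approximation is refined.\<close>
    have mcpow: "(\<integral>\<^sup>+\<omega>. ennreal (cpow k R (Y n \<omega>)) \<partial>M) \<le> ennreal (4 * K1) * (ennreal N * e n + ennreal ((1 / \<epsilon>) ^ k * \<Gamma>))"
      if fin: "e n < \<top>" for n
    proof -
      define E where "E z = (\<integral>\<^sup>+\<omega>. ennreal ((gn n (fst z) (snd z) \<omega> - f' (fst z) (snd z) \<omega>)\<^sup>2) \<partial>M) * indicator halfspace z" for z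
      have jd: "jointly_measurable M (\<lambda>s y \<omega>. gn n s y \<omega> - f' s y \<omega>)"
        by (intro jm_diff simple_walsh_jm(1)[OF a1] a(4))
      have [measurable]: "E \<in> borel_measurable borel" unfolding E_def[abs_def]
        by (rule jm_section[OF prob_space_axioms jd]) measurable
      define W where "W K z = ennreal (2 * K1) * (ennreal N * E z + ennreal ((h z)\<^sup>2) * (ennreal (\<epsilon> * real (Suc k) * K) + ennreal ((1 / \<epsilon>) ^ k) * \<gamma> z))"
        for K z
      obtain e0 where e0: "e n = ennreal e0" "0 \<le> e0" using fin by (cases "e n") auto
      have "(\<integral>\<^sup>+\<omega>. ennreal (cpow k R (Y n \<omega>)) \<partial>M) \<le> ennreal (2 * K1 * (N * e0 + (1 / \<epsilon>) ^ k * \<Gamma>) / (1 - 1/2))"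
      proof (rule simple_walsh_bound[OF a1, where \<phi>="cpow k R" and \<phi>'="\<lambda>x. 2 * x * (clip R x)\<^sup>2 ^ k"
            and \<psi>="\<lambda>x. K1 * (clip R x)\<^sup>2 ^ k" and C\<psi>="K1 * N" and C'="2 * N" and C\<phi>=N and L="5 * 9 ^ k" and l="Suc k" and W=W])
        show "0 \<le> K1 * (clip R x)\<^sup>2 ^ k" for x using K1 by simp
        have cN: "(clip R x)\<^sup>2 ^ k \<le> N" for x unfolding N_def using clip_bounds[OF R] by (intro power_mono) auto
        then show "K1 * (clip R x)\<^sup>2 ^ k \<le> K1 * N" for x using K1 by (intro mult_left_mono) auto
        show "\<bar>2 * x * (clip R x)\<^sup>2 ^ k\<bar> \<le> 2 * N * \<bar>x\<bar>" for x
          using mult_right_mono[OF cN[of x], of "2 * \<bar>x\<bar>"] by (simp add: abs_mult mult_ac)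
        show "0 \<le> cpow k R x" for x by (rule cpow_bounds[OF R])
        show "cpow k R x \<le> N * x\<^sup>2" for x
          using cpow_bounds(3)[OF R, of k x] cpow_bounds(4)[OF R, of k x] by (simp add: N_def)
        show "cpow k R (x + d) \<le> cpow k R x + 2 * x * (clip R x)\<^sup>2 ^ k * d + K1 * (clip R x)\<^sup>2 ^ k * d\<^sup>2 + 5 * 9 ^ k * d ^ (2 * Suc k)" for x d
          using cpow_taylor[OF R k, of x d] by (simp add: K1_def)
        show "W K \<in> borel_measurable borel" for K unfolding W_def[abs_def] by measurable
        show "0 \<le> 2 * K1 * (N * e0 + (1 / \<epsilon>) ^ k * \<Gamma>)" using K1 N e0 \<epsilon> \<Gamma> by simp
      next
        fix V :: "'w \<Rightarrow> real" and K and z :: "real \<times> real"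
        assume V[measurable]: "V \<in> borel_measurable M" and K: "0 \<le> K" "integrable M (\<lambda>\<omega>. cpow k R (V \<omega>))"
          "(\<integral>\<omega>. cpow k R (V \<omega>) \<partial>M) \<le> K" and z: "0 < fst z"
        then have zh: "z \<in> halfspace" by (cases z) (auto simp: halfspace_def)
        have [measurable]: "(\<lambda>\<omega>. g (fst z) (snd z) \<omega>) \<in> borel_measurable M" using g z by auto
        have [measurable]: "gn n (fst z) (snd z) \<in> borel_measurable M"
          by (rule jm_measurable_section[OF simple_walsh_jm(1)[OF a1] z])
        have [measurable]: "f' (fst z) (snd z) \<in> borel_measurable M"
          by (rule jm_measurable_section[OF a(4) z])
        \<comment> \<open>The approximant is split into the target plus the error. On the error the
          slope is bounded by \<open>N\<close>; on the target Young's inequality separates the state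
          \<open>V\<close> from the random factor \<open>g\<close>.\<close>
        have pw: "K1 * (clip R (V \<omega>))\<^sup>2 ^ k * (gn n (fst z) (snd z) \<omega>)\<^sup>2 \<le>
          (2 * K1) * (N * (gn n (fst z) (snd z) \<omega> - f' (fst z) (snd z) \<omega>)\<^sup>2
           + (h z)\<^sup>2 * (\<epsilon> * real (Suc k) * cpow k R (V \<omega>) + (1 / \<epsilon>) ^ k * tpow k R (g (fst z) (snd z) \<omega>)))" for \<omega>
        proof -
          define c where "c = (clip R (V \<omega>))\<^sup>2 ^ k"
          define p q where "p = gn n (fst z) (snd z) \<omega>" and "q = f' (fst z) (snd z) \<omega>"
          have c: "0 \<le> c" "c \<le> N" unfolding c_def N_def using clip_bounds[OF R] by (auto intro!: power_mono)
          have "0 \<le> (p - 2 * q)\<^sup>2" by simp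
          then have "p\<^sup>2 \<le> 2 * (p - q)\<^sup>2 + 2 * q\<^sup>2" by (simp add: power2_eq_square algebra_simps)
          then have "c * p\<^sup>2 \<le> c * (2 * (p - q)\<^sup>2 + 2 * q\<^sup>2)" using c by (intro mult_left_mono)
          also have "\<dots> = 2 * (c * (p - q)\<^sup>2 + (h z)\<^sup>2 * (c * (g (fst z) (snd z) \<omega>)\<^sup>2))"
            by (simp add: q_def f'_def power_mult_distrib algebra_simps)
          also have "\<dots> \<le> 2 * (N * (p - q)\<^sup>2 + (h z)\<^sup>2 * (\<epsilon> * real (Suc k) * cpow k R (V \<omega>) + (1 / \<epsilon>) ^ k * tpow k R (g (fst z) (snd z) \<omega>)))"
          proof (intro mult_left_mono add_mono mult_right_mono)
            have "c * (g (fst z) (snd z) \<omega>)\<^sup>2 \<le> \<epsilon> * tpow k R (V \<omega>) + (1 / \<epsilon>) ^ k * tpow k R (g (fst z) (snd z) \<omega>)"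
              unfolding c_def by (rule tpow_young[OF R \<epsilon>])
            moreover have "\<epsilon> * tpow k R (V \<omega>) \<le> \<epsilon> * (real (Suc k) * cpow k R (V \<omega>))"
              using \<epsilon> by (intro mult_left_mono cpow_bounds(2)[OF R]) auto
            ultimately show "c * (g (fst z) (snd z) \<omega>)\<^sup>2 \<le> \<epsilon> * real (Suc k) * cpow k R (V \<omega>) + (1 / \<epsilon>) ^ k * tpow k R (g (fst z) (snd z) \<omega>)"
              unfolding mult.assoc by linarith
          qed (use c in auto)
          finally have "K1 * (c * p\<^sup>2) \<le> K1 * (2 * (N * (p - q)\<^sup>2 + (h z)\<^sup>2 * (\<epsilon> * real (Suc k) * cpow k R (V \<omega>) + (1 / \<epsilon>) ^ k * tpow k R (g (fst z) (snd z) \<omega>))))"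
            using K1 by (intro mult_left_mono) auto
          then show ?thesis unfolding c_def p_def q_def by (simp only: mult_ac)
        qed
        have "(\<integral>\<^sup>+\<omega>. ennreal (K1 * (clip R (V \<omega>))\<^sup>2 ^ k * (gn n (fst z) (snd z) \<omega>)\<^sup>2) \<partial>M)
          \<le> (\<integral>\<^sup>+\<omega>. ennreal (2 * K1) * (ennreal N * ennreal ((gn n (fst z) (snd z) \<omega> - f' (fst z) (snd z) \<omega>)\<^sup>2)
           + ennreal ((h z)\<^sup>2) * (ennreal (\<epsilon> * real (Suc k)) * ennreal (cpow k R (V \<omega>)) + ennreal ((1 / \<epsilon>) ^ k) * ennreal (tpow k R (g (fst z) (snd z) \<omega>)))) \<partial>M)"
        proof (rule nn_integral_mono)
          fix \<omega>
          have nn: "0 \<le> cpow k R (V \<omega>)" "0 \<le> tpow k R (g (fst z) (snd z) \<omega>)" "0 \<le> \<epsilon>" "0 \<le> (1 / \<epsilon>) ^ k" "0 \<le> K1"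
            using cpow_bounds[OF R] \<epsilon> K1 by auto
          show "ennreal (K1 * (clip R (V \<omega>))\<^sup>2 ^ k * (gn n (fst z) (snd z) \<omega>)\<^sup>2)
            \<le> ennreal (2 * K1) * (ennreal N * ennreal ((gn n (fst z) (snd z) \<omega> - f' (fst z) (snd z) \<omega>)\<^sup>2)
           + ennreal ((h z)\<^sup>2) * (ennreal (\<epsilon> * real (Suc k)) * ennreal (cpow k R (V \<omega>)) + ennreal ((1 / \<epsilon>) ^ k) * ennreal (tpow k R (g (fst z) (snd z) \<omega>))))"
            using ennreal_leI[OF pw[of \<omega>]] nn N
            by (simp add: ennreal_mult'[symmetric] ennreal_plus[symmetric] del: ennreal_plus of_nat_Suc)
        qed
        also have "\<dots> = ennreal (2 * K1) * (ennreal N * E z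
           + ennreal ((h z)\<^sup>2) * (ennreal (\<epsilon> * real (Suc k)) * (\<integral>\<^sup>+\<omega>. ennreal (cpow k R (V \<omega>)) \<partial>M)
             + ennreal ((1 / \<epsilon>) ^ k) * (\<integral>\<^sup>+\<omega>. ennreal (tpow k R (g (fst z) (snd z) \<omega>)) \<partial>M)))"
          using zh by (simp add: nn_integral_cmult nn_integral_add E_def)
        also have "\<dots> \<le> W K z"
          unfolding W_def
        proof (intro mult_left_mono add_mono order_refl)
          have "(\<integral>\<^sup>+\<omega>. ennreal (cpow k R (V \<omega>)) \<partial>M) \<le> ennreal K"
            using K by (subst nn_integral_eq_integral) (auto intro: ennreal_leI cpow_bounds[OF R])
          then have "ennreal (\<epsilon> * real (Suc k)) * (\<integral>\<^sup>+\<omega>. ennreal (cpow k R (V \<omega>)) \<partial>M) \<le> ennreal (\<epsilon> * real (Suc k)) * ennreal K"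
            by (rule mult_left_mono) simp
          also have "\<dots> = ennreal (\<epsilon> * real (Suc k) * K)" using \<epsilon> K by (simp add: ennreal_mult')
          finally show "ennreal (\<epsilon> * real (Suc k)) * (\<integral>\<^sup>+\<omega>. ennreal (cpow k R (V \<omega>)) \<partial>M) \<le> ennreal (\<epsilon> * real (Suc k) * K)" .
          show "(\<integral>\<^sup>+\<omega>. ennreal (tpow k R (g (fst z) (snd z) \<omega>)) \<partial>M) \<le> \<gamma> z"
            using g\<gamma>[rule_format, OF z, of "snd z"] by simp
        qed auto
        finally show "(\<integral>\<^sup>+\<omega>. ennreal (K1 * (clip R (V \<omega>))\<^sup>2 ^ k * (gn n (fst z) (snd z) \<omega>)\<^sup>2) \<partial>M) \<le> W K z" .
      next
        fix K :: real assume K: "0 \<le> K"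
        have "(\<integral>\<^sup>+z\<in>halfspace. W K z \<partial>lborel)
          = (\<integral>\<^sup>+z. ennreal (2 * K1) * (ennreal N * E z + ennreal (\<epsilon> * real (Suc k) * K) * (ennreal ((h z)\<^sup>2) * indicator halfspace z)
            + ennreal ((1 / \<epsilon>) ^ k) * (ennreal ((h z)\<^sup>2) * \<gamma> z * indicator halfspace z)) \<partial>lborel)"
          unfolding W_def E_def by (intro nn_integral_cong) (auto simp: indicator_def algebra_simps)
        also have "\<dots> = ennreal (2 * K1) * (ennreal N * (\<integral>\<^sup>+z. E z \<partial>lborel) + ennreal (\<epsilon> * real (Suc k) * K) * (\<integral>\<^sup>+z\<in>halfspace. ennreal ((h z)\<^sup>2) \<partial>lborel)
            + ennreal ((1 / \<epsilon>) ^ k) * (\<integral>\<^sup>+z\<in>halfspace. ennreal ((h z)\<^sup>2) * \<gamma> z \<partial>lborel))"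
          by (simp add: nn_integral_cmult nn_integral_add)
        also have "(\<integral>\<^sup>+z. E z \<partial>lborel) = ennreal e0" using e0 by (simp add: E_def e_def sqn_def)
        also have "ennreal (2 * K1) * (ennreal N * ennreal e0 + ennreal (\<epsilon> * real (Suc k) * K) * (\<integral>\<^sup>+z\<in>halfspace. ennreal ((h z)\<^sup>2) \<partial>lborel)
            + ennreal ((1 / \<epsilon>) ^ k) * (\<integral>\<^sup>+z\<in>halfspace. ennreal ((h z)\<^sup>2) * \<gamma> z \<partial>lborel))
          \<le> ennreal (2 * K1) * (ennreal N * ennreal e0 + ennreal (\<epsilon> * real (Suc k) * K) * ennreal \<kappa> + ennreal ((1 / \<epsilon>) ^ k) * ennreal \<Gamma>)"
          by (intro mult_left_mono add_mono order_refl h\<kappa> h\<gamma>) auto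
        also have "\<dots> = ennreal (2 * K1 * (N * e0 + \<epsilon> * real (Suc k) * K * \<kappa> + (1 / \<epsilon>) ^ k * \<Gamma>))"
          using N e0 \<epsilon> K \<kappa> \<Gamma> K1 by (simp add: ennreal_mult'[symmetric] ennreal_plus[symmetric] del: ennreal_plus of_nat_Suc)
        \<comment> \<open>The part proportional to K has coefficient at most 1/2 by the choice of
          \<epsilon>; the rest plays the role of c0.\<close>
        also have "2 * K1 * (N * e0 + \<epsilon> * real (Suc k) * K * \<kappa> + (1 / \<epsilon>) ^ k * \<Gamma>) \<le> 2 * K1 * (N * e0 + (1 / \<epsilon>) ^ k * \<Gamma>) + 1/2 * K"
          using mult_right_mono[OF \<theta> K] by (simp add: algebra_simps)
        finally show "(\<integral>\<^sup>+z\<in>halfspace. W K z \<partial>lborel) \<le> ennreal (2 * K1 * (N * e0 + (1 / \<epsilon>) ^ k * \<Gamma>) + 1/2 * K)"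
          by (simp add: ennreal_leI)
      qed (use k in auto)
      also have "\<dots> = ennreal (4 * K1) * (ennreal N * e n + ennreal ((1 / \<epsilon>) ^ k * \<Gamma>))"
        using e0 N \<epsilon> \<Gamma> K1 by (simp add: ennreal_mult'[symmetric] ennreal_plus[symmetric] del: ennreal_plus)
      finally show ?thesis .
    qed
    define B where "B n = ennreal (4 ^ Suc k) * (ennreal (real (Suc k)) * (ennreal (4 * K1) * (ennreal N * e n + ennreal ((1 / \<epsilon>) ^ k * \<Gamma>))) + ennreal N * i n)" for n
    have bound: "(\<integral>\<^sup>+\<omega>. ennreal (tpow k R (Z \<omega>)) \<partial>M) \<le> B n" if "e n < \<top>" for n
    proof -
      have "(\<integral>\<^sup>+\<omega>. ennreal (tpow k R (Z \<omega>)) \<partial>M) \<le> (\<integral>\<^sup>+\<omega>. ennreal (4 ^ Suc k) * (ennreal (real (Suc k)) * ennreal (cpow k R (Y n \<omega>)) + ennreal N * ennreal ((Y n \<omega> - Z \<omega>)\<^sup>2)) \<partial>M)"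
      proof (rule nn_integral_mono)
        fix \<omega>
        have "tpow k R (Z \<omega>) \<le> 4 ^ Suc k * (tpow k R (Y n \<omega>) + tpow k R (Z \<omega> - Y n \<omega>))"
          using tpow_add[OF R, of k "Y n \<omega>" "Z \<omega> - Y n \<omega>"] by simp
        also have "\<dots> \<le> 4 ^ Suc k * (real (Suc k) * cpow k R (Y n \<omega>) + N * (Y n \<omega> - Z \<omega>)\<^sup>2)"
          using cpow_bounds(2)[OF R, of k "Y n \<omega>"] cpow_bounds(4)[OF R, of k "Z \<omega> - Y n \<omega>"]
          by (intro mult_left_mono add_mono) (auto simp: N_def power2_commute)
        finally have "ennreal (tpow k R (Z \<omega>)) \<le> ennreal (4 ^ Suc k * (real (Suc k) * cpow k R (Y n \<omega>) + N * (Y n \<omega> - Z \<omega>)\<^sup>2))"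
          by (rule ennreal_leI)
        then show "ennreal (tpow k R (Z \<omega>)) \<le> ennreal (4 ^ Suc k) * (ennreal (real (Suc k)) * ennreal (cpow k R (Y n \<omega>)) + ennreal N * ennreal ((Y n \<omega> - Z \<omega>)\<^sup>2))"
          using cpow_bounds(1)[OF R, of k "Y n \<omega>"] N
          by (simp add: ennreal_mult'[symmetric] ennreal_plus[symmetric] del: ennreal_plus of_nat_Suc power_Suc)
      qed
      also have "\<dots> = ennreal (4 ^ Suc k) * (ennreal (real (Suc k)) * (\<integral>\<^sup>+\<omega>. ennreal (cpow k R (Y n \<omega>)) \<partial>M) + ennreal N * i n)"
        by (simp add: nn_integral_cmult nn_integral_add i_def del: power_Suc of_nat_Suc)
      also have "\<dots> \<le> B n" unfolding B_def
        by (intro mult_left_mono add_mono order_refl mcpow that) auto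
      finally show ?thesis .
    qed
    have lim: "B \<longlonglongrightarrow> ennreal (4 ^ Suc k) * (ennreal (real (Suc k)) * (ennreal (4 * K1) * (ennreal N * 0 + ennreal ((1 / \<epsilon>) ^ k * \<Gamma>))) + ennreal N * 0)"
      unfolding B_def using a(2,3) unfolding e_def i_def
      by (intro tendsto_add ennreal_tendsto_cmult tendsto_const) auto
    \<comment> \<open>An individual approximation error could be infinite; convergence to 0 makes
      the errors finite from some index on, which is enough for the limit.\<close>
    have ev: "\<forall>\<^sub>F n in sequentially. e n < \<top>"
      using order_tendstoD(2)[OF a(2), of \<top>] by (simp add: e_def)
    have "(\<integral>\<^sup>+\<omega>. ennreal (tpow k R (Z \<omega>)) \<partial>M) \<le> ennreal (4 ^ Suc k) * (ennreal (real (Suc k)) * (ennreal (4 * K1) * (ennreal N * 0 + ennreal ((1 / \<epsilon>) ^ k * \<Gamma>))) + ennreal N * 0)"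
      by (rule tendsto_lowerbound[OF lim]) (use ev bound in \<open>auto elim: eventually_mono\<close>)
    also have "\<dots> = ennreal (C * \<Gamma>)"
      unfolding C_def using K1 \<epsilon> \<Gamma> by (simp add: ennreal_mult'[symmetric] mult.assoc del: power_Suc of_nat_Suc)
    finally show "(\<integral>\<^sup>+\<omega>. ennreal (tpow k R (Z \<omega>)) \<partial>M) \<le> ennreal (C * \<Gamma>)" .
  qed
qed

end

section \<open>Continuity of translations\<close>

lemma nn_integral_translation:
  fixes f :: "'a::euclidean_space \<Rightarrow> ennreal"
  assumes [measurable]: "f \<in> borel_measurable borel"
  shows "(\<integral>\<^sup>+x. f (x + h) \<partial>lborel) = (\<integral>\<^sup>+x. f x \<partial>lborel)"
proof -
  have "(\<integral>\<^sup>+x. f x \<partial>lborel) = (\<integral>\<^sup>+x. f x \<partial>distr lborel borel ((+) h))" by (simp add: lborel_distr_plus)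
  also have "\<dots> = (\<integral>\<^sup>+x. f (x + h) \<partial>lborel)" by (subst nn_integral_distr) (auto simp: add.commute)
  finally show ?thesis ..
qed

text \<open>The set is squeezed between a compact \<open>K\<close> and an open \<open>U\<close>. A
  shift shorter than the distance from \<open>K\<close> to the complement of \<open>U\<close> can
  change the indicator only at points that lie in U - K before or after the shift.\<close>

lemma indicator_translation_L1:
  fixes A :: "'a::euclidean_space set"
  assumes A: "A \<in> sets borel" "emeasure lborel A < \<infinity>" and e: "e > 0"
  shows "\<exists>d>0. \<forall>h. norm h < d \<longrightarrow> (\<integral>\<^sup>+x. ennreal \<bar>indicator A (x + h) - indicator A x\<bar> \<partial>lborel) \<le> ennreal e"
proof -
  \<comment> \<open>Three pieces of measure at most e / 6 make up U - K, and U - K is counted twice,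
    once for each position of the point.\<close>
  define \<eta> where "\<eta> = e / 6"
  have \<eta>: "\<eta> > 0" using e by (simp add: \<eta>_def)
  obtain U where U: "open U" "A \<subseteq> U" "emeasure lebesgue (U - A) < ennreal \<eta>"
    using sets_lebesgue_outer_open[of A \<eta>] A(1) \<eta> by (metis sets_completionI_sets sets_lborel)
  obtain T where T: "closed T" "T \<subseteq> A" "emeasure lebesgue (A - T) < ennreal \<eta>"
    using sets_lebesgue_inner_closed[of A \<eta>] A(1) \<eta> by (metis sets_completionI_sets sets_lborel)
  have [measurable]: "U \<in> sets borel" "T \<in> sets borel" "A \<in> sets borel" using U T A by auto
  have Tfin: "emeasure lborel T < \<infinity>" using emeasure_mono[of T A lborel] T A by (auto intro: le_less_trans)
  have dec: "(\<lambda>n. emeasure lborel (T - cball 0 (real n))) \<longlonglongrightarrow> emeasure lborel (\<Inter>n. T - cball 0 (real n))"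
  proof (rule Lim_emeasure_decseq)
    show "decseq (\<lambda>n. T - cball 0 (real n))" by (auto simp: decseq_def)
    show "emeasure lborel (T - cball 0 (real i)) \<noteq> \<infinity>" for i
      using emeasure_mono[of "T - cball 0 (real i)" T lborel] Tfin by (auto simp: top_unique)
  qed auto
  have "(\<Inter>n. T - cball 0 (real n)) = {}"
  proof -
    have "\<exists>n. norm x \<le> real n" for x :: 'a by (rule real_arch_simple)
    then show ?thesis by auto
  qed
  then have "(\<lambda>n. emeasure lborel (T - cball 0 (real n))) \<longlonglongrightarrow> 0" using dec by (simp only: emeasure_empty)
  then have "\<forall>\<^sub>F n in sequentially. emeasure lborel (T - cball 0 (real n)) < ennreal \<eta>"
    using \<eta> by (intro order_tendstoD) auto
  then obtain n where n: "emeasure lborel (T - cball 0 (real n)) < ennreal \<eta>"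
    by (auto simp: eventually_sequentially)
  define K where "K = T \<inter> cball 0 (real n)"
  have K: "compact K" "K \<subseteq> A" using T by (auto simp: K_def closed_Int_compact)
  have [measurable]: "K \<in> sets borel" using K by (simp add: borel_compact)
  have "U - K = (U - A) \<union> ((A - T) \<union> (T - cball 0 (real n)))" using K T U by (auto simp: K_def)
  then have "emeasure lborel (U - K) \<le> emeasure lborel (U - A) + (emeasure lborel (A - T) + emeasure lborel (T - cball 0 (real n)))"
    by (auto intro!: order_trans[OF emeasure_subadditive] add_left_mono)
  also have "\<dots> \<le> ennreal \<eta> + (ennreal \<eta> + ennreal \<eta>)"
    using U(3) T(3) n by (intro add_mono) (auto intro: less_imp_le)
  also have "\<dots> = ennreal (e / 2)" using \<eta> by (simp add: \<eta>_def ennreal_plus[symmetric] del: ennreal_plus)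
  finally have UK: "emeasure lborel (U - K) \<le> ennreal (e / 2)" .
  have "K \<inter> - U = {}" using K U by auto
  then obtain d where d: "d > 0" "\<And>x y. x \<in> K \<Longrightarrow> y \<in> - U \<Longrightarrow> d \<le> dist x y"
    using separate_compact_closed[OF K(1), of "- U"] U(1) by (auto simp: closed_Compl)
  show ?thesis
  proof (intro exI[of _ d] conjI allI impI d(1))
    fix h :: 'a assume h: "norm h < d"
    have "(\<integral>\<^sup>+x. ennreal \<bar>indicator A (x + h) - indicator A x\<bar> \<partial>lborel)
      \<le> (\<integral>\<^sup>+x. indicator (U - K) (x + h) + indicator (U - K) x \<partial>lborel)"
    proof (rule nn_integral_mono)
      fix x
      have "x \<in> K \<Longrightarrow> x + h \<in> U" using d(2)[of x "x + h"] h by (auto simp: dist_norm)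
      moreover have "x + h \<in> K \<Longrightarrow> x \<in> U" using d(2)[of "x + h" x] h by (auto simp: dist_norm)
      ultimately show "ennreal \<bar>indicator A (x + h) - indicator A x\<bar> \<le> indicator (U - K) (x + h) + indicator (U - K) x"
        using U K by (auto simp: indicator_def)
    qed
    also have "\<dots> = (\<integral>\<^sup>+x. indicator (U - K) (x + h) \<partial>lborel) + (\<integral>\<^sup>+x. indicator (U - K) x \<partial>lborel)"
      by (rule nn_integral_add) measurable
    also have "(\<integral>\<^sup>+x. indicator (U - K) (x + h) \<partial>lborel) = (\<integral>\<^sup>+x. indicator (U - K) x \<partial>lborel)"
      by (rule nn_integral_translation) measurable
    also have "(\<integral>\<^sup>+x. indicator (U - K) x \<partial>lborel) + (\<integral>\<^sup>+x. indicator (U - K) x \<partial>lborel) \<le> ennreal (e/2) + ennreal (e/2)"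
      using UK by (intro add_mono) auto
    also have "\<dots> = ennreal e" using e by (simp add: ennreal_plus[symmetric] del: ennreal_plus)
    finally show "(\<integral>\<^sup>+x. ennreal \<bar>indicator A (x + h) - indicator A x\<bar> \<partial>lborel) \<le> ennreal e" .
  qed
qed

text \<open>Indicators are the base case, and the property is stable under sums and L^1 limits:
  shifting preserves Lebesgue measure, so the approximation error of f is the same before and after
  the shift.\<close>

lemma translation_continuous_L1:
  fixes f :: "'a::euclidean_space \<Rightarrow> real"
  assumes "integrable lborel f" and "e > 0"
  shows "\<exists>d>0. \<forall>h. norm h < d \<longrightarrow> (\<integral>\<^sup>+x. ennreal \<bar>f (x + h) - f x\<bar> \<partial>lborel) \<le> ennreal e"
  using assms
proof (induction f arbitrary: e rule: integrable_induct)
  case (base A c)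
  obtain d where d: "d > 0" "\<And>h. norm h < d \<Longrightarrow>
    (\<integral>\<^sup>+x. ennreal \<bar>indicator A (x + h) - indicator A x\<bar> \<partial>lborel) \<le> ennreal (e / (\<bar>c\<bar> + 1))"
    using indicator_translation_L1[of A "e / (\<bar>c\<bar> + 1)"] base by auto
  show ?case
  proof (intro exI[of _ d] conjI allI impI d(1))
    fix h :: 'a assume h: "norm h < d"
    have [measurable]: "A \<in> sets borel" using base by simp
    have "(\<integral>\<^sup>+x. ennreal \<bar>indicator A (x + h) *\<^sub>R c - indicator A x *\<^sub>R c\<bar> \<partial>lborel)
      = ennreal \<bar>c\<bar> * (\<integral>\<^sup>+x. ennreal \<bar>indicator A (x + h) - indicator A x\<bar> \<partial>lborel)"
      by (subst nn_integral_cmult[symmetric], measurable, intro nn_integral_cong)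
        (simp add: left_diff_distrib[symmetric] abs_mult ennreal_mult'[symmetric] mult.commute
          flip: right_diff_distrib)
    also have "\<dots> \<le> ennreal \<bar>c\<bar> * ennreal (e / (\<bar>c\<bar> + 1))" by (intro mult_left_mono d h) auto
    also have "\<dots> \<le> ennreal e"
    proof -
      have "\<bar>c\<bar> * (e / (\<bar>c\<bar> + 1)) \<le> e" using base(3) by (simp add: pos_divide_le_eq algebra_simps)
      then show ?thesis by (subst ennreal_mult'[symmetric]) (auto intro: ennreal_leI)
    qed
    finally show "(\<integral>\<^sup>+x. ennreal \<bar>indicator A (x + h) *\<^sub>R c - indicator A x *\<^sub>R c\<bar> \<partial>lborel) \<le> ennreal e" .
  qed
next
  case (add f g)
  have [measurable]: "f \<in> borel_measurable borel" "g \<in> borel_measurable borel"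
    using add.hyps by (auto dest: borel_measurable_integrable)
  obtain d where d: "d > 0" "\<And>h. norm h < d \<Longrightarrow> (\<integral>\<^sup>+x. ennreal \<bar>f (x + h) - f x\<bar> \<partial>lborel) \<le> ennreal (e/2)"
    using add.IH(1)[of "e/2"] add.prems by auto
  obtain d' where d': "d' > 0" "\<And>h. norm h < d' \<Longrightarrow> (\<integral>\<^sup>+x. ennreal \<bar>g (x + h) - g x\<bar> \<partial>lborel) \<le> ennreal (e/2)"
    using add.IH(2)[of "e/2"] add.prems by auto
  show ?case
  proof (intro exI[of _ "min d d'"] conjI allI impI)
    fix h :: 'a assume h: "norm h < min d d'"
    have "(\<integral>\<^sup>+x. ennreal \<bar>(f (x + h) + g (x + h)) - (f x + g x)\<bar> \<partial>lborel)
      \<le> (\<integral>\<^sup>+x. ennreal \<bar>f (x + h) - f x\<bar> + ennreal \<bar>g (x + h) - g x\<bar> \<partial>lborel)"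
      by (intro nn_integral_mono) (auto simp: ennreal_plus[symmetric] simp del: ennreal_plus intro!: ennreal_leI)
    also have "\<dots> = (\<integral>\<^sup>+x. ennreal \<bar>f (x + h) - f x\<bar> \<partial>lborel) + (\<integral>\<^sup>+x. ennreal \<bar>g (x + h) - g x\<bar> \<partial>lborel)"
      by (rule nn_integral_add) measurable
    also have "\<dots> \<le> ennreal (e/2) + ennreal (e/2)" using h by (intro add_mono d d') auto
    also have "\<dots> = ennreal e" using add.prems by (simp add: ennreal_plus[symmetric] del: ennreal_plus)
    finally show "(\<integral>\<^sup>+x. ennreal \<bar>(f (x + h) + g (x + h)) - (f x + g x)\<bar> \<partial>lborel) \<le> ennreal e" .
  qed (use d d' in auto)
next
  case (lim f s)
  have fm[measurable]: "f \<in> borel_measurable borel" "\<And>i. s i \<in> borel_measurable borel"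
    using lim.hyps by (auto dest: borel_measurable_integrable)
  have "(\<lambda>i. (\<integral>\<^sup>+x. norm (f x - s i x) \<partial>lborel)) \<longlonglongrightarrow> 0"
  proof (rule nn_integral_dominated_convergence_norm[where w="\<lambda>x. 2 * norm (f x)"])
    show "(\<integral>\<^sup>+ x. ennreal (2 * norm (f x)) \<partial>lborel) < \<infinity>"
      using lim.hyps(4) unfolding integrable_iff_bounded
      by (simp add: nn_integral_cmult ennreal_mult ennreal_mult_less_top)
  qed (use lim in auto)
  then have "\<forall>\<^sub>F i in sequentially. (\<integral>\<^sup>+x. norm (f x - s i x) \<partial>lborel) < ennreal (e/3)"
    using lim.prems by (intro order_tendstoD) auto
  then obtain i where i: "(\<integral>\<^sup>+x. norm (f x - s i x) \<partial>lborel) < ennreal (e/3)"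
    by (auto simp: eventually_sequentially)
  obtain d where d: "d > 0" "\<And>h. norm h < d \<Longrightarrow> (\<integral>\<^sup>+x. ennreal \<bar>s i (x + h) - s i x\<bar> \<partial>lborel) \<le> ennreal (e/3)"
    using lim.IH[of "e/3" i] lim.prems by auto
  show ?case
  proof (intro exI[of _ d] conjI allI impI d(1))
    fix h :: 'a assume h: "norm h < d"
    have "(\<integral>\<^sup>+x. ennreal \<bar>f (x + h) - f x\<bar> \<partial>lborel)
      \<le> (\<integral>\<^sup>+x. ennreal (norm (f (x + h) - s i (x + h))) + (ennreal \<bar>s i (x + h) - s i x\<bar> + ennreal (norm (f x - s i x))) \<partial>lborel)"
      by (intro nn_integral_mono) (auto simp: ennreal_plus[symmetric] simp del: ennreal_plus intro!: ennreal_leI)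
    also have "\<dots> = (\<integral>\<^sup>+x. ennreal (norm (f (x + h) - s i (x + h))) \<partial>lborel) +
       ((\<integral>\<^sup>+x. ennreal \<bar>s i (x + h) - s i x\<bar> \<partial>lborel) + (\<integral>\<^sup>+x. ennreal (norm (f x - s i x)) \<partial>lborel))"
      by (subst nn_integral_add, measurable, subst nn_integral_add, measurable)
    also have "(\<integral>\<^sup>+x. ennreal (norm (f (x + h) - s i (x + h))) \<partial>lborel) = (\<integral>\<^sup>+x. ennreal (norm (f x - s i x)) \<partial>lborel)"
      by (rule nn_integral_translation) measurable
    also have "(\<integral>\<^sup>+x. ennreal (norm (f x - s i x)) \<partial>lborel) + ((\<integral>\<^sup>+x. ennreal \<bar>s i (x + h) - s i x\<bar> \<partial>lborel) + (\<integral>\<^sup>+x. ennreal (norm (f x - s i x)) \<partial>lborel))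
      \<le> ennreal (e/3) + (ennreal (e/3) + ennreal (e/3))"
      using i h by (intro add_mono d) auto
    also have "\<dots> = ennreal e" using lim.prems by (simp add: ennreal_plus[symmetric] del: ennreal_plus)
    finally show "(\<integral>\<^sup>+x. ennreal \<bar>f (x + h) - f x\<bar> \<partial>lborel) \<le> ennreal e" .
  qed
qed

text \<open>For nonnegative a and b, (a - b)^2 is at most |a^2 - b^2|, so the claim is L^1
  continuity of translations of the square of f.\<close>

lemma translation_continuous_L2:
  fixes f :: "'a::euclidean_space \<Rightarrow> real"
  assumes [measurable]: "f \<in> borel_measurable borel" and f: "\<And>x. 0 \<le> f x"
    "(\<integral>\<^sup>+x. ennreal ((f x)\<^sup>2) \<partial>lborel) < \<infinity>" and "e > 0"
  shows "\<exists>d>0. \<forall>h. norm h < d \<longrightarrow> (\<integral>\<^sup>+x. ennreal ((f (x + h) - f x)\<^sup>2) \<partial>lborel) \<le> ennreal e"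
proof -
  have "integrable lborel (\<lambda>x. (f x)\<^sup>2)" using f by (intro integrableI_nonneg) auto
  from translation_continuous_L1[OF this \<open>e > 0\<close>]
  obtain d where d: "d > 0" "\<And>h. norm h < d \<Longrightarrow> (\<integral>\<^sup>+x. ennreal \<bar>(f (x + h))\<^sup>2 - (f x)\<^sup>2\<bar> \<partial>lborel) \<le> ennreal e" by auto
  have sq: "(a - b)\<^sup>2 \<le> \<bar>a\<^sup>2 - b\<^sup>2\<bar>" if "0 \<le> a" "0 \<le> b" for a b :: real
  proof -
    have "\<bar>a - b\<bar> * \<bar>a - b\<bar> \<le> \<bar>a - b\<bar> * \<bar>a + b\<bar>" using that by (intro mult_left_mono) auto
    then show ?thesis by (simp add: power2_eq_square abs_mult[symmetric] algebra_simps)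
  qed
  show ?thesis
  proof (intro exI[of _ d] conjI allI impI d(1))
    fix h :: 'a assume "norm h < d"
    from d(2)[OF this] show "(\<integral>\<^sup>+x. ennreal ((f (x + h) - f x)\<^sup>2) \<partial>lborel) \<le> ennreal e"
      by (rule order_trans[rotated]) (intro nn_integral_mono ennreal_leI sq f)
  qed
qed

section \<open>Plancherel's inequality for densities\<close>

lemma std_normal_cos: "(\<integral>v. cos (t * v) \<partial>std_normal_distribution) = exp (- t\<^sup>2 / 2)"
proof -
  interpret prob_space std_normal_distribution by (rule prob_space_normal_density) simp
  have i: "integrable std_normal_distribution (\<lambda>v. iexp (t * v))"
    by (rule integrable_const_bound[where B=1]) auto
  have "(\<integral>v. cos (t * v) \<partial>std_normal_distribution) = (\<integral>v. Re (iexp (t * v)) \<partial>std_normal_distribution)"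
    by (intro Bochner_Integration.integral_cong) (auto simp: cis_conv_exp[symmetric] simp flip: of_real_mult)
  also have "\<dots> = Re (char std_normal_distribution t)" unfolding char_def by (rule integral_Re[OF i])
  finally show ?thesis by (simp add: char_std_normal_distribution flip: of_real_exp)
qed

text \<open>The squared modulus is the characteristic function of the difference of two independent
  copies, which is real, so only the cosine survives.\<close>

lemma norm_char_sq:
  assumes "real_distribution K"
  shows "(norm (char K t))\<^sup>2 = (\<integral>x. (\<integral>y. cos (t * (x - y)) \<partial>K) \<partial>K)"
proof -
  interpret real_distribution K by fact
  have ci: "integrable K (\<lambda>x. cos (t * x))" "integrable K (\<lambda>x. sin (t * x))"
    by (auto intro!: integrable_const_bound[where B=1])
  have i: "integrable K (\<lambda>x. iexp (t * x))" by (auto intro!: integrable_const_bound[where B=1])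
  have "Re (char K t) = (\<integral>x. Re (iexp (t * x)) \<partial>K)" "Im (char K t) = (\<integral>x. Im (iexp (t * x)) \<partial>K)"
    unfolding char_def by (simp_all only: integral_Re[OF i] integral_Im[OF i])
  then have "Re (char K t) = (\<integral>x. cos (t * x) \<partial>K)" "Im (char K t) = (\<integral>x. sin (t * x) \<partial>K)"
    by (simp_all add: cis_conv_exp[symmetric] flip: of_real_mult)
  then have "(norm (char K t))\<^sup>2 = (\<integral>x. cos (t * x) \<partial>K) * (\<integral>x. cos (t * x) \<partial>K) + (\<integral>x. sin (t * x) \<partial>K) * (\<integral>x. sin (t * x) \<partial>K)"
    by (simp only: cmod_power2) (simp only: power2_eq_square)
  also have "\<dots> = (\<integral>x. cos (t * x) * (\<integral>y. cos (t * y) \<partial>K) + sin (t * x) * (\<integral>y. sin (t * y) \<partial>K) \<partial>K)"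
    using ci by simp
  also have "\<dots> = (\<integral>x. (\<integral>y. cos (t * (x - y)) \<partial>K) \<partial>K)"
  proof (intro Bochner_Integration.integral_cong refl)
    fix x
    have "(\<integral>y. cos (t * (x - y)) \<partial>K) = (\<integral>y. cos (t * x) * cos (t * y) + sin (t * x) * sin (t * y) \<partial>K)"
      by (intro Bochner_Integration.integral_cong) (simp_all add: right_diff_distrib cos_diff)
    then show "cos (t * x) * (\<integral>y. cos (t * y) \<partial>K) + sin (t * x) * (\<integral>y. sin (t * y) \<partial>K) = (\<integral>y. cos (t * (x - y)) \<partial>K)"
      using ci by simp
  qed
  finally show ?thesis .
qed

text \<open>Smoothing the difference of two independent copies by a Gaussian turns \<open>\<bar>char K\<bar>\<^sup>2\<close> into an integrable weight.\<close>

lemma gaussian_smoothing: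
  assumes K: "real_distribution K" and \<epsilon>: "\<epsilon> > 0"
  shows "(\<integral>\<^sup>+x. (\<integral>\<^sup>+y. ennreal (exp (- ((x - y) / \<epsilon>)\<^sup>2 / 2)) \<partial>K) \<partial>K)
    \<le> ennreal (\<epsilon> / sqrt (2 * pi)) * (\<integral>\<^sup>+\<xi>. ennreal ((norm (char K \<xi>))\<^sup>2) \<partial>lborel)"
proof -
  interpret K: real_distribution K by fact
  interpret N: prob_space std_normal_distribution by (rule prob_space_normal_density) simp
  interpret KN: pair_prob_space K std_normal_distribution ..
  have fin: "finite_measure (K \<Otimes>\<^sub>M std_normal_distribution)" by (rule KN.finite_measure_axioms)
  have e: "(\<integral>\<^sup>+y. ennreal (exp (- ((x - y) / \<epsilon>)\<^sup>2 / 2)) \<partial>K) = ennreal (\<integral>y. exp (- ((x - y) / \<epsilon>)\<^sup>2 / 2) \<partial>K)" for x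
    by (intro nn_integral_eq_integral K.integrable_const_bound[where B=1]) auto
  \<comment> \<open>The Gaussian kernel is itself an average of cosines over a standard normal
    frequency; Fubini moves that average outside.\<close>
  have e2: "(\<integral>y. exp (- ((x - y) / \<epsilon>)\<^sup>2 / 2) \<partial>K) = (\<integral>v. (\<integral>y. cos (v / \<epsilon> * (x - y)) \<partial>K) \<partial>std_normal_distribution)" for x
  proof -
    have "(\<integral>y. exp (- ((x - y) / \<epsilon>)\<^sup>2 / 2) \<partial>K) = (\<integral>y. (\<integral>v. cos (v / \<epsilon> * (x - y)) \<partial>std_normal_distribution) \<partial>K)"
      unfolding std_normal_cos[symmetric] by (simp add: mult_ac)
    also have "\<dots> = (\<integral>v. (\<integral>y. cos (v / \<epsilon> * (x - y)) \<partial>K) \<partial>std_normal_distribution)"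
      by (rule KN.Fubini_integral[symmetric]) (auto intro!: finite_measure.integrable_const_bound[OF fin, where B=1] simp: split_def)
    finally show ?thesis .
  qed
  have m1: "(\<lambda>x. \<integral>y. cos (v / \<epsilon> * (x - y)) \<partial>K) \<in> borel_measurable K" for v by measurable
  have b1: "\<bar>\<integral>y. cos (v / \<epsilon> * (x - y)) \<partial>K\<bar> \<le> 1" for v x
  proof -
    have i: "integrable K (\<lambda>y. \<bar>cos (v / \<epsilon> * (x - y))\<bar>)"
      by (rule K.integrable_const_bound[where B=1]) auto
    have "\<bar>\<integral>y. cos (v / \<epsilon> * (x - y)) \<partial>K\<bar> \<le> (\<integral>y. \<bar>cos (v / \<epsilon> * (x - y))\<bar> \<partial>K)"
      using integral_norm_bound[of K "\<lambda>y. cos (v / \<epsilon> * (x - y))"] by simp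
    also have "\<dots> \<le> 1" by (rule K.integral_le_const[OF i]) auto
    finally show ?thesis .
  qed
  have "(\<integral>\<^sup>+x. (\<integral>\<^sup>+y. ennreal (exp (- ((x - y) / \<epsilon>)\<^sup>2 / 2)) \<partial>K) \<partial>K)
    = ennreal (\<integral>x. (\<integral>y. exp (- ((x - y) / \<epsilon>)\<^sup>2 / 2) \<partial>K) \<partial>K)"
    unfolding e
  proof (rule nn_integral_eq_integral)
    show "integrable K (\<lambda>x. \<integral>y. exp (- ((x - y) / \<epsilon>)\<^sup>2 / 2) \<partial>K)"
    proof (rule K.integrable_const_bound[where B=1])
      show "AE x in K. norm (\<integral>y. exp (- ((x - y) / \<epsilon>)\<^sup>2 / 2) \<partial>K) \<le> 1"
      proof (intro AE_I2)
        fix x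
        have "integrable K (\<lambda>y. exp (- ((x - y) / \<epsilon>)\<^sup>2 / 2))" by (rule K.integrable_const_bound[where B=1]) auto
        then have "(\<integral>y. exp (- ((x - y) / \<epsilon>)\<^sup>2 / 2) \<partial>K) \<le> 1" by (rule K.integral_le_const) auto
        moreover have "0 \<le> (\<integral>y. exp (- ((x - y) / \<epsilon>)\<^sup>2 / 2) \<partial>K)" by (rule Bochner_Integration.integral_nonneg) auto
        ultimately show "norm (\<integral>y. exp (- ((x - y) / \<epsilon>)\<^sup>2 / 2) \<partial>K) \<le> 1" by simp
      qed
    qed measurable
  qed (auto intro!: AE_I2 Bochner_Integration.integral_nonneg)
  also have "(\<integral>x. (\<integral>y. exp (- ((x - y) / \<epsilon>)\<^sup>2 / 2) \<partial>K) \<partial>K) = (\<integral>v. (\<integral>x. (\<integral>y. cos (v / \<epsilon> * (x - y)) \<partial>K) \<partial>K) \<partial>std_normal_distribution)"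
    unfolding e2
    by (rule KN.Fubini_integral[symmetric]) (auto intro!: finite_measure.integrable_const_bound[OF fin, where B=1] AE_I2
        b1[unfolded times_divide_eq_left] simp: split_def)
  also have "\<dots> = (\<integral>v. (norm (char K (v / \<epsilon>)))\<^sup>2 \<partial>std_normal_distribution)"
    unfolding norm_char_sq[OF K] ..
  also have "ennreal \<dots> = (\<integral>\<^sup>+v. ennreal ((norm (char K (v / \<epsilon>)))\<^sup>2) \<partial>std_normal_distribution)"
  proof (rule nn_integral_eq_integral[symmetric])
    show "integrable std_normal_distribution (\<lambda>v. (norm (char K (v / \<epsilon>)))\<^sup>2)"
      using K.cmod_char_le_1 by (intro N.integrable_const_bound[where B=1]) (auto intro!: power_le_one AE_I2)
  qed auto
  also have "\<dots> = (\<integral>\<^sup>+v. ennreal (std_normal_density v) * ennreal ((norm (char K (v / \<epsilon>)))\<^sup>2) \<partial>lborel)"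
    by (subst nn_integral_density) auto
  \<comment> \<open>The normal density is replaced by its maximum, which leaves a plain Lebesgue
    integral. The argument is written as 0 + (1 / \<epsilon>) v to match the affine substitution
    that follows.\<close>
  also have "\<dots> \<le> (\<integral>\<^sup>+v. ennreal (1 / sqrt (2 * pi)) * ennreal ((norm (char K (0 + (1 / \<epsilon>) * v)))\<^sup>2) \<partial>lborel)"
    by (intro nn_integral_mono mult_mono ennreal_leI) (auto simp: std_normal_density_def divide_right_mono)
  also have "\<dots> = ennreal (1 / sqrt (2 * pi)) * (\<integral>\<^sup>+v. ennreal ((norm (char K (0 + (1 / \<epsilon>) * v)))\<^sup>2) \<partial>lborel)"
    by (rule nn_integral_cmult) measurable
  also have "\<dots> = ennreal (\<epsilon> / sqrt (2 * pi)) * (ennreal (1 / \<epsilon>) * (\<integral>\<^sup>+v. ennreal ((norm (char K (0 + (1 / \<epsilon>) * v)))\<^sup>2) \<partial>lborel))"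
    using \<epsilon> by (simp add: mult.assoc[symmetric] ennreal_mult'[symmetric])
  also have "ennreal (1 / \<epsilon>) * (\<integral>\<^sup>+v. ennreal ((norm (char K (0 + (1 / \<epsilon>) * v)))\<^sup>2) \<partial>lborel) = (\<integral>\<^sup>+\<xi>. ennreal ((norm (char K \<xi>))\<^sup>2) \<partial>lborel)"
    using nn_integral_real_affine[of "\<lambda>\<xi>. ennreal ((norm (char K \<xi>))\<^sup>2)" "1 / \<epsilon>" 0] \<epsilon> by simp
  finally show ?thesis .
qed

text \<open>The integral of p^2 is the autocorrelation of p at shift 0. Its Gaussian average over
  shifts of size \<epsilon> is at most the Fourier side by \<open>gaussian_smoothing\<close>, and
  \<epsilon> tends to 0. Continuity of the autocorrelation at 0 is not known for p, whose square
  might fail to be integrable, so p is first cut off at a constant, which is removed by Fatou's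
  lemma.\<close>

lemma plancherel_le:
  fixes p :: "real \<Rightarrow> real"
  assumes K: "real_distribution K" and p[measurable]: "p \<in> borel_measurable borel" and p0: "\<And>x. 0 \<le> p x"
    and Kp: "K = density lborel (\<lambda>x. ennreal (p x))"
  shows "(\<integral>\<^sup>+x. ennreal ((p x)\<^sup>2) \<partial>lborel) \<le> ennreal (1 / (2 * pi)) * (\<integral>\<^sup>+\<xi>. ennreal ((norm (char K \<xi>))\<^sup>2) \<partial>lborel)"
proof -
  interpret K: real_distribution K by fact
  define R where "R = ennreal (1 / (2 * pi)) * (\<integral>\<^sup>+\<xi>. ennreal ((norm (char K \<xi>))\<^sup>2) \<partial>lborel)"
  have p1: "(\<integral>\<^sup>+x. ennreal (p x) \<partial>lborel) = 1"
    using K.emeasure_space_1 unfolding Kp by (subst (asm) emeasure_density) (auto simp: K.space_eq_univ)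
  have trunc: "(\<integral>\<^sup>+x. ennreal ((min (p x) (real n))\<^sup>2) \<partial>lborel) \<le> R" for n
  proof -
    define r where "r x = min (p x) (real n)" for x
    have [measurable]: "r \<in> borel_measurable borel" unfolding r_def by measurable
    have r: "0 \<le> r x" "r x \<le> p x" "r x \<le> real n" for x using p0 by (auto simp: r_def)
    have ri: "integrable lborel r"
    proof (rule integrableI_nonneg)
      have "(\<integral>\<^sup>+x. ennreal (r x) \<partial>lborel) \<le> (\<integral>\<^sup>+x. ennreal (p x) \<partial>lborel)"
        by (intro nn_integral_mono ennreal_leI r)
      then show "(\<integral>\<^sup>+x. ennreal (r x) \<partial>lborel) < \<infinity>" unfolding p1 by (auto intro: le_less_trans)
    qed (use r in auto)
    define A where "A h = (\<integral>\<^sup>+x. ennreal (r x) * ennreal (r (x + h)) \<partial>lborel)" for h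
    have [measurable]: "A \<in> borel_measurable borel" unfolding A_def by measurable
    \<comment> \<open>Substituting y = x + \<epsilon> v turns the averaged autocorrelation into the
      double integral of the smoothing estimate, after bounding the cut-off density by p.\<close>
    have smooth: "(\<integral>\<^sup>+v. ennreal (std_normal_density v) * A (\<epsilon> * v) \<partial>lborel) \<le> R" if \<epsilon>: "\<epsilon> > 0" for \<epsilon>
    proof -
      have "ennreal \<epsilon> * (\<integral>\<^sup>+v. ennreal (exp (- v\<^sup>2 / 2)) * A (\<epsilon> * v) \<partial>lborel)
        = ennreal \<epsilon> * (\<integral>\<^sup>+v. (\<integral>\<^sup>+x. ennreal (r x) * (ennreal (r (x + \<epsilon> * v)) * ennreal (exp (- v\<^sup>2 / 2))) \<partial>lborel) \<partial>lborel)"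
        unfolding A_def by (subst nn_integral_cmult[symmetric], measurable) (simp add: mult_ac)
      also have "\<dots> = ennreal \<epsilon> * (\<integral>\<^sup>+x. (\<integral>\<^sup>+v. ennreal (r x) * (ennreal (r (x + \<epsilon> * v)) * ennreal (exp (- v\<^sup>2 / 2))) \<partial>lborel) \<partial>lborel)"
        by (subst lborel_pair.Fubini') (auto simp: split_def)
      also have "\<dots> = (\<integral>\<^sup>+x. ennreal (r x) * (ennreal \<epsilon> * (\<integral>\<^sup>+v. ennreal (r (x + \<epsilon> * v)) * ennreal (exp (- ((x - (x + \<epsilon> * v)) / \<epsilon>)\<^sup>2 / 2)) \<partial>lborel)) \<partial>lborel)"
        using \<epsilon> by (subst nn_integral_cmult[symmetric], measurable)
          (intro nn_integral_cong, subst nn_integral_cmult, auto simp: mult_ac)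
      also have "\<dots> = (\<integral>\<^sup>+x. ennreal (r x) * (\<integral>\<^sup>+y. ennreal (r y) * ennreal (exp (- ((x - y) / \<epsilon>)\<^sup>2 / 2)) \<partial>lborel) \<partial>lborel)"
      proof (intro nn_integral_cong arg_cong2[where f="(*)"] refl)
        fix x
        show "ennreal \<epsilon> * (\<integral>\<^sup>+v. ennreal (r (x + \<epsilon> * v)) * ennreal (exp (- ((x - (x + \<epsilon> * v)) / \<epsilon>)\<^sup>2 / 2)) \<partial>lborel)
          = (\<integral>\<^sup>+y. ennreal (r y) * ennreal (exp (- ((x - y) / \<epsilon>)\<^sup>2 / 2)) \<partial>lborel)"
          using \<epsilon> nn_integral_real_affine[of "\<lambda>y. ennreal (r y) * ennreal (exp (- ((x - y) / \<epsilon>)\<^sup>2 / 2))" \<epsilon> x]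
          by simp
      qed
      also have "\<dots> \<le> (\<integral>\<^sup>+x. ennreal (p x) * (\<integral>\<^sup>+y. ennreal (p y) * ennreal (exp (- ((x - y) / \<epsilon>)\<^sup>2 / 2)) \<partial>lborel) \<partial>lborel)"
        by (intro nn_integral_mono mult_mono ennreal_leI r) auto
      also have "\<dots> = (\<integral>\<^sup>+x. (\<integral>\<^sup>+y. ennreal (exp (- ((x - y) / \<epsilon>)\<^sup>2 / 2)) \<partial>K) \<partial>K)"
        unfolding Kp by (simp add: nn_integral_density)
      also have "\<dots> \<le> ennreal (\<epsilon> / sqrt (2 * pi)) * (\<integral>\<^sup>+\<xi>. ennreal ((norm (char K \<xi>))\<^sup>2) \<partial>lborel)"
        by (rule gaussian_smoothing[OF K \<epsilon>])
      finally have *: "ennreal \<epsilon> * (\<integral>\<^sup>+v. ennreal (exp (- v\<^sup>2 / 2)) * A (\<epsilon> * v) \<partial>lborel)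
        \<le> ennreal (\<epsilon> / sqrt (2 * pi)) * (\<integral>\<^sup>+\<xi>. ennreal ((norm (char K \<xi>))\<^sup>2) \<partial>lborel)" .
      have "(\<integral>\<^sup>+v. ennreal (std_normal_density v) * A (\<epsilon> * v) \<partial>lborel)
        = (\<integral>\<^sup>+v. ennreal (1 / sqrt (2 * pi)) * (ennreal (exp (- v\<^sup>2 / 2)) * A (\<epsilon> * v)) \<partial>lborel)"
        by (intro nn_integral_cong) (simp add: std_normal_density_def ennreal_mult'[symmetric] mult.assoc[symmetric])
      also have "\<dots> = ennreal (1 / sqrt (2 * pi)) * (\<integral>\<^sup>+v. ennreal (exp (- v\<^sup>2 / 2)) * A (\<epsilon> * v) \<partial>lborel)"
        by (rule nn_integral_cmult) measurable
      also have "\<dots> = ennreal (1 / (sqrt (2 * pi) * \<epsilon>)) * (ennreal \<epsilon> * (\<integral>\<^sup>+v. ennreal (exp (- v\<^sup>2 / 2)) * A (\<epsilon> * v) \<partial>lborel))"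
        using \<epsilon> by (simp add: mult.assoc[symmetric] ennreal_mult'[symmetric])
      also have "\<dots> \<le> ennreal (1 / (sqrt (2 * pi) * \<epsilon>)) * (ennreal (\<epsilon> / sqrt (2 * pi)) * (\<integral>\<^sup>+\<xi>. ennreal ((norm (char K \<xi>))\<^sup>2) \<partial>lborel))"
        by (intro mult_left_mono *) auto
      also have "\<dots> = ennreal (1 / (sqrt (2 * pi) * \<epsilon>) * (\<epsilon> / sqrt (2 * pi))) * (\<integral>\<^sup>+\<xi>. ennreal ((norm (char K \<xi>))\<^sup>2) \<partial>lborel)"
        using \<epsilon> by (subst ennreal_mult) (auto simp: mult.assoc)
      also have "1 / (sqrt (2 * pi) * \<epsilon>) * (\<epsilon> / sqrt (2 * pi)) = 1 / (2 * pi)"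
        using \<epsilon> by (simp add: divide_simps)
      finally show ?thesis by (simp add: R_def)
    qed
    \<comment> \<open>A bounded function has an autocorrelation continuous at 0: the change is at
      most the bound \<open>n\<close> times the L^1 modulus of translation. Dividing by n + 1 covers
      n = 0.\<close>
    have lim: "\<forall>\<^sub>F k in sequentially. A 0 - ennreal e \<le> A (1 / Suc k * v)" if e: "e > 0" for e v
      proof -
        obtain d where d: "d > 0" "\<And>h. norm h < d \<Longrightarrow> (\<integral>\<^sup>+x. ennreal \<bar>r (x + h) - r x\<bar> \<partial>lborel) \<le> ennreal (e / (real n + 1))"
          using translation_continuous_L1[OF ri, of "e / (real n + 1)"] e by auto
        have le: "A 0 \<le> A h + ennreal e" if "norm h < d" for h
        proof -
          have "A 0 \<le> (\<integral>\<^sup>+x. ennreal (r x) * ennreal (r (x + h)) + ennreal (real n) * ennreal \<bar>r (x + h) - r x\<bar> \<partial>lborel)"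
            unfolding A_def
          proof (rule nn_integral_mono)
            fix x
            have "r x * (r x - r (x + h)) \<le> real n * \<bar>r (x + h) - r x\<bar>"
            proof -
              have "r x * (r x - r (x + h)) \<le> r x * \<bar>r (x + h) - r x\<bar>" using r by (intro mult_left_mono) auto
              also have "\<dots> \<le> real n * \<bar>r (x + h) - r x\<bar>" using r by (intro mult_right_mono) auto
              finally show ?thesis .
            qed
            then have "r x * r x \<le> r x * r (x + h) + real n * \<bar>r (x + h) - r x\<bar>" by (simp add: algebra_simps)
            then show "ennreal (r x) * ennreal (r (x + 0)) \<le> ennreal (r x) * ennreal (r (x + h)) + ennreal (real n) * ennreal \<bar>r (x + h) - r x\<bar>"
              using r by (simp add: ennreal_mult'[symmetric] ennreal_plus[symmetric] del: ennreal_plus)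
          qed
          also have "\<dots> = A h + ennreal (real n) * (\<integral>\<^sup>+x. ennreal \<bar>r (x + h) - r x\<bar> \<partial>lborel)"
            unfolding A_def by (simp add: nn_integral_add nn_integral_cmult del: ennreal_of_nat_eq_real_of_nat)
          also have "\<dots> \<le> A h + ennreal (real n) * ennreal (e / (real n + 1))"
            by (intro add_left_mono mult_left_mono d that) auto
          also have "ennreal (real n) * ennreal (e / (real n + 1)) \<le> ennreal e"
            using e by (subst ennreal_mult[symmetric]) (auto simp: divide_simps intro!: ennreal_leI)
          finally show ?thesis by (simp add: add_left_mono)
        qed
        have "(\<lambda>k. 1 / Suc k * v) \<longlonglongrightarrow> 0 * v" by (intro tendsto_intros LIMSEQ_Suc lim_1_over_n)
        then have "\<forall>\<^sub>F k in sequentially. norm (1 / Suc k * v) < d"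
          using d(1) tendsto_iff[of "\<lambda>k. 1 / Suc k * v" 0] by (simp add: dist_norm del: of_nat_Suc)
        then show ?thesis
        proof eventually_elim
          case (elim k)
          from le[OF this] show ?case by (simp only: ennreal_minus_le_iff add.commute) auto
        qed
      qed
    have "(\<integral>\<^sup>+x. ennreal ((min (p x) (real n))\<^sup>2) \<partial>lborel) = A 0"
      unfolding A_def r_def[symmetric] by (intro nn_integral_cong) (simp add: r power2_eq_square ennreal_mult)
    also have "A 0 \<le> R"
    proof (rule ennreal_le_epsilon)
      fix e :: real assume e: "0 < e"
      have "(\<integral>\<^sup>+v. ennreal (std_normal_density v) \<partial>lborel) = 1"
        by (subst nn_integral_eq_integral) auto
      \<comment> \<open>The lower bound is constant in the shift, so it is its own average against
        the normal density of total mass 1; Fatou's lemma then applies along \<epsilon> = 1 / Suc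
        k.\<close>
      then have "A 0 - ennreal e = (\<integral>\<^sup>+v. ennreal (std_normal_density v) * (A 0 - ennreal e) \<partial>lborel)"
        by (subst nn_integral_multc) auto
      also have "\<dots> \<le> (\<integral>\<^sup>+v. liminf (\<lambda>k. ennreal (std_normal_density v) * A (1 / Suc k * v)) \<partial>lborel)"
        by (intro nn_integral_mono Liminf_bounded)
          (auto intro!: eventually_mono[OF lim[OF e]] mult_left_mono simp del: of_nat_Suc)
      also have "\<dots> \<le> liminf (\<lambda>k. (\<integral>\<^sup>+v. ennreal (std_normal_density v) * A (1 / Suc k * v) \<partial>lborel))"
        by (rule nn_integral_liminf) measurable
      also have "\<dots> \<le> R"
      proof (rule Liminf_le)
        have "(\<integral>\<^sup>+v. ennreal (std_normal_density v) * A (1 / Suc k * v) \<partial>lborel) \<le> R" for k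
          by (rule smooth) simp
        then show "\<forall>\<^sub>F k in sequentially. (\<integral>\<^sup>+v. ennreal (std_normal_density v) * A (1 / Suc k * v) \<partial>lborel) \<le> R"
          by (intro always_eventually allI)
      qed simp
      finally show "A 0 \<le> R + ennreal e" by (simp only: ennreal_minus_le_iff add.commute)
    qed
    finally show ?thesis .
  qed
  have "(\<integral>\<^sup>+x. ennreal ((p x)\<^sup>2) \<partial>lborel) \<le> (\<integral>\<^sup>+x. liminf (\<lambda>n. ennreal ((min (p x) (real n))\<^sup>2)) \<partial>lborel)"
  proof (rule nn_integral_mono)
    fix x
    have "\<forall>\<^sub>F n in sequentially. ennreal ((p x)\<^sup>2) \<le> ennreal ((min (p x) (real n))\<^sup>2)"
    proof -
      obtain m where "p x \<le> real m" using real_arch_simple by blast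
      then have "\<forall>n\<ge>m. min (p x) (real n) = p x" by auto
      then show ?thesis unfolding eventually_sequentially by (intro exI[of _ m]) auto
    qed
    then show "ennreal ((p x)\<^sup>2) \<le> liminf (\<lambda>n. ennreal ((min (p x) (real n))\<^sup>2))" by (rule Liminf_bounded)
  qed
  also have "\<dots> \<le> liminf (\<lambda>n. (\<integral>\<^sup>+x. ennreal ((min (p x) (real n))\<^sup>2) \<partial>lborel))"
    by (rule nn_integral_liminf) measurable
  also have "\<dots> \<le> R" by (rule Liminf_le) (auto intro!: always_eventually trunc)
  finally show ?thesis unfolding R_def .
qed

section \<open>The transition kernel\<close>

definition slab :: "real \<Rightarrow> (real \<times> real) set" where "slab T = {0<..T} \<times> UNIV"

lemma slab_sets[measurable]: "slab T \<in> sets borel"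
  unfolding slab_def by (intro borel_Times) auto

lemma fst_snd_borel[measurable]:
  "fst \<in> borel_measurable (borel :: (real \<times> real) measure)"
  "snd \<in> borel_measurable (borel :: (real \<times> real) measure)"
  by (auto intro!: borel_measurable_continuous_onI continuous_intros)

lemma Pair_borel:
  assumes [measurable]: "f \<in> borel_measurable M" "g \<in> borel_measurable M"
  shows "(\<lambda>x. (f x, g x) :: real \<times> real) \<in> borel_measurable M"
  by (rule borel_measurable_Pair) measurable

lemma nn_integral_lborel2:
  assumes "H \<in> borel_measurable (borel :: (real \<times> real) measure)"
  shows "(\<integral>\<^sup>+z. H z \<partial>lborel) = (\<integral>\<^sup>+s. \<integral>\<^sup>+y. H (s, y) \<partial>lborel \<partial>lborel)"
proof -
  have "(\<integral>\<^sup>+z. H z \<partial>lborel) = (\<integral>\<^sup>+z. H z \<partial>(lborel \<Otimes>\<^sub>M lborel))" by (simp add: lborel_prod)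
  also have "\<dots> = (\<integral>\<^sup>+s. \<integral>\<^sup>+y. H (s, y) \<partial>lborel \<partial>lborel)"
    by (rule lborel.nn_integral_fst[symmetric]) (use assms in \<open>simp add: lborel_prod\<close>)
  finally show ?thesis .
qed

text \<open>Reflecting time about t and translating space by x preserve Lebesgue measure. This turns
  the backward kernel of the mild equation into the kernel at the origin.\<close>

lemma nn_integral_reflect:
  assumes H[measurable]: "H \<in> borel_measurable (borel :: (real \<times> real) measure)"
  shows "(\<integral>\<^sup>+z. H (t - fst z, snd z - x) \<partial>lborel) = (\<integral>\<^sup>+z. H z \<partial>lborel)"
proof -
  have m: "(\<lambda>z. H (t - fst z, snd z - x)) \<in> borel_measurable borel"
    by (rule measurable_compose[OF Pair_borel H]) measurable
  have Hs: "(\<lambda>y. H (s, y)) \<in> borel_measurable borel" for s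
    by (rule measurable_compose[OF Pair_borel H]) measurable
  have inner: "(\<lambda>s. \<integral>\<^sup>+y. H (s, y) \<partial>lborel) \<in> borel_measurable borel"
  proof -
    have "H \<in> borel_measurable (lborel \<Otimes>\<^sub>M lborel)" using H by (simp add: lborel_prod)
    then show ?thesis using lborel.borel_measurable_nn_integral_fst[of H lborel] by simp
  qed
  have "(\<integral>\<^sup>+z. H (t - fst z, snd z - x) \<partial>lborel) = (\<integral>\<^sup>+s. \<integral>\<^sup>+y. H (t - s, y - x) \<partial>lborel \<partial>lborel)"
    using nn_integral_lborel2[OF m] by simp
  also have "\<dots> = (\<integral>\<^sup>+s. \<integral>\<^sup>+y. H (t - s, y) \<partial>lborel \<partial>lborel)"
    using nn_integral_real_affine[OF Hs, of 1 _ "- x"] by (simp add: uminus_add_conv_diff)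
  also have "\<dots> = (\<integral>\<^sup>+s. \<integral>\<^sup>+y. H (s, y) \<partial>lborel \<partial>lborel)"
    using nn_integral_real_affine[OF inner, of "-1" t] by simp
  finally show ?thesis using nn_integral_lborel2[OF H] by simp
qed

lemma nn_integral_exp_decay:
  assumes "0 < c" shows "(\<integral>\<^sup>+s. ennreal (exp (- c * s)) * indicator {0<..} s \<partial>lborel) = ennreal (1 / c)"
proof -
  have "(\<integral>\<^sup>+s. ennreal (exp (- c * s)) * indicator {0<..} s \<partial>lborel) = (\<integral>\<^sup>+s. ennreal (exp (- c * s)) * indicator {0..} s \<partial>lborel)"
    by (intro nn_integral_cong_AE eventually_mono[OF AE_lborel_singleton[of 0]]) (auto simp: indicator_def)
  also have "\<dots> = ennreal (0 - (- exp (- c * 0) / c))"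
  proof (rule nn_integral_FTC_atLeast)
    show "((\<lambda>s. - exp (- c * s) / c) \<longlongrightarrow> 0) at_top"
    proof -
      have "((\<lambda>s. - exp (- c * s) / c) \<longlongrightarrow> - 0 / c) at_top"
        using assms by (intro tendsto_intros filterlim_compose[OF exp_at_bot] filterlim_tendsto_neg_mult_at_bot[OF tendsto_const]) (auto intro: filterlim_ident)
      then show ?thesis by simp
    qed
    show "((\<lambda>s. - exp (- c * s) / c) has_real_derivative exp (- c * x)) (at x)" for x
      using assms by (auto intro!: derivative_eq_intros)
  qed auto
  finally show ?thesis using assms by simp
qed

text \<open>The transition density extended by 0 to nonpositive times. The extension absorbs the
  cut-off at s < t of the mild equation and avoids the meaningless density at time 0.\<close>

definition pker :: "(real \<Rightarrow> real \<Rightarrow> real) \<Rightarrow> real \<times> real \<Rightarrow> real" where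
  "pker p z = indicator halfspace z * p (fst z) (snd z)"

lemma pker_eq: "indicator {0..<t} s * p (t - s) (y - x) = indicator {0..} s * pker p (t - s, y - x)"
  by (auto simp: pker_def halfspace_def indicator_def)

locale levy_setting =
  fixes N :: "'v measure" and Xp :: "real \<Rightarrow> 'v \<Rightarrow> real" and \<Psi> :: "real \<Rightarrow> complex" and p :: "real \<Rightarrow> real \<Rightarrow> real"
  assumes levy: "levy_process N Xp" and chexp: "characteristic_exponent N Xp \<Psi>"
    and Ups: "\<forall>\<beta>>0. Upsilon \<Psi> \<beta> < \<infinity>" and dens: "transition_density N Xp p"
begin

lemma pker_nonneg: "0 \<le> pker p z"
  using dens by (cases z) (auto simp: pker_def halfspace_def indicator_def transition_density_def)

lemma pker_borel: "pker p \<in> borel_measurable borel"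
proof -
  have "(\<lambda>(t, y). p t y) \<in> borel_measurable (restrict_space borel halfspace)"
    using dens by (simp add: transition_density_def halfspace_def)
  then have "(\<lambda>z. indicator halfspace z *\<^sub>R (case z of (t, y) \<Rightarrow> p t y)) \<in> borel_measurable borel"
    by (subst (asm) borel_measurable_restrict_space_iff) auto
  then show ?thesis by (simp add: pker_def[abs_def] split_def)
qed

lemma levy_X_meas: "0 \<le> s \<Longrightarrow> Xp s \<in> borel_measurable N"
  using levy by (simp add: levy_process_def)

lemma levy_distr:
  assumes "0 \<le> s" shows "real_distribution (distr N borel (Xp s))"
proof -
  interpret prob_space N using levy by (simp add: levy_process_def)
  show ?thesis using levy_X_meas[OF assms] by (rule real_distribution_distr)
qed

lemma density_borel:
  assumes "0 < s" shows "p s \<in> borel_measurable borel"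
proof -
  have "(\<lambda>y. pker p (s, y)) \<in> borel_measurable borel"
    by (rule measurable_compose[OF Pair_borel pker_borel]) measurable
  then show ?thesis using assms by (simp add: pker_def halfspace_def)
qed

lemma levy_density: "0 < s \<Longrightarrow> distr N borel (Xp s) = density lborel (\<lambda>y. ennreal (p s y))"
proof -
  assume s: "0 < s"
  then have "distributed N lborel (Xp s) (\<lambda>y. ennreal (p s y))"
    using dens by (simp add: transition_density_def)
  then have "distr N lborel (Xp s) = density lborel (\<lambda>y. ennreal (p s y))" by (simp add: distributed_def)
  moreover have "distr N borel (Xp s) = distr N lborel (Xp s)" by (rule distr_cong) auto
  ultimately show ?thesis by simp
qed

lemma norm_char_levy: "0 \<le> s \<Longrightarrow> (norm (char (distr N borel (Xp s)) \<xi>))\<^sup>2 = exp (- (2 * s * Re (\<Psi> \<xi>)))"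
  using chexp by (simp add: characteristic_exponent_def power2_eq_square exp_add[symmetric])

lemma Re_exponent_nonneg: "0 \<le> Re (\<Psi> \<xi>)"
proof -
  interpret real_distribution "distr N borel (Xp 1)" by (rule levy_distr) simp
  have "(norm (char (distr N borel (Xp 1)) \<xi>))\<^sup>2 \<le> 1" using cmod_char_le_1 by (simp add: power_le_one)
  then show ?thesis using norm_char_levy[of 1 \<xi>] by simp
qed

text \<open>Measurability of \<open>\<Psi>\<close> is not part of its definition; its real part is
  recovered as a logarithm of the modulus of the characteristic function at time 1.\<close>

lemma Re_exponent_borel: "(\<lambda>\<xi>. Re (\<Psi> \<xi>)) \<in> borel_measurable borel"
proof -
  interpret real_distribution "distr N borel (Xp 1)" by (rule levy_distr) simp
  have [measurable]: "char (distr N borel (Xp 1)) \<in> borel_measurable borel" by (rule char_measurable)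
  have "Re (\<Psi> \<xi>) = - ln ((norm (char (distr N borel (Xp 1)) \<xi>))\<^sup>2) / 2" for \<xi>
    using norm_char_levy[of 1 \<xi>] by simp
  then show ?thesis by simp
qed

lemma density_L2:
  assumes s: "0 < s"
  shows "(\<integral>\<^sup>+y. ennreal ((p s y)\<^sup>2) \<partial>lborel) \<le> ennreal (1 / (2 * pi)) * (\<integral>\<^sup>+\<xi>. ennreal (exp (- (2 * s * Re (\<Psi> \<xi>)))) \<partial>lborel)"
  using plancherel_le[OF levy_distr[of s] density_borel[OF s] _ levy_density[OF s]] s dens
  by (simp add: norm_char_levy transition_density_def)

text \<open>Plancherel's inequality at each time s bounds the spatial L^2 norm by a Fourier integral
  of exp (-2 s Re \<Psi>). On the slab the factor exp (T - s) is at least 1; inserting it and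
  integrating in s produces exp T times \<Upsilon>(1).\<close>

lemma pker_slab_finite: "(\<integral>\<^sup>+z\<in>slab T. ennreal ((pker p z)\<^sup>2) \<partial>lborel) < \<infinity>"
proof -
  note [measurable] = pker_borel Re_exponent_borel
  have sec: "(\<lambda>y. pker p (s, y)) \<in> borel_measurable borel" for s
    by (rule measurable_compose[OF Pair_borel pker_borel]) measurable
  have "(\<integral>\<^sup>+z\<in>slab T. ennreal ((pker p z)\<^sup>2) \<partial>lborel) = (\<integral>\<^sup>+s. \<integral>\<^sup>+y. ennreal ((pker p (s, y))\<^sup>2) * indicator (slab T) (s, y) \<partial>lborel \<partial>lborel)"
    by (rule nn_integral_lborel2) measurable
  also have "\<dots> \<le> (\<integral>\<^sup>+s. ennreal (exp T / (2 * pi)) * (\<integral>\<^sup>+\<xi>. ennreal (exp (- (1 + 2 * Re (\<Psi> \<xi>)) * s)) * indicator {0<..} s \<partial>lborel) \<partial>lborel)"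
  proof (rule nn_integral_mono)
    fix s :: real
    show "(\<integral>\<^sup>+y. ennreal ((pker p (s, y))\<^sup>2) * indicator (slab T) (s, y) \<partial>lborel)
      \<le> ennreal (exp T / (2 * pi)) * (\<integral>\<^sup>+\<xi>. ennreal (exp (- (1 + 2 * Re (\<Psi> \<xi>)) * s)) * indicator {0<..} s \<partial>lborel)"
    proof (cases "0 < s \<and> s \<le> T")
      case True
      have "(\<integral>\<^sup>+y. ennreal ((pker p (s, y))\<^sup>2) * indicator (slab T) (s, y) \<partial>lborel) = (\<integral>\<^sup>+y. ennreal ((p s y)\<^sup>2) \<partial>lborel)"
        using True by (simp add: pker_def halfspace_def slab_def)
      also have "\<dots> \<le> ennreal (1 / (2 * pi)) * (\<integral>\<^sup>+\<xi>. ennreal (exp (- (2 * s * Re (\<Psi> \<xi>)))) \<partial>lborel)"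
        using True by (intro density_L2) simp
      also have "\<dots> \<le> ennreal (exp (T - s) / (2 * pi)) * (\<integral>\<^sup>+\<xi>. ennreal (exp (- (2 * s * Re (\<Psi> \<xi>)))) \<partial>lborel)"
        using True by (intro mult_right_mono ennreal_leI divide_right_mono) auto
      also have "\<dots> = ennreal (exp T / (2 * pi)) * (ennreal (exp (- s)) * (\<integral>\<^sup>+\<xi>. ennreal (exp (- (2 * s * Re (\<Psi> \<xi>)))) \<partial>lborel))"
      proof -
        have "exp (T - s) / (2 * pi) = exp T / (2 * pi) * exp (- s)"
          unfolding exp_diff exp_minus by (simp add: field_simps)
        then have "ennreal (exp (T - s) / (2 * pi)) = ennreal (exp T / (2 * pi)) * ennreal (exp (- s))"
          by (subst ennreal_mult'[symmetric]) auto
        then show ?thesis by (simp only: mult.assoc)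
      qed
      also have "\<dots> = ennreal (exp T / (2 * pi)) * (\<integral>\<^sup>+\<xi>. ennreal (exp (- (1 + 2 * Re (\<Psi> \<xi>)) * s)) * indicator {0<..} s \<partial>lborel)"
        using True by (subst nn_integral_cmult[symmetric], measurable)
          (simp add: ennreal_mult'[symmetric] exp_add[symmetric] algebra_simps)
      finally show ?thesis .
    qed (auto simp: slab_def indicator_def)
  qed
  also have "\<dots> = ennreal (exp T / (2 * pi)) * (\<integral>\<^sup>+s. \<integral>\<^sup>+\<xi>. ennreal (exp (- (1 + 2 * Re (\<Psi> \<xi>)) * s)) * indicator {0<..} s \<partial>lborel \<partial>lborel)"
    by (rule nn_integral_cmult) measurable
  also have "(\<integral>\<^sup>+s. \<integral>\<^sup>+\<xi>. ennreal (exp (- (1 + 2 * Re (\<Psi> \<xi>)) * s)) * indicator {0<..} s \<partial>lborel \<partial>lborel)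
    = (\<integral>\<^sup>+\<xi>. \<integral>\<^sup>+s. ennreal (exp (- (1 + 2 * Re (\<Psi> \<xi>)) * s)) * indicator {0<..} s \<partial>lborel \<partial>lborel)"
    by (rule lborel_pair.Fubini') (simp add: split_def)
  also have "\<dots> = (\<integral>\<^sup>+\<xi>. ennreal (1 / (1 + 2 * Re (\<Psi> \<xi>))) \<partial>lborel)"
    by (intro nn_integral_cong nn_integral_exp_decay) (use Re_exponent_nonneg in \<open>auto intro: add_pos_nonneg\<close>)
  also have "ennreal (exp T / (2 * pi)) * \<dots> = ennreal (exp T) * Upsilon \<Psi> 1"
    by (simp add: Upsilon_def mult.assoc[symmetric] ennreal_mult'[symmetric])
  also have "\<dots> < \<infinity>" using Ups[rule_format, of 1] by (simp add: ennreal_mult_less_top)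
  finally show ?thesis .
qed

text \<open>Dominated convergence in \<beta>: the weight tends to 0 at every positive time and the
  square of the kernel is an integrable majorant on the slab.\<close>

lemma pker_weighted:
  assumes "0 < e"
  shows "\<exists>\<beta>>0. (\<integral>\<^sup>+z\<in>slab T. ennreal (exp (- \<beta> * fst z) * (pker p z)\<^sup>2) \<partial>lborel) \<le> ennreal e"
proof -
  note [measurable] = pker_borel
  have "(\<lambda>j. (\<integral>\<^sup>+z. ennreal (exp (- real j * fst z) * (pker p z)\<^sup>2) * indicator (slab T) z \<partial>lborel)) \<longlonglongrightarrow> (\<integral>\<^sup>+z. 0 \<partial>(lborel :: (real \<times> real) measure))"
  proof (rule nn_integral_dominated_convergence[where w="\<lambda>z. ennreal ((pker p z)\<^sup>2) * indicator (slab T) z"])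
    show "AE z in lborel. ennreal (exp (- real j * fst z) * (pker p z)\<^sup>2) * indicator (slab T) z \<le> ennreal ((pker p z)\<^sup>2) * indicator (slab T) z" for j
      by (intro AE_I2) (auto simp: slab_def indicator_def intro!: ennreal_leI mult_left_le_one_le)
    show "(\<integral>\<^sup>+z. ennreal ((pker p z)\<^sup>2) * indicator (slab T) z \<partial>lborel) < \<infinity>" by (rule pker_slab_finite)
    show "AE z in lborel. (\<lambda>j. ennreal (exp (- real j * fst z) * (pker p z)\<^sup>2) * indicator (slab T) z) \<longlonglongrightarrow> 0"
    proof (intro AE_I2)
      fix z :: "real \<times> real"
      show "(\<lambda>j. ennreal (exp (- real j * fst z) * (pker p z)\<^sup>2) * indicator (slab T) z) \<longlonglongrightarrow> 0"
      proof (cases "z \<in> slab T")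
        case True
        then have z: "0 < fst z" by (auto simp: slab_def)
        have "(\<lambda>j. exp (- real j * fst z) * (pker p z)\<^sup>2) = (\<lambda>j. exp (- fst z) ^ j * (pker p z)\<^sup>2)"
          by (simp add: exp_of_nat_mult[symmetric])
        also have "\<dots> \<longlonglongrightarrow> 0 * (pker p z)\<^sup>2"
          using z by (intro tendsto_intros LIMSEQ_realpow_zero) auto
        finally have "(\<lambda>j. ennreal (exp (- real j * fst z) * (pker p z)\<^sup>2)) \<longlonglongrightarrow> ennreal 0" by (intro tendsto_ennrealI) simp
        then show ?thesis using True by simp
      qed simp
    qed
  qed measurable
  then have "\<forall>\<^sub>F j in sequentially. (\<integral>\<^sup>+z. ennreal (exp (- real j * fst z) * (pker p z)\<^sup>2) * indicator (slab T) z \<partial>lborel) < ennreal e"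
    using assms by (intro order_tendstoD) auto
  then obtain n where "\<And>j. n \<le> j \<Longrightarrow> (\<integral>\<^sup>+z. ennreal (exp (- real j * fst z) * (pker p z)\<^sup>2) * indicator (slab T) z \<partial>lborel) < ennreal e"
    by (auto simp: eventually_sequentially)
  \<comment> \<open>The successor makes \<beta> strictly positive.\<close>
  from this[of "Suc n"] show ?thesis by (intro exI[of _ "real (Suc n)"]) (auto simp del: of_nat_Suc intro: less_imp_le)
qed

lemma pker_shift_L2:
  assumes "0 \<le> t" "t \<le> T" and [measurable]: "c \<in> borel_measurable borel"
  shows "(\<integral>\<^sup>+z\<in>halfspace. ennreal ((pker p (t - fst z, snd z - x))\<^sup>2) * c (fst z) \<partial>lborel)
    \<le> (\<integral>\<^sup>+z\<in>slab T. ennreal ((pker p z)\<^sup>2) * c (t - fst z) \<partial>lborel)"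
proof -
  note [measurable] = pker_borel
  have "(\<integral>\<^sup>+z\<in>halfspace. ennreal ((pker p (t - fst z, snd z - x))\<^sup>2) * c (fst z) \<partial>lborel)
    \<le> (\<integral>\<^sup>+z. (\<lambda>z. ennreal ((pker p z)\<^sup>2) * c (t - fst z) * indicator (slab T) z) (t - fst z, snd z - x) \<partial>lborel)"
    using assms(2) by (intro nn_integral_mono) (auto simp: pker_def halfspace_def slab_def indicator_def)
  also have "\<dots> = (\<integral>\<^sup>+z. ennreal ((pker p z)\<^sup>2) * c (t - fst z) * indicator (slab T) z \<partial>lborel)"
    by (rule nn_integral_reflect) measurable
  finally show ?thesis .
qed

text \<open>After reflection both kernels are translates of the same function, with offset (t' - t,
  x - x'). Continuity of translations in L^2 of the plane thus gives a modulus independent of the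
  base point.\<close>

lemma pker_modulus:
  assumes "0 < e"
  shows "\<exists>d>0. \<forall>t\<in>{0..T}. \<forall>t'\<in>{0..T}. \<forall>x x'. \<bar>t - t'\<bar> < d \<longrightarrow> \<bar>x - x'\<bar> < d \<longrightarrow>
    (\<integral>\<^sup>+z\<in>halfspace. ennreal ((pker p (t - fst z, snd z - x) - pker p (t' - fst z, snd z - x'))\<^sup>2) \<partial>lborel) \<le> ennreal e"
proof -
  note [measurable] = pker_borel
  \<comment> \<open>Square integrability is known on slabs only. Cutting off at T is invisible here,
    since t - s stays below T for s > 0 and t up to T.\<close>
  define q where "q z = indicator (slab T) z * pker p z" for z
  have [measurable]: "q \<in> borel_measurable borel" unfolding q_def by measurable
  have "0 \<le> q z" for z using pker_nonneg by (simp add: q_def)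
  moreover have "(\<integral>\<^sup>+z. ennreal ((q z)\<^sup>2) \<partial>lborel) < \<infinity>"
  proof -
    have "(\<integral>\<^sup>+z. ennreal ((q z)\<^sup>2) \<partial>lborel) = (\<integral>\<^sup>+z\<in>slab T. ennreal ((pker p z)\<^sup>2) \<partial>lborel)"
      by (intro nn_integral_cong) (auto simp: q_def indicator_def)
    then show ?thesis using pker_slab_finite by simp
  qed
  ultimately obtain d where d: "d > 0" "\<And>h. norm h < d \<Longrightarrow> (\<integral>\<^sup>+z. ennreal ((q (z + h) - q z)\<^sup>2) \<partial>lborel) \<le> ennreal e"
    using translation_continuous_L2[of q e] assms by auto
  show ?thesis
  proof (intro exI[of _ "d / 2"] conjI ballI allI impI)
    fix t t' x x' assume t: "t \<in> {0..T}" "t' \<in> {0..T}" "\<bar>t - t'\<bar> < d / 2" "\<bar>x - x'\<bar> < d / 2"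
    define h where "h = (t' - t, x - x')"
    have "norm h \<le> \<bar>t' - t\<bar> + \<bar>x - x'\<bar>" using norm_Pair_le[of "t' - t" "x - x'"] by (simp add: h_def)
    then have h: "norm h < d" using t(3,4) by linarith
    have "(\<integral>\<^sup>+z\<in>halfspace. ennreal ((pker p (t - fst z, snd z - x) - pker p (t' - fst z, snd z - x'))\<^sup>2) \<partial>lborel)
      \<le> (\<integral>\<^sup>+z. (\<lambda>z. ennreal ((q (z + h) - q z)\<^sup>2)) (t - fst z, snd z - x) \<partial>lborel)"
    proof (rule nn_integral_mono)
      fix z :: "real \<times> real"
      show "ennreal ((pker p (t - fst z, snd z - x) - pker p (t' - fst z, snd z - x'))\<^sup>2) * indicator halfspace z
        \<le> ennreal ((q ((t - fst z, snd z - x) + h) - q (t - fst z, snd z - x))\<^sup>2)"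
      proof (cases "z \<in> halfspace")
        case True
        then have z: "0 < fst z" by (auto simp: halfspace_def)
        have "pker p (t - fst z, snd z - x) = q (t - fst z, snd z - x)"
          "pker p (t' - fst z, snd z - x') = q (t' - fst z, snd z - x')"
          using z t by (auto simp: q_def pker_def slab_def halfspace_def indicator_def)
        moreover have "(t - fst z, snd z - x) + h = (t' - fst z, snd z - x')" by (simp add: h_def)
        ultimately show ?thesis by (simp only: power2_commute) (simp add: indicator_def)
      qed simp
    qed
    also have "\<dots> = (\<integral>\<^sup>+z. ennreal ((q (z + h) - q z)\<^sup>2) \<partial>lborel)" by (rule nn_integral_reflect) measurable
    also have "\<dots> \<le> ennreal e" by (rule d(2)[OF h])
    finally show "(\<integral>\<^sup>+z\<in>halfspace. ennreal ((pker p (t - fst z, snd z - x) - pker p (t' - fst z, snd z - x'))\<^sup>2) \<partial>lborel) \<le> ennreal e" .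
  qed (use d in auto)
qed

section \<open>The semigroup acting on the initial datum\<close>

lemma levy_stationary:
  assumes "0 \<le> s" "0 \<le> t"
  shows "distr N borel (\<lambda>\<omega>. Xp (s + t) \<omega> - Xp s \<omega>) = distr N borel (Xp t)"
  using levy assms by (simp add: levy_process_def)

text \<open>The probabilistic form treats t = 0 on the same footing, as the process starts at 0
  almost surely, and reduces continuity of the semigroup to properties of the process.\<close>

lemma semigroup_eq:
  assumes u0: "u0 \<in> borel_measurable borel" and t: "0 \<le> t"
  shows "levy_semigroup p t u0 x = (\<integral>\<omega>. u0 (x + Xp t \<omega>) \<partial>N)"
proof -
  interpret prob_space N using levy by (simp add: levy_process_def)
  note [measurable] = u0 levy_X_meas[OF t]
  show ?thesis
  proof (cases "t = 0")
    case True
    have "AE \<omega> in N. Xp 0 \<omega> = 0" using levy by (simp add: levy_process_def)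
    then have "(\<integral>\<omega>. u0 (x + Xp t \<omega>) \<partial>N) = (\<integral>\<omega>. u0 x \<partial>N)"
      using True levy_X_meas[of 0] by (intro integral_cong_AE) (auto elim!: eventually_mono)
    then show ?thesis using True by (simp add: levy_semigroup_def prob_space)
  next
    case False
    then have t0: "0 < t" using t by simp
    have [measurable]: "p t \<in> borel_measurable borel" by (rule density_borel[OF t0])
    have "levy_semigroup p t u0 x = (\<integral>y. p t (y - x) * u0 y \<partial>lborel)" using False by (simp add: levy_semigroup_def)
    also have "\<dots> = (\<integral>y. p t y * u0 (x + y) \<partial>lborel)"
      using lborel_integral_real_affine[of 1 "\<lambda>y. p t (y - x) * u0 y" x] by simp
    also have "\<dots> = (\<integral>y. u0 (x + y) \<partial>distr N borel (Xp t))"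
      unfolding levy_density[OF t0] using t0 dens
      by (subst integral_density) (auto simp: transition_density_def)
    also have "\<dots> = (\<integral>\<omega>. u0 (x + Xp t \<omega>) \<partial>N)" by (subst integral_distr) auto
    finally show ?thesis .
  qed
qed

lemma semigroup_bounded:
  assumes u0: "u0 \<in> borel_measurable borel" and b: "\<And>x. \<bar>u0 x\<bar> \<le> U" and t: "0 \<le> t"
  shows "\<bar>levy_semigroup p t u0 x\<bar> \<le> U"
proof -
  interpret prob_space N using levy by (simp add: levy_process_def)
  note [measurable] = u0 levy_X_meas[OF t]
  have i: "integrable N (\<lambda>\<omega>. u0 (x + Xp t \<omega>))" by (rule integrable_const_bound[where B=U]) (use b in auto)
  have "\<bar>\<integral>\<omega>. u0 (x + Xp t \<omega>) \<partial>N\<bar> \<le> (\<integral>\<omega>. \<bar>u0 (x + Xp t \<omega>)\<bar> \<partial>N)"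
    using integral_norm_bound[of N "\<lambda>\<omega>. u0 (x + Xp t \<omega>)"] by simp
  also have "\<dots> \<le> U" using i b by (intro integral_le_const) auto
  finally show ?thesis unfolding semigroup_eq[OF u0 t] .
qed

text \<open>Both values are expectations over the same path. Outside the exceptional events the
  difference is at most \<open>e\<close>; on them the bound on u0 gives 2 U. Two events are allowed
  because one controls increments and the other large values.\<close>

lemma semigroup_diff:
  assumes u0: "u0 \<in> borel_measurable borel" and b: "\<And>x. \<bar>u0 x\<bar> \<le> U" and t: "0 \<le> t" "0 \<le> t'"
    and E: "E \<in> sets N" and D: "D \<in> sets N" and e: "0 \<le> e"
    and close: "\<And>\<omega>. \<omega> \<in> space N \<Longrightarrow> \<omega> \<notin> E \<Longrightarrow> \<omega> \<notin> D \<Longrightarrow> \<bar>u0 (x + Xp t \<omega>) - u0 (x' + Xp t' \<omega>)\<bar> \<le> e"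
  shows "\<bar>levy_semigroup p t u0 x - levy_semigroup p t' u0 x'\<bar> \<le> e + 2 * U * (measure N E + measure N D)"
proof -
  interpret prob_space N using levy by (simp add: levy_process_def)
  note [measurable] = u0 levy_X_meas[OF t(1)] levy_X_meas[OF t(2)] E D
  have i: "integrable N (\<lambda>\<omega>. u0 (x + Xp t \<omega>))" "integrable N (\<lambda>\<omega>. u0 (x' + Xp t' \<omega>))"
    by (rule integrable_const_bound[where B=U]; use b in auto)+
  have U: "0 \<le> U" using b[of 0] by simp
  have "\<bar>levy_semigroup p t u0 x - levy_semigroup p t' u0 x'\<bar> = \<bar>\<integral>\<omega>. u0 (x + Xp t \<omega>) - u0 (x' + Xp t' \<omega>) \<partial>N\<bar>"
    using i by (simp add: semigroup_eq u0 t)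
  also have "\<dots> \<le> (\<integral>\<omega>. \<bar>u0 (x + Xp t \<omega>) - u0 (x' + Xp t' \<omega>)\<bar> \<partial>N)"
    using integral_norm_bound[of N "\<lambda>\<omega>. u0 (x + Xp t \<omega>) - u0 (x' + Xp t' \<omega>)"] by simp
  also have "\<dots> \<le> (\<integral>\<omega>. e + 2 * U * (indicator E \<omega> + indicator D \<omega>) \<partial>N)"
  proof (rule integral_mono)
    show "integrable N (\<lambda>\<omega>. e + 2 * U * (indicator E \<omega> + indicator D \<omega>))"
      by (intro Bochner_Integration.integrable_add integrable_mult_right integrable_real_indicator integrable_const)
        (auto simp: emeasure_eq_measure)
    fix \<omega> assume \<omega>: "\<omega> \<in> space N"
    have "\<bar>u0 (x + Xp t \<omega>) - u0 (x' + Xp t' \<omega>)\<bar> \<le> 2 * U" using b[of "x + Xp t \<omega>"] b[of "x' + Xp t' \<omega>"] by linarith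
    then show "\<bar>u0 (x + Xp t \<omega>) - u0 (x' + Xp t' \<omega>)\<bar> \<le> e + 2 * U * (indicator E \<omega> + indicator D \<omega>)"
      using close[OF \<omega>] U e by (cases "\<omega> \<in> E"; cases "\<omega> \<in> D") auto
  qed (use i in auto)
  also have "\<dots> = e + 2 * U * (measure N E + measure N D)"
    by (simp add: prob_space emeasure_eq_measure)
  finally show ?thesis .
qed

end

section \<open>Continuity of the semigroup in time and space\<close>

context levy_setting
begin

text \<open>Stationarity of the increments reduces the claim to stochastic continuity at time 0,
  which makes it uniform over all pairs of times.\<close>

lemma increment_small:
  assumes "0 < \<eta>" "0 < e"
  shows "\<exists>d>0. \<forall>s\<ge>0. \<forall>t\<ge>0. \<bar>t - s\<bar> < d \<longrightarrow> measure N {\<omega> \<in> space N. \<eta> < \<bar>Xp t \<omega> - Xp s \<omega>\<bar>} < e"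
proof -
  interpret prob_space N using levy by (simp add: levy_process_def)
  have AE0: "AE \<omega> in N. Xp 0 \<omega> = 0" using levy by (simp add: levy_process_def)
  have "((\<lambda>s. measure N {\<omega> \<in> space N. \<eta> < \<bar>Xp s \<omega> - Xp 0 \<omega>\<bar>}) \<longlongrightarrow> 0) (at 0 within {0..})"
    using levy assms unfolding levy_process_def by auto
  then have "\<forall>\<^sub>F s in at 0 within {0..}. measure N {\<omega> \<in> space N. \<eta> < \<bar>Xp s \<omega> - Xp 0 \<omega>\<bar>} < e"
    using assms(2) by (intro order_tendstoD) auto
  then obtain d where d: "d > 0" "\<And>s. 0 \<le> s \<Longrightarrow> s \<noteq> 0 \<Longrightarrow> s < d \<Longrightarrow> measure N {\<omega> \<in> space N. \<eta> < \<bar>Xp s \<omega> - Xp 0 \<omega>\<bar>} < e"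
    unfolding eventually_at by (auto simp: dist_real_def)
  have one: "measure N {\<omega> \<in> space N. \<eta> < \<bar>Xp t \<omega> - Xp s \<omega>\<bar>} < e" if st: "0 \<le> s" "s < t" "t - s < d" for s t
  proof -
    note [measurable] = levy_X_meas[OF st(1)] levy_X_meas[of t] levy_X_meas[of "t - s"] levy_X_meas[of 0]
    have tm[measurable]: "Xp t \<in> borel_measurable N" "Xp (t - s) \<in> borel_measurable N" "Xp 0 \<in> borel_measurable N"
      using levy_X_meas st by auto
    have "measure N {\<omega> \<in> space N. \<eta> < \<bar>Xp t \<omega> - Xp s \<omega>\<bar>} = measure (distr N borel (\<lambda>\<omega>. Xp (s + (t - s)) \<omega> - Xp s \<omega>)) {v. \<eta> < \<bar>v\<bar>}"
      by (subst measure_distr) (auto intro!: arg_cong[where f="measure N"])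
    also have "\<dots> = measure (distr N borel (Xp (t - s))) {v. \<eta> < \<bar>v\<bar>}"
      using levy_stationary[of s "t - s"] st by simp
    also have "\<dots> = measure N {\<omega> \<in> space N. \<eta> < \<bar>Xp (t - s) \<omega>\<bar>}"
      by (subst measure_distr) (auto intro!: arg_cong[where f="measure N"])
    also have "\<dots> = measure N {\<omega> \<in> space N. \<eta> < \<bar>Xp (t - s) \<omega> - Xp 0 \<omega>\<bar>}"
      by (rule measure_eq_AE) (use AE0 in auto)
    also have "\<dots> < e" using d(2)[of "t - s"] st by simp
    finally show ?thesis .
  qed
  show ?thesis
  proof (intro exI[of _ d] conjI d(1) allI impI)
    fix s t :: real assume st: "0 \<le> s" "0 \<le> t" "\<bar>t - s\<bar> < d"
    show "measure N {\<omega> \<in> space N. \<eta> < \<bar>Xp t \<omega> - Xp s \<omega>\<bar>} < e"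
    proof (cases s t rule: linorder_cases)
      case less then show ?thesis using one[of s t] st by simp
    next
      case equal then show ?thesis using assms by simp
    next
      case greater then show ?thesis using one[of t s] st by (simp add: abs_minus_commute)
    qed
  qed
qed

lemma semigroup_uniform:
  assumes u0: "u0 \<in> borel_measurable borel" "uniformly_continuous_on UNIV u0" and b: "\<And>x. \<bar>u0 x\<bar> \<le> U" and e: "0 < e"
  shows "\<exists>d>0. \<forall>s\<ge>0. \<forall>t\<ge>0. \<forall>x y. \<bar>t - s\<bar> < d \<longrightarrow> \<bar>x - y\<bar> < d \<longrightarrow>
    \<bar>levy_semigroup p t u0 x - levy_semigroup p s u0 y\<bar> \<le> e"
proof -
  have U: "0 \<le> U" using b[of 0] by simp
  obtain \<eta> where \<eta>: "\<eta> > 0" "\<And>x y. \<bar>x - y\<bar> < \<eta> \<Longrightarrow> \<bar>u0 x - u0 y\<bar> < e / 2"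
    using u0(2) e unfolding uniformly_continuous_on_def dist_real_def by (metis UNIV_I half_gt_zero abs_minus_commute)
  obtain d where d: "d > 0" "\<And>s t. 0 \<le> s \<Longrightarrow> 0 \<le> t \<Longrightarrow> \<bar>t - s\<bar> < d \<Longrightarrow>
      measure N {\<omega> \<in> space N. \<eta> / 2 < \<bar>Xp t \<omega> - Xp s \<omega>\<bar>} < e / (4 * (U + 1))"
    using increment_small[of "\<eta> / 2" "e / (4 * (U + 1))"] \<eta>(1) e U by auto
  show ?thesis
  proof (intro exI[of _ "min d (\<eta> / 2)"] conjI allI impI)
    fix s t x y :: real assume st: "0 \<le> s" "0 \<le> t" "\<bar>t - s\<bar> < min d (\<eta> / 2)" "\<bar>x - y\<bar> < min d (\<eta> / 2)"
    note [measurable] = levy_X_meas[OF st(1)] levy_X_meas[OF st(2)]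
    define E where "E = {\<omega> \<in> space N. \<eta> / 2 < \<bar>Xp t \<omega> - Xp s \<omega>\<bar>}"
    have "\<bar>levy_semigroup p t u0 x - levy_semigroup p s u0 y\<bar> \<le> e / 2 + 2 * U * (measure N E + measure N {})"
    proof (rule semigroup_diff[OF u0(1) b st(2,1)])
      show "E \<in> sets N" unfolding E_def by measurable
      fix \<omega> assume "\<omega> \<in> space N" "\<omega> \<notin> E"
      then have "\<bar>Xp t \<omega> - Xp s \<omega>\<bar> \<le> \<eta> / 2" by (simp add: E_def)
      moreover have "\<bar>x - y\<bar> < \<eta> / 2" using st(4) by simp
      ultimately have "\<bar>(x + Xp t \<omega>) - (y + Xp s \<omega>)\<bar> < \<eta>" by linarith
      then show "\<bar>u0 (x + Xp t \<omega>) - u0 (y + Xp s \<omega>)\<bar> \<le> e / 2" using \<eta>(2) less_imp_le by blast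
    qed (use e in auto)
    moreover have "2 * U * measure N E \<le> 2 * U * (e / (4 * (U + 1)))"
      using d(2)[OF st(1,2)] st(3) U by (intro mult_left_mono) (auto simp: E_def)
    moreover have "2 * U * (e / (4 * (U + 1))) \<le> e / 2" using U e by (simp add: divide_simps)
    ultimately show "\<bar>levy_semigroup p t u0 x - levy_semigroup p s u0 y\<bar> \<le> e" by simp
  qed (use d \<eta> in auto)
qed

text \<open>Without uniform continuity of u0 on the line, uniform continuity on a large ball is
  used, and paths with large |Xp s| are discarded. Their probability is small at the fixed time s,
  but the radius depends on (s, y), so the result is local.\<close>

lemma semigroup_continuous:
  assumes u0: "u0 \<in> borel_measurable borel" "continuous_on UNIV u0" and b: "\<And>x. \<bar>u0 x\<bar> \<le> U" and e: "0 < e" and s: "0 \<le> s"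
  shows "\<exists>d>0. \<forall>t\<ge>0. \<forall>x. \<bar>t - s\<bar> < d \<longrightarrow> \<bar>x - y\<bar> < d \<longrightarrow>
    \<bar>levy_semigroup p t u0 x - levy_semigroup p s u0 y\<bar> \<le> e"
proof -
  interpret prob_space N using levy by (simp add: levy_process_def)
  have U: "0 \<le> U" using b[of 0] by simp
  note [measurable] = levy_X_meas[OF s]
  have "(\<lambda>n. measure N {\<omega> \<in> space N. real n < \<bar>Xp s \<omega>\<bar>}) \<longlonglongrightarrow> measure N (\<Inter>n. {\<omega> \<in> space N. real n < \<bar>Xp s \<omega>\<bar>})"
    by (rule finite_Lim_measure_decseq) (auto simp: decseq_def)
  moreover have "(\<Inter>n. {\<omega> \<in> space N. real n < \<bar>Xp s \<omega>\<bar>}) = {}"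
  proof (intro equals0I)
    fix \<omega> assume a: "\<omega> \<in> (\<Inter>n. {\<omega> \<in> space N. real n < \<bar>Xp s \<omega>\<bar>})"
    obtain n where "\<bar>Xp s \<omega>\<bar> \<le> real n" using real_arch_simple by blast
    then show False using a by (auto simp: not_less[symmetric])
  qed
  ultimately have "(\<lambda>n. measure N {\<omega> \<in> space N. real n < \<bar>Xp s \<omega>\<bar>}) \<longlonglongrightarrow> 0" by (simp only: measure_empty)
  then have "\<forall>\<^sub>F n in sequentially. measure N {\<omega> \<in> space N. real n < \<bar>Xp s \<omega>\<bar>} < e / (8 * (U + 1))"
    using e U by (intro order_tendstoD) auto
  then obtain n where n: "measure N {\<omega> \<in> space N. real n < \<bar>Xp s \<omega>\<bar>} < e / (8 * (U + 1))"
    by (auto simp: eventually_sequentially)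
  \<comment> \<open>The extra 1 leaves room for the second point, whose distance from
    \<open>y + Xp s\<close> is kept below \<eta>', at most 1.\<close>
  define R where "R = \<bar>y\<bar> + real n + 1"
  have "uniformly_continuous_on (cball 0 R) u0"
    using u0(2) by (intro compact_uniformly_continuous continuous_on_subset[OF u0(2)]) auto
  then obtain \<eta> where \<eta>: "\<eta> > 0" "\<And>x y. \<bar>x\<bar> \<le> R \<Longrightarrow> \<bar>y\<bar> \<le> R \<Longrightarrow> \<bar>x - y\<bar> < \<eta> \<Longrightarrow> \<bar>u0 x - u0 y\<bar> < e / 2"
  proof -
    from \<open>uniformly_continuous_on (cball 0 R) u0\<close> obtain \<eta> where "\<eta> > 0"
      "\<And>x x'. x \<in> cball 0 R \<Longrightarrow> x' \<in> cball 0 R \<Longrightarrow> dist x' x < \<eta> \<Longrightarrow> dist (u0 x') (u0 x) < e / 2"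
      using e half_gt_zero[OF e] unfolding uniformly_continuous_on_def by meson
    then show thesis using that[of \<eta>] by (simp add: dist_real_def)
  qed
  define \<eta>' where "\<eta>' = min \<eta> 1"
  obtain d where d: "d > 0" "\<And>t. 0 \<le> t \<Longrightarrow> \<bar>t - s\<bar> < d \<Longrightarrow>
      measure N {\<omega> \<in> space N. \<eta>' / 2 < \<bar>Xp t \<omega> - Xp s \<omega>\<bar>} < e / (8 * (U + 1))"
    using increment_small[of "\<eta>' / 2" "e / (8 * (U + 1))"] \<eta>(1) e U s by (auto simp: \<eta>'_def)
  show ?thesis
  proof (intro exI[of _ "min d (\<eta>' / 2)"] conjI allI impI)
    fix t x :: real assume t: "0 \<le> t" "\<bar>t - s\<bar> < min d (\<eta>' / 2)" "\<bar>x - y\<bar> < min d (\<eta>' / 2)"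
    note [measurable] = levy_X_meas[OF t(1)]
    define E D where "E = {\<omega> \<in> space N. \<eta>' / 2 < \<bar>Xp t \<omega> - Xp s \<omega>\<bar>}" and "D = {\<omega> \<in> space N. real n < \<bar>Xp s \<omega>\<bar>}"
    have "\<bar>levy_semigroup p t u0 x - levy_semigroup p s u0 y\<bar> \<le> e / 2 + 2 * U * (measure N E + measure N D)"
    proof (rule semigroup_diff[OF u0(1) b t(1) s])
      show "E \<in> sets N" "D \<in> sets N" unfolding E_def D_def by measurable
      fix \<omega> assume "\<omega> \<in> space N" "\<omega> \<notin> E" "\<omega> \<notin> D"
      then have "\<bar>Xp t \<omega> - Xp s \<omega>\<bar> \<le> \<eta>' / 2" and n': "\<bar>Xp s \<omega>\<bar> \<le> real n" by (simp_all add: E_def D_def)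
      moreover have "\<bar>x - y\<bar> < \<eta>' / 2" using t(3) by simp
      ultimately have c: "\<bar>(x + Xp t \<omega>) - (y + Xp s \<omega>)\<bar> < \<eta>'" by linarith
      moreover have "\<eta>' \<le> 1" by (simp add: \<eta>'_def)
      ultimately have "\<bar>x + Xp t \<omega>\<bar> \<le> R" "\<bar>y + Xp s \<omega>\<bar> \<le> R" using n' unfolding R_def by linarith+
      then show "\<bar>u0 (x + Xp t \<omega>) - u0 (y + Xp s \<omega>)\<bar> \<le> e / 2" using \<eta>(2) c less_imp_le by (metis \<eta>'_def min_less_iff_conj)
    qed (use e in auto)
    moreover have "2 * U * (measure N E + measure N D) \<le> 2 * U * (e / (8 * (U + 1)) + e / (8 * (U + 1)))"
      using d(2)[OF t(1)] t(2) n U by (intro mult_left_mono add_mono) (auto simp: E_def D_def)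
    moreover have "2 * U * (e / (8 * (U + 1)) + e / (8 * (U + 1))) \<le> e / 2" using U e by (simp add: divide_simps)
    ultimately show "\<bar>levy_semigroup p t u0 x - levy_semigroup p s u0 y\<bar> \<le> e" by simp
  qed (use d \<eta> in \<open>auto simp: \<eta>'_def\<close>)
qed

end

section \<open>Moments of the solution\<close>

locale mild_setting = levy_setting N Xp \<Psi> p + white_noise_space M w
  for N :: "'v measure" and Xp \<Psi> p and M :: "'w measure" and w +
  fixes \<sigma> u0 :: "real \<Rightarrow> real" and u :: "real \<Rightarrow> real \<Rightarrow> 'w \<Rightarrow> real" and L U :: real
  assumes lip: "L-lipschitz_on UNIV \<sigma>" and u0_borel: "u0 \<in> borel_measurable borel"
    and u0_bound: "\<And>x. \<bar>u0 x\<bar> \<le> U" and mild: "mild_solution M w p \<sigma> u0 u"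
begin

text \<open>A section of a predictable field at a fixed point is measurable. The argument is done on
  the generators so that time 0, which joint measurability on the half-space leaves out, is
  included.\<close>

lemma u_meas:
  assumes t: "0 \<le> t" shows "u t x \<in> borel_measurable M"
proof -
  have pred: "(\<lambda>(s, y, \<omega>). u s y \<omega>) \<in> borel_measurable (predictable_sigma M F)"
    using mild by (simp add: mild_solution_def predictable_def F_def)
  define \<G> where "\<G> = {{a<..b} \<times> A \<times> G | a b A G. 0 \<le> (a::real) \<and> a < b \<and> A \<in> sets (borel :: real measure) \<and> G \<in> sets (F a)} \<union>
        {{0} \<times> A \<times> G | A G. A \<in> sets (borel :: real measure) \<and> G \<in> sets (F 0)}"
  have Fsp: "G \<in> sets M" "G \<subseteq> space M" if "G \<in> sets (F a)" for G a
    using F_sub sets.sets_into_space that by blast+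
  have sub: "\<G> \<subseteq> Pow ({0..} \<times> UNIV \<times> space M)"
    unfolding \<G>_def using Fsp(2) by fastforce
  have "(\<lambda>\<omega>. (t, x, \<omega>)) \<in> measurable M (predictable_sigma M F)"
    unfolding predictable_sigma_def \<G>_def[symmetric]
  proof (rule measurable_measure_of[OF sub])
    fix C assume "C \<in> \<G>"
    then obtain I A G a where "C = I \<times> A \<times> G" "G \<in> sets (F a)" unfolding \<G>_def by auto
    moreover from this have "(\<lambda>\<omega>. (t, x, \<omega>)) -` C \<inter> space M = (if t \<in> I \<and> x \<in> A then G else {})" using Fsp(2)[of G a] by auto
    ultimately show "(\<lambda>\<omega>. (t, x, \<omega>)) -` C \<inter> space M \<in> sets M" using Fsp(1) by auto
  qed (use t in auto)
  from measurable_compose[OF this pred] show ?thesis by simp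
qed

lemma \<sigma>_borel[measurable]: "\<sigma> \<in> borel_measurable borel"
  using lipschitz_on_continuous_on[OF lip] by (rule borel_measurable_continuous_onI)

text \<open>The deterministic factor of the integrand in the mild equation for the point (t, x); it
  vanishes for s at or after t because \<open>pker\<close> does at nonpositive times.\<close>

definition shifted :: "real \<Rightarrow> real \<Rightarrow> real \<times> real \<Rightarrow> real" where
  "shifted t x z = indicator {0..} (fst z) * pker p (t - fst z, snd z - x)"

lemma shifted_borel: "shifted t x \<in> borel_measurable borel"
proof -
  have "(\<lambda>z. pker p (t - fst z, snd z - x)) \<in> borel_measurable borel"
    by (rule measurable_compose[OF Pair_borel pker_borel]) measurable
  then show ?thesis unfolding shifted_def[abs_def] by measurable
qed

lemma shifted_zero: "t \<le> fst z \<Longrightarrow> shifted t x z = 0"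
  by (auto simp: shifted_def pker_def halfspace_def)

lemma mild_Z:
  assumes "0 \<le> t"
  obtains Z where "has_walsh_integral M F w (\<lambda>s y \<omega>. shifted t x (s, y) * \<sigma> (u s y \<omega>)) Z"
    "AE \<omega> in M. u t x \<omega> = levy_semigroup p t u0 x + Z \<omega>" "Z \<in> borel_measurable M"
proof -
  obtain Z where Z: "has_walsh_integral M F w (\<lambda>s y \<omega>. indicator {0..<t} s * (\<sigma> (u s y \<omega>) * p (t - s) (y - x))) Z"
    "AE \<omega> in M. u t x \<omega> = levy_semigroup p t u0 x + Z \<omega>"
    using mild assms unfolding mild_solution_def F_def by blast
  have "(\<lambda>s y \<omega>. indicator {0..<t} s * (\<sigma> (u s y \<omega>) * p (t - s) (y - x))) = (\<lambda>s y \<omega>. shifted t x (s, y) * \<sigma> (u s y \<omega>))"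
  proof (intro ext)
    fix s y \<omega>
    show "indicator {0..<t} s * (\<sigma> (u s y \<omega>) * p (t - s) (y - x)) = shifted t x (s, y) * \<sigma> (u s y \<omega>)"
      using pker_eq[of t s p y x] by (simp add: shifted_def)
  qed
  then have W: "has_walsh_integral M F w (\<lambda>s y \<omega>. shifted t x (s, y) * \<sigma> (u s y \<omega>)) Z" using Z(1) by simp
  then have "Z \<in> borel_measurable M" by (simp add: has_walsh_integral_def)
  then show thesis using that W Z(2) by blast
qed

lemma second_moment:
  assumes "0 < T"
  shows "\<exists>B\<ge>0. \<forall>t\<in>{0..T}. \<forall>x. (\<integral>\<^sup>+\<omega>. ennreal ((u t x \<omega>)\<^sup>2) \<partial>M) \<le> ennreal B"
proof -
  define S where "S = (SUP x. SUP t\<in>{0..T}. \<integral>\<^sup>+\<omega>. ennreal (\<bar>u t x \<omega>\<bar>\<^sup>2) \<partial>M)"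
  have "S < \<infinity>" using mild assms unfolding mild_solution_def S_def by blast
  then obtain B where B: "S = ennreal B" "0 \<le> B" by (cases S) auto
  have "(\<integral>\<^sup>+\<omega>. ennreal ((u t x \<omega>)\<^sup>2) \<partial>M) \<le> S" if "t \<in> {0..T}" for t x
    unfolding S_def by (rule SUP_upper2[of x], simp, rule SUP_upper2[OF that]) simp
  then show ?thesis using B by auto
qed

text \<open>Linear growth, written with an outer absolute value and a constant at least 1, which is
  the form in which \<open>tpow_scale\<close> is applied.\<close>

lemma \<sigma>_growth: "\<exists>A\<ge>1. \<forall>v. \<bar>\<sigma> v\<bar> \<le> A * \<bar>1 + \<bar>v\<bar>\<bar>"
proof (intro exI[of _ "1 + \<bar>\<sigma> 0\<bar> + \<bar>L\<bar>"] conjI allI)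
  fix v
  have "dist (\<sigma> v) (\<sigma> 0) \<le> L * dist v 0" using lip by (rule lipschitz_onD) auto
  then have "\<bar>\<sigma> v\<bar> \<le> \<bar>\<sigma> 0\<bar> + L * \<bar>v\<bar>" by (simp add: dist_real_def)
  also have "L * \<bar>v\<bar> \<le> \<bar>L\<bar> * \<bar>v\<bar>" by (intro mult_right_mono) auto
  also have "\<bar>\<sigma> 0\<bar> + \<bar>L\<bar> * \<bar>v\<bar> \<le> (1 + \<bar>\<sigma> 0\<bar> + \<bar>L\<bar>) * \<bar>1 + \<bar>v\<bar>\<bar>" by (simp add: algebra_simps)
  finally show "\<bar>\<sigma> v\<bar> \<le> (1 + \<bar>\<sigma> 0\<bar> + \<bar>L\<bar>) * \<bar>1 + \<bar>v\<bar>\<bar>" by simp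
qed auto

lemma kernel_mass:
  assumes "0 < T"
  shows "\<exists>\<kappa>\<ge>0. \<forall>t\<in>{0..T}. \<forall>x. (\<integral>\<^sup>+z\<in>halfspace. ennreal ((shifted t x z)\<^sup>2) \<partial>lborel) \<le> ennreal \<kappa>"
proof -
  obtain \<kappa> where \<kappa>: "(\<integral>\<^sup>+z\<in>slab T. ennreal ((pker p z)\<^sup>2) \<partial>lborel) = ennreal \<kappa>" "0 \<le> \<kappa>"
    using pker_slab_finite[of T] by (cases "\<integral>\<^sup>+z\<in>slab T. ennreal ((pker p z)\<^sup>2) \<partial>lborel") auto
  have "(\<integral>\<^sup>+z\<in>halfspace. ennreal ((shifted t x z)\<^sup>2) \<partial>lborel) \<le> ennreal \<kappa>" if "t \<in> {0..T}" for t x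
  proof -
    have "(\<integral>\<^sup>+z\<in>halfspace. ennreal ((shifted t x z)\<^sup>2) \<partial>lborel) = (\<integral>\<^sup>+z\<in>halfspace. ennreal ((pker p (t - fst z, snd z - x))\<^sup>2) * 1 \<partial>lborel)"
      by (intro nn_integral_cong) (auto simp: shifted_def halfspace_def indicator_def)
    also have "\<dots> \<le> (\<integral>\<^sup>+z\<in>slab T. ennreal ((pker p z)\<^sup>2) * 1 \<partial>lborel)"
      using that by (intro pker_shift_L2[where c="\<lambda>_. 1"]) auto
    finally show ?thesis using \<kappa> by simp
  qed
  then show ?thesis using \<kappa>(2) by blast
qed

text \<open>
  With the truncated power in place of the power all quantities are finite beforehand, so the
  weighted supremum can be absorbed; the resulting bound does not depend on the truncation level.
\<close>

lemma truncated_moment: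
  assumes T: "0 < T" and k: "1 \<le> k"
  shows "\<exists>B\<ge>0. \<forall>R>0. \<forall>t\<in>{0..T}. \<forall>x. (\<integral>\<^sup>+\<omega>. ennreal (tpow k R (u t x \<omega>)) \<partial>M) \<le> ennreal B"
proof -
  obtain \<kappa> where \<kappa>: "0 \<le> \<kappa>" "\<And>t x. t \<in> {0..T} \<Longrightarrow> (\<integral>\<^sup>+z\<in>halfspace. ennreal ((shifted t x z)\<^sup>2) \<partial>lborel) \<le> ennreal \<kappa>"
    using kernel_mass[OF T] by blast
  obtain C where C: "0 \<le> C" and "\<forall>R>0. \<forall>h g Z \<gamma> \<Gamma>.
    has_walsh_integral M F w (\<lambda>s y \<omega>. h (s, y) * g s y \<omega>) Z \<longrightarrow> h \<in> borel_measurable borel \<longrightarrow>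
    (\<forall>s>0. \<forall>y. g s y \<in> borel_measurable M) \<longrightarrow> \<gamma> \<in> borel_measurable borel \<longrightarrow>
    (\<integral>\<^sup>+z\<in>halfspace. ennreal ((h z)\<^sup>2) \<partial>lborel) \<le> ennreal \<kappa> \<longrightarrow>
    (\<forall>s>0. \<forall>y. (\<integral>\<^sup>+\<omega>. ennreal (tpow k R (g s y \<omega>)) \<partial>M) \<le> \<gamma> (s, y)) \<longrightarrow>
    (\<integral>\<^sup>+z\<in>halfspace. ennreal ((h z)\<^sup>2) * \<gamma> z \<partial>lborel) \<le> ennreal \<Gamma> \<longrightarrow> 0 \<le> \<Gamma> \<longrightarrow>
    (\<integral>\<^sup>+\<omega>. ennreal (tpow k R (Z \<omega>)) \<partial>M) \<le> ennreal (C * \<Gamma>)"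
    using walsh_moment[OF k \<kappa>(1)] by (elim exE conjE)
  note C2 = this(2)[rule_format]
  obtain A where A: "1 \<le> A" "\<And>v. \<bar>\<sigma> v\<bar> \<le> A * \<bar>1 + \<bar>v\<bar>\<bar>" using \<sigma>_growth by blast
  \<comment> \<open>The growth constant of \<open>\<sigma>\<close> enters through scaling, and
    4^(k+1) through splitting 1 + |v|; neither depends on R.\<close>
  define A' where "A' = A\<^sup>2 ^ Suc k * 4 ^ Suc k"
  have A': "0 \<le> A'" by (simp add: A'_def)
  have \<sigma>tp: "tpow k R (\<sigma> v) \<le> A' * (1 + tpow k R v)" if R: "R > 0" for R v
  proof -
    have "tpow k R (\<sigma> v) \<le> A\<^sup>2 ^ Suc k * tpow k R (1 + \<bar>v\<bar>)" by (rule tpow_scale[OF R A])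
    also have "tpow k R (1 + \<bar>v\<bar>) \<le> 4 ^ Suc k * (tpow k R 1 + tpow k R \<bar>v\<bar>)" by (rule tpow_add[OF R])
    also have "tpow k R 1 \<le> 1" using clip_bounds[OF R, of 1] by (auto simp: tpow_def intro!: power_le_one)
    also have "tpow k R \<bar>v\<bar> = tpow k R v" by (simp add: tpow_def clip_def)
    finally show ?thesis by (simp add: A'_def mult.assoc mult_left_mono)
  qed
  define c4 where "c4 = (4 ^ Suc k :: real)"
  have c4: "0 < c4" by (simp add: c4_def)
  \<comment> \<open>Small enough for c4 C A' \<delta> to be at most 1/2, the coefficient with which
    the weighted supremum returns. The weight \<beta> is then chosen to push the weighted kernel
    mass below \<delta>; both choices precede R.\<close>
  define \<delta> where "\<delta> = 1 / (2 * (c4 * C * A') + 1)"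
  have cca: "0 \<le> c4 * C * A'" using c4 C A' by simp
  have \<delta>: "0 < \<delta>" using cca by (simp add: \<delta>_def)
  have \<delta>2: "c4 * C * A' * \<delta> \<le> 1/2" using cca by (simp add: \<delta>_def divide_simps)
  obtain \<beta> where \<beta>: "\<beta> > 0" "(\<integral>\<^sup>+z\<in>slab T. ennreal (exp (- \<beta> * fst z) * (pker p z)\<^sup>2) \<partial>lborel) \<le> ennreal \<delta>"
    using pker_weighted[OF \<delta>] by blast
  define D where "D = c4 * (U\<^sup>2 ^ Suc k + C * A' * \<kappa>)"
  have D: "0 \<le> D" using c4 C A' \<kappa> by (simp add: D_def)
  show ?thesis
  proof (intro exI[of _ "2 * D * exp (\<beta> * T)"] conjI allI impI ballI)
    show "0 \<le> 2 * D * exp (\<beta> * T)" using D by simp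
    fix R t x assume R: "(0::real) < R" and t: "t \<in> {0..T}"
    define a where "a t x = (\<integral>\<^sup>+\<omega>. ennreal (tpow k R (u t x \<omega>)) \<partial>M)" for t x
    define S' where "S' = (SUP (t, x)\<in>{0..T} \<times> UNIV. ennreal (exp (- \<beta> * t)) * a t x)"
    obtain B where B: "0 \<le> B" "\<And>t x. t \<in> {0..T} \<Longrightarrow> (\<integral>\<^sup>+\<omega>. ennreal ((u t x \<omega>)\<^sup>2) \<partial>M) \<le> ennreal B"
      using second_moment[OF T] by blast
    \<comment> \<open>A priori finiteness: the truncated power is at most R^(2k) times the square,
      and second moments are bounded by the definition of a solution. The bound depends on R but is
      used only for finiteness.\<close>
    have "S' \<le> ennreal (R\<^sup>2 ^ k * B)"
      unfolding S'_def
    proof (intro SUP_least, clarify)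
      fix t x assume t: "t \<in> {0..T}"
      note [measurable] = u_meas[of t x]
      have "a t x \<le> (\<integral>\<^sup>+\<omega>. ennreal (R\<^sup>2 ^ k) * ennreal ((u t x \<omega>)\<^sup>2) \<partial>M)"
        unfolding a_def by (intro nn_integral_mono) (auto simp: ennreal_mult'[symmetric] intro!: ennreal_leI cpow_bounds(4)[OF R])
      also have "\<dots> = ennreal (R\<^sup>2 ^ k) * (\<integral>\<^sup>+\<omega>. ennreal ((u t x \<omega>)\<^sup>2) \<partial>M)"
        using t by (intro nn_integral_cmult) (auto intro!: measurable_compose[OF u_meas])
      also have "\<dots> \<le> ennreal (R\<^sup>2 ^ k) * ennreal B" by (intro mult_left_mono B t) auto
      also have "\<dots> = ennreal (R\<^sup>2 ^ k * B)" by (simp add: ennreal_mult')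
      finally have "ennreal (exp (- \<beta> * t)) * a t x \<le> 1 * ennreal (R\<^sup>2 ^ k * B)"
        using \<beta> t by (intro mult_mono) (auto simp: ennreal_le_1)
      then show "ennreal (exp (- \<beta> * t)) * a t x \<le> ennreal (R\<^sup>2 ^ k * B)" by simp
    qed
    then have "S' < \<top>" using ennreal_less_top le_less_trans by blast
    then obtain S where S: "S' = ennreal S" "0 \<le> S" by (cases S') auto
    have aS: "a t x \<le> ennreal (S * exp (\<beta> * t))" if "t \<in> {0..T}" for t x
    proof -
      have "ennreal (exp (- \<beta> * t)) * a t x \<le> ennreal S"
        unfolding S(1)[symmetric] S'_def by (rule SUP_upper2[of "(t, x)"]) (use that in auto)
      then have "ennreal (exp (\<beta> * t)) * (ennreal (exp (- \<beta> * t)) * a t x) \<le> ennreal (exp (\<beta> * t)) * ennreal S"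
        by (rule mult_left_mono) simp
      moreover have "ennreal (exp (\<beta> * t)) * ennreal (exp (- \<beta> * t)) = 1"
        by (subst ennreal_mult'[symmetric]) (auto simp: exp_add[symmetric])
      ultimately have "a t x \<le> ennreal (exp (\<beta> * t)) * ennreal S" by (simp only: mult.assoc[symmetric] mult_1)
      then show ?thesis unfolding ennreal_mult'[OF S(2)] by (simp only: mult.commute)
    qed
    have "S' \<le> ennreal (D + S / 2)"
      unfolding S'_def
    proof (intro SUP_least, clarify)
      fix t x assume t: "t \<in> {0..T}"
      then have t0: "0 \<le> t" by simp
      obtain Z where Z: "has_walsh_integral M F w (\<lambda>s y \<omega>. shifted t x (s, y) * \<sigma> (u s y \<omega>)) Z"
        "AE \<omega> in M. u t x \<omega> = levy_semigroup p t u0 x + Z \<omega>" "Z \<in> borel_measurable M"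
        using mild_Z[OF t0] by blast
      \<comment> \<open>After time T nothing is claimed about the solution, so the moment bound is
        set to infinity; the kernel vanishes there and the product counts as 0.\<close>
      define \<gamma> where "\<gamma> z = (if fst z \<le> T then ennreal (A' * (1 + S * exp (\<beta> * fst z))) else \<top>)" for z :: "real \<times> real"
      have [measurable]: "\<gamma> \<in> borel_measurable borel" unfolding \<gamma>_def by measurable
      have g\<gamma>: "(\<integral>\<^sup>+\<omega>. ennreal (tpow k R (\<sigma> (u s y \<omega>))) \<partial>M) \<le> \<gamma> (s, y)" if s: "0 < s" for s y
      proof (cases "s \<le> T")
        case True
        note [measurable] = u_meas[OF less_imp_le[OF s], of y]
        have "(\<integral>\<^sup>+\<omega>. ennreal (tpow k R (\<sigma> (u s y \<omega>))) \<partial>M) \<le> (\<integral>\<^sup>+\<omega>. ennreal A' * (1 + ennreal (tpow k R (u s y \<omega>))) \<partial>M)"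
        proof (rule nn_integral_mono)
          fix \<omega>
          have "ennreal (tpow k R (\<sigma> (u s y \<omega>))) \<le> ennreal (A' * (1 + tpow k R (u s y \<omega>)))" by (rule ennreal_leI[OF \<sigma>tp[OF R]])
          then show "ennreal (tpow k R (\<sigma> (u s y \<omega>))) \<le> ennreal A' * (1 + ennreal (tpow k R (u s y \<omega>)))"
            using A' cpow_bounds(5)[OF R, of k] by (simp add: ennreal_mult' ennreal_plus)
        qed
        also have "\<dots> = ennreal A' * (1 + a s y)"
          by (simp add: nn_integral_cmult nn_integral_add a_def emeasure_space_1)
        also have "\<dots> \<le> ennreal A' * (1 + ennreal (S * exp (\<beta> * s)))"
          using True s by (intro mult_left_mono add_left_mono aS) auto
        also have "\<dots> = \<gamma> (s, y)" using True A' S by (simp add: \<gamma>_def ennreal_mult' ennreal_plus)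
        finally show ?thesis .
      qed (simp add: \<gamma>_def)
      \<comment> \<open>The constant part of the moment bound meets the plain mass \<kappa> of the
        kernel. The part growing like exp (\<beta> s) becomes, after reflection, exp (\<beta> t)
        times the weighted mass, at most \<delta>.\<close>
      define \<Gamma> where "\<Gamma> = A' * (\<kappa> + S * exp (\<beta> * t) * \<delta>)"
      have \<Gamma>: "0 \<le> \<Gamma>" using A' \<kappa> S \<delta> by (simp add: \<Gamma>_def)
      note [measurable] = shifted_borel pker_borel
      have h\<gamma>: "(\<integral>\<^sup>+z\<in>halfspace. ennreal ((shifted t x z)\<^sup>2) * \<gamma> z \<partial>lborel) \<le> ennreal \<Gamma>"
      proof -
        have "(\<integral>\<^sup>+z\<in>halfspace. ennreal ((shifted t x z)\<^sup>2) * \<gamma> z \<partial>lborel)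
          \<le> (\<integral>\<^sup>+z. ennreal A' * (ennreal ((shifted t x z)\<^sup>2) * indicator halfspace z
            + ennreal S * (ennreal ((pker p (t - fst z, snd z - x))\<^sup>2) * ennreal (exp (\<beta> * fst z)) * indicator halfspace z)) \<partial>lborel)"
        proof (rule nn_integral_mono)
          fix z :: "real \<times> real"
          show "ennreal ((shifted t x z)\<^sup>2) * \<gamma> z * indicator halfspace z \<le> ennreal A' * (ennreal ((shifted t x z)\<^sup>2) * indicator halfspace z
            + ennreal S * (ennreal ((pker p (t - fst z, snd z - x))\<^sup>2) * ennreal (exp (\<beta> * fst z)) * indicator halfspace z))"
          proof (cases "z \<in> halfspace \<and> fst z \<le> T")
            case True
            then have "shifted t x z = pker p (t - fst z, snd z - x)" by (auto simp: shifted_def halfspace_def)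
            then show ?thesis using True A' S
              by (simp add: \<gamma>_def ennreal_mult' ennreal_plus distrib_left distrib_right mult_ac)
          next
            case False
            then have "z \<in> halfspace \<Longrightarrow> shifted t x z = 0" using t by (intro shifted_zero) auto
            then show ?thesis by (cases "z \<in> halfspace") auto
          qed
        qed
        also have "\<dots> = ennreal A' * ((\<integral>\<^sup>+z\<in>halfspace. ennreal ((shifted t x z)\<^sup>2) \<partial>lborel)
            + ennreal S * (\<integral>\<^sup>+z\<in>halfspace. ennreal ((pker p (t - fst z, snd z - x))\<^sup>2) * ennreal (exp (\<beta> * fst z)) \<partial>lborel))"
        proof -
          have [measurable]: "(\<lambda>z. pker p (t - fst z, snd z - x)) \<in> borel_measurable borel"
            by (rule measurable_compose[OF Pair_borel pker_borel]) measurable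
          show ?thesis by (simp add: nn_integral_cmult nn_integral_add)
        qed
        also have "\<dots> \<le> ennreal A' * (ennreal \<kappa> + ennreal S * (ennreal (exp (\<beta> * t)) * ennreal \<delta>))"
        proof (intro mult_left_mono add_mono \<kappa>(2) t)
          have "(\<integral>\<^sup>+z\<in>halfspace. ennreal ((pker p (t - fst z, snd z - x))\<^sup>2) * ennreal (exp (\<beta> * fst z)) \<partial>lborel)
            \<le> (\<integral>\<^sup>+z\<in>slab T. ennreal ((pker p z)\<^sup>2) * ennreal (exp (\<beta> * (t - fst z))) \<partial>lborel)"
            using t by (intro pker_shift_L2[where c="\<lambda>s. ennreal (exp (\<beta> * s))"]) auto
          also have "\<dots> = (\<integral>\<^sup>+z. ennreal (exp (\<beta> * t)) * (ennreal (exp (- \<beta> * fst z) * (pker p z)\<^sup>2) * indicator (slab T) z) \<partial>lborel)"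
          proof (intro nn_integral_cong)
            fix z :: "real \<times> real"
            have "exp (\<beta> * (t - fst z)) = exp (\<beta> * t) * exp (- \<beta> * fst z)" by (simp add: exp_add[symmetric] right_diff_distrib)
            then show "ennreal ((pker p z)\<^sup>2) * ennreal (exp (\<beta> * (t - fst z))) * indicator (slab T) z
              = ennreal (exp (\<beta> * t)) * (ennreal (exp (- \<beta> * fst z) * (pker p z)\<^sup>2) * indicator (slab T) z)"
              by (simp add: ennreal_mult' mult_ac)
          qed
          also have "\<dots> = ennreal (exp (\<beta> * t)) * (\<integral>\<^sup>+z\<in>slab T. ennreal (exp (- \<beta> * fst z) * (pker p z)\<^sup>2) \<partial>lborel)"
            by (rule nn_integral_cmult) measurable
          also have "\<dots> \<le> ennreal (exp (\<beta> * t)) * ennreal \<delta>" by (intro mult_left_mono \<beta>) auto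
          finally show "(\<integral>\<^sup>+z\<in>halfspace. ennreal ((pker p (t - fst z, snd z - x))\<^sup>2) * ennreal (exp (\<beta> * fst z)) \<partial>lborel)
            \<le> ennreal (exp (\<beta> * t)) * ennreal \<delta>" .
        qed auto
        also have "\<dots> = ennreal \<Gamma>"
          unfolding \<Gamma>_def using A' \<kappa> S \<delta> by (simp add: ennreal_mult' ennreal_plus mult.assoc)
        finally show ?thesis .
      qed
      have Zb: "(\<integral>\<^sup>+\<omega>. ennreal (tpow k R (Z \<omega>)) \<partial>M) \<le> ennreal (C * \<Gamma>)"
      proof (rule C2[OF R Z(1) shifted_borel _ _ \<kappa>(2)[OF t] _ h\<gamma> \<Gamma>])
        show "(\<lambda>\<omega>. \<sigma> (u s y \<omega>)) \<in> borel_measurable M" if "0 < s" for s y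
          using that by (auto intro!: measurable_compose[OF u_meas \<sigma>_borel])
      qed (use g\<gamma> in auto)
      note [measurable] = Z(3)
      have "a t x = (\<integral>\<^sup>+\<omega>. ennreal (tpow k R (levy_semigroup p t u0 x + Z \<omega>)) \<partial>M)"
        unfolding a_def by (rule nn_integral_cong_AE) (use Z(2) in \<open>auto elim: eventually_mono\<close>)
      also have "\<dots> \<le> (\<integral>\<^sup>+\<omega>. ennreal c4 * (ennreal (U\<^sup>2 ^ Suc k) + ennreal (tpow k R (Z \<omega>))) \<partial>M)"
      proof (rule nn_integral_mono)
        fix \<omega>
        define P where "P = levy_semigroup p t u0 x"
        have P: "P\<^sup>2 \<le> U\<^sup>2" using semigroup_bounded[OF u0_borel u0_bound t0, of x] power_mono[of "\<bar>P\<bar>" U 2] by (simp add: P_def)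
        have "(clip R P)\<^sup>2 \<le> U\<^sup>2" using P clip_bounds(4)[OF R, of P] by linarith
        then have "tpow k R P \<le> U\<^sup>2 * U\<^sup>2 ^ k" unfolding tpow_def by (intro mult_mono[OF P power_mono]) auto
        then have "c4 * (tpow k R P + tpow k R (Z \<omega>)) \<le> c4 * (U\<^sup>2 ^ Suc k + tpow k R (Z \<omega>))"
          using c4 by (intro mult_left_mono) auto
        then have "tpow k R (P + Z \<omega>) \<le> c4 * (U\<^sup>2 ^ Suc k + tpow k R (Z \<omega>))"
          using tpow_add[OF R, of k P "Z \<omega>"] unfolding c4_def[symmetric] by linarith
        from ennreal_leI[OF this] show "ennreal (tpow k R (levy_semigroup p t u0 x + Z \<omega>)) \<le> ennreal c4 * (ennreal (U\<^sup>2 ^ Suc k) + ennreal (tpow k R (Z \<omega>)))"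
          using c4 cpow_bounds(5)[OF R, of k "Z \<omega>"] by (simp add: P_def ennreal_mult' ennreal_plus)
      qed
      also have "\<dots> = ennreal c4 * (ennreal (U\<^sup>2 ^ Suc k) + (\<integral>\<^sup>+\<omega>. ennreal (tpow k R (Z \<omega>)) \<partial>M))"
        by (simp add: nn_integral_cmult nn_integral_add emeasure_space_1 del: power_Suc)
      also have "\<dots> \<le> ennreal c4 * (ennreal (U\<^sup>2 ^ Suc k) + ennreal (C * \<Gamma>))"
        by (intro mult_left_mono add_left_mono Zb) auto
      also have "\<dots> = ennreal (c4 * (U\<^sup>2 ^ Suc k + C * \<Gamma>))"
        using c4 C \<Gamma> by (simp add: ennreal_mult'[symmetric] ennreal_plus[symmetric] del: ennreal_plus power_Suc)
      finally have "ennreal (exp (- \<beta> * t)) * a t x \<le> ennreal (exp (- \<beta> * t)) * ennreal (c4 * (U\<^sup>2 ^ Suc k + C * \<Gamma>))"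
        by (rule mult_left_mono) simp
      also have "\<dots> = ennreal (exp (- \<beta> * t) * (c4 * (U\<^sup>2 ^ Suc k + C * \<Gamma>)))" by (simp add: ennreal_mult')
      also have "\<dots> \<le> ennreal (D + S / 2)"
      proof (rule ennreal_leI)
        have e: "exp (- \<beta> * t) * exp (\<beta> * t) = 1" by (simp add: exp_add[symmetric])
        have "exp (- \<beta> * t) * (c4 * (U\<^sup>2 ^ Suc k + C * \<Gamma>)) = exp (- \<beta> * t) * D + (exp (- \<beta> * t) * exp (\<beta> * t)) * (c4 * C * A' * \<delta>) * S"
          unfolding \<Gamma>_def D_def by (simp add: algebra_simps del: power_Suc)
        also have "\<dots> \<le> 1 * D + 1/2 * S"
          unfolding e using D \<beta> t \<delta>2 S by (intro add_mono mult_right_mono) auto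
        finally show "exp (- \<beta> * t) * (c4 * (U\<^sup>2 ^ Suc k + C * \<Gamma>)) \<le> D + S / 2" by simp
      qed
      finally show "ennreal (exp (- \<beta> * t)) * a t x \<le> ennreal (D + S / 2)" .
    qed
    \<comment> \<open>Since S is finite, half of it can be absorbed; the bound 2 D that results is
      free of R.\<close>
    then have "S \<le> D + S / 2" unfolding S(1) using S(2) D by (simp add: ennreal_le_iff del: ennreal_plus)
    then have "S \<le> 2 * D" by simp
    then have "S * exp (\<beta> * t) \<le> 2 * D * exp (\<beta> * T)"
      using D \<beta> t by (intro mult_mono) auto
    then have "ennreal (S * exp (\<beta> * t)) \<le> ennreal (2 * D * exp (\<beta> * T))" by (rule ennreal_leI)
    then show "(\<integral>\<^sup>+\<omega>. ennreal (tpow k R (u t x \<omega>)) \<partial>M) \<le> ennreal (2 * D * exp (\<beta> * T))"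
      using aS[OF t, of x] by (simp add: a_def)
  qed
qed

text \<open>The truncated bounds are uniform in R, so Fatou's lemma along R = Suc n yields the full
  even moment.\<close>

lemma moment:
  assumes T: "0 < T" and k: "1 \<le> k"
  shows "\<exists>B\<ge>0. \<forall>t\<in>{0..T}. \<forall>x. (\<integral>\<^sup>+\<omega>. ennreal (u t x \<omega> ^ (2 * Suc k)) \<partial>M) \<le> ennreal B"
proof -
  obtain B where B: "0 \<le> B" "\<And>R t x. 0 < R \<Longrightarrow> t \<in> {0..T} \<Longrightarrow> (\<integral>\<^sup>+\<omega>. ennreal (tpow k R (u t x \<omega>)) \<partial>M) \<le> ennreal B"
    using truncated_moment[OF assms] by blast
  have "(\<integral>\<^sup>+\<omega>. ennreal (u t x \<omega> ^ (2 * Suc k)) \<partial>M) \<le> ennreal B" if t: "t \<in> {0..T}" for t x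
  proof -
    have [measurable]: "u t x \<in> borel_measurable M" using t by (intro u_meas) simp
    have "(\<integral>\<^sup>+\<omega>. ennreal (u t x \<omega> ^ (2 * Suc k)) \<partial>M) \<le> (\<integral>\<^sup>+\<omega>. liminf (\<lambda>n. ennreal (tpow k (real (Suc n)) (u t x \<omega>))) \<partial>M)"
    proof (intro nn_integral_mono Liminf_bounded)
      fix \<omega>
      obtain m where "\<bar>u t x \<omega>\<bar> \<le> real m" using real_arch_simple by blast
      then have "tpow k (real (Suc n)) (u t x \<omega>) = u t x \<omega> ^ (2 * Suc k)" if "m \<le> n" for n
        using that by (simp add: tpow_def clip_def power_mult power2_eq_square)
      then show "\<forall>\<^sub>F n in sequentially. ennreal (u t x \<omega> ^ (2 * Suc k)) \<le> ennreal (tpow k (real (Suc n)) (u t x \<omega>))"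
        unfolding eventually_sequentially by (intro exI[of _ m]) auto
    qed
    also have "\<dots> \<le> liminf (\<lambda>n. (\<integral>\<^sup>+\<omega>. ennreal (tpow k (real (Suc n)) (u t x \<omega>)) \<partial>M))"
      by (rule nn_integral_liminf) measurable
    also have "\<dots> \<le> ennreal B"
      by (rule Liminf_le) (use B(2)[OF _ t] in \<open>auto intro!: always_eventually simp del: of_nat_Suc\<close>)
    finally show ?thesis .
  qed
  then show ?thesis using B(1) by blast
qed

end

section \<open>Continuity in mean\<close>

lemma ennreal_tendsto_0I:
  assumes "\<And>e. 0 < e \<Longrightarrow> \<forall>\<^sub>F x in A. f x \<le> ennreal e"
  shows "(f \<longlongrightarrow> 0) A"
proof (rule order_tendstoI)
  fix a :: ennreal assume "0 < a"
  then obtain e where e: "0 < e" "ennreal e < a"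
  proof (cases a)
    case (real r)
    then show thesis using that[of "r / 2"] \<open>0 < a\<close> by (auto simp: ennreal_less_iff)
  next
    case top
    then show thesis using that[of 1] by simp
  qed
  show "\<forall>\<^sub>F x in A. f x < a" by (rule eventually_mono[OF assms[OF e(1)]]) (use e in auto)
qed simp

text \<open>Interpolation between the second and a high even power replaces Hoelder's inequality.\<close>

lemma powr_le_interpolation:
  assumes q: "0 < q"
  shows "\<exists>k\<ge>1. \<forall>e>0. \<exists>C\<ge>0. \<forall>d::real. \<bar>d\<bar> powr q \<le> e * (1 + d ^ (2 * Suc k)) + C * d\<^sup>2"
proof -
  obtain k0 :: nat where k0: "q \<le> real k0" using real_arch_simple by blast
  \<comment> \<open>Large enough for 2 (k + 1) to be at least q + 1, and positive, as the moment
    bound requires.\<close>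
  define k where "k = Suc k0"
  show ?thesis
  proof (intro exI[of _ k] conjI allI impI)
    show "1 \<le> k" by (simp add: k_def)
    fix e :: real assume e: "0 < e"
    define r where "r = e powr (1 / q)"
    define s where "s = 1 + 1 / e"
    have r: "0 < r" "r powr q = e" using e q by (auto simp: r_def powr_powr)
    have s: "1 \<le> s" "1 / s \<le> e" using e by (auto simp: s_def divide_simps)
    have kq: "q + 1 \<le> real (2 * Suc k)" using k0 by (simp add: k_def)
    define C where "C = s powr q / r\<^sup>2"
    have C: "0 \<le> C" by (simp add: C_def)
    have "\<bar>d\<bar> powr q \<le> e * (1 + d ^ (2 * Suc k)) + C * d\<^sup>2" for d
    proof -
      have nn: "0 \<le> e * d ^ (2 * Suc k)" "0 \<le> C * d\<^sup>2" using e C by (auto simp: zero_le_even_power simp del: mult_Suc_right)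
      \<comment> \<open>Small values have |d|^q at most e, and intermediate ones are controlled by a
        large multiple of d^2. For large values the surplus exponent gains a factor 1 / s, which is
        at most e.\<close>
      consider "\<bar>d\<bar> \<le> r" | "r < \<bar>d\<bar>" "\<bar>d\<bar> \<le> s" | "s < \<bar>d\<bar>" by linarith
      then show ?thesis
      proof cases
        case 1
        then have "\<bar>d\<bar> powr q \<le> e" using powr_mono2[of q "\<bar>d\<bar>" r] q r by simp
        then show ?thesis using nn by (simp add: distrib_left)
      next
        case 2
        have "r\<^sup>2 \<le> \<bar>d\<bar>\<^sup>2" using 2 r by (intro power_mono) auto
        then have "s powr q * 1 \<le> s powr q * (d\<^sup>2 / r\<^sup>2)" using r by (intro mult_left_mono) auto
        moreover have "\<bar>d\<bar> powr q \<le> s powr q" using 2 q by (intro powr_mono2) auto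
        ultimately have "\<bar>d\<bar> powr q \<le> C * d\<^sup>2" by (simp add: C_def)
        then show ?thesis using nn e by (simp add: distrib_left)
      next
        case 3
        then have d: "1 < \<bar>d\<bar>" using s by simp
        have "\<bar>d\<bar> powr q * \<bar>d\<bar> = \<bar>d\<bar> powr (q + 1)" using d by (simp add: powr_add)
        also have "\<dots> \<le> \<bar>d\<bar> powr real (2 * Suc k)" using d kq by (intro powr_mono) auto
        also have "\<dots> = d ^ (2 * Suc k)" using d by (subst powr_realpow) (auto simp: power_even_abs simp del: mult_Suc_right)
        finally have "\<bar>d\<bar> powr q * \<bar>d\<bar> \<le> d ^ (2 * Suc k)" .
        moreover have "\<bar>d\<bar> powr q * s \<le> \<bar>d\<bar> powr q * \<bar>d\<bar>" using 3 by (intro mult_left_mono) auto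
        ultimately have "\<bar>d\<bar> powr q \<le> (1 / s) * d ^ (2 * Suc k)" using s by (simp add: field_simps del: mult_Suc_right)
        also have "\<dots> \<le> e * d ^ (2 * Suc k)" using s by (intro mult_right_mono) (auto simp: zero_le_even_power simp del: mult_Suc_right)
        finally show ?thesis using nn e by (simp add: distrib_left)
      qed
    qed
    then show "\<exists>C\<ge>0. \<forall>d::real. \<bar>d\<bar> powr q \<le> e * (1 + d ^ (2 * Suc k)) + C * d\<^sup>2" using C by blast
  qed
qed

lemma even_power_diff_le: "(a - b) ^ (2 * m) \<le> 4 ^ m * (a ^ (2 * m) + b ^ (2 * m))" for a b :: real
proof -
  define c where "c = max \<bar>a\<bar> \<bar>b\<bar>"
  have "\<bar>a - b\<bar> ^ (2 * m) \<le> (2 * c) ^ (2 * m)" by (intro power_mono) (auto simp: c_def)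
  also have "\<dots> = 4 ^ m * c ^ (2 * m)" by (simp add: power_mult_distrib power_mult)
  also have "c ^ (2 * m) \<le> a ^ (2 * m) + b ^ (2 * m)"
    by (cases "\<bar>a\<bar> \<le> \<bar>b\<bar>") (auto simp: c_def max_def power_even_abs zero_le_even_power)
  finally show ?thesis by (simp add: power_even_abs mult_left_mono)
qed

lemma Lp_norm_le:
  assumes "0 < q" "0 \<le> e" "(\<integral>\<^sup>+\<omega>. ennreal (\<bar>Z \<omega>\<bar> powr q) \<partial>M) \<le> ennreal (e powr q)"
  shows "Lp_norm M q Z \<le> ennreal e"
proof -
  define m where "m = (\<integral>\<^sup>+\<omega>. ennreal (\<bar>Z \<omega>\<bar> powr q) \<partial>M)"
  have m: "m \<noteq> \<infinity>" "enn2real m \<le> e powr q"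
    using assms(3) unfolding m_def[symmetric] by (auto simp: top_unique intro: enn2real_leI)
  have "enn2real m powr (1 / q) \<le> (e powr q) powr (1 / q)"
    using m assms by (intro powr_mono2) auto
  also have "\<dots> = e" using assms by (simp add: powr_powr)
  finally show ?thesis using m unfolding Lp_norm_def m_def[symmetric] by (simp add: Let_def ennreal_leI)
qed

context mild_setting
begin

text \<open>The high even moment of the difference is bounded uniformly, so interpolation with a
  small enough parameter leaves only \<open>e\<close> and a multiple of the second moment. Thus L^2
  smallness is all that remains to be checked.\<close>

lemma q_moment_bound:
  assumes T: "0 < T" and q: "0 < q" and e: "0 < e"
  shows "\<exists>C\<ge>0. \<forall>t\<in>{0..T}. \<forall>t'\<in>{0..T}. \<forall>x x'.
    (\<integral>\<^sup>+\<omega>. ennreal (\<bar>u t x \<omega> - u t' x' \<omega>\<bar> powr q) \<partial>M) \<le> ennreal e + ennreal C * (\<integral>\<^sup>+\<omega>. ennreal ((u t x \<omega> - u t' x' \<omega>)\<^sup>2) \<partial>M)"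
proof -
  obtain k where k: "1 \<le> k" and *: "\<And>e. 0 < e \<Longrightarrow> \<exists>C\<ge>0. \<forall>d::real. \<bar>d\<bar> powr q \<le> e * (1 + d ^ (2 * Suc k)) + C * d\<^sup>2"
    using powr_le_interpolation[OF q] by blast
  obtain B where B: "0 \<le> B" "\<And>t x. t \<in> {0..T} \<Longrightarrow> (\<integral>\<^sup>+\<omega>. ennreal (u t x \<omega> ^ (2 * Suc k)) \<partial>M) \<le> ennreal B"
    using moment[OF T k] by blast
  define m where "m = Suc k"
  \<comment> \<open>Scaled by the uniform bound for 1 plus the high moment of a difference, so that
    the contribution of this part is exactly e.\<close>
  define e' where "e' = e / (1 + 4 ^ m * (B + B))"
  have den: "0 < 1 + 4 ^ m * (B + B)" using B by (intro add_pos_nonneg) auto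
  have e': "0 < e'" using e den by (simp add: e'_def)
  obtain C where C: "0 \<le> C" "\<And>d::real. \<bar>d\<bar> powr q \<le> e' * (1 + d ^ (2 * m)) + C * d\<^sup>2"
    using *[OF e'] unfolding m_def by blast
  show ?thesis
  proof (intro exI[of _ C] conjI C(1) ballI allI)
    fix t t' x x' assume t: "t \<in> {0..T}" "t' \<in> {0..T}"
    have [measurable]: "u t x \<in> borel_measurable M" "u t' x' \<in> borel_measurable M" using t by (auto intro: u_meas)
    let ?D = "\<lambda>\<omega>. u t x \<omega> - u t' x' \<omega>"
    have nn: "0 \<le> v ^ (2 * m)" for v :: real by (rule zero_le_even_power) simp
    have "(\<integral>\<^sup>+\<omega>. ennreal (\<bar>?D \<omega>\<bar> powr q) \<partial>M)
      \<le> (\<integral>\<^sup>+\<omega>. ennreal e' * (1 + ennreal (4 ^ m) * (ennreal (u t x \<omega> ^ (2 * m)) + ennreal (u t' x' \<omega> ^ (2 * m)))) + ennreal C * ennreal ((?D \<omega>)\<^sup>2) \<partial>M)"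
    proof (rule nn_integral_mono)
      fix \<omega>
      have "e' * (1 + ?D \<omega> ^ (2 * m)) \<le> e' * (1 + 4 ^ m * (u t x \<omega> ^ (2 * m) + u t' x' \<omega> ^ (2 * m)))"
        using e' by (intro mult_left_mono add_left_mono even_power_diff_le) auto
      then have "\<bar>?D \<omega>\<bar> powr q \<le> e' * (1 + 4 ^ m * (u t x \<omega> ^ (2 * m) + u t' x' \<omega> ^ (2 * m))) + C * (?D \<omega>)\<^sup>2"
        using C(2)[of "?D \<omega>"] by linarith
      from ennreal_leI[OF this]
      show "ennreal (\<bar>?D \<omega>\<bar> powr q) \<le> ennreal e' * (1 + ennreal (4 ^ m) * (ennreal (u t x \<omega> ^ (2 * m)) + ennreal (u t' x' \<omega> ^ (2 * m)))) + ennreal C * ennreal ((?D \<omega>)\<^sup>2)"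
        using e' C(1) nn by (simp add: ennreal_mult' ennreal_plus)
    qed
    also have "\<dots> = ennreal e' * (1 + ennreal (4 ^ m) * ((\<integral>\<^sup>+\<omega>. ennreal (u t x \<omega> ^ (2 * m)) \<partial>M) + (\<integral>\<^sup>+\<omega>. ennreal (u t' x' \<omega> ^ (2 * m)) \<partial>M)))
       + ennreal C * (\<integral>\<^sup>+\<omega>. ennreal ((?D \<omega>)\<^sup>2) \<partial>M)"
      by (simp add: nn_integral_cmult nn_integral_add emeasure_space_1)
    also have "\<dots> \<le> ennreal e' * (1 + ennreal (4 ^ m) * (ennreal B + ennreal B)) + ennreal C * (\<integral>\<^sup>+\<omega>. ennreal ((?D \<omega>)\<^sup>2) \<partial>M)"
      using t unfolding m_def by (intro add_mono mult_left_mono B order_refl) auto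
    also have "ennreal e' * (1 + ennreal (4 ^ m) * (ennreal B + ennreal B)) = ennreal (e' * (1 + 4 ^ m * (B + B)))"
    proof -
      have "ennreal (4 ^ m * (B + B)) = ennreal (4 ^ m) * (ennreal B + ennreal B)"
        by (simp only: ennreal_mult'[OF zero_le_power[OF zero_le_numeral]] ennreal_plus[OF B(1) B(1)])
      moreover have "ennreal (e' * (1 + c)) = ennreal e' * (1 + ennreal c)" if "0 \<le> c" for c
        using e' that by (simp add: ennreal_mult' ennreal_plus)
      ultimately show ?thesis using B(1) by simp
    qed
    also have "e' * (1 + 4 ^ m * (B + B)) = e" using den by (simp add: e'_def)
    finally show "(\<integral>\<^sup>+\<omega>. ennreal (\<bar>?D \<omega>\<bar> powr q) \<partial>M) \<le> ennreal e + ennreal C * (\<integral>\<^sup>+\<omega>. ennreal ((?D \<omega>)\<^sup>2) \<partial>M)" .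
  qed
qed

lemma Lp_norm_small:
  assumes T: "0 < T" and q: "0 < q" and e: "0 < e"
  shows "\<exists>\<eta>>0. \<forall>t\<in>{0..T}. \<forall>t'\<in>{0..T}. \<forall>x x'. (\<integral>\<^sup>+\<omega>. ennreal ((u t x \<omega> - u t' x' \<omega>)\<^sup>2) \<partial>M) \<le> ennreal \<eta> \<longrightarrow>
    Lp_norm M q (\<lambda>\<omega>. u t x \<omega> - u t' x' \<omega>) \<le> ennreal e"
proof -
  define e2 where "e2 = e powr q / 2"
  have e2: "0 < e2" using e by (simp add: e2_def)
  obtain C where C: "0 \<le> C" "\<And>t t' x x'. t \<in> {0..T} \<Longrightarrow> t' \<in> {0..T} \<Longrightarrow>
    (\<integral>\<^sup>+\<omega>. ennreal (\<bar>u t x \<omega> - u t' x' \<omega>\<bar> powr q) \<partial>M) \<le> ennreal e2 + ennreal C * (\<integral>\<^sup>+\<omega>. ennreal ((u t x \<omega> - u t' x' \<omega>)\<^sup>2) \<partial>M)"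
    using q_moment_bound[OF T q e2] by blast
  show ?thesis
  proof (intro exI[of _ "e2 / (C + 1)"] conjI ballI allI impI)
    show "0 < e2 / (C + 1)" using e2 C by simp
    fix t t' x x' assume t: "t \<in> {0..T}" "t' \<in> {0..T}"
      and small: "(\<integral>\<^sup>+\<omega>. ennreal ((u t x \<omega> - u t' x' \<omega>)\<^sup>2) \<partial>M) \<le> ennreal (e2 / (C + 1))"
    have "(\<integral>\<^sup>+\<omega>. ennreal (\<bar>u t x \<omega> - u t' x' \<omega>\<bar> powr q) \<partial>M) \<le> ennreal e2 + ennreal C * ennreal (e2 / (C + 1))"
      by (rule order_trans[OF C(2)[OF t]]) (intro add_left_mono mult_left_mono small, simp)
    also have "\<dots> = ennreal (e2 + C * (e2 / (C + 1)))" using e2 C by (simp add: ennreal_mult'[symmetric] ennreal_plus)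
    also have "\<dots> \<le> ennreal (e powr q)"
    proof (rule ennreal_leI)
      have "C * (e2 / (C + 1)) \<le> e2" using e2 C by (simp add: divide_simps)
      moreover have "e2 + e2 = e powr q" by (simp add: e2_def)
      ultimately show "e2 + C * (e2 / (C + 1)) \<le> e powr q" by linarith
    qed
    finally show "Lp_norm M q (\<lambda>\<omega>. u t x \<omega> - u t' x' \<omega>) \<le> ennreal e"
      using q e by (intro Lp_norm_le) auto
  qed
qed

lemma Lp_norm_finite:
  assumes q: "0 < q" and t: "0 \<le> t" shows "Lp_norm M q (u t x) < \<infinity>"
proof -
  have T: "0 < t + 1" "t \<in> {0..t + 1}" using t by auto
  obtain k where k: "1 \<le> k" and "\<exists>C\<ge>0. \<forall>d::real. \<bar>d\<bar> powr q \<le> 1 * (1 + d ^ (2 * Suc k)) + C * d\<^sup>2"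
    using powr_le_interpolation[OF q] zero_less_one by blast
  then obtain C where C: "0 \<le> C" "\<And>d::real. \<bar>d\<bar> powr q \<le> 1 + d ^ (2 * Suc k) + C * d\<^sup>2" by auto
  obtain B where B: "0 \<le> B" "(\<integral>\<^sup>+\<omega>. ennreal (u t x \<omega> ^ (2 * Suc k)) \<partial>M) \<le> ennreal B"
    using moment[OF T(1) k] T(2) by blast
  obtain B2 where B2: "0 \<le> B2" "(\<integral>\<^sup>+\<omega>. ennreal ((u t x \<omega>)\<^sup>2) \<partial>M) \<le> ennreal B2"
    using second_moment[OF T(1)] T(2) by blast
  have [measurable]: "u t x \<in> borel_measurable M" using t by (rule u_meas)
  have "(\<integral>\<^sup>+\<omega>. ennreal (\<bar>u t x \<omega>\<bar> powr q) \<partial>M) \<le> (\<integral>\<^sup>+\<omega>. 1 + ennreal (u t x \<omega> ^ (2 * Suc k)) + ennreal C * ennreal ((u t x \<omega>)\<^sup>2) \<partial>M)"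
  proof (rule nn_integral_mono)
    fix \<omega>
    have "0 \<le> u t x \<omega> ^ (2 * Suc k)" by (rule zero_le_even_power) simp
    then show "ennreal (\<bar>u t x \<omega>\<bar> powr q) \<le> 1 + ennreal (u t x \<omega> ^ (2 * Suc k)) + ennreal C * ennreal ((u t x \<omega>)\<^sup>2)"
      using ennreal_leI[OF C(2)[of "u t x \<omega>"]] C(1) by (simp add: ennreal_mult' ennreal_plus del: power_Suc mult_Suc_right)
  qed
  also have "\<dots> = 1 + (\<integral>\<^sup>+\<omega>. ennreal (u t x \<omega> ^ (2 * Suc k)) \<partial>M) + ennreal C * (\<integral>\<^sup>+\<omega>. ennreal ((u t x \<omega>)\<^sup>2) \<partial>M)"
    by (simp add: nn_integral_cmult nn_integral_add emeasure_space_1 del: power_Suc mult_Suc_right)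
  also have "\<dots> \<le> 1 + ennreal B + ennreal C * ennreal B2"
    by (intro add_mono mult_left_mono B B2) auto
  also have "\<dots> < \<infinity>" by (simp add: ennreal_mult_less_top)
  finally show ?thesis unfolding Lp_norm_def by (auto simp: Let_def)
qed

section \<open>Modulus of continuity in L^2 and in L^p\<close>

text \<open>The stochastic convolutions at two points differ by an integral against the difference
  of two shifted kernels, with a random factor of bounded second moment. Its size follows from the
  kernel modulus, uniformly over bounded times and all of space; the initial datum stays separate,
  since its modulus is uniform only for uniformly continuous u0.\<close>

lemma L2_modulus:
  assumes T: "0 < T" and e: "0 < e"
  shows "\<exists>d>0. \<forall>t\<in>{0..T}. \<forall>t'\<in>{0..T}. \<forall>x x'. \<bar>t - t'\<bar> < d \<longrightarrow> \<bar>x - x'\<bar> < d \<longrightarrow>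
    (\<integral>\<^sup>+\<omega>. ennreal ((u t x \<omega> - u t' x' \<omega>)\<^sup>2) \<partial>M) \<le> ennreal (e + 2 * (levy_semigroup p t u0 x - levy_semigroup p t' u0 x')\<^sup>2)"
proof -
  obtain B where B: "0 \<le> B" "\<And>t x. t \<in> {0..T} \<Longrightarrow> (\<integral>\<^sup>+\<omega>. ennreal ((u t x \<omega>)\<^sup>2) \<partial>M) \<le> ennreal B"
    using second_moment[OF T] by blast
  obtain A where A: "1 \<le> A" "\<And>v. \<bar>\<sigma> v\<bar> \<le> A * \<bar>1 + \<bar>v\<bar>\<bar>" using \<sigma>_growth by blast
  define Cs where "Cs = 2 * A\<^sup>2 * (1 + B)"
  have Cs: "0 \<le> Cs" using B by (simp add: Cs_def)
  have \<sigma>2: "(\<integral>\<^sup>+\<omega>. ennreal ((\<sigma> (u s y \<omega>))\<^sup>2) \<partial>M) \<le> ennreal Cs" if s: "s \<in> {0..T}" for s y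
  proof -
    have [measurable]: "u s y \<in> borel_measurable M" using s by (auto intro: u_meas)
    have "(\<integral>\<^sup>+\<omega>. ennreal ((\<sigma> (u s y \<omega>))\<^sup>2) \<partial>M) \<le> (\<integral>\<^sup>+\<omega>. ennreal (2 * A\<^sup>2) * (1 + ennreal ((u s y \<omega>)\<^sup>2)) \<partial>M)"
    proof (rule nn_integral_mono)
      fix \<omega>
      define v where "v = u s y \<omega>"
      have "(\<sigma> v)\<^sup>2 \<le> (A * \<bar>1 + \<bar>v\<bar>\<bar>)\<^sup>2" using power_mono[OF A(2)[of v], of 2] by simp
      also have "\<dots> = A\<^sup>2 * (1 + \<bar>v\<bar>)\<^sup>2" by (simp add: power_mult_distrib)
      also have "\<dots> \<le> A\<^sup>2 * (2 * (1 + v\<^sup>2))"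
      proof (rule mult_left_mono)
        have "0 \<le> (1 - \<bar>v\<bar>)\<^sup>2" by simp
        then show "(1 + \<bar>v\<bar>)\<^sup>2 \<le> 2 * (1 + v\<^sup>2)" by (simp add: power2_eq_square algebra_simps)
      qed simp
      finally have "ennreal ((\<sigma> v)\<^sup>2) \<le> ennreal (2 * A\<^sup>2 * (1 + v\<^sup>2))" by (intro ennreal_leI) (simp add: algebra_simps)
      then show "ennreal ((\<sigma> (u s y \<omega>))\<^sup>2) \<le> ennreal (2 * A\<^sup>2) * (1 + ennreal ((u s y \<omega>)\<^sup>2))"
        unfolding v_def by (simp add: ennreal_mult' ennreal_plus)
    qed
    also have "\<dots> = ennreal (2 * A\<^sup>2) * (1 + (\<integral>\<^sup>+\<omega>. ennreal ((u s y \<omega>)\<^sup>2) \<partial>M))"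
      by (simp add: nn_integral_cmult nn_integral_add emeasure_space_1)
    also have "\<dots> \<le> ennreal (2 * A\<^sup>2) * (1 + ennreal B)" by (intro mult_left_mono add_left_mono B s) auto
    also have "\<dots> = ennreal Cs" using B by (simp add: Cs_def ennreal_mult' ennreal_plus)
    finally show ?thesis .
  qed
  \<comment> \<open>The factor 18 is 2 from splitting the square times 9 from the Walsh estimate; Cs
    + 1 avoids dividing by zero.\<close>
  define e0 where "e0 = e / (18 * (Cs + 1))"
  have e0: "0 < e0" using e Cs by (simp add: e0_def)
  have e0': "18 * (Cs * e0) \<le> e" using e Cs by (simp add: e0_def divide_simps)
  obtain d where d: "0 < d" "\<And>t t' x x'. t \<in> {0..T} \<Longrightarrow> t' \<in> {0..T} \<Longrightarrow> \<bar>t - t'\<bar> < d \<Longrightarrow> \<bar>x - x'\<bar> < d \<Longrightarrow>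
    (\<integral>\<^sup>+z\<in>halfspace. ennreal ((pker p (t - fst z, snd z - x) - pker p (t' - fst z, snd z - x'))\<^sup>2) \<partial>lborel) \<le> ennreal e0"
    using pker_modulus[OF e0, of T] by blast
  show ?thesis
  proof (intro exI[of _ d] conjI d(1) ballI allI impI)
    fix t t' x x' assume t: "t \<in> {0..T}" "t' \<in> {0..T}" "\<bar>t - t'\<bar> < d" "\<bar>x - x'\<bar> < d"
    then have t0: "0 \<le> t" "0 \<le> t'" by auto
    define P P' where "P = levy_semigroup p t u0 x" and "P' = levy_semigroup p t' u0 x'"
    obtain Z where Z: "has_walsh_integral M F w (\<lambda>s y \<omega>. shifted t x (s, y) * \<sigma> (u s y \<omega>)) Z"
      "AE \<omega> in M. u t x \<omega> = P + Z \<omega>" "Z \<in> borel_measurable M"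
      using mild_Z[OF t0(1)] unfolding P_def by blast
    obtain Z' where Z': "has_walsh_integral M F w (\<lambda>s y \<omega>. shifted t' x' (s, y) * \<sigma> (u s y \<omega>)) Z'"
      "AE \<omega> in M. u t' x' \<omega> = P' + Z' \<omega>" "Z' \<in> borel_measurable M"
      using mild_Z[OF t0(2)] unfolding P'_def by blast
    note [measurable] = Z(3) Z'(3) shifted_borel pker_borel
    have sq: "sqn M (\<lambda>s y \<omega>. shifted t x (s, y) * \<sigma> (u s y \<omega>) - shifted t' x' (s, y) * \<sigma> (u s y \<omega>)) \<le> ennreal (Cs * e0)"
    proof -
      have m1: "(\<lambda>z. pker p (r - fst z, snd z - v)) \<in> borel_measurable borel" for r v
        by (rule measurable_compose[OF Pair_borel pker_borel]) measurable
      have "sqn M (\<lambda>s y \<omega>. shifted t x (s, y) * \<sigma> (u s y \<omega>) - shifted t' x' (s, y) * \<sigma> (u s y \<omega>))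
        \<le> (\<integral>\<^sup>+z. ennreal Cs * (ennreal ((pker p (t - fst z, snd z - x) - pker p (t' - fst z, snd z - x'))\<^sup>2) * indicator halfspace z) \<partial>lborel)"
        unfolding sqn_def
      proof (rule nn_integral_mono)
        fix z :: "real \<times> real"
        let ?k = "shifted t x z - shifted t' x' z"
        show "(\<integral>\<^sup>+\<omega>. ennreal ((shifted t x (fst z, snd z) * \<sigma> (u (fst z) (snd z) \<omega>) - shifted t' x' (fst z, snd z) * \<sigma> (u (fst z) (snd z) \<omega>))\<^sup>2) \<partial>M) * indicator halfspace z
          \<le> ennreal Cs * (ennreal ((pker p (t - fst z, snd z - x) - pker p (t' - fst z, snd z - x'))\<^sup>2) * indicator halfspace z)"
        proof (cases "z \<in> halfspace")
          case True
          then have z: "0 < fst z" by (auto simp: halfspace_def)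
          have [measurable]: "u (fst z) (snd z) \<in> borel_measurable M" using z by (intro u_meas) simp
          have k: "?k = pker p (t - fst z, snd z - x) - pker p (t' - fst z, snd z - x')" using z by (simp add: shifted_def)
          have "(\<integral>\<^sup>+\<omega>. ennreal ((shifted t x (fst z, snd z) * \<sigma> (u (fst z) (snd z) \<omega>) - shifted t' x' (fst z, snd z) * \<sigma> (u (fst z) (snd z) \<omega>))\<^sup>2) \<partial>M)
            = (\<integral>\<^sup>+\<omega>. ennreal (?k\<^sup>2) * ennreal ((\<sigma> (u (fst z) (snd z) \<omega>))\<^sup>2) \<partial>M)"
            by (intro nn_integral_cong) (simp add: left_diff_distrib[symmetric] power_mult_distrib ennreal_mult')
          also have "\<dots> = ennreal (?k\<^sup>2) * (\<integral>\<^sup>+\<omega>. ennreal ((\<sigma> (u (fst z) (snd z) \<omega>))\<^sup>2) \<partial>M)"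
            by (rule nn_integral_cmult) measurable
          also have "\<dots> \<le> ennreal (?k\<^sup>2) * ennreal Cs"
          proof (cases "fst z \<le> T")
            case True
            then show ?thesis using z by (intro mult_left_mono \<sigma>2) auto
          next
            case False
            then have "?k = 0" using t by (simp add: shifted_zero)
            then show ?thesis by simp
          qed
          finally show ?thesis using True unfolding k by (simp add: mult.commute)
        qed simp
      qed
      also have "\<dots> = ennreal Cs * (\<integral>\<^sup>+z\<in>halfspace. ennreal ((pker p (t - fst z, snd z - x) - pker p (t' - fst z, snd z - x'))\<^sup>2) \<partial>lborel)"
        by (rule nn_integral_cmult) (use m1 in measurable)
      also have "\<dots> \<le> ennreal Cs * ennreal e0" by (intro mult_left_mono d t) auto
      finally show ?thesis using Cs by (simp add: ennreal_mult')
    qed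
    have "(\<integral>\<^sup>+\<omega>. ennreal ((u t x \<omega> - u t' x' \<omega>)\<^sup>2) \<partial>M) \<le> (\<integral>\<^sup>+\<omega>. ennreal (2 * (P - P')\<^sup>2) + 2 * ennreal ((Z \<omega> - Z' \<omega>)\<^sup>2) \<partial>M)"
    proof (rule nn_integral_mono_AE)
      show "AE \<omega> in M. ennreal ((u t x \<omega> - u t' x' \<omega>)\<^sup>2) \<le> ennreal (2 * (P - P')\<^sup>2) + 2 * ennreal ((Z \<omega> - Z' \<omega>)\<^sup>2)"
        using Z(2) Z'(2)
      proof eventually_elim
        case (elim \<omega>)
        define v where "v = Z \<omega> - Z' \<omega>"
        have "0 \<le> ((P - P') - v)\<^sup>2" by simp
        then have "((P - P') + v)\<^sup>2 \<le> 2 * (P - P')\<^sup>2 + 2 * v\<^sup>2" by (simp add: power2_eq_square algebra_simps)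
        moreover have "u t x \<omega> - u t' x' \<omega> = (P - P') + v" using elim by (simp add: v_def)
        ultimately have "ennreal ((u t x \<omega> - u t' x' \<omega>)\<^sup>2) \<le> ennreal (2 * (P - P')\<^sup>2 + 2 * v\<^sup>2)" by (intro ennreal_leI) simp
        then show ?case by (simp add: v_def ennreal_plus ennreal_mult')
      qed
    qed
    also have "\<dots> = ennreal (2 * (P - P')\<^sup>2) + 2 * (\<integral>\<^sup>+\<omega>. ennreal ((Z \<omega> - Z' \<omega>)\<^sup>2) \<partial>M)"
      by (simp add: nn_integral_cmult nn_integral_add emeasure_space_1)
    also have "\<dots> \<le> ennreal (2 * (P - P')\<^sup>2) + 2 * (9 * ennreal (Cs * e0))"
      by (intro add_left_mono mult_left_mono order_trans[OF walsh_diff_L2[OF Z(1) Z'(1)]] sq) auto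
    also have "2 * (9 * ennreal (Cs * e0)) = ennreal (18 * (Cs * e0))"
      using Cs e0 by (simp add: ennreal_mult' mult.assoc[symmetric])
    also have "ennreal (2 * (P - P')\<^sup>2) + ennreal (18 * (Cs * e0)) \<le> ennreal (2 * (P - P')\<^sup>2) + ennreal e"
      by (intro add_left_mono ennreal_leI e0')
    also have "\<dots> = ennreal (e + 2 * (P - P')\<^sup>2)" using e by (simp add: ennreal_plus add.commute)
    finally show "(\<integral>\<^sup>+\<omega>. ennreal ((u t x \<omega> - u t' x' \<omega>)\<^sup>2) \<partial>M) \<le> ennreal (e + 2 * (levy_semigroup p t u0 x - levy_semigroup p t' u0 x')\<^sup>2)"
      unfolding P_def P'_def .
  qed
qed

lemma semigroup_sq_small:
  assumes "0 < e" "\<bar>v\<bar> \<le> sqrt (e / 4)" shows "e / 2 + 2 * v\<^sup>2 \<le> e"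
  using power_mono[OF assms(2), of 2] assms(1) by simp

text \<open>The modulus is taken on the interval up to t + 1, and the neighbourhood has radius at
  most 1, so all nearby times stay in that interval.\<close>

lemma L2_continuous:
  assumes u0: "continuous_on UNIV u0" and t: "0 \<le> t" and e: "0 < e"
  shows "\<exists>d>0. \<forall>s\<ge>0. \<forall>y. \<bar>s - t\<bar> < d \<longrightarrow> \<bar>y - x\<bar> < d \<longrightarrow> (\<integral>\<^sup>+\<omega>. ennreal ((u s y \<omega> - u t x \<omega>)\<^sup>2) \<partial>M) \<le> ennreal e"
proof -
  have e': "0 < e / 2" "0 < sqrt (e / 4)" using e by auto
  obtain d1 where d1: "0 < d1" "\<And>s s' y y'. s \<in> {0..t+1} \<Longrightarrow> s' \<in> {0..t+1} \<Longrightarrow> \<bar>s - s'\<bar> < d1 \<Longrightarrow> \<bar>y - y'\<bar> < d1 \<Longrightarrow>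
    (\<integral>\<^sup>+\<omega>. ennreal ((u s y \<omega> - u s' y' \<omega>)\<^sup>2) \<partial>M) \<le> ennreal (e / 2 + 2 * (levy_semigroup p s u0 y - levy_semigroup p s' u0 y')\<^sup>2)"
    using L2_modulus[of "t + 1" "e / 2"] e' t by auto
  obtain d2 where d2: "0 < d2" "\<And>s y. 0 \<le> s \<Longrightarrow> \<bar>s - t\<bar> < d2 \<Longrightarrow> \<bar>y - x\<bar> < d2 \<Longrightarrow> \<bar>levy_semigroup p s u0 y - levy_semigroup p t u0 x\<bar> \<le> sqrt (e / 4)"
    using semigroup_continuous[OF u0_borel u0 u0_bound e'(2) t, of x] by blast
  show ?thesis
  proof (intro exI[of _ "min (min d1 d2) 1"] conjI allI impI)
    fix s y assume s: "0 \<le> s" "\<bar>s - t\<bar> < min (min d1 d2) 1" "\<bar>y - x\<bar> < min (min d1 d2) 1"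
    then have "s \<in> {0..t+1}" "t \<in> {0..t+1}" using t by auto
    then have "(\<integral>\<^sup>+\<omega>. ennreal ((u s y \<omega> - u t x \<omega>)\<^sup>2) \<partial>M) \<le> ennreal (e / 2 + 2 * (levy_semigroup p s u0 y - levy_semigroup p t u0 x)\<^sup>2)"
      using s by (intro d1) auto
    also have "\<dots> \<le> ennreal e" using s by (intro ennreal_leI semigroup_sq_small e d2) auto
    finally show "(\<integral>\<^sup>+\<omega>. ennreal ((u s y \<omega> - u t x \<omega>)\<^sup>2) \<partial>M) \<le> ennreal e" .
  qed (use d1 d2 in auto)
qed

lemma continuous_Lp:
  assumes u0: "continuous_on UNIV u0" and q: "0 < q"
  shows "continuous_in_Lp M q u"
  unfolding continuous_in_Lp_def
proof (intro conjI allI impI)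
  fix t x :: real assume t: "0 \<le> t"
  show "u t x \<in> borel_measurable M" by (rule u_meas[OF t])
  show "Lp_norm M q (u t x) < \<infinity>" by (rule Lp_norm_finite[OF q t])
  show "((\<lambda>(s, y). Lp_norm M q (\<lambda>\<omega>. u s y \<omega> - u t x \<omega>)) \<longlongrightarrow> 0) (at (t, x) within {0..} \<times> UNIV)"
  proof (rule ennreal_tendsto_0I)
    fix e :: real assume e: "0 < e"
    obtain \<eta> where \<eta>: "0 < \<eta>" "\<And>s s' y y'. s \<in> {0..t+1} \<Longrightarrow> s' \<in> {0..t+1} \<Longrightarrow> (\<integral>\<^sup>+\<omega>. ennreal ((u s y \<omega> - u s' y' \<omega>)\<^sup>2) \<partial>M) \<le> ennreal \<eta> \<Longrightarrow>
      Lp_norm M q (\<lambda>\<omega>. u s y \<omega> - u s' y' \<omega>) \<le> ennreal e"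
      using Lp_norm_small[of "t + 1" q e] t q e by auto
    obtain d where d: "0 < d" "\<And>s y. 0 \<le> s \<Longrightarrow> \<bar>s - t\<bar> < d \<Longrightarrow> \<bar>y - x\<bar> < d \<Longrightarrow> (\<integral>\<^sup>+\<omega>. ennreal ((u s y \<omega> - u t x \<omega>)\<^sup>2) \<partial>M) \<le> ennreal \<eta>"
      using L2_continuous[OF u0 t \<eta>(1), of x] by blast
    show "\<forall>\<^sub>F z in at (t, x) within {0..} \<times> UNIV. (case z of (s, y) \<Rightarrow> Lp_norm M q (\<lambda>\<omega>. u s y \<omega> - u t x \<omega>)) \<le> ennreal e"
      unfolding eventually_at
    proof (intro exI[of _ "min d 1"] conjI ballI impI)
      fix z assume z: "z \<in> {0..} \<times> (UNIV :: real set)" "z \<noteq> (t, x) \<and> dist z (t, x) < min d 1"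
      obtain s y where sy: "z = (s, y)" by (cases z)
      have "\<bar>s - t\<bar> \<le> dist z (t, x)" "\<bar>y - x\<bar> \<le> dist z (t, x)"
        using dist_fst_le[of z "(t, x)"] dist_snd_le[of z "(t, x)"] by (simp_all add: sy dist_real_def)
      then have c: "\<bar>s - t\<bar> < min d 1" "\<bar>y - x\<bar> < d" using z by linarith+
      then show "(case z of (s, y) \<Rightarrow> Lp_norm M q (\<lambda>\<omega>. u s y \<omega> - u t x \<omega>)) \<le> ennreal e"
        unfolding sy prod.case using z t by (intro \<eta>(2) d(2)) (auto simp: sy)
    qed (use d in auto)
  qed
qed

lemma uniform_Lp:
  assumes u0: "uniformly_continuous_on UNIV u0" and T: "0 < T" and q: "0 < q"
  shows "((\<lambda>(\<delta>, \<rho>).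
                   SUP (s, t)\<in>{(s, t). s \<in> {0..T} \<and> t \<in> {0..T} \<and> \<bar>t - s\<bar> \<le> \<rho>}.
                   SUP (x, y)\<in>{(x, y). \<bar>x - y\<bar> \<le> \<delta>}.
                     Lp_norm M q (\<lambda>\<omega>. u t x \<omega> - u s y \<omega>)) \<longlongrightarrow> 0)
               (at_right 0 \<times>\<^sub>F at_right 0)"
proof (rule ennreal_tendsto_0I)
  fix e :: real assume e: "0 < e"
  obtain \<eta> where \<eta>: "0 < \<eta>" "\<And>s s' y y'. s \<in> {0..T} \<Longrightarrow> s' \<in> {0..T} \<Longrightarrow> (\<integral>\<^sup>+\<omega>. ennreal ((u s y \<omega> - u s' y' \<omega>)\<^sup>2) \<partial>M) \<le> ennreal \<eta> \<Longrightarrow>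
      Lp_norm M q (\<lambda>\<omega>. u s y \<omega> - u s' y' \<omega>) \<le> ennreal e"
    using Lp_norm_small[OF T q e] by blast
  have e': "0 < \<eta> / 2" "0 < sqrt (\<eta> / 4)" using \<eta> by auto
  obtain d1 where d1: "0 < d1" "\<And>s s' y y'. s \<in> {0..T} \<Longrightarrow> s' \<in> {0..T} \<Longrightarrow> \<bar>s - s'\<bar> < d1 \<Longrightarrow> \<bar>y - y'\<bar> < d1 \<Longrightarrow>
    (\<integral>\<^sup>+\<omega>. ennreal ((u s y \<omega> - u s' y' \<omega>)\<^sup>2) \<partial>M) \<le> ennreal (\<eta> / 2 + 2 * (levy_semigroup p s u0 y - levy_semigroup p s' u0 y')\<^sup>2)"
    using L2_modulus[OF T e'(1)] by blast
  obtain d2 where d2: "0 < d2" "\<And>s t x y. 0 \<le> s \<Longrightarrow> 0 \<le> t \<Longrightarrow> \<bar>t - s\<bar> < d2 \<Longrightarrow> \<bar>x - y\<bar> < d2 \<Longrightarrow> \<bar>levy_semigroup p t u0 x - levy_semigroup p s u0 y\<bar> \<le> sqrt (\<eta> / 4)"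
    using semigroup_uniform[OF u0_borel u0 u0_bound e'(2)] by blast
  define d where "d = min d1 d2"
  have d: "0 < d" using d1 d2 by (simp add: d_def)
  have main: "Lp_norm M q (\<lambda>\<omega>. u t x \<omega> - u s y \<omega>) \<le> ennreal e"
    if "s \<in> {0..T}" "t \<in> {0..T}" "\<bar>t - s\<bar> < d" "\<bar>x - y\<bar> < d" for s t x y
  proof (rule \<eta>(2))
    have "(\<integral>\<^sup>+\<omega>. ennreal ((u t x \<omega> - u s y \<omega>)\<^sup>2) \<partial>M) \<le> ennreal (\<eta> / 2 + 2 * (levy_semigroup p t u0 x - levy_semigroup p s u0 y)\<^sup>2)"
      using that by (intro d1) (auto simp: d_def)
    also have "\<dots> \<le> ennreal \<eta>" using that by (intro ennreal_leI semigroup_sq_small \<eta> d2) (auto simp: d_def)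
    finally show "(\<integral>\<^sup>+\<omega>. ennreal ((u t x \<omega> - u s y \<omega>)\<^sup>2) \<partial>M) \<le> ennreal \<eta>" .
  qed (use that in auto)
  \<comment> \<open>Only upper bounds on the two radii matter, so one threshold serves both
    right-hand limits of the product filter.\<close>
  have ev: "\<forall>\<^sub>F \<delta> in at_right (0::real). \<delta> < d" using d by (intro order_tendstoD[OF tendsto_ident_at])
  show "\<forall>\<^sub>F z in at_right 0 \<times>\<^sub>F at_right 0. (case z of (\<delta>, \<rho>) \<Rightarrow>
                   SUP (s, t)\<in>{(s, t). s \<in> {0..T} \<and> t \<in> {0..T} \<and> \<bar>t - s\<bar> \<le> \<rho>}.
                   SUP (x, y)\<in>{(x, y). \<bar>x - y\<bar> \<le> \<delta>}.
                     Lp_norm M q (\<lambda>\<omega>. u t x \<omega> - u s y \<omega>)) \<le> ennreal e"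
    unfolding eventually_prod_filter
  proof (intro exI[of _ "\<lambda>\<delta>. \<delta> < d"] conjI ev allI impI)
    fix \<delta> \<rho> :: real assume "\<delta> < d" "\<rho> < d"
    then show "(case (\<delta>, \<rho>) of (\<delta>, \<rho>) \<Rightarrow>
                   SUP (s, t)\<in>{(s, t). s \<in> {0..T} \<and> t \<in> {0..T} \<and> \<bar>t - s\<bar> \<le> \<rho>}.
                   SUP (x, y)\<in>{(x, y). \<bar>x - y\<bar> \<le> \<delta>}.
                     Lp_norm M q (\<lambda>\<omega>. u t x \<omega> - u s y \<omega>)) \<le> ennreal e"
      unfolding prod.case by (intro SUP_least) (auto intro!: SUP_least main)
  qed
qed

text \<open>
  A modification that is separable for a dense countable set: at the points of that set nothing is
  changed, elsewhere take the upper limit along a sequence of such points converging so fast that the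
  values of \<open>u\<close> converge almost surely.
\<close>

lemma separable_modification:
  assumes u0: "continuous_on UNIV u0"
  shows "\<exists>v. is_modification M u v \<and> separable_field M v"
proof -
  obtain D where D: "countable D" "D \<subseteq> {0::real..} \<times> (UNIV :: real set)" "{0::real..} \<times> (UNIV :: real set) \<subseteq> closure D"
    using separable[of "{0::real..} \<times> (UNIV :: real set)"] by blast
  \<comment> \<open>Square errors at most 2^(-n) are summable, which later gives almost sure
    convergence along the sequence. At points of \<open>D\<close> the sequence is constant, so the
    field is left unchanged there.\<close>
  define Q where "Q z \<zeta> \<longleftrightarrow> (\<forall>n. \<zeta> n \<in> D) \<and> \<zeta> \<longlonglongrightarrow> z \<and> (z \<in> D \<longrightarrow> \<zeta> = (\<lambda>_. z)) \<and>
    (\<forall>n. (\<integral>\<^sup>+\<omega>. ennreal ((u (fst (\<zeta> n)) (snd (\<zeta> n)) \<omega> - u (fst z) (snd z) \<omega>)\<^sup>2) \<partial>M) \<le> ennreal ((1/2) ^ n))"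
    for z and \<zeta> :: "nat \<Rightarrow> real \<times> real"
  have "\<exists>\<zeta>. Q z \<zeta>"
    if z: "z \<in> {0::real..} \<times> (UNIV :: real set)" for z
  proof (cases "z \<in> D")
    case True
    then show ?thesis unfolding Q_def by (intro exI[of _ "\<lambda>_. z"]) auto
  next
    case False
    obtain t x where tx: "z = (t, x)" "0 \<le> t" using z by (cases z) auto
    have "\<exists>\<zeta>\<in>D. dist \<zeta> z < 1 / real (Suc n) \<and> (\<integral>\<^sup>+\<omega>. ennreal ((u (fst \<zeta>) (snd \<zeta>) \<omega> - u (fst z) (snd z) \<omega>)\<^sup>2) \<partial>M) \<le> ennreal ((1/2) ^ n)" for n
    proof -
      obtain d where d: "0 < d" "\<And>s y. 0 \<le> s \<Longrightarrow> \<bar>s - t\<bar> < d \<Longrightarrow> \<bar>y - x\<bar> < d \<Longrightarrow> (\<integral>\<^sup>+\<omega>. ennreal ((u s y \<omega> - u t x \<omega>)\<^sup>2) \<partial>M) \<le> ennreal ((1/2) ^ n)"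
        using L2_continuous[OF u0 tx(2), of "(1/2) ^ n" x] by auto
      have "0 < min d (1 / real (Suc n))" using d by simp
      moreover have "z \<in> closure D" using D(3) z by blast
      ultimately obtain \<zeta> where \<zeta>: "\<zeta> \<in> D" "dist \<zeta> z < min d (1 / real (Suc n))"
        unfolding closure_approachable by blast
      have "\<bar>fst \<zeta> - t\<bar> < d" "\<bar>snd \<zeta> - x\<bar> < d"
        using dist_fst_le[of \<zeta> z] dist_snd_le[of \<zeta> z] \<zeta>(2) by (auto simp: tx dist_real_def)
      moreover have "0 \<le> fst \<zeta>" using \<zeta>(1) D(2) by auto
      ultimately show ?thesis using \<zeta> d(2) by (intro bexI[of _ \<zeta>]) (auto simp: tx)
    qed
    then have "\<forall>n. \<exists>\<zeta>. \<zeta> \<in> D \<and> dist \<zeta> z < 1 / real (Suc n) \<and> (\<integral>\<^sup>+\<omega>. ennreal ((u (fst \<zeta>) (snd \<zeta>) \<omega> - u (fst z) (snd z) \<omega>)\<^sup>2) \<partial>M) \<le> ennreal ((1/2) ^ n)"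
      by blast
    from choice[OF this] obtain \<zeta> where \<zeta>: "\<forall>n. \<zeta> n \<in> D \<and> dist (\<zeta> n) z < 1 / real (Suc n) \<and>
      (\<integral>\<^sup>+\<omega>. ennreal ((u (fst (\<zeta> n)) (snd (\<zeta> n)) \<omega> - u (fst z) (snd z) \<omega>)\<^sup>2) \<partial>M) \<le> ennreal ((1/2) ^ n)" by blast
    have "(\<lambda>n. dist (\<zeta> n) z) \<longlonglongrightarrow> 0"
    proof (rule tendsto_sandwich[OF _ _ tendsto_const LIMSEQ_Suc[OF lim_1_over_n]])
      show "\<forall>\<^sub>F n in sequentially. 0 \<le> dist (\<zeta> n) z" by simp
      have le: "dist (\<zeta> n) z \<le> 1 / real (Suc n)" for n
        using \<zeta>[rule_format, THEN conjunct2, THEN conjunct1, of n] by (rule less_imp_le)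
      show "\<forall>\<^sub>F n in sequentially. dist (\<zeta> n) z \<le> 1 / real (Suc n)"
        unfolding eventually_sequentially using le by blast
    qed
    then have "\<zeta> \<longlonglongrightarrow> z" by (subst tendsto_dist_iff)
    then have "Q z \<zeta>" unfolding Q_def
    proof (intro conjI allI impI)
      show "\<zeta> n \<in> D" for n using \<zeta>[rule_format, of n] by (elim conjE)
      show "\<zeta> = (\<lambda>_. z)" if "z \<in> D" using that False by contradiction
      show "(\<integral>\<^sup>+\<omega>. ennreal ((u (fst (\<zeta> n)) (snd (\<zeta> n)) \<omega> - u (fst z) (snd z) \<omega>)\<^sup>2) \<partial>M) \<le> ennreal ((1/2) ^ n)" for n
        using \<zeta>[rule_format, of n] by (elim conjE)
    qed
    then show ?thesis by (intro exI[of _ \<zeta>])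
  qed
  then have "\<exists>\<zeta>. \<forall>z\<in>{0::real..} \<times> (UNIV :: real set). Q z (\<zeta> z)" by (intro bchoice) blast
  then obtain \<zeta> where \<zeta>0: "\<And>z. z \<in> {0::real..} \<times> (UNIV :: real set) \<Longrightarrow> Q z (\<zeta> z)" by blast
  note \<zeta>' = \<zeta>0[unfolded Q_def]
  have \<zeta>: "\<zeta> z n \<in> D" "\<zeta> z \<longlonglongrightarrow> z" "z \<in> D \<Longrightarrow> \<zeta> z = (\<lambda>_. z)"
    "(\<integral>\<^sup>+\<omega>. ennreal ((u (fst (\<zeta> z n)) (snd (\<zeta> z n)) \<omega> - u (fst z) (snd z) \<omega>)\<^sup>2) \<partial>M) \<le> ennreal ((1/2) ^ n)"
    if "z \<in> {0::real..} \<times> (UNIV :: real set)" for z n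
    using \<zeta>'[OF that] by (elim conjE; simp)+
  \<comment> \<open>The upper limit exists in the extended reals for every outcome, so no
    exceptional set depending on the point has to be removed.\<close>
  define v where "v t x \<omega> = limsup (\<lambda>n. ereal (u (fst (\<zeta> (t, x) n)) (snd (\<zeta> (t, x) n)) \<omega>))" for t x \<omega>
  have "is_modification M u v"
    unfolding is_modification_def
  proof (intro allI impI conjI)
    fix t x :: real assume t: "0 \<le> t"
    then have z: "(t, x) \<in> {0..} \<times> UNIV" by simp
    have "0 \<le> fst (\<zeta> (t, x) n)" for n using \<zeta>(1)[OF z, of n] D(2) by auto
    then have [measurable]: "u (fst (\<zeta> (t, x) n)) (snd (\<zeta> (t, x) n)) \<in> borel_measurable M" for n by (rule u_meas)
    have [measurable]: "u t x \<in> borel_measurable M" by (rule u_meas[OF t])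
    show "v t x \<in> borel_measurable M" unfolding v_def[abs_def] by measurable
    define E where "E n \<omega> = (u (fst (\<zeta> (t, x) n)) (snd (\<zeta> (t, x) n)) \<omega> - u t x \<omega>)\<^sup>2" for n \<omega>
    have [measurable]: "E n \<in> borel_measurable M" for n unfolding E_def[abs_def] by measurable
    \<comment> \<open>The squared errors have a sum of finite expectation; hence they are almost
      surely summable and tend to 0.\<close>
    have "(\<integral>\<^sup>+\<omega>. (\<Sum>n. ennreal (E n \<omega>)) \<partial>M) = (\<Sum>n. \<integral>\<^sup>+\<omega>. ennreal (E n \<omega>) \<partial>M)"
      by (rule nn_integral_suminf) measurable
    also have "\<dots> \<le> (\<Sum>n. ennreal ((1/2) ^ n))"
      using \<zeta>(4)[OF z] by (intro suminf_le) (auto simp: E_def)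
    also have "\<dots> = ennreal (\<Sum>n. (1/2) ^ n)" by (rule suminf_ennreal2) auto
    finally have "(\<integral>\<^sup>+\<omega>. (\<Sum>n. ennreal (E n \<omega>)) \<partial>M) \<noteq> \<infinity>" by (auto simp: top_unique)
    then have "AE \<omega> in M. (\<Sum>n. ennreal (E n \<omega>)) \<noteq> \<infinity>" by (intro nn_integral_PInf_AE) auto
    then show "AE \<omega> in M. v t x \<omega> = ereal (u t x \<omega>)"
    proof eventually_elim
      case (elim \<omega>)
      then have "summable (\<lambda>n. E n \<omega>)" by (intro summable_suminf_not_top) (auto simp: E_def)
      then have "(\<lambda>n. sqrt (E n \<omega>)) \<longlonglongrightarrow> sqrt 0" by (intro tendsto_real_sqrt summable_LIMSEQ_zero)
      then have "(\<lambda>n. u (fst (\<zeta> (t, x) n)) (snd (\<zeta> (t, x) n)) \<omega> - u t x \<omega>) \<longlonglongrightarrow> 0"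
        by (simp add: E_def tendsto_rabs_zero_iff)
      then have "(\<lambda>n. u (fst (\<zeta> (t, x) n)) (snd (\<zeta> (t, x) n)) \<omega>) \<longlonglongrightarrow> u t x \<omega>" by (rule LIM_zero_cancel)
      then have "(\<lambda>n. ereal (u (fst (\<zeta> (t, x) n)) (snd (\<zeta> (t, x) n)) \<omega>)) \<longlonglongrightarrow> ereal (u t x \<omega>)" by (rule tendsto_ereal)
      then show ?case unfolding v_def by (rule lim_imp_Limsup[rotated]) simp
    qed
  qed
  moreover have "separable_field M v"
    unfolding separable_field_def
  \<comment> \<open>The exceptional null set is empty: separability holds for every outcome by
    construction of the field.\<close>
  proof (intro exI[of _ D] exI[of _ "{}"] conjI D ballI allI impI)
    fix \<omega> G C z assume GC: "open G \<and> closed C \<and> (\<forall>(t, x)\<in>G \<inter> D. v t x \<omega> \<in> C)"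
      and zG: "z \<in> G \<inter> ({0::real..} \<times> (UNIV :: real set))"
    have "v t x \<omega> \<in> C" if tx: "(t, x) \<in> G" "0 \<le> t" for t x
    proof -
      have z: "(t, x) \<in> {0..} \<times> UNIV" using tx by simp
      let ?X = "\<lambda>n. ereal (u (fst (\<zeta> (t, x) n)) (snd (\<zeta> (t, x) n)) \<omega>)"
      have inC: "?X n \<in> C" if n: "\<zeta> (t, x) n \<in> G" for n
      proof -
        obtain s y where sy: "\<zeta> (t, x) n = (s, y)" by (cases "\<zeta> (t, x) n")
        have d: "(s, y) \<in> D" using \<zeta>(1)[OF z, of n] sy by simp
        then have "\<zeta> (s, y) = (\<lambda>_. (s, y))" using D(2) by (intro \<zeta>(3)) auto
        then have "v s y \<omega> = ereal (u s y \<omega>)" by (simp add: v_def Limsup_const)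
        moreover have "v s y \<omega> \<in> C" using GC d n sy by auto
        ultimately show ?thesis by (simp add: sy)
      qed
      have "\<forall>\<^sub>F n in sequentially. \<zeta> (t, x) n \<in> G"
        using topological_tendstoD[OF \<zeta>(2)[OF z]] GC tx by blast
      then have ev: "\<forall>\<^sub>F n in sequentially. ?X n \<in> C" by eventually_elim (rule inC)
      \<comment> \<open>The upper limit is attained along a subsequence. Its terms are eventually
        values of the field at points of \<open>D\<close> in \<open>G\<close>, hence in
        \<open>C\<close>, and \<open>C\<close> is closed.\<close>
      obtain r :: "nat \<Rightarrow> nat" where r: "strict_mono r" "(?X \<circ> r) \<longlonglongrightarrow> limsup ?X" using limsup_subseq_lim by blast
      have "\<forall>\<^sub>F n in sequentially. (?X \<circ> r) n \<in> C"
        using eventually_subseq[OF r(1) ev] by (simp add: o_def)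
      then have "limsup ?X \<in> C" using GC r(2) by (intro Lim_in_closed_set[of C "?X \<circ> r" sequentially]) auto
      then show ?thesis by (simp add: v_def)
    qed
    then show "case z of (t, x) \<Rightarrow> v t x \<omega> \<in> C" using zG by (cases z) auto
  qed auto
  ultimately show ?thesis by blast
qed

end

lemma mild_settingI:
  assumes "levy_process N X" "characteristic_exponent N X \<Psi>" "\<forall>\<beta>>0. Upsilon \<Psi> \<beta> < \<infinity>"
    "transition_density N X p" "prob_space M" "white_noise M w" "L-lipschitz_on UNIV \<sigma>"
    "u0 \<in> borel_measurable borel" "\<And>x. \<bar>u0 x\<bar> \<le> U" "mild_solution M w p \<sigma> u0 u"
  shows "mild_setting N X \<Psi> p M w \<sigma> u0 u L U"
  using assms by (simp add: mild_setting_def mild_setting_axioms_def levy_setting_def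
      white_noise_space_def white_noise_space_axioms_def)

theorem theoremA1:
  fixes N :: "'v measure" and X :: "real \<Rightarrow> 'v \<Rightarrow> real"
    and \<Psi> :: "real \<Rightarrow> complex" and p :: "real \<Rightarrow> real \<Rightarrow> real"
    and M :: "'w measure" and w :: "(real \<times> real) set \<Rightarrow> 'w \<Rightarrow> real"
    and \<sigma> u0 :: "real \<Rightarrow> real" and u :: "real \<Rightarrow> real \<Rightarrow> 'w \<Rightarrow> real"
  assumes "levy_process N X"
    and "characteristic_exponent N X \<Psi>"
    and "\<forall>\<beta>>0. Upsilon \<Psi> \<beta> < \<infinity>"
    and "transition_density N X p"
    and "prob_space M" and "complete_measure M"
    and "white_noise M w"
    and "\<exists>L. L-lipschitz_on UNIV \<sigma>" and "0 < Lip \<sigma>"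
    and "u0 \<in> borel_measurable borel" and "bounded (range u0)" and "\<forall>x. 0 \<le> u0 x"
    and "mild_solution M w p \<sigma> u0 u"
  shows "(continuous_on UNIV u0 \<longrightarrow>
            (\<forall>q>0. continuous_in_Lp M q u) \<and>
            (\<exists>v. is_modification M u v \<and> separable_field M v)) \<and>
         (uniformly_continuous_on UNIV u0 \<longrightarrow>
            (\<forall>T>0. \<forall>q>0.
               ((\<lambda>(\<delta>, \<rho>).
                   SUP (s, t)\<in>{(s, t). s \<in> {0..T} \<and> t \<in> {0..T} \<and> \<bar>t - s\<bar> \<le> \<rho>}.
                   SUP (x, y)\<in>{(x, y). \<bar>x - y\<bar> \<le> \<delta>}.
                     Lp_norm M q (\<lambda>\<omega>. u t x \<omega> - u s y \<omega>)) \<longlongrightarrow> 0)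
               (at_right 0 \<times>\<^sub>F at_right 0)))"
proof -
  obtain L where L: "L-lipschitz_on UNIV \<sigma>" using assms(8) by blast
  obtain U where U: "\<And>x. \<bar>u0 x\<bar> \<le> U" using assms(11) by (auto simp: bounded_iff)
  interpret mild_setting N X \<Psi> p M w \<sigma> u0 u L U
    by (rule mild_settingI[OF assms(1-5,7) L assms(10) U assms(13)])
  show ?thesis
    using continuous_Lp separable_modification uniform_Lp by blast
qed

end
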